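(* Let $G_0$ be an infinite, connected, quasi-transitive, cubic graph, let $\phi$ be a local transformation and $G_1=\phi(G_0)$ (assumed connected), with connective constants $\mu_0,\mu_1$. Let $W_0$ be a minimal fundamental domain of $G_0$, $W_1$ the set of all vertices of the gadgets $\phi(v)$, $v\in W_0$, and $X_k$ the set of edges of $G_k$ incident to vertices in $W_k$ ($k=0,1$). Assume $|\gamma(G_0)|<\infty$ (so that $\gamma:=\gamma(G_0)=\gamma(G_1)$), and let $\sigma_{n,k}$ be the number of $n$-step SAWs on $G_k$ starting at mid-edges in $X_k$. Suppose there exist constants $0<C_{1,k}\le C_{2,k}<\infty$ ($k=0,1$) and a single slowly varying function $L$ such that \[ C_{1,k}L(n)n^{\gamma-1}\mu_k^n\le\sigma_{n,k}\le C_{2,k}L(n)n^{\gamma-1}\mu_k^n\qquad(n\ge1,\ k=0,1). \] Then $\nu(G_0)=\nu(G_1)$.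
   Context: All graphs are simple (no loops, no multiple edges). A graph $G=(V,E)$ is quasi-transitive if there is a finite $W\subseteq V$ such that every vertex is mapped into $W$ by some automorphism of $G$ (such $W$ is a fundamental domain); it is cubic if every vertex has degree $3$. Local transformation: a local transformation $\phi$ acts at a degree-$3$ vertex $v$ of a simple graph by replacing $v$ with a finite connected graph (the gadget) $\phi(v)$ having three distinct distinguished outer vertices (ports) $w_1,w_2,w_3$, each port being attached to exactly one of the three edges formerly incident to $v$ (one port per edge). It is required that (i) all gadgets $\phi(v)$ are isomorphic via isomorphisms sending ports to ports, and (ii) some subgroup of the automorphism group of $\phi(v)$ preserves the set $\{w_1,w_2,w_3\}$ and acts transitively on it. $\phi(G)$ denotes the graph obtained by applying $\phi$ at every degree-$3$ vertex of $G$. Mid-edge convention: each edge $e$ is identified with a point at its middle (also denoted $e$). Walks may start and end at mid-edges; such a walk is self-avoiding (a SAW) if it visits no vertex and no mid-edge more than once, and its length $|\pi|$ (number of steps) is the number of vertices it visits. For quasi-transitive $G$, $\mu(G)$ denotes the connective constant. Exponents: for an infinite, connected, quasi-transitive graph $G$ with connective constant $\mu$, fundamental domain $W$, and $X$ the set of edges incident to vertices in $W$, let $\Sigma$ be the set of SAWs on $G$ starting at mid-edges in $X$ and $\Sigma_n$ those of length $n$. Set $Y(x,y)=\sum_{\pi\in\Sigma}x^{|\pi|}/|\pi|^{y}$ (denominator $1$ if $|\pi|=0$), and let $\gamma(G)\in[-\infty,\infty]$ be such that $Y(\mu^{-1},y)=\infty$ for $y<\gamma$ and $<\infty$ for $y>\gamma$.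 For a SAW $\pi$, $\|\pi\|$ is the graph distance between its endpoints. Let $V(z)=\sum_{n\ge1}n^{-(2z+1)}\langle\|\pi\|^2\rangle_n$, where $\langle\cdot\rangle_n$ is the uniform average over $\Sigma_n$, and let $\nu(G)\in[-\infty,\infty]$ be such that $V(z)=\infty$ for $z<\nu$ and $V(z)<\infty$ for $z>\nu$. A function $L:(0,\infty)\to(0,\infty)$ is slowly varying if $L(cn)/L(n)\to1$ as $n\to\infty$ for every $c>0$. *)

theory Defs
  imports Complex_Main "HOL-Library.Extended_Nonnegative_Real" "HOL-Library.Extended_Real"
begin

definition simple_graph :: "'v set \<Rightarrow> ('v \<Rightarrow> 'v \<Rightarrow> bool) \<Rightarrow> bool" where
  "simple_graph V E \<longleftrightarrow> (\<forall>a b. E a b \<longrightarrow> a \<in> V \<and> b \<in> V \<and> a \<noteq> b \<and> E b a)"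

definition is_walk :: "'v set \<Rightarrow> ('v \<Rightarrow> 'v \<Rightarrow> bool) \<Rightarrow> 'v list \<Rightarrow> bool" where
  "is_walk V E p \<longleftrightarrow> p \<noteq> [] \<and> set p \<subseteq> V \<and> (\<forall>i. Suc i < length p \<longrightarrow> E (p ! i) (p ! Suc i))"

definition connected_graph :: "'v set \<Rightarrow> ('v \<Rightarrow> 'v \<Rightarrow> bool) \<Rightarrow> bool" where
  "connected_graph V E \<longleftrightarrow>
     (\<forall>a\<in>V. \<forall>b\<in>V. \<exists>p. is_walk V E p \<and> hd p = a \<and> last p = b)"

definition gdist :: "'v set \<Rightarrow> ('v \<Rightarrow> 'v \<Rightarrow> bool) \<Rightarrow> 'v \<Rightarrow> 'v \<Rightarrow> nat" where
  "gdist V E a b = (LEAST k. \<exists>p. is_walk V E p \<and> length p = Suc k \<and> hd p = a \<and> last p = b)"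

definition nbrs :: "'v set \<Rightarrow> ('v \<Rightarrow> 'v \<Rightarrow> bool) \<Rightarrow> 'v \<Rightarrow> 'v set" where
  "nbrs V E v = {u \<in> V. E v u}"

definition cubic :: "'v set \<Rightarrow> ('v \<Rightarrow> 'v \<Rightarrow> bool) \<Rightarrow> bool" where
  "cubic V E \<longleftrightarrow> (\<forall>v\<in>V. finite (nbrs V E v) \<and> card (nbrs V E v) = 3)"

definition automorphism :: "'v set \<Rightarrow> ('v \<Rightarrow> 'v \<Rightarrow> bool) \<Rightarrow> ('v \<Rightarrow> 'v) \<Rightarrow> bool" where
  "automorphism V E f \<longleftrightarrow> bij_betw f V V \<and> (\<forall>a\<in>V. \<forall>b\<in>V. E a b \<longleftrightarrow> E (f a) (f b))"

definition fundamental_domain :: "'v set \<Rightarrow> ('v \<Rightarrow> 'v \<Rightarrow> bool) \<Rightarrow> 'v set \<Rightarrow> bool" where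
  "fundamental_domain V E W \<longleftrightarrow> finite W \<and> W \<subseteq> V \<and>
     (\<forall>v\<in>V. \<exists>f. automorphism V E f \<and> f v \<in> W)"

definition quasi_transitive :: "'v set \<Rightarrow> ('v \<Rightarrow> 'v \<Rightarrow> bool) \<Rightarrow> bool" where
  "quasi_transitive V E \<longleftrightarrow> (\<exists>W. fundamental_domain V E W)"

definition minimal_fundamental_domain :: "'v set \<Rightarrow> ('v \<Rightarrow> 'v \<Rightarrow> bool) \<Rightarrow> 'v set \<Rightarrow> bool" where
  "minimal_fundamental_domain V E W \<longleftrightarrow> fundamental_domain V E W \<and>
     (\<forall>W'. W' \<subset> W \<longrightarrow> \<not> fundamental_domain V E W')"

definition saw_count :: "'v set \<Rightarrow> ('v \<Rightarrow> 'v \<Rightarrow> bool) \<Rightarrow> 'v \<Rightarrow> nat \<Rightarrow> nat" where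
  "saw_count V E v n = card {p. is_walk V E p \<and> length p = Suc n \<and> hd p = v \<and> distinct p}"

definition connective_constant :: "'v set \<Rightarrow> ('v \<Rightarrow> 'v \<Rightarrow> bool) \<Rightarrow> real" where
  "connective_constant V E =
     lim (\<lambda>n. (SUP v\<in>V. real (saw_count V E v n)) powr (1 / real n))"

text \<open>Edges are represented by two-element vertex sets; an edge is identified with its mid-point.\<close>
definition edges :: "'v set \<Rightarrow> ('v \<Rightarrow> 'v \<Rightarrow> bool) \<Rightarrow> 'v set set" where
  "edges V E = {{a, b} | a b. a \<in> V \<and> b \<in> V \<and> E a b}"

definition incident_edges :: "'v set \<Rightarrow> ('v \<Rightarrow> 'v \<Rightarrow> bool) \<Rightarrow> 'v set \<Rightarrow> 'v set set" where
  "incident_edges V E W = {e \<in> edges V E. e \<inter> W \<noteq> {}}"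

text \<open>A mid-edge SAW: mid-edge es!0, vertex vs!0, mid-edge es!1, ..., vertex vs!(n-1),
  mid-edge es!n; no vertex and no mid-edge repeated. Its length is n = number of vertices.\<close>
definition mid_saw :: "'v set \<Rightarrow> ('v \<Rightarrow> 'v \<Rightarrow> bool) \<Rightarrow> 'v list \<Rightarrow> 'v set list \<Rightarrow> bool" where
  "mid_saw V E vs es \<longleftrightarrow> length es = Suc (length vs) \<and> set es \<subseteq> edges V E \<and> set vs \<subseteq> V \<and>
     distinct vs \<and> distinct es \<and>
     (\<forall>i<length vs. vs ! i \<in> es ! i \<and> vs ! i \<in> es ! Suc i)"

definition Sigma_n :: "'v set \<Rightarrow> ('v \<Rightarrow> 'v \<Rightarrow> bool) \<Rightarrow> 'v set set \<Rightarrow> nat \<Rightarrow> ('v list \<times> 'v set list) set" where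
  "Sigma_n V E X n = {(vs, es). mid_saw V E vs es \<and> length vs = n \<and> es ! 0 \<in> X}"

definition sigma_n :: "'v set \<Rightarrow> ('v \<Rightarrow> 'v \<Rightarrow> bool) \<Rightarrow> 'v set set \<Rightarrow> nat \<Rightarrow> nat" where
  "sigma_n V E X n = card (Sigma_n V E X n)"

text \<open>Distance between mid-edges: graph distance in the 1-subdivision, halved
  (a mid-edge is at distance 1/2 from each of its endpoints).\<close>
definition mid_dist :: "'v set \<Rightarrow> ('v \<Rightarrow> 'v \<Rightarrow> bool) \<Rightarrow> 'v set \<Rightarrow> 'v set \<Rightarrow> real" where
  "mid_dist V E e f = (if e = f then 0
      else 1 + real (Min {gdist V E a b | a b. a \<in> e \<and> b \<in> f}))"

definition saw_norm :: "'v set \<Rightarrow> ('v \<Rightarrow> 'v \<Rightarrow> bool) \<Rightarrow> ('v list \<times> 'v set list) \<Rightarrow> real" where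
  "saw_norm V E \<pi> = mid_dist V E (hd (snd \<pi>)) (last (snd \<pi>))"

definition Y_fun :: "'v set \<Rightarrow> ('v \<Rightarrow> 'v \<Rightarrow> bool) \<Rightarrow> 'v set \<Rightarrow> real \<Rightarrow> real \<Rightarrow> ennreal" where
  "Y_fun V E W x y = (\<Sum>n. ennreal (real (sigma_n V E (incident_edges V E W) n) * x ^ n
        / (if n = 0 then 1 else real n powr y)))"

definition gamma_exp :: "'v set \<Rightarrow> ('v \<Rightarrow> 'v \<Rightarrow> bool) \<Rightarrow> 'v set \<Rightarrow> ereal" where
  "gamma_exp V E W = Inf {ereal y | y. Y_fun V E W (1 / connective_constant V E) y < top}"

definition mean_sq_disp :: "'v set \<Rightarrow> ('v \<Rightarrow> 'v \<Rightarrow> bool) \<Rightarrow> 'v set \<Rightarrow> nat \<Rightarrow> real" where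
  "mean_sq_disp V E W n =
     (\<Sum>\<pi>\<in>Sigma_n V E (incident_edges V E W) n. (saw_norm V E \<pi>)\<^sup>2)
       / real (card (Sigma_n V E (incident_edges V E W) n))"

definition V_fun :: "'v set \<Rightarrow> ('v \<Rightarrow> 'v \<Rightarrow> bool) \<Rightarrow> 'v set \<Rightarrow> real \<Rightarrow> ennreal" where
  "V_fun V E W z = (\<Sum>n. if n = 0 then 0
        else ennreal (real n powr (- (2 * z + 1)) * mean_sq_disp V E W n))"

definition nu_exp :: "'v set \<Rightarrow> ('v \<Rightarrow> 'v \<Rightarrow> bool) \<Rightarrow> 'v set \<Rightarrow> ereal" where
  "nu_exp V E W = Inf {ereal z | z. V_fun V E W z < top}"

definition slowly_varying :: "(real \<Rightarrow> real) \<Rightarrow> bool" where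
  "slowly_varying L \<longleftrightarrow> (\<forall>x>0. L x > 0) \<and>
     (\<forall>c>0. ((\<lambda>n. L (c * n) / L n) \<longlongrightarrow> 1) at_top)"

definition gadget :: "'g set \<Rightarrow> ('g \<Rightarrow> 'g \<Rightarrow> bool) \<Rightarrow> 'g \<Rightarrow> 'g \<Rightarrow> 'g \<Rightarrow> bool" where
  "gadget Hv EH w1 w2 w3 \<longleftrightarrow> finite Hv \<and> simple_graph Hv EH \<and> connected_graph Hv EH \<and>
     w1 \<in> Hv \<and> w2 \<in> Hv \<and> w3 \<in> Hv \<and> w1 \<noteq> w2 \<and> w1 \<noteq> w3 \<and> w2 \<noteq> w3 \<and>
     (\<exists>S. S \<noteq> {} \<and> (\<forall>f\<in>S. automorphism Hv EH f) \<and>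
        (\<forall>f\<in>S. \<forall>g\<in>S. \<exists>h\<in>S. \<forall>x\<in>Hv. h x = f (g x)) \<and>
        (\<forall>f\<in>S. \<exists>g\<in>S. \<forall>x\<in>Hv. g (f x) = x) \<and>
        (\<forall>f\<in>S. f ` {w1, w2, w3} = {w1, w2, w3}) \<and>
        (\<forall>a\<in>{w1, w2, w3}. \<forall>b\<in>{w1, w2, w3}. \<exists>f\<in>S. f a = b))"

text \<open>A port assignment P: at each vertex v, P v is a bijection from the neighbours of v
  (equivalently the incident edges) onto the ports.\<close>
definition port_assignment :: "'v set \<Rightarrow> ('v \<Rightarrow> 'v \<Rightarrow> bool) \<Rightarrow> ('v \<Rightarrow> 'v \<Rightarrow> 'g) \<Rightarrow> 'g \<Rightarrow> 'g \<Rightarrow> 'g \<Rightarrow> bool" where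
  "port_assignment V E P w1 w2 w3 \<longleftrightarrow> (\<forall>v\<in>V. bij_betw (P v) (nbrs V E v) {w1, w2, w3})"

text \<open>The transformed graph \<phi>(G) (for cubic G every vertex is replaced by a copy of the gadget).\<close>
definition lt_vertices :: "'v set \<Rightarrow> 'g set \<Rightarrow> ('v \<times> 'g) set" where
  "lt_vertices V Hv = V \<times> Hv"

definition lt_edges :: "('v \<Rightarrow> 'v \<Rightarrow> bool) \<Rightarrow> 'g set \<Rightarrow> ('g \<Rightarrow> 'g \<Rightarrow> bool) \<Rightarrow> ('v \<Rightarrow> 'v \<Rightarrow> 'g)
     \<Rightarrow> ('v \<times> 'g) \<Rightarrow> ('v \<times> 'g) \<Rightarrow> bool" where
  "lt_edges E Hv EH P x y \<longleftrightarrow>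
     (fst x = fst y \<and> EH (snd x) (snd y)) \<or>
     (E (fst x) (fst y) \<and> snd x = P (fst x) (fst y) \<and> snd y = P (fst y) (fst x))"

end

theory Submission
  imports Defs
begin

text \<open>
  Write $s_n = \sigma_{n,0}\mu_0^{-n}$ and $t_m = \sigma_{m,1}\mu_1^{-m}$; by hypothesis both are
  comparable to $\ell(n) = L(n) n^{\gamma-1}$. A walk of length $n$ on $G_0$ becomes a walk on
  $G_1$ by choosing a port-to-port path in every gadget it visits, and up to two end pieces inside
  one gadget each every walk on $G_1$ arises in this way. Hence counts and squared displacements on
  the two graphs are related through the convolution powers of the path length enumerator $g$ of the
  gadget. The counts force $p_a = \mu_0 g_a \mu_1^{-a}$ to be a probability distribution, and the
  second moments reduce the theorem to $\sum_m p^{*n}(m)/s_m = n^{o(1)}/s_n$.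

  Since $L$ is not assumed measurable, slow variation gives no control of $s_{n+j}/s_n$ but only of
  $s_{kn}/s_n$ for integers $k$. If $p$ charges two lengths, the missing smoothness is extracted from
  the renewal structure: $p^{*y}(m)$ and $p^{*y}(m+d)$ are nearly equal, so $s$ is comparable on
  windows of width $n^{1/2-\epsilon}$, and halving the argument repeatedly enlarges the windows to
  $n^{1/2+\epsilon}$ at a cost $n^{O(\epsilon)}$, beyond which Chernoff bounds take over. If all
  paths have the same length $k_0$, this mechanism is absent; then $m \approx k_0 n$ up to a bounded
  error, and a walk with partial end gadgets is charged to a walk on $G_0$ in such a way that
  the longest admissible end pieces are also available in the reverse construction.
\<close>

subsection \<open>Convolution powers\<close>

text \<open>The obstacle is one-sidedness. Submultiplicativity bounds \<open>s (n + j)\<close> by a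
  constant times \<open>s n\<close>, but nothing elementary bounds \<open>s n\<close> by
  \<open>s (n + j)\<close>. Cutting a walk of G_1 shortens it by up to two gadget sizes and
  therefore calls for the second inequality. When the gadget has two path lengths it is recovered as
  \<open>shift_down_bounded\<close>. When there is only one, the comparison is arranged to run
  upwards: apart from walks of bounded displacement, a walk of length m on G_1 is charged to walks
  of length n on G_0 with k0 * n + 2 * J >= m, and \<open>count_lower_monomial\<close> compares
  these with the walks of length exactly k0 * n + 2 * J on G_1, from where an upward shift leads
  back to m. Factors n^\<epsilon> are free throughout, because \<nu> is a threshold and is compared
  through arbitrarily small shifts of the exponent. Moments of order 0 and 2 of the displacement
  obey the same basic pair of inequalities; order 0 yields the renewal inequalities for s, order 2
  the transfer of displacements.\<close>

fun cpow :: "nat \<Rightarrow> (nat \<Rightarrow> real) \<Rightarrow> nat \<Rightarrow> nat \<Rightarrow> real" where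
  "cpow h g 0 m = of_bool (m = 0)"
| "cpow h g (Suc n) m = (\<Sum>a\<in>{1..h}. if a \<le> m then g a * cpow h g n (m - a) else 0)"

text \<open>Expectation over n independent draws from the weights \<open>p\<close>, kept as an
  iterated finite sum: no probability space is set up, and the weights may have any total
  mass.\<close>

fun list_expect :: "nat \<Rightarrow> (nat \<Rightarrow> real) \<Rightarrow> nat \<Rightarrow> (nat list \<Rightarrow> real) \<Rightarrow> real" where
  "list_expect h p 0 F = F []"
| "list_expect h p (Suc n) F = (\<Sum>a\<in>{1..h}. p a * list_expect h p n (\<lambda>xs. F (a # xs)))"

lemma list_expect_mono:
  assumes "\<And>a. p a \<ge> 0" "\<And>xs. length xs = n \<Longrightarrow> set xs \<subseteq> {1..h} \<Longrightarrow> F xs \<le> G xs"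
  shows "list_expect h p n F \<le> list_expect h p n G"
  using assms(2)
proof (induction n arbitrary: F G)
  case (Suc n)
  have "list_expect h p n (\<lambda>xs. F (a # xs)) \<le> list_expect h p n (\<lambda>xs. G (a # xs))"
    if "a \<in> {1..h}" for a
    by (rule Suc.IH) (use Suc.prems that in auto)
  then show ?case by (auto intro!: sum_mono mult_left_mono assms(1))
qed auto

lemma list_expect_add:
  "list_expect h p n (\<lambda>xs. F xs + G xs) = list_expect h p n F + list_expect h p n G"
  by (induction n arbitrary: F G) (auto simp: sum.distrib algebra_simps)

lemma list_expect_cmult:
  "list_expect h p n (\<lambda>xs. c * F xs) = c * list_expect h p n F"
  by (induction n arbitrary: F) (auto simp: sum_distrib_left algebra_simps)

lemma list_expect_zero: "list_expect h p n (\<lambda>xs. 0) = 0"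
  using list_expect_cmult[of h p n 0 "\<lambda>_. 0"] by simp

lemma list_expect_prod:
  "list_expect h p n (\<lambda>xs. prod_list (map f xs)) = (\<Sum>a\<in>{1..h}. p a * f a) ^ n"
  by (induction n) (auto simp: list_expect_cmult sum_distrib_left sum_distrib_right algebra_simps)

lemma cpow_eq_list_expect:
  "cpow h p n m = list_expect h p n (\<lambda>xs. of_bool (sum_list xs = m))"
proof (induction n arbitrary: m)
  case (Suc n)
  have "(if a \<le> m then p a * cpow h p n (m - a) else 0)
      = p a * list_expect h p n (\<lambda>xs. of_bool (a + sum_list xs = m))" for a
  proof (cases "a \<le> m")
    case True
    then have "(\<lambda>xs. of_bool (a + sum_list xs = m) :: real) = (\<lambda>xs. of_bool (sum_list xs = m - a))"
      by (auto simp: fun_eq_iff)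
    then show ?thesis using True by (simp add: Suc)
  next
    case False
    then have "(\<lambda>xs. of_bool (a + sum_list xs = m) :: real) = (\<lambda>xs. 0)"
      by (auto simp: fun_eq_iff)
    then show ?thesis using False by (simp add: list_expect_zero)
  qed
  then show ?case by simp
qed auto

lemma cpow_nonneg: "(\<And>a. g a \<ge> 0) \<Longrightarrow> cpow h g n m \<ge> 0"
  by (induction n arbitrary: m) (auto intro!: sum_nonneg)

lemma cpow_eq_0:
  assumes "m < n \<or> h * n < m"
  shows "cpow h g n m = 0"
  using assms
proof (induction n arbitrary: m)
  case (Suc n)
  show ?case
    unfolding cpow.simps
  proof (rule sum.neutral, intro ballI)
    fix a assume a: "a \<in> {1..h}"
    have "m - a < n \<or> h * n < m - a" if "a \<le> m"
      using Suc.prems a that by (auto simp: algebra_simps)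
    then show "(if a \<le> m then g a * cpow h g n (m - a) else 0) = 0"
      using Suc.IH by auto
  qed
qed auto

text \<open>Exponential tilting. It turns the path counts of the gadget into a probability law while
  multiplying each coefficient of the n-th convolution power by an explicit factor.\<close>

lemma cpow_scale: "cpow h (\<lambda>a. c * x ^ a * g a) n m = c ^ n * x ^ m * cpow h g n m"
proof (induction n arbitrary: m)
  case (Suc n)
  have "(if a \<le> m then c * x ^ a * g a * cpow h (\<lambda>a. c * x ^ a * g a) n (m - a) else 0)
     = c ^ Suc n * x ^ m * (if a \<le> m then g a * cpow h g n (m - a) else 0)" for a
  proof (cases "a \<le> m")
    case True
    then have "x ^ m = x ^ a * x ^ (m - a)" by (simp flip: power_add)
    then show ?thesis using True by (simp only: if_True Suc) (simp add: algebra_simps)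
  qed simp
  then show ?case by (simp add: sum_distrib_left)
qed (auto intro!: Nat.gr0I)

lemma sum_cpow:
  assumes "h * n \<le> N"
  shows "(\<Sum>m\<le>N. cpow h g n m) = (\<Sum>a\<in>{1..h}. g a) ^ n"
  using assms
proof (induction n arbitrary: N)
  case (Suc n)
  have "(\<Sum>m\<le>N. if a \<le> m then g a * cpow h g n (m - a) else 0) = g a * (\<Sum>a\<in>{1..h}. g a) ^ n"
    if a: "a \<in> {1..h}" for a
  proof -
    have aN: "a \<le> N" using Suc.prems a by (auto simp: algebra_simps intro: le_trans)
    have "(\<Sum>m\<le>N. if a \<le> m then g a * cpow h g n (m - a) else 0)
        = (\<Sum>m\<in>{a..N}. g a * cpow h g n (m - a))"
      by (rule sum.mono_neutral_cong_right) auto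
    also have "\<dots> = (\<Sum>m\<le>N - a. g a * cpow h g n m)"
      by (rule sum.reindex_bij_witness[of _ "\<lambda>m. m + a" "\<lambda>m. m - a"]) (use aN in auto)
    also have "\<dots> = g a * (\<Sum>a\<in>{1..h}. g a) ^ n"
    proof -
      have "h * n \<le> N - a" using Suc.prems a by auto
      then show ?thesis by (simp only: Suc.IH flip: sum_distrib_left)
    qed
    finally show ?thesis .
  qed
  then have "(\<Sum>a\<in>{1..h}. \<Sum>m\<le>N. if a \<le> m then g a * cpow h g n (m - a) else 0)
     = (\<Sum>a\<in>{1..h}. g a) ^ Suc n"
    by (simp add: sum_distrib_right)
  then show ?case by (subst (asm) sum.swap) simp
qed auto

text \<open>By exchangeability each of the n positions contributes the same amount, and deleting one
  letter i leaves n - 1 free draws with sum m. The truncated \<open>n - 1\<close> is harmless at n =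
  0 because of the factor \<open>real n\<close>.\<close>

lemma list_expect_count:
  assumes i: "i \<in> {1..h}"
  shows "list_expect h p n (\<lambda>xs. real (count_list xs i) * of_bool (sum_list xs = m + i))
       = real n * p i * cpow h p (n - 1) m"
proof (induction n arbitrary: m)
  case (Suc n)
  let ?C = "\<lambda>xs. real (count_list xs i)"
  have A: "list_expect h p n (\<lambda>xs. ?C (a # xs) * of_bool (sum_list (a # xs) = m + i))
     = of_bool (a = i) * cpow h p n m
       + (if a \<le> m then real n * p i * cpow h p (n - 1) (m - a) else 0)" for a
  proof -
    have "(\<lambda>xs. ?C (a # xs) * of_bool (sum_list (a # xs) = m + i))
      = (\<lambda>xs. of_bool (a = i) * of_bool (sum_list xs = m)
            + (if a \<le> m then ?C xs * of_bool (sum_list xs = (m - a) + i) else 0))"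
    proof
      fix xs :: "nat list"
      have "i \<le> sum_list xs" if "count_list xs i \<noteq> 0"
        using that by (intro member_le_sum_list) (auto simp: count_list_0_iff)
      then have z: "?C xs * of_bool (a + sum_list xs = m + i) = 0" if "\<not> a \<le> m"
        using that by (cases "count_list xs i = 0") auto
      show "?C (a # xs) * of_bool (sum_list (a # xs) = m + i)
         = of_bool (a = i) * of_bool (sum_list xs = m)
            + (if a \<le> m then ?C xs * of_bool (sum_list xs = (m - a) + i) else 0)"
        using z by (auto simp: algebra_simps)
    qed
    then have "list_expect h p n (\<lambda>xs. ?C (a # xs) * of_bool (sum_list (a # xs) = m + i))
       = list_expect h p n (\<lambda>xs. of_bool (a = i) * of_bool (sum_list xs = m))
        + list_expect h p n (\<lambda>xs. (if a \<le> m then ?C xs * of_bool (sum_list xs = (m - a) + i) else 0))"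
      by (simp only: list_expect_add)
    also have "list_expect h p n (\<lambda>xs. of_bool (a = i) * of_bool (sum_list xs = m)) = of_bool (a = i) * cpow h p n m"
      by (simp only: list_expect_cmult cpow_eq_list_expect)
    also have "list_expect h p n (\<lambda>xs. (if a \<le> m then ?C xs * of_bool (sum_list xs = (m - a) + i) else 0))
       = (if a \<le> m then real n * p i * cpow h p (n - 1) (m - a) else 0)"
      using Suc[of "m - a"] by (auto simp: list_expect_zero)
    finally show ?thesis .
  qed
  have B: "(\<Sum>a\<in>{1..h}. p a * (of_bool (a = i) * cpow h p n m)) = p i * cpow h p n m"
  proof -
    have "(\<Sum>a\<in>{1..h}. p a * (of_bool (a = i) * cpow h p n m))
        = (\<Sum>a\<in>{1..h}. if a = i then p i * cpow h p n m else 0)"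
      by (rule sum.cong) auto
    then show ?thesis using i by simp
  qed
  have C: "(\<Sum>a\<in>{1..h}. p a * (if a \<le> m then real n * p i * cpow h p (n - 1) (m - a) else 0))
      = real n * p i * cpow h p n m"
  proof (cases n)
    case (Suc k)
    then show ?thesis
      by (auto simp: sum_distrib_left algebra_simps intro!: sum.cong)
  qed (auto intro: sum.neutral)
  have "list_expect h p (Suc n) (\<lambda>xs. ?C xs * of_bool (sum_list xs = m + i))
     = (\<Sum>a\<in>{1..h}. p a * (of_bool (a = i) * cpow h p n m))
     + (\<Sum>a\<in>{1..h}. p a * (if a \<le> m then real n * p i * cpow h p (n - 1) (m - a) else 0))"
    unfolding list_expect.simps A by (simp only: distrib_left sum.distrib)
  then show ?case unfolding B C by (simp add: algebra_simps)
qed simp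

lemma exp_le_quadratic:
  fixes x :: real
  assumes "\<bar>x\<bar> \<le> 1"
  shows "exp x \<le> 1 + x + x\<^sup>2"
proof (cases "x \<ge> 0")
  case True
  then show ?thesis using assms exp_bound by auto
next
  case False
  define y where "y = - x"
  have y: "y > 0" using False y_def by auto
  have "exp x = 1 / exp y" by (simp add: y_def exp_minus field_simps)
  also have "\<dots> \<le> 1 / (1 + y)" using y exp_ge_add_one_self[of y] by (intro divide_left_mono) auto
  also have "\<dots> \<le> 1 - y + y\<^sup>2"
  proof -
    have "(1 - y + y\<^sup>2) * (1 + y) = 1 + y ^ 3" by (simp add: algebra_simps power2_eq_square power3_eq_cube)
    then show ?thesis using y by (simp add: divide_le_eq)
  qed
  finally show ?thesis by (simp add: y_def)
qed

text \<open>Exponential Markov inequality at the single parameter \<theta> = 1 / (K * sqrt n), for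
  which the moment generating factor is at most (1 + 1/n)^n <= e. The bound is only exponential in t
  / sqrt n, not Gaussian; with t = n^(1/2 + e) it still beats every power of n.\<close>

lemma list_expect_chernoff:
  assumes p: "\<And>a. p a \<ge> 0" "(\<Sum>a\<in>{1..h}. p a) = 1" and K: "K > 0"
    and f: "\<And>a. a \<in> {1..h} \<Longrightarrow> \<bar>f a\<bar> \<le> K" "(\<Sum>a\<in>{1..h}. p a * f a) = 0"
    and n: "n \<ge> 1"
  shows "list_expect h p n (\<lambda>xs. of_bool (t \<le> sum_list (map f xs))) \<le> exp (1 - t / (K * sqrt n))"
proof -
  define \<theta> where "\<theta> = 1 / (K * sqrt n)"
  have th: "\<theta> > 0" "(\<theta> * K)\<^sup>2 = 1 / n" "\<theta> * K \<le> 1"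
    using K n by (auto simp: \<theta>_def power_divide)
  have ex: "exp (\<theta> * sum_list (map f xs)) = prod_list (map (\<lambda>a. exp (\<theta> * f a)) xs)" for xs
    by (induction xs) (auto simp: exp_add distrib_left)
  have "list_expect h p n (\<lambda>xs. of_bool (t \<le> sum_list (map f xs)))
     \<le> list_expect h p n (\<lambda>xs. exp (- \<theta> * t) * prod_list (map (\<lambda>a. exp (\<theta> * f a)) xs))"
  proof (rule list_expect_mono[OF p(1)])
    fix xs :: "nat list"
    have "exp (- \<theta> * t) * prod_list (map (\<lambda>a. exp (\<theta> * f a)) xs) = exp (\<theta> * (sum_list (map f xs) - t))"
      by (simp add: ex[symmetric] algebra_simps flip: exp_add)
    then show "of_bool (t \<le> sum_list (map f xs)) \<le> exp (- \<theta> * t) * prod_list (map (\<lambda>a. exp (\<theta> * f a)) xs)"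
      using th(1) by (auto simp: of_bool_def)
  qed
  also have "\<dots> = exp (- \<theta> * t) * (\<Sum>a\<in>{1..h}. p a * exp (\<theta> * f a)) ^ n"
    by (simp only: list_expect_cmult list_expect_prod)
  also have "\<dots> \<le> exp (- \<theta> * t) * (1 + 1 / n) ^ n"
  proof -
    have "(\<Sum>a\<in>{1..h}. p a * exp (\<theta> * f a)) \<le> (\<Sum>a\<in>{1..h}. p a * (1 + \<theta> * f a + 1 / n))"
    proof (intro sum_mono mult_left_mono p(1))
      fix a assume a: "a \<in> {1..h}"
      have 1: "\<bar>\<theta> * f a\<bar> \<le> \<theta> * K" using f(1)[OF a] th(1) by (simp add: abs_mult)
      then have "(\<theta> * f a)\<^sup>2 \<le> (\<theta> * K)\<^sup>2" using abs_le_square_iff by fastforce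
      then show "exp (\<theta> * f a) \<le> 1 + \<theta> * f a + 1 / n"
        using exp_le_quadratic[of "\<theta> * f a"] 1 th by auto
    qed
    also have "\<dots> = 1 + 1 / n"
    proof -
      have "(\<Sum>a\<in>{1..h}. p a * (1 + \<theta> * f a + 1 / n))
          = (\<Sum>a\<in>{1..h}. p a) * (1 + 1 / n) + \<theta> * (\<Sum>a\<in>{1..h}. p a * f a)"
        by (simp only: sum_distrib_left sum_distrib_right sum.distrib[symmetric]) (auto simp: algebra_simps intro!: sum.cong)
      then show ?thesis using p(2) f(2) by simp
    qed
    finally show ?thesis by (intro mult_left_mono power_mono sum_nonneg) (auto simp: p(1))
  qed
  also have "\<dots> \<le> exp (- \<theta> * t) * exp 1"
  proof -
    have "(1 + 1 / n) ^ n \<le> exp (1 / real n) ^ n"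
      by (intro power_mono) auto
    also have "\<dots> = exp 1" using n by (simp flip: exp_of_nat_mult)
    finally show ?thesis by simp
  qed
  also have "\<dots> = exp (1 - t / (K * sqrt n))" by (simp add: \<theta>_def flip: exp_add)
  finally show ?thesis .
qed

lemma exp_powr_superpoly:
  fixes c e B :: real
  assumes "c > 0" "e > 0"
  shows "\<exists>C>0. \<forall>x\<ge>1. exp (- c * x powr e) * x powr B \<le> C"
proof -
  \<comment> \<open>A single Taylor term z^k / k! of exp z suffices once e * k >= B.\<close>
  obtain k :: nat where k: "B / e \<le> real k" using real_arch_simple by blast
  have kB: "B \<le> e * real k" using k assms by (simp add: field_simps)
  show ?thesis
  proof (intro exI[of _ "fact k / c ^ k"] conjI allI impI)
    show "fact k / c ^ k > 0" using assms by simp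
    fix x :: real assume x: "x \<ge> 1"
    define z where "z = c * x powr e"
    have z: "z > 0" using assms x by (simp add: z_def)
    have "z ^ k / fact k \<le> exp z"
    proof -
      have "(\<lambda>n. z ^ n /\<^sub>R fact n) sums exp z" by (rule exp_converges)
      then have "(\<lambda>n. z ^ n / fact n) sums exp z" by (simp add: field_simps)
      moreover have "z ^ k / fact k = (\<Sum>i\<in>{k}. z ^ i / fact i)" by simp
      ultimately show ?thesis
        using z sum_le_suminf[of "\<lambda>n. z ^ n / fact n" "{k}"] by (auto simp: sums_iff)
    qed
    then have "exp (- z) \<le> fact k / z ^ k"
      using z by (simp add: exp_minus field_simps)
    moreover have "z ^ k = c ^ k * x powr (e * real k)"
      using x by (simp add: z_def power_mult_distrib powr_powr flip: powr_realpow)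
    ultimately have "exp (- z) * x powr B \<le> fact k / (c ^ k * x powr (e * real k)) * x powr B"
      using x by (intro mult_right_mono) auto
    also have "\<dots> \<le> fact k / (c ^ k * x powr (e * real k)) * x powr (e * real k)"
      using x kB assms by (intro mult_left_mono powr_mono) auto
    also have "\<dots> = fact k / c ^ k" using x by simp
    finally show "exp (- c * x powr e) * x powr B \<le> fact k / c ^ k" by (simp add: z_def)
  qed
qed

subsection \<open>Submultiplicative sequences with bounded doubling\<close>

text \<open>Models the normalised counts. Among the dilations controlled by slow variation only the
  factor 2 is kept. Nothing is assumed about \<open>s 0\<close>, so sums over the argument of
  \<open>s\<close> start at 1.\<close>

locale doubling_submult =
  fixes s :: "nat \<Rightarrow> real" and D :: real
  assumes pos: "n \<ge> 1 \<Longrightarrow> s n > 0"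
    and submult: "m \<ge> 1 \<Longrightarrow> n \<ge> 1 \<Longrightarrow> s (m + n) \<le> s m * s n"
    and double_le: "n \<ge> 1 \<Longrightarrow> s (2 * n) \<le> D * s n"
    and le_double: "n \<ge> 1 \<Longrightarrow> s n \<le> D * s (2 * n)"
begin

lemma D_pos: "D > 0"
proof -
  have "D * s 1 > 0" using double_le[of 1] pos[of 2] by simp
  then show ?thesis using pos[of 1] by (simp add: zero_less_mult_iff)
qed

lemma D_ge_1: "D \<ge> 1"
proof (rule ccontr)
  assume "\<not> D \<ge> 1"
  then have D: "D < 1" by simp
  have "s 2 \<le> D * s 1" "s 1 \<le> D * s 2" using double_le[of 1] le_double[of 1] by (simp_all add: numeral_2_eq_2)
  moreover have "D * s 1 < 1 * s 1" using D pos[of 1] by (intro mult_strict_right_mono) auto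
  moreover have "D * s 2 < 1 * s 2" using D pos[of 2] by (intro mult_strict_right_mono) auto
  ultimately have "s 1 < s 2" "s 2 < s 1" by simp_all
  then show False by simp
qed

text \<open>A value below 1 would make s (2^i * n) doubly exponentially small in i by
  submultiplicativity, whereas i doublings can lose a factor D^i only.\<close>

lemma ge_1:
  assumes n: "n \<ge> 1"
  shows "s n \<ge> 1"
proof (rule ccontr)
  assume c: "\<not> s n \<ge> 1"
  define c where "c = - ln (s n)"
  have cpos: "c > 0" using c pos[OF n] by (simp add: c_def)
  have 1: "s (2 ^ i * n) \<le> s n ^ (2 ^ i)" for i
  proof (induction i)
    case (Suc i)
    have "s (2 ^ Suc i * n) \<le> s (2 ^ i * n) * s (2 ^ i * n)"
      using submult[of "2 ^ i * n" "2 ^ i * n"] n by (simp add: mult_2 distrib_right)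
    also have "\<dots> \<le> s n ^ (2 ^ i) * s n ^ (2 ^ i)"
      using Suc pos[of "2 ^ i * n"] n by (intro mult_mono) auto
    finally show ?case by (simp add: mult_2 flip: power_add)
  qed simp
  have 2: "s n \<le> D ^ i * s (2 ^ i * n)" for i
  proof (induction i)
    case (Suc i)
    also have "D ^ i * s (2 ^ i * n) \<le> D ^ i * (D * s (2 * (2 ^ i * n)))"
      using le_double[of "2 ^ i * n"] n D_pos by (intro mult_left_mono) auto
    finally show ?case by (simp add: algebra_simps)
  qed simp
  have 3: "(2 ^ i - 1) * c \<le> real i * ln D" for i
  proof -
    have "s n \<le> D ^ i * s n ^ (2 ^ i)" using order_trans[OF 2[of i] mult_left_mono[OF 1[of i], of "D ^ i"]] D_pos by simp
    then have "ln (s n) \<le> ln (D ^ i * s n ^ (2 ^ i))" using pos[OF n] D_pos by (subst ln_le_cancel_iff) auto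
    also have "\<dots> = real i * ln D + 2 ^ i * ln (s n)"
      using pos[OF n] D_pos by (simp add: ln_mult ln_realpow)
    finally show ?thesis by (simp add: c_def algebra_simps)
  qed
  \<comment> \<open>A quadratic lower bound for 2^i - 1 is enough to beat the linear right-hand side
    of fact \<open>3\<close>.\<close>
  have quad: "real i * real i / 4 \<le> 2 ^ i - 1" for i
  proof (induction i)
    case (Suc i)
    have "real i + 1 \<le> 2 ^ i" by (induction i) auto
    moreover have "real (Suc i) * real (Suc i) / 4 = real i * real i / 4 + real i / 2 + 1 / 4"
      by (simp add: field_simps)
    ultimately show ?case using Suc by (simp only: power_Suc)
  qed simp
  obtain i :: nat where i: "real i > 4 * ln D / c + 1" using reals_Archimedean2 by blast
  have "ln D \<ge> 0" using D_ge_1 by simp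
  then have "real i > 0" using i cpos by (smt (verit) divide_nonneg_pos)
  have "real i * real i / 4 * c \<le> real i * ln D"
    using quad[of i] 3[of i] cpos by (meson mult_right_mono less_imp_le order_trans)
  then have "real i * c / 4 \<le> ln D" using \<open>real i > 0\<close> by simp
  then have "real i \<le> 4 * ln D / c" using cpos by (simp add: field_simps)
  then show False using i by simp
qed

text \<open>One halving of n costs the factor D * s 1, where s 1 pays for an odd n, and about log2 n
  halvings reach 1; hence the exponent log2 (D * s 1).\<close>

lemma poly_bound: "\<exists>B\<ge>0. \<forall>n\<ge>1. s n \<le> s 1 * real n powr B"
proof -
  define B where "B = log 2 (D * s 1)"
  have D1: "D * s 1 \<ge> 1" using D_ge_1 ge_1[of 1] mult_mono[of 1 D 1 "s 1"] by simp
  have B: "2 powr B = D * s 1" "B \<ge> 0" using D1 by (auto simp: B_def powr_log_cancel)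
  have "s n \<le> s 1 * real n powr B" if "n \<ge> 1" for n
    using that
  proof (induction n rule: less_induct)
    case (less n)
    show ?case
    proof (cases "n = 1")
      case False
      define k where "k = n div 2"
      have k: "1 \<le> k" "k < n" "n = 2 * k \<or> n = 2 * k + 1" using less.prems False by (auto simp: k_def)
      have "s n \<le> s 1 * s (2 * k)"
      proof (cases "n = 2 * k")
        case True
        then show ?thesis using ge_1[of 1] pos[of "2*k"] k mult_right_mono[of 1 "s 1" "s n"] by simp
      next
        case False
        then show ?thesis using k submult[of 1 "2 * k"] by simp
      qed
      also have "\<dots> \<le> s 1 * (D * s k)" using double_le[of k] k ge_1[of 1] by (intro mult_left_mono) auto
      also have "\<dots> \<le> s 1 * (D * (s 1 * real k powr B))"
        using less.IH[of k] k ge_1[of 1] D_pos by (intro mult_left_mono) auto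
      also have "\<dots> = s 1 * (2 * real k) powr B" using B(1) by (simp add: powr_mult)
      also have "\<dots> \<le> s 1 * real n powr B" using k ge_1[of 1] B(2) by (intro mult_left_mono powr_mono2) auto
      finally show ?thesis .
    qed simp
  qed
  then show ?thesis using B by blast
qed

lemma shift_up: "j \<ge> 1 \<Longrightarrow> n \<ge> 1 \<Longrightarrow> s (n + j) \<le> s j * s n"
  using submult[of n j] by (simp add: mult.commute)

text \<open>Only shifts that enlarge the argument on the left are available at this stage. The
  converse \<open>s n \<le> A * s (n + j)\<close> is obtained later from a renewal kernel charging
  two lengths, see \<open>shift_down_bounded\<close>.\<close>

lemma shift_up_bounded: "\<exists>C\<ge>1. \<forall>j\<le>J. \<forall>n\<ge>1. s (n + j) \<le> C * s n"
proof -
  obtain B where B: "B \<ge> 0" "\<And>n. n \<ge> 1 \<Longrightarrow> s n \<le> s 1 * real n powr B" using poly_bound by blast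
  define C where "C = s 1 * real (J + 1) powr B"
  have C1: "C \<ge> 1" using ge_1[of 1] B(1) mult_mono[of 1 "s 1" 1 "real (J + 1) powr B"] by (auto simp: C_def ge_one_powr_ge_zero)
  have "s (n + j) \<le> C * s n" if "j \<le> J" "n \<ge> 1" for j n
  proof (cases "j = 0")
    case True
    then show ?thesis using C1 pos[OF that(2)] by simp
  next
    case False
    have "s j \<le> s 1 * real j powr B" using B False by simp
    also have "\<dots> \<le> C" unfolding C_def using that ge_1[of 1] B by (intro mult_left_mono powr_mono2) auto
    finally have "s j * s n \<le> C * s n" using pos[OF that(2)] by (intro mult_right_mono) auto
    then show ?thesis using shift_up[of j n] that False by simp
  qed
  then show ?thesis using C1 by blast
qed

definition "E = D * s 1"

lemma E_ge_1: "E \<ge> 1" using D_ge_1 ge_1[of 1] mult_mono[of 1 D 1 "s 1"] by (simp add: E_def)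

lemma halve_le: "n \<ge> 2 \<Longrightarrow> s n \<le> E * s (n div 2)"
proof -
  assume n: "n \<ge> 2"
  define k where "k = n div 2"
  have k: "k \<ge> 1" "n = 2 * k \<or> n = 2 * k + 1" using n by (auto simp: k_def)
  have "s n \<le> s 1 * s (2 * k)"
  proof (cases "n = 2 * k")
    case True
    then show ?thesis using ge_1[of 1] pos[of n] n mult_right_mono[of 1 "s 1" "s n"] by simp
  next
    case False
    then show ?thesis using k submult[of 1 "2 * k"] by simp
  qed
  also have "\<dots> \<le> s 1 * (D * s k)" using double_le[of k] k ge_1[of 1] by (intro mult_left_mono) auto
  finally show ?thesis by (simp add: E_def k_def algebra_simps)
qed

text \<open>The half is rounded up here and down in \<open>halve_le\<close>: submultiplicativity can
  strip a unit only from the argument on the left of an inequality.\<close>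

lemma le_halve: "n \<ge> 1 \<Longrightarrow> s ((n + 1) div 2) \<le> E * s n"
proof -
  assume n: "n \<ge> 1"
  define k where "k = (n + 1) div 2"
  have k: "k \<ge> 1" "n = 2 * k \<or> n + 1 = 2 * k" using n by (auto simp: k_def)
  have "s (2 * k) \<le> s 1 * s n"
  proof (cases "n = 2 * k")
    case True
    then show ?thesis using ge_1[of 1] pos[of n] n mult_right_mono[of 1 "s 1" "s n"] by simp
  next
    case False
    then show ?thesis using k submult[of 1 n] n by (simp add: add.commute)
  qed
  then have "D * s (2 * k) \<le> D * (s 1 * s n)" using D_pos by (intro mult_left_mono) auto
  then show ?thesis using le_double[of k] k by (simp add: E_def k_def algebra_simps)
qed

lemma halve_iter_le: "n \<ge> 2 ^ k \<Longrightarrow> s n \<le> E ^ k * s (n div 2 ^ k)"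
proof (induction k)
  case (Suc k)
  define n1 where "n1 = n div 2 ^ k"
  have n1: "n1 \<ge> 2" using Suc.prems by (simp add: n1_def less_eq_div_iff_mult_less_eq mult.commute)
  have "s n \<le> E ^ k * s n1" using Suc by (simp add: n1_def)
  also have "\<dots> \<le> E ^ k * (E * s (n1 div 2))" using halve_le[OF n1] E_ge_1 by (intro mult_left_mono) auto
  also have "n1 div 2 = n div 2 ^ Suc k" unfolding n1_def power_Suc2 by (simp only: div_mult2_eq)
  finally show ?case by (simp add: algebra_simps)
qed simp

lemma le_halve_iter:
  "n \<ge> 1 \<Longrightarrow> \<exists>n2\<ge>1. real n / 2 ^ k \<le> real n2 \<and> real n2 \<le> real n / 2 ^ k + 1 \<and> s n2 \<le> E ^ k * s n"
proof (induction k)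
  case 0
  then show ?case by (intro exI[of _ n]) auto
next
  case (Suc k)
  then obtain n2 where n2: "n2 \<ge> 1" "real n / 2 ^ k \<le> real n2" "real n2 \<le> real n / 2 ^ k + 1" "s n2 \<le> E ^ k * s n"
    by blast
  have "real (2 * ((n2 + 1) div 2)) \<le> real (n2 + 1)" by (subst of_nat_le_iff) simp
  moreover have "real n2 \<le> real (2 * ((n2 + 1) div 2))" by (subst of_nat_le_iff) simp
  ultimately have a: "real n2 / 2 \<le> real ((n2 + 1) div 2)" "real ((n2 + 1) div 2) \<le> (real n2 + 1) / 2"
    by simp_all
  have "s ((n2 + 1) div 2) \<le> E * (E ^ k * s n)"
    using order_trans[OF le_halve[OF n2(1)] mult_left_mono[OF n2(4), of E]] E_ge_1 by simp
  then show ?case using n2 a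
    by (intro exI[of _ "(n2 + 1) div 2"]) (auto simp: algebra_simps)
qed

end

subsection \<open>Renewal kernels\<close>

text \<open>Conditioned on the sum being \<open>m + i\<close>, resp. \<open>m + j\<close>, replacing one step \<open>i\<close> by \<open>j\<close> is a bijection; both
  step counts are concentrated around their means.\<close>
lemma cpow_exchange:
  assumes p: "\<And>a. p a \<ge> 0" "(\<Sum>a\<in>{1..h}. p a) = 1"
    and i: "i \<in> {1..h}" "p i > 0" and j: "j \<in> {1..h}" "p j > 0"
    and y: "y \<ge> 1" and d: "0 < \<delta>" "\<delta> \<le> 1"
  shows "(1 - \<delta>) * cpow h p y (m + i)
    \<le> (1 + \<delta>) * cpow h p y (m + j) + exp (1 - \<delta> * p i * sqrt y) + exp (1 - \<delta> * p j * sqrt y) / p j"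
proof -
  have le1: "p a \<le> 1" if "a \<in> {1..h}" for a
    using member_le_sum[of a "{1..h}" p] that p by auto
  have sq: "real y / sqrt (real y) = sqrt y" by (simp add: real_div_sqrt)
  have sumN: "sum_list (map (\<lambda>a. of_bool (a = b) - c) xs) = real (count_list xs b) - real (length xs) * c" for b :: nat and c :: real and xs
    by (induction xs) (auto simp: algebra_simps)
  have sumN': "sum_list (map (\<lambda>a. c - of_bool (a = b)) xs) = real (length xs) * c - real (count_list xs b)" for b :: nat and c :: real and xs
    by (induction xs) (auto simp: algebra_simps)
  have mean: "(\<Sum>a\<in>{1..h}. p a * (of_bool (a = b) - p b)) = 0" if "b \<in> {1..h}" for b
  proof -
    have "(\<Sum>a\<in>{1..h}. p a * (of_bool (a = b) - p b)) = (\<Sum>a\<in>{1..h}. if a = b then p a else 0) - (\<Sum>a\<in>{1..h}. p a) * p b"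
      unfolding sum_distrib_right sum_subtractf[symmetric] by (rule sum.cong) (auto simp: algebra_simps)
    also have "\<dots> = p b - p b" using that by (simp only: p(2)) simp
    finally show ?thesis by simp
  qed
  have mean': "(\<Sum>a\<in>{1..h}. p a * (p b - of_bool (a = b))) = 0" if "b \<in> {1..h}" for b
    using mean[OF that] by (simp add: algebra_simps sum_subtractf)
  define ei where "ei = list_expect h p y (\<lambda>xs. of_bool (\<delta> * p i * y \<le> sum_list (map (\<lambda>a. p i - of_bool (a = i)) xs)))"
  define ej where "ej = list_expect h p y (\<lambda>xs. of_bool (\<delta> * p j * y \<le> sum_list (map (\<lambda>a. of_bool (a = j) - p j) xs)))"
  have "ei \<le> exp (1 - (\<delta> * p i * y) / (1 * sqrt y))" unfolding ei_def
    by (rule list_expect_chernoff[OF p]) (use mean'[OF i(1)] y le1[OF i(1)] p(1)[of i] in \<open>auto\<close>)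
  then have ei: "ei \<le> exp (1 - \<delta> * p i * sqrt y)" using sq by (simp flip: times_divide_eq_right)
  have "ej \<le> exp (1 - (\<delta> * p j * y) / (1 * sqrt y))" unfolding ej_def
    by (rule list_expect_chernoff[OF p]) (use mean[OF j(1)] y le1[OF j(1)] p(1)[of j] in \<open>auto\<close>)
  then have ej: "ej \<le> exp (1 - \<delta> * p j * sqrt y)" using sq by (simp flip: times_divide_eq_right)
  let ?Q = "cpow h p (y - 1) m"
  \<comment> \<open>A pointwise inequality: on the rare event that i occurs at most (1 - \<delta>) *
    p i * y times the left side is not positive, and off that event the number of letters i exceeds
    this threshold.\<close>
  have "list_expect h p y (\<lambda>xs. ((1 - \<delta>) * p i * y) * of_bool (sum_list xs = m + i)
      + (- ((1 - \<delta>) * p i * y)) * of_bool (\<delta> * p i * y \<le> sum_list (map (\<lambda>a. p i - of_bool (a = i)) xs)))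
     \<le> list_expect h p y (\<lambda>xs. real (count_list xs i) * of_bool (sum_list xs = m + i))"
  proof (rule list_expect_mono[OF p(1)])
    fix xs :: "nat list" assume l: "length xs = y"
    have nn: "(1 - \<delta>) * p i * y \<ge> 0" using d i by simp
    show "((1 - \<delta>) * p i * y) * of_bool (sum_list xs = m + i)
      + (- ((1 - \<delta>) * p i * y)) * of_bool (\<delta> * p i * y \<le> sum_list (map (\<lambda>a. p i - of_bool (a = i)) xs))
      \<le> real (count_list xs i) * of_bool (sum_list xs = m + i)"
      unfolding sumN' l using nn by (auto simp: of_bool_def algebra_simps)
  qed
  then have "(1 - \<delta>) * p i * y * cpow h p y (m + i) - (1 - \<delta>) * p i * y * ei \<le> real y * p i * ?Q"
    unfolding list_expect_add list_expect_cmult list_expect_count[OF i(1)] by (simp add: ei_def cpow_eq_list_expect)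
  then have "(p i * y) * ((1 - \<delta>) * (cpow h p y (m + i) - ei)) \<le> (p i * y) * ?Q" by (simp add: algebra_simps)
  then have 1: "(1 - \<delta>) * (cpow h p y (m + i) - ei) \<le> ?Q" using i y by (subst (asm) mult_le_cancel_left_pos) auto
  have "list_expect h p y (\<lambda>xs. real (count_list xs j) * of_bool (sum_list xs = m + j))
     \<le> list_expect h p y (\<lambda>xs. ((1 + \<delta>) * p j * y) * of_bool (sum_list xs = m + j)
      + real y * of_bool (\<delta> * p j * y \<le> sum_list (map (\<lambda>a. of_bool (a = j) - p j) xs)))"
  proof (rule list_expect_mono[OF p(1)])
    fix xs :: "nat list" assume l: "length xs = y"
    have nn: "(1 + \<delta>) * p j * y \<ge> 0" using d j by simp
    have cl: "real (count_list xs j) \<le> real y" using l count_le_length by (simp flip: l)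
    show "real (count_list xs j) * of_bool (sum_list xs = m + j)
      \<le> ((1 + \<delta>) * p j * y) * of_bool (sum_list xs = m + j)
      + real y * of_bool (\<delta> * p j * y \<le> sum_list (map (\<lambda>a. of_bool (a = j) - p j) xs))"
      unfolding sumN l using nn cl by (auto simp: of_bool_def algebra_simps)
  qed
  then have "real y * p j * ?Q \<le> (1 + \<delta>) * p j * y * cpow h p y (m + j) + y * ej"
    unfolding list_expect_add list_expect_cmult list_expect_count[OF j(1)] by (simp add: ej_def cpow_eq_list_expect)
  then have "(p j * y) * ?Q \<le> (p j * y) * ((1 + \<delta>) * cpow h p y (m + j) + ej / p j)"
    using j by (simp add: algebra_simps)
  then have 2: "?Q \<le> (1 + \<delta>) * cpow h p y (m + j) + ej / p j"
    using j y by (subst (asm) mult_le_cancel_left_pos) auto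
  have 3: "(1 - \<delta>) * ei \<le> exp (1 - \<delta> * p i * sqrt y)"
  proof -
    have "ei \<ge> 0" unfolding ei_def
      using list_expect_mono[OF p(1), of y h "\<lambda>_. 0"] by (simp add: list_expect_zero)
    then have "(1 - \<delta>) * ei \<le> 1 * ei" using d by (intro mult_right_mono) auto
    then show ?thesis using ei by simp
  qed
  have 4: "ej / p j \<le> exp (1 - \<delta> * p j * sqrt y) / p j" using ej j by (simp add: divide_right_mono)
  show ?thesis using 1 2 3 4 by (simp add: algebra_simps)
qed

text \<open>The shift j \<le> K in the upper inequality absorbs the pieces cut off at the two ends
  of a walk. Stopping the sums at y = m loses nothing, because \<open>cpow h p y m\<close> vanishes
  for y > m.\<close>

locale renewal_kernel = doubling_submult +
  fixes h :: nat and p :: "nat \<Rightarrow> real" and K :: nat and c C :: real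
  assumes p_nonneg: "\<And>a. p a \<ge> 0" and p_sum: "(\<Sum>a\<in>{1..h}. p a) = 1" and c_pos: "c > 0" and C_pos: "C > 0"
    and renewal_lower: "\<And>m. m \<ge> 1 \<Longrightarrow> c * (\<Sum>y\<in>{1..m}. s y * cpow h p y m) \<le> s m"
    and renewal_upper: "\<And>m. m > K \<Longrightarrow> s m \<le> C * (\<Sum>j\<le>K. \<Sum>y\<in>{1..m}. s y * cpow h p y (m - j))"
begin

lemma cp_nonneg: "cpow h p y m \<ge> 0" using cpow_nonneg p_nonneg by blast

lemma h_ge_1: "h \<ge> 1" using p_sum by (cases h) auto

lemma renewal_lower_upto: "m \<ge> 1 \<Longrightarrow> c * (\<Sum>y\<in>{1..N}. s y * cpow h p y m) \<le> s m"
proof -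
  assume m: "m \<ge> 1"
  have "(\<Sum>y\<in>{1..N}. s y * cpow h p y m) \<le> (\<Sum>y\<in>{1..max N m}. s y * cpow h p y m)"
    using pos by (intro sum_mono2) (auto simp: cp_nonneg less_imp_le)
  also have "\<dots> = (\<Sum>y\<in>{1..m}. s y * cpow h p y m)"
    by (rule sum.mono_neutral_right) (auto simp: cpow_eq_0)
  finally show ?thesis using renewal_lower[OF m] c_pos by (meson less_imp_le mult_left_mono order_trans)
qed

definition mean :: real where "mean = (\<Sum>a\<in>{1..h}. p a * real a)"

lemma mean_bounds: "1 \<le> mean" "mean \<le> real h"
proof -
  have "(\<Sum>a\<in>{1..h}. p a * 1) \<le> mean" unfolding mean_def
    by (intro sum_mono mult_left_mono p_nonneg) auto
  then show "1 \<le> mean" using p_sum by simp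
  have "mean \<le> (\<Sum>a\<in>{1..h}. p a * real h)" unfolding mean_def
    by (intro sum_mono mult_left_mono p_nonneg) auto
  then show "mean \<le> real h" using p_sum by (simp flip: sum_distrib_right)
qed

lemma cpow_tail:
  assumes y: "y \<ge> 1" and m: "\<bar>real m - mean * real y\<bar> \<ge> real y powr (1/2 + e)"
  shows "cpow h p y m \<le> exp (1 - real y powr e / real h)"
proof -
  have sm: "sum_list (map (\<lambda>a. real a - mean) xs) = real (sum_list xs) - mean * real (length xs)"
    "sum_list (map (\<lambda>a. mean - real a) xs) = mean * real (length xs) - real (sum_list xs)" for xs
    by (induction xs) (auto simp: algebra_simps)
  have bd: "\<bar>real a - mean\<bar> \<le> real h" "\<bar>mean - real a\<bar> \<le> real h" if "a \<in> {1..h}" for a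
    using that mean_bounds by auto
  have z: "(\<Sum>a\<in>{1..h}. p a * (real a - mean)) = 0"
  proof -
    have "(\<Sum>a\<in>{1..h}. p a * (real a - mean)) = mean - (\<Sum>a\<in>{1..h}. p a) * mean"
      unfolding mean_def sum_distrib_right sum_subtractf[symmetric] by (rule sum.cong) (auto simp: algebra_simps)
    then show ?thesis unfolding p_sum by simp
  qed
  then have z': "(\<Sum>a\<in>{1..h}. p a * (mean - real a)) = 0" by (simp add: algebra_simps sum_subtractf)
  have hp: "real h > 0" using h_ge_1 by simp
  have t: "real y powr (1/2 + e) / (real h * sqrt y) = real y powr e / h"
    using y by (simp add: powr_add powr_half_sqrt)
  show ?thesis
  proof (cases "real m \<ge> mean * real y")
    case True
    have "cpow h p y m \<le> list_expect h p y (\<lambda>xs. of_bool (real y powr (1/2+e) \<le> sum_list (map (\<lambda>a. real a - mean) xs)))"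
      unfolding cpow_eq_list_expect
      by (rule list_expect_mono[OF p_nonneg]) (use m True in \<open>auto simp: sm\<close>)
    also have "\<dots> \<le> exp (1 - real y powr (1/2+e) / (real h * sqrt y))"
      by (rule list_expect_chernoff[OF p_nonneg p_sum hp bd(1) z y])
    finally show ?thesis unfolding t .
  next
    case False
    have "cpow h p y m \<le> list_expect h p y (\<lambda>xs. of_bool (real y powr (1/2+e) \<le> sum_list (map (\<lambda>a. mean - real a) xs)))"
      unfolding cpow_eq_list_expect
      by (rule list_expect_mono[OF p_nonneg]) (use m False in \<open>auto simp: sm\<close>)
    also have "\<dots> \<le> exp (1 - real y powr (1/2+e) / (real h * sqrt y))"
      by (rule list_expect_chernoff[OF p_nonneg p_sum hp bd(2) z' y])
    finally show ?thesis unfolding t .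
  qed
qed

text \<open>The renewal mass function: the probability that the random walk with step law
  \<open>p\<close>, started at 0, ever visits k. Steps are positive, so a site is visited at most
  once. Integer arguments let \<open>U_rec\<close> reach below 0, where the value is 0.\<close>

definition U :: "int \<Rightarrow> real" where
  "U k = (if k < 0 then 0 else (\<Sum>y\<le>nat k. cpow h p y (nat k)))"

lemma U_upto: "k \<le> int N \<Longrightarrow> 0 \<le> k \<Longrightarrow> U k = (\<Sum>y\<le>N. cpow h p y (nat k))"
  unfolding U_def by (auto intro!: sum.mono_neutral_left cpow_eq_0)

lemma U_nonneg: "U k \<ge> 0" by (auto simp: U_def intro!: sum_nonneg cp_nonneg)

lemma U_0: "U 0 = 1" by (simp add: U_def)

lemma U_rec:
  assumes k: "k \<ge> 1"
  shows "U k = (\<Sum>a\<in>{1..h}. p a * U (k - int a))"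
proof -
  obtain n where n: "k = int (Suc n)" using k by (metis Suc_pred' nonneg_int_cases of_nat_0_less_iff less_le_trans zero_less_one order_trans zero_le_one)
  have nk: "nat k = Suc n" "(k < 0) = False" using n by auto
  have "U k = (\<Sum>y\<le>Suc n. cpow h p y (Suc n))" by (simp only: U_def nk if_False)
  also have "\<dots> = (\<Sum>y\<le>n. cpow h p (Suc y) (Suc n))" by (simp only: sum.atMost_Suc_shift) simp
  also have "\<dots> = (\<Sum>a\<in>{1..h}. \<Sum>y\<le>n. if a \<le> Suc n then p a * cpow h p y (Suc n - a) else 0)"
    unfolding cpow.simps by (rule sum.swap)
  also have "\<dots> = (\<Sum>a\<in>{1..h}. p a * U (k - int a))"
  proof (rule sum.cong[OF refl])
    fix a assume a: "a \<in> {1..h}"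
    show "(\<Sum>y\<le>n. if a \<le> Suc n then p a * cpow h p y (Suc n - a) else 0) = p a * U (k - int a)"
    proof (cases "a \<le> Suc n")
      case True
      have "U (k - int a) = (\<Sum>y\<le>n. cpow h p y (nat (k - int a)))"
        by (rule U_upto) (use a n True in auto)
      moreover have "nat (k - int a) = Suc n - a" using n True by auto
      ultimately show ?thesis using True by (simp add: sum_distrib_left)
    next
      case False
      then show ?thesis using n by (auto simp: U_def)
    qed
  qed
  finally show ?thesis .
qed

lemma U_le_1: "U k \<le> 1"
proof (induction "nat k" arbitrary: k rule: less_induct)
  case less
  show ?case
  proof (cases "k \<ge> 1")
    case True
    have "U k \<le> (\<Sum>a\<in>{1..h}. p a * 1)" unfolding U_rec[OF True]
    proof (intro sum_mono mult_left_mono p_nonneg)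
      fix a assume "a \<in> {1..h}"
      then show "U (k - int a) \<le> 1" using True by (intro less) auto
    qed
    then show ?thesis using p_sum by simp
  next
    case False
    then show ?thesis using U_0 by (cases "k = 0") (auto simp: U_def)
  qed
qed

text \<open>Steps are at most h, so the walk cannot jump over h consecutive sites. The induction
  also covers windows that start strictly between -h and 1; these contain 0 and serve as the base
  case.\<close>

lemma U_window: "k \<ge> 0 \<Longrightarrow> (\<Sum>j<h. U (k + int j)) \<ge> 1"
proof -
  have "k > - int h \<Longrightarrow> (\<Sum>j<h. U (k + int j)) \<ge> 1" for k
  proof (induction "nat (k + int h)" arbitrary: k rule: less_induct)
    case less
    show ?case
    proof (cases "k \<ge> 1")
      case True
      have "1 = (\<Sum>a\<in>{1..h}. p a * 1)" using p_sum by simp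
      also have "\<dots> \<le> (\<Sum>a\<in>{1..h}. p a * (\<Sum>j<h. U (k - int a + int j)))"
        using less.hyps True by (intro sum_mono mult_left_mono p_nonneg) auto
      also have "\<dots> = (\<Sum>j<h. \<Sum>a\<in>{1..h}. p a * U (k + int j - int a))"
        unfolding sum_distrib_left by (subst sum.swap) (simp add: algebra_simps)
      also have "\<dots> = (\<Sum>j<h. U (k + int j))"
        using True by (intro sum.cong refl U_rec[symmetric]) auto
      finally show ?thesis .
    next
      case False
      define j where "j = nat (- k)"
      have j: "j < h" "k + int j = 0" using False less.prems by (auto simp: j_def)
      have "U (k + int j) \<le> (\<Sum>j<h. U (k + int j))"
        by (rule member_le_sum) (use j U_nonneg in auto)
      then show ?thesis using j U_0 by simp
    qed
  qed
  then show "k \<ge> 0 \<Longrightarrow> (\<Sum>j<h. U (k + int j)) \<ge> 1" using h_ge_1 by simp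
qed

end

lemma powr_eventually_ge:
  fixes e A :: real
  assumes "e > 0"
  shows "\<exists>n0::nat\<ge>1. \<forall>n\<ge>n0. A \<le> real n powr e"
proof -
  define B where "B = max A 1"
  obtain n0 :: nat where n0: "B powr (1 / e) \<le> real n0" using real_arch_simple by blast
  have "A \<le> real n powr e" if "n \<ge> max n0 1" for n
  proof -
    have "B = (B powr (1 / e)) powr e" using assms by (simp add: powr_powr B_def)
    also have "\<dots> \<le> real n powr e" using that n0 assms by (intro powr_mono2) auto
    finally show ?thesis by (simp add: B_def)
  qed
  then show ?thesis by (intro exI[of _ "max n0 1"]) auto
qed

subsection \<open>Kernels charging two lengths\<close>

text \<open>Exchanging a step i for a step i + d moves the sum by d. No aperiodicity is assumed, so
  only arguments congruent modulo d are compared directly, and a remainder below d is left to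
  \<open>shift_up_bounded\<close>.\<close>

locale spread_kernel = renewal_kernel +
  fixes i d :: nat
  assumes i: "i \<ge> 1" and d: "d \<ge> 1" and id: "i + d \<le> h"
    and p_i: "p i > 0" and p_id: "p (i + d) > 0"
begin

definition q :: real where "q = min (p i) (p (i + d))"

lemma p_le_1: "a \<in> {1..h} \<Longrightarrow> p a \<le> 1"
  using member_le_sum[of a "{1..h}" p] p_nonneg p_sum by auto

lemma q_bounds: "0 < q" "q \<le> 1" "q \<le> p i" "q \<le> p (i + d)"
  using p_i p_id p_le_1[of i] i id by (auto simp: q_def)

text \<open>Joint error of the two Chernoff estimates in \<open>cpow_exchange\<close> at \<delta> =
  x powr (-1/2 + e): each is at most exp (1 - q * x powr e) / q, and dividing by 1 - \<delta> >= 1/2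
  doubles their sum.\<close>

definition T :: "real \<Rightarrow> real \<Rightarrow> real" where "T e x = (4 / q) * exp (1 - q * x powr e)"

lemma T_nonneg: "T e x \<ge> 0" using q_bounds by (simp add: T_def)

lemma exchange_step:
  assumes ab: "a \<in> {1..h}" "b \<in> {1..h}" "q \<le> p a" "q \<le> p b"
    and y: "y \<ge> 1" and del: "\<delta> = real y powr (-1/2 + e)" "\<delta> \<le> 1/2"
  shows "cpow h p y (m + a) \<le> (1 + 4 * \<delta>) * cpow h p y (m + b) + T e y"
proof -
  let ?X = "cpow h p y (m + a)" and ?Z = "cpow h p y (m + b)"
  let ?G = "exp (1 - q * real y powr e)"
  have dpos: "\<delta> > 0" using y del by simp
  have ds: "\<delta> * sqrt y = real y powr e"
    using y unfolding del by (simp add: powr_half_sqrt[symmetric] flip: powr_add)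
  have pa: "p a > 0" "p b > 0" using ab q_bounds by auto
  have g: "exp (1 - \<delta> * p x * sqrt y) \<le> ?G" if "q \<le> p x" for x
  proof -
    have eq: "\<delta> * p x * sqrt y = p x * real y powr e" by (simp add: algebra_simps flip: ds)
    have "q * real y powr e \<le> p x * real y powr e" using that by (intro mult_right_mono) auto
    then show ?thesis unfolding eq by simp
  qed
  have "(1 - \<delta>) * ?X \<le> (1 + \<delta>) * ?Z + exp (1 - \<delta> * p a * sqrt y) + exp (1 - \<delta> * p b * sqrt y) / p b"
    by (rule cpow_exchange[OF p_nonneg p_sum ab(1) pa(1) ab(2) pa(2) y dpos]) (use del in simp)
  moreover have "exp (1 - \<delta> * p a * sqrt y) \<le> ?G / q"
  proof -
    have "?G * q \<le> ?G * 1" using q_bounds by (intro mult_left_mono) auto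
    then have "?G \<le> ?G / q" using q_bounds by (simp add: pos_le_divide_eq)
    then show ?thesis by (rule order_trans[OF g[OF ab(3)]])
  qed
  moreover have "exp (1 - \<delta> * p b * sqrt y) / p b \<le> ?G / q"
    using g[OF ab(4)] ab q_bounds by (intro frac_le) auto
  ultimately have 1: "(1 - \<delta>) * ?X \<le> (1 + \<delta>) * ?Z + T e y / 2" by (simp add: T_def)
  have "(1 + \<delta>) * ?Z \<le> ((1 - \<delta>) * (1 + 4 * \<delta>)) * ?Z"
  proof (rule mult_right_mono[OF _ cp_nonneg])
    have "\<delta> * \<delta> \<le> \<delta> * (1/2)" using dpos del(2) by (intro mult_left_mono) auto
    then show "1 + \<delta> \<le> (1 - \<delta>) * (1 + 4 * \<delta>)" by (simp add: algebra_simps)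
  qed
  moreover have "T e y / 2 \<le> (1 - \<delta>) * T e y"
    using mult_right_mono[OF _ T_nonneg, of "1/2" "1 - \<delta>" e "real y"] del(2) by simp
  ultimately have "(1 - \<delta>) * ?X \<le> (1 - \<delta>) * ((1 + 4 * \<delta>) * ?Z + T e y)"
    using 1 by (simp add: algebra_simps)
  then show ?thesis using del(2) by (subst (asm) mult_le_cancel_left_pos) auto
qed

lemma exchange_iter:
  assumes y: "y \<ge> 1" and del: "\<delta> = real y powr (-1/2 + e)" "\<delta> \<le> 1/2" and m: "m \<ge> i"
  shows "cpow h p y m \<le> (1 + 4 * \<delta>) ^ r * (cpow h p y (m + r * d) + r * T e y)"
    and "cpow h p y (m + r * d) \<le> (1 + 4 * \<delta>) ^ r * (cpow h p y m + r * T e y)"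
proof -
  have dpos: "\<delta> > 0" using y del by simp
  let ?A = "1 + 4 * \<delta>"
  have A1: "?A ^ k \<ge> 1" for k using dpos by simp
  have up: "cpow h p y n \<le> ?A * cpow h p y (n + d) + T e y" if "n \<ge> i" for n
    using exchange_step[of i "i + d" y \<delta> e "n - i"] that q_bounds i id y del by auto
  have dn: "cpow h p y (n + d) \<le> ?A * cpow h p y n + T e y" if "n \<ge> i" for n
    using exchange_step[of "i + d" i y \<delta> e "n - i"] that q_bounds i id y del by auto
  show "cpow h p y m \<le> ?A ^ r * (cpow h p y (m + r * d) + r * T e y)"
  proof (induction r)
    case (Suc r)
    have "cpow h p y m \<le> ?A ^ r * (cpow h p y (m + r * d) + r * T e y)" by fact
    also have "\<dots> \<le> ?A ^ r * ((?A * cpow h p y (m + r * d + d) + T e y) + r * T e y)"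
      using up[of "m + r * d"] m dpos by (intro mult_left_mono add_right_mono) auto
    also have "\<dots> \<le> ?A ^ r * (?A * (cpow h p y (m + r * d + d) + real (Suc r) * T e y))"
    proof (intro mult_left_mono)
      have "1 * (real (Suc r) * T e y) \<le> ?A * (real (Suc r) * T e y)"
        using dpos T_nonneg by (intro mult_right_mono) auto
      then show "(?A * cpow h p y (m + r * d + d) + T e y) + r * T e y \<le> ?A * (cpow h p y (m + r * d + d) + real (Suc r) * T e y)"
        by (simp add: algebra_simps)
    qed (use dpos in auto)
    finally show ?case by (simp add: algebra_simps)
  qed simp
  show "cpow h p y (m + r * d) \<le> ?A ^ r * (cpow h p y m + r * T e y)"
  proof (induction r)
    case (Suc r)
    have "cpow h p y (m + Suc r * d) \<le> ?A * cpow h p y (m + r * d) + T e y"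
      using dn[of "m + r * d"] m by (simp add: algebra_simps)
    also have "\<dots> \<le> ?A * (?A ^ r * (cpow h p y m + r * T e y)) + T e y"
      using Suc dpos by (intro add_right_mono mult_left_mono) auto
    also have "\<dots> \<le> ?A ^ Suc r * (cpow h p y m + real (Suc r) * T e y)"
      using mult_right_mono[OF A1[of "Suc r"] T_nonneg, of e "real y"] by (simp add: algebra_simps)
    finally show ?case .
  qed simp
qed

text \<open>The remainder j is added above n, the direction in which \<open>shift_up_bounded\<close>
  can remove it. It depends on m and n but not on y, so that the estimate can be summed against
  \<open>s y\<close> to give a renewal sum at the single point n + j. R bounds the number of
  exchanges.\<close>

lemma exchange_window:
  assumes m: "m \<ge> i" "n \<ge> i" and R: "m \<le> n + R" "n + d \<le> m + R"
  shows "\<exists>j<d. \<forall>y\<ge>1. \<forall>e. real y powr (-1/2 + e) \<le> 1/2 \<longrightarrow>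
     cpow h p y m \<le> (1 + 4 * real y powr (-1/2 + e)) ^ R * (cpow h p y (n + j) + R * T e y)"
proof -
  have mono: "(1 + 4 * x) ^ r * (z + real r * T e y) \<le> (1 + 4 * x) ^ R * (z + R * T e y)"
    if "r \<le> R" "x \<ge> 0" "z \<ge> 0" for r x z e y
    using that T_nonneg[of e y] by (intro mult_mono power_increasing add_mono mult_right_mono) auto
  show ?thesis
  proof (cases "m \<le> n")
    case True
    define r where "r = (n - m + d - 1) div d"
    have a: "r * d \<le> n - m + d - 1" by (simp add: r_def)
    have b: "n - m \<le> r * d"
    proof -
      have "n - m + d - 1 = r * d + (n - m + d - 1) mod d" by (simp add: r_def)
      moreover have "(n - m + d - 1) mod d < d" using d by simp
      ultimately show ?thesis using d by linarith
    qed
    have "r \<le> r * d" using d by simp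
    then have rR: "r \<le> R" using a R True d by linarith
    have "m + r * d = n + (m + r * d - n)" "m + r * d - n < d" using a b True d by linarith+
    then obtain j where j: "j < d" "m + r * d = n + j" by blast
    show ?thesis
    proof (intro exI[of _ j] conjI allI impI)
      fix y :: nat and e :: real assume y: "1 \<le> y" "real y powr (-1/2 + e) \<le> 1/2"
      show "cpow h p y m \<le> (1 + 4 * real y powr (-1/2 + e)) ^ R * (cpow h p y (n + j) + R * T e y)"
        using order_trans[OF exchange_iter(1)[OF y(1) refl y(2) m(1), of r] mono[OF rR powr_ge_zero cp_nonneg]]
        by (simp only: j(2))
    qed (rule j(1))
  next
    case False
    define r where "r = (m - n) div d"
    define j where "j = (m - n) mod d"
    have mm: "m = (n + j) + r * d" using False by (simp add: r_def j_def)
    have "r \<le> r * d" using d by simp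
    then have rR: "r \<le> R" using mm R by linarith
    have ji: "n + j \<ge> i" using m by simp
    show ?thesis
    proof (intro exI[of _ j] conjI allI impI)
      show "j < d" using d by (simp add: j_def)
      fix y :: nat and e :: real assume y: "1 \<le> y" "real y powr (-1/2 + e) \<le> 1/2"
      show "cpow h p y m \<le> (1 + 4 * real y powr (-1/2 + e)) ^ R * (cpow h p y (n + j) + R * T e y)"
        using order_trans[OF exchange_iter(2)[OF y(1) refl y(2) ji, of r] mono[OF rR powr_ge_zero cp_nonneg]]
        by (simp only: mm[symmetric])
    qed
  qed
qed

lemma poly_on: "\<exists>B\<ge>0. \<exists>M\<ge>1. (\<forall>n\<ge>1. s n \<le> M * real n powr B)"
  using poly_bound ge_1[of 1] by blast

lemma small_case: "\<exists>A>0. \<forall>n\<ge>1. \<forall>n'. n' \<ge> 1 \<longrightarrow> n' \<le> N \<longrightarrow> s n' \<le> A * s n"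
proof -
  obtain B M where B: "B \<ge> 0" "M \<ge> 1" "\<And>n. n \<ge> 1 \<Longrightarrow> s n \<le> M * real n powr B" using poly_on by blast
  have "s n' \<le> (M * real (N + 1) powr B) * s n" if "n \<ge> 1" "n' \<ge> 1" "n' \<le> N" for n n'
  proof -
    have "s n' \<le> M * real n' powr B" using B that by auto
    also have "\<dots> \<le> M * real (N + 1) powr B" using that B by (intro mult_left_mono powr_mono2) auto
    also have "\<dots> * 1 \<le> \<dots> * s n" using ge_1[OF that(1)] B by (intro mult_left_mono) auto
    finally show ?thesis by simp
  qed
  moreover have "M * real (N + 1) powr B > 0" using B(2) by (intro mult_pos_pos) auto
  ultimately show ?thesis by blast
qed

text \<open>\<open>renewal_upper\<close> expands s n', the kernels at n' - j0 are moved to n + j by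
  at most R exchanges, and \<open>renewal_lower\<close> resums them. Each exchange has relative
  error of order y^(-1/2 + e) with y at least of order n, so R exchanges cost a bounded factor
  because R is of order n^(1/2 - 2 e). The additive errors are smaller than any power of n, while s
  is at least 1 and grows at most polynomially.\<close>

lemma smooth_small:
  assumes e: "0 < e" "e \<le> 1/8"
  shows "\<exists>A>0. \<forall>n\<ge>1. \<forall>n'\<ge>1. \<bar>real n' - real n\<bar> \<le> real n powr (1/2 - 2 * e) \<longrightarrow> s n' \<le> A * s n"
proof -
  obtain B M where B: "B \<ge> 0" "M \<ge> 1" "\<And>n. n \<ge> 1 \<Longrightarrow> s n \<le> M * real n powr B" using poly_on by blast
  have hp: "real h > 0" "real h \<ge> 1" using h_ge_1 by auto
  \<comment> \<open>The rate in the additive error: q * Y powr e = w * n powr e for the Y = n / (4 *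
    h) introduced below.\<close>
  define w where "w = q * (1 / (4 * real h)) powr e"
  have wpos: "w > 0" using q_bounds hp by (simp add: w_def)
  obtain S where S: "S > 0" "\<And>x. x \<ge> 1 \<Longrightarrow> exp (- w * x powr e) * x powr (B + 2) \<le> S"
    using exp_powr_superpoly[OF wpos e(1), of "B + 2"] by blast
  obtain C1 where C1: "C1 \<ge> 1" "\<And>j n. j \<le> h \<Longrightarrow> n \<ge> 1 \<Longrightarrow> s (n + j) \<le> C1 * s n"
    using shift_up_bounded[of h] by blast
  \<comment> \<open>(1 + 4 \<delta>)^R is at most exp (4 * \<delta> * R), and \<delta> * R is at
    most 4 * h * (2 + K + h) for \<delta> = Y powr (-1/2 + e).\<close>
  define G where "G = exp (16 * real h * (2 + real K + real h))"
  define S' where "S' = 24 / q * exp 1 * M * 2 powr B * S"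
  define A where "A = C * (real K + 1) * (G * (C1 / c + S'))"
  define n0 where "n0 = 32 * h + 4 * K + 4"
  have large: "s n' \<le> A * s n" if n: "n \<ge> n0" and n': "\<bar>real n' - real n\<bar> \<le> real n powr (1/2 - 2 * e)" for n n'
  proof -
    have n1: "real n \<ge> 1" "n \<ge> 1" using n by (auto simp: n0_def)
    have sq: "real n powr (1/2 - 2*e) \<le> real n / 2"
    proof -
      have "real n powr (1/2 - 2*e) \<le> real n powr (1/2)" using n1 e by (intro powr_mono) auto
      also have "\<dots> = sqrt n" by (simp add: powr_half_sqrt)
      also have "\<dots> \<le> real n / 2"
      proof (rule real_le_lsqrt)
        have "real n * 4 \<le> real n * real n" using n by (intro mult_left_mono) (auto simp: n0_def)
        then show "real n \<le> (real n / 2)\<^sup>2" by (simp add: power2_eq_square)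
      qed auto
      finally show ?thesis .
    qed
    have n'b: "real n' \<ge> real n / 2" "real n' \<le> 2 * real n" using n' sq by linarith+
    have nK: "real K + real h \<le> real n / 4" using n by (simp add: n0_def)
    have Kn': "K < n'" using n'b nK hp by linarith
    \<comment> \<open>A nonzero kernel at n' - j0 forces h * y >= n' - j0 >= n / 4, hence y >= Y;
      this makes the exchange errors uniform in y.\<close>
    define Y where "Y = real n / (4 * real h)"
    have Y8: "Y \<ge> 8" using n hp by (simp add: Y_def n0_def field_simps flip: of_nat_mult)
    \<comment> \<open>Distance of the two arguments, plus K for the shift j0, plus h for the
      remainder modulo d.\<close>
    define R where "R = nat \<lceil>real n powr (1/2 - 2*e)\<rceil> + K + h"
    have R1: "real R \<le> real n powr (1/2 - 2*e) + 1 + real K + real h"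
      unfolding R_def by (simp add: of_nat_nat powr_ge_zero)
    have R2: "real n powr (1/2 - 2*e) + real K + real h \<le> real R"
      unfolding R_def by (simp add: of_nat_nat powr_ge_zero)
    have R3: "real R \<le> 3 * real n" using R1 sq nK n1 by linarith
    have exch: "\<exists>j<d. \<forall>y\<in>{1..n'}. cpow h p y (n' - j0) \<le> G * (cpow h p y (n + j) + R * T e Y)"
      if j0: "j0 \<le> K" for j0
    proof -
      have m: "real (n' - j0) = real n' - real j0" using j0 Kn' by (simp add: of_nat_diff)
      have m4: "real (n' - j0) \<ge> real n / 4" using m n'b nK j0 hp by linarith
      have "real (n' - j0) \<ge> real h" using m4 nK by linarith
      then have mi: "n' - j0 \<ge> i" using id by simp
      have "real n \<ge> real h" using nK by linarith
      then have ni: "n \<ge> i" using id by simp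
      have "real (n' - j0) \<le> real n + real R" using m n' R2 by linarith
      then have Ra: "n' - j0 \<le> n + R" by linarith
      have "real n + real d \<le> real (n' - j0) + real R" using m n' R2 j0 id by linarith
      then have Rb: "n + d \<le> (n' - j0) + R" by linarith
      obtain j where j: "j < d" "\<And>y. y \<ge> 1 \<Longrightarrow> real y powr (-1/2 + e) \<le> 1/2 \<Longrightarrow>
          cpow h p y (n' - j0) \<le> (1 + 4 * real y powr (-1/2 + e)) ^ R * (cpow h p y (n + j) + R * T e y)"
        using exchange_window[OF mi ni Ra Rb] by blast
      have "cpow h p y (n' - j0) \<le> G * (cpow h p y (n + j) + R * T e Y)" if y: "y \<in> {1..n'}" for y
      proof (cases "h * y < n' - j0")
        case True
        then show ?thesis using cpow_eq_0[of "n' - j0" y h p] cp_nonneg[of y "n + j"] T_nonneg by (simp add: G_def)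
      next
        case False
        then have "real h * real y \<ge> real (n' - j0)" by (simp flip: of_nat_mult)
        then have yY: "real y \<ge> Y" using m4 hp by (simp add: Y_def field_simps)
        have ex: "-1/2 + e \<le> 0" using e by simp
        have d1: "real y powr (-1/2 + e) \<le> Y powr (-1/2 + e)"
          using yY Y8 ex by (intro powr_mono2') auto
        have "Y powr (-1/2 + e) \<le> 8 powr (-1/2 + e)" using Y8 ex by (intro powr_mono2') auto
        also have "\<dots> \<le> 8 powr (-1/3)" using e by (intro powr_mono) auto
        also have "\<dots> = 1/2"
        proof -
          have "(8::real) = 2 powr 3" by simp
          then have "(8::real) powr (-1/3) = 2 powr (3 * (-1/3))" by (metis powr_powr)
          then show ?thesis by (simp add: powr_minus_divide)
        qed
        finally have d2: "real y powr (-1/2 + e) \<le> 1/2" using d1 by simp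
        have d3: "Y powr (-1/2 + e) * real R \<le> 4 * real h * (2 + real K + real h)"
        proof -
          have Ye: "Y powr (-1/2 + e) \<le> 4 * real h * real n powr (-1/2 + e)"
          proof -
            have a: "Y powr (-1/2 + e) = real n powr (-1/2 + e) * (1 / (4 * real h)) powr (-1/2 + e)"
              unfolding Y_def using hp by (subst powr_mult[symmetric]) auto
            have "(1 / (4 * real h)) powr (-1/2 + e) = (4 * real h) powr (1/2 - e)"
              using hp by (simp add: powr_divide powr_minus_divide[symmetric] powr_minus)
            also have "\<dots> \<le> (4 * real h) powr 1" using hp e by (intro powr_mono) auto
            finally have "(1 / (4 * real h)) powr (-1/2 + e) \<le> 4 * real h" using hp by simp
            then have "real n powr (-1/2 + e) * (1 / (4 * real h)) powr (-1/2 + e) \<le> real n powr (-1/2 + e) * (4 * real h)"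
              by (intro mult_left_mono) auto
            then show ?thesis unfolding a by (simp add: mult_ac)
          qed
          have "real n powr (-1/2 + e) * real R \<le> real n powr (-1/2 + e) * (real n powr (1/2 - 2*e) + 1 + real K + real h)"
            using R1 by (intro mult_left_mono) auto
          also have "\<dots> = real n powr (-e) + real n powr (-1/2 + e) * (1 + real K + real h)"
            by (simp add: algebra_simps flip: powr_add)
          also have "\<dots> \<le> 1 + 1 * (1 + real K + real h)"
          proof (intro add_mono mult_right_mono)
            show "real n powr (-e) \<le> 1" using n1 e powr_mono[of "-e" 0 "real n"] by simp
            show "real n powr (-1/2 + e) \<le> 1" using n1 ex powr_mono[of "-1/2+e" 0 "real n"] by simp
          qed auto
          finally have z: "real n powr (-1/2 + e) * real R \<le> 2 + real K + real h" by simp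
          have "Y powr (-1/2 + e) * real R \<le> 4 * real h * real n powr (-1/2 + e) * real R"
            using Ye by (intro mult_right_mono) auto
          also have "\<dots> \<le> 4 * real h * (2 + real K + real h)" using z hp by simp
          finally show ?thesis .
        qed
        have pw: "(1 + 4 * real y powr (-1/2 + e)) ^ R \<le> G"
        proof -
          have "(1 + 4 * real y powr (-1/2 + e)) ^ R \<le> exp (4 * Y powr (-1/2 + e)) ^ R"
          proof (intro power_mono)
            have "1 + 4 * real y powr (-1/2 + e) \<le> 1 + 4 * Y powr (-1/2 + e)" using d1 by simp
            also have "\<dots> \<le> exp (4 * Y powr (-1/2 + e))" by (rule exp_ge_add_one_self)
            finally show "1 + 4 * real y powr (-1/2 + e) \<le> exp (4 * Y powr (-1/2 + e))" .
          qed auto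
          also have "\<dots> = exp (4 * (Y powr (-1/2 + e) * real R))" by (simp add: algebra_simps flip: exp_of_nat_mult)
          also have "\<dots> \<le> exp (4 * (4 * real h * (2 + real K + real h)))" using d3 by (simp only: exp_le_cancel_iff)
          also have "\<dots> = G" unfolding G_def by (simp add: mult.assoc)
          finally show ?thesis .
        qed
        have Tm: "T e y \<le> T e Y"
        proof -
          have "Y powr e \<le> real y powr e" using yY Y8 e by (intro powr_mono2) auto
          then have "q * Y powr e \<le> q * real y powr e" using q_bounds by simp
          then show ?thesis using q_bounds unfolding T_def by (intro mult_left_mono) auto
        qed
        have y1: "y \<ge> 1" using y by simp
        note j(2)[OF y1 d2]
        also have "(1 + 4 * real y powr (-1/2 + e)) ^ R * (cpow h p y (n + j) + R * T e y)
          \<le> G * (cpow h p y (n + j) + R * T e Y)"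
          using pw Tm T_nonneg cp_nonneg by (intro mult_mono add_mono mult_left_mono) (auto simp: G_def)
        finally show ?thesis .
      qed
      then show ?thesis using j(1) by blast
    qed
    have err: "(\<Sum>y\<in>{1..n'}. s y * (R * T e Y)) \<le> S'"
    proof -
      have "(\<Sum>y\<in>{1..n'}. s y * (R * T e Y)) \<le> (\<Sum>y\<in>{1..n'}. (M * (2 * real n) powr B) * (3 * real n * T e Y))"
      proof (intro sum_mono mult_mono)
        fix y assume y: "y \<in> {1..n'}"
        have "s y \<le> M * real y powr B" using B y by auto
        also have "\<dots> \<le> M * (2 * real n) powr B" using y n'b B by (intro mult_left_mono powr_mono2) auto
        finally show "s y \<le> M * (2 * real n) powr B" .
        show "real R \<le> 3 * real n" by fact
      qed (use B T_nonneg in auto)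
      also have "\<dots> = real n' * ((M * (2 * real n) powr B) * (3 * real n * T e Y))" by simp
      also have "\<dots> \<le> (2 * real n) * ((M * (2 * real n) powr B) * (3 * real n * T e Y))"
        using n'b B T_nonneg by (intro mult_right_mono) auto
      also have "\<dots> = (24 / q * exp 1 * M * 2 powr B) * (exp (- w * real n powr e) * real n powr (B + 2))"
      proof -
        have "T e Y = 4 / q * exp 1 * exp (- w * real n powr e)"
        proof -
          have "Y powr e = real n powr e * (1 / (4 * real h)) powr e" unfolding Y_def using hp by (subst powr_mult[symmetric]) auto
          then have "1 - q * Y powr e = 1 + (- w * real n powr e)" by (simp add: w_def algebra_simps)
          then show ?thesis unfolding T_def by (simp only: exp_add)
        qed
        moreover have "real n powr (B + 2) = real n powr B * (real n * real n)" using n1 by (simp add: powr_add power2_eq_square)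
        moreover have "(2 * real n) powr B = 2 powr B * real n powr B" using n1 by (simp add: powr_mult)
        ultimately show ?thesis by (simp add: algebra_simps)
      qed
      also have "\<dots> \<le> S'" unfolding S'_def using S(2)[OF n1(1)] B q_bounds by (intro mult_left_mono) auto
      finally show ?thesis .
    qed
    have "(\<Sum>y\<in>{1..n'}. s y * cpow h p y (n' - j0)) \<le> G * (C1 / c + S') * s n" if j0: "j0 \<le> K" for j0
    proof -
      obtain j where j: "j < d" "\<And>y. y \<in> {1..n'} \<Longrightarrow> cpow h p y (n' - j0) \<le> G * (cpow h p y (n + j) + R * T e Y)"
        using exch[OF j0] by blast
      have "(\<Sum>y\<in>{1..n'}. s y * cpow h p y (n' - j0)) \<le> (\<Sum>y\<in>{1..n'}. s y * (G * (cpow h p y (n + j) + R * T e Y)))"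
        using j pos by (intro sum_mono mult_left_mono) (auto simp: less_imp_le)
      also have "\<dots> = G * ((\<Sum>y\<in>{1..n'}. s y * cpow h p y (n + j)) + (\<Sum>y\<in>{1..n'}. s y * (R * T e Y)))"
        by (simp add: sum_distrib_left sum.distrib algebra_simps)
      also have "\<dots> \<le> G * (C1 / c * s n + S' * s n)"
      proof (intro mult_left_mono add_mono)
        have "c * (\<Sum>y\<in>{1..n'}. s y * cpow h p y (n + j)) \<le> s (n + j)" by (rule renewal_lower_upto) (use n1 in simp)
        also have "\<dots> \<le> C1 * s n" using C1 j(1) id n1 by simp
        finally show "(\<Sum>y\<in>{1..n'}. s y * cpow h p y (n + j)) \<le> C1 / c * s n" using c_pos by (simp add: field_simps)
        have "S' \<ge> 0" unfolding S'_def using S B q_bounds by (simp add: less_imp_le)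
        then have "S' * 1 \<le> S' * s n" using ge_1[OF n1(2)] by (intro mult_left_mono) auto
        then show "(\<Sum>y\<in>{1..n'}. s y * (R * T e Y)) \<le> S' * s n" using err by simp
      qed (simp add: G_def)
      finally show ?thesis by (simp add: algebra_simps)
    qed
    then have "(\<Sum>j0\<le>K. \<Sum>y\<in>{1..n'}. s y * cpow h p y (n' - j0)) \<le> (\<Sum>j0\<le>K. G * (C1 / c + S') * s n)"
      by (intro sum_mono) auto
    also have "\<dots> = (real K + 1) * (G * (C1 / c + S') * s n)" by (simp add: algebra_simps)
    finally have "C * (\<Sum>j0\<le>K. \<Sum>y\<in>{1..n'}. s y * cpow h p y (n' - j0)) \<le> C * ((real K + 1) * (G * (C1 / c + S') * s n))"
      using C_pos by (intro mult_left_mono) auto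
    from order_trans[OF renewal_upper[OF Kn'] this] show ?thesis by (simp only: A_def mult.assoc)
  qed
  obtain A2 where A2: "A2 > 0" "\<And>n n'. n \<ge> 1 \<Longrightarrow> n' \<ge> 1 \<Longrightarrow> n' \<le> 2 * n0 \<Longrightarrow> s n' \<le> A2 * s n"
    using small_case[of "2 * n0"] by blast
  have "s n' \<le> max A A2 * s n" if n: "n \<ge> 1" "n' \<ge> 1" "\<bar>real n' - real n\<bar> \<le> real n powr (1/2 - 2 * e)" for n n'
  proof (cases "n \<ge> n0")
    case True
    have "A * s n \<le> max A A2 * s n" using pos[OF n(1)] by (intro mult_right_mono) auto
    then show ?thesis using large[OF True n(3)] by simp
  next
    case False
    have "real n powr (1/2 - 2 * e) \<le> real n powr 1" using n e by (intro powr_mono) auto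
    then have "real n' \<le> 2 * real n" using n by simp
    then have "n' \<le> 2 * n0" using False by linarith
    then have "s n' \<le> A2 * s n" using A2 n by blast
    moreover have "A2 * s n \<le> max A A2 * s n" using pos[OF n(1)] by (intro mult_right_mono) auto
    ultimately show ?thesis by simp
  qed
  then show ?thesis using A2(1) by (intro exI[of _ "max A A2"]) auto
qed


text \<open>Halve both arguments about \<open>8 e log n\<close> times to get into the range of \<open>smooth_small\<close>.\<close>
lemma smooth:
  "\<exists>\<beta>\<ge>0. \<forall>e. 0 < e \<longrightarrow> e \<le> 1/32 \<longrightarrow> (\<exists>A>0. \<forall>n\<ge>1. \<forall>n'\<ge>1.
     \<bar>real n' - real n\<bar> \<le> real n powr (1/2 + e) \<longrightarrow> s n' \<le> A * real n powr (\<beta> * e) * s n)"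
proof -
  \<comment> \<open>One halving costs E = 2^b, so k halvings with 2^k of order n^(8 e) cost a factor
    of order n^(8 b e). Both arguments are halved, whence 16 * b.\<close>
  define b where "b = log 2 E"
  have b: "b \<ge> 0" "2 powr b = E" using E_ge_1 by (auto simp: b_def)
  show ?thesis
  proof (rule exI[of _ "16 * b"], intro conjI allI impI)
    show "16 * b \<ge> 0" using b by simp
    fix e :: real assume e: "0 < e" "e \<le> 1/32"
    obtain A1 where A1: "A1 > 0" "\<And>n n'. n \<ge> 1 \<Longrightarrow> n' \<ge> 1 \<Longrightarrow>
        \<bar>real n' - real n\<bar> \<le> real n powr (1/2 - 2 * e) \<Longrightarrow> s n' \<le> A1 * s n"
      using smooth_small[of e] e by auto
    obtain na where na: "na \<ge> 1" "\<And>n. n \<ge> na \<Longrightarrow> 4 \<le> real n powr e" using powr_eventually_ge[OF e(1)] by blast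
    obtain nb where nb: "nb \<ge> 1" "\<And>n. n \<ge> nb \<Longrightarrow> 8 \<le> real n powr (1/4)" using powr_eventually_ge[of "1/4"] by auto
    define n0 where "n0 = max na nb"
    have large: "s n' \<le> (A1 * 2 powr (2 * b)) * real n powr (16 * b * e) * s n"
      if n: "n \<ge> n0" and n': "\<bar>real n' - real n\<bar> \<le> real n powr (1/2 + e)" for n n'
    proof -
      have n1: "real n \<ge> 1" "n \<ge> 1" "n \<ge> na" "n \<ge> nb" using n na nb by (auto simp: n0_def)
      note pa = na(2)[OF n1(3)] and pb = nb(2)[OF n1(4)]
      \<comment> \<open>Why 8: division by 2^k >= z brings the distance down to n^(1/2 - 7 e), while
        the new argument is of order n^(1 - 8 e), whose power 1/2 - 2 e is of order at least n^(1/2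
        - 6 e). The spare factor n^e absorbs rounding and constants.\<close>
      define z where "z = real n powr (8 * e)"
      have z: "z \<ge> 1" using n1 e by (simp add: z_def ge_one_powr_ge_zero)
      define k where "k = nat \<lceil>log 2 z\<rceil>"
      have k: "log 2 z \<le> real k" "real k \<le> log 2 z + 1"
        using z by (auto simp: k_def of_nat_nat)
      have k1: "z \<le> 2 ^ k"
      proof -
        have "z = 2 powr (log 2 z)" using z by simp
        also have "\<dots> \<le> 2 powr (real k)" using k by (intro powr_mono) auto
        finally show ?thesis by (simp add: powr_realpow)
      qed
      have k2: "2 ^ k \<le> 2 * z"
      proof -
        have "(2::real) ^ k = 2 powr real k" by (simp add: powr_realpow)
        also have "\<dots> \<le> 2 powr (log 2 z + 1)" using k by (intro powr_mono) auto
        also have "\<dots> = 2 * z" using z by (simp add: powr_add)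
        finally show ?thesis .
      qed
      have q34: "real n powr (3/4) \<le> real n / 8"
      proof -
        have "real n powr (3/4) * 8 \<le> real n powr (3/4) * real n powr (1/4)" using pb by (intro mult_left_mono) auto
        also have "\<dots> = real n" using n1 by (simp flip: powr_add)
        finally show ?thesis by simp
      qed
      have "real n powr (1/2 + e) \<le> real n powr (3/4)" using n1 e by (intro powr_mono) auto
      then have n'1: "real n' \<ge> real n / 2" using n' q34 n1 by linarith
      have "z \<le> real n powr (1/4)" unfolding z_def using n1 e by (intro powr_mono) auto
      also have "\<dots> \<le> real n powr (3/4)" using n1 by (intro powr_mono) auto
      finally have z8: "z \<le> real n / 8" using q34 by simp
      have "(2::real) ^ k \<le> real n'" using k2 z8 n'1 n1 by linarith
      then have "real (2 ^ k) \<le> real n'" by (simp only: of_nat_power of_nat_numeral)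
      then have n'k: "2 ^ k \<le> n'" by (simp only: of_nat_le_iff)
      define n1' where "n1' = n' div 2 ^ k"
      have n1'1: "n1' \<ge> 1" using n'k by (simp add: n1'_def div_greater_zero_iff Suc_leI)
      have s1: "s n' \<le> E ^ k * s n1'" using halve_iter_le[OF n'k] by (simp add: n1'_def)
      obtain n2 where n2: "n2 \<ge> 1" "real n / 2 ^ k \<le> real n2" "real n2 \<le> real n / 2 ^ k + 1" "s n2 \<le> E ^ k * s n"
        using le_halve_iter[OF n1(2)] by blast
      have fl: "real n1' \<le> real n' / 2 ^ k" "real n' / 2 ^ k - 1 \<le> real n1'"
      proof -
        have "n1' * 2 ^ k \<le> n'" by (simp add: n1'_def)
        then have "real n1' * 2 ^ k \<le> real n'" by (metis of_nat_le_iff of_nat_mult of_nat_numeral of_nat_power)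
        then show "real n1' \<le> real n' / 2 ^ k" by (simp add: field_simps)
        have "n' < (n1' + 1) * 2 ^ k" using dividend_less_div_times[of "2^k" n'] by (simp add: n1'_def)
        then have "real n' < real ((n1' + 1) * 2 ^ k)" by (simp only: of_nat_less_iff)
        then have "real n' < (real n1' + 1) * 2 ^ k" by (simp add: algebra_simps)
        then show "real n' / 2 ^ k - 1 \<le> real n1'" by (simp add: field_simps)
      qed
      have "\<bar>real n' / 2 ^ k - real n / 2 ^ k\<bar> \<le> real n powr (1/2 + e) / 2 ^ k"
        using n' by (simp add: divide_right_mono flip: diff_divide_distrib)
      also have "\<dots> \<le> real n powr (1/2 + e) / z" using k1 z by (intro divide_left_mono) auto
      also have "\<dots> = real n powr (1/2 - 7 * e)" unfolding z_def using n1 by (simp flip: powr_diff)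
      finally have dd: "\<bar>real n1' - real n2\<bar> \<le> real n powr (1/2 - 7 * e) + 2" using fl n2 by linarith
      have "real n powr (1/2 - 7 * e) + 2 \<le> real n powr (1/2 - 6 * e) / 2"
      proof -
        have "real n powr (1/2 - 7 * e) * 4 \<le> real n powr (1/2 - 7 * e) * real n powr e" using pa by (intro mult_left_mono) auto
        also have "\<dots> = real n powr (1/2 - 6 * e)" by (simp flip: powr_add)
        finally have 1: "real n powr (1/2 - 7 * e) * 4 \<le> real n powr (1/2 - 6 * e)" .
        have "real n powr (1/4) \<le> real n powr (1/2 - 6 * e)" using n1 e by (intro powr_mono) auto
        then show ?thesis using 1 pb by linarith
      qed
      also have "\<dots> \<le> real n2 powr (1/2 - 2 * e)"
      proof -
        have r: "real n powr (1 - 8 * e) / 2 \<le> real n2"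
        proof -
          have "real n powr (1 - 8 * e) / 2 = real n / (2 * z)" using n1 by (simp add: z_def powr_diff)
          also have "\<dots> \<le> real n / 2 ^ k" using k2 z by (intro divide_left_mono) auto
          finally show ?thesis using n2 by linarith
        qed
        have "real n powr (1/2 - 6 * e) \<le> real n powr ((1 - 8 * e) * (1/2 - 2 * e))"
        proof (intro powr_mono)
          have "(1 - 8 * e) * (1/2 - 2 * e) = 1/2 - 6 * e + 16 * (e * e)" by (simp add: algebra_simps)
          then show "1/2 - 6 * e \<le> (1 - 8 * e) * (1/2 - 2 * e)" using e by simp
        qed (use n1 in auto)
        also have "\<dots> = (real n powr (1 - 8 * e)) powr (1/2 - 2 * e)" by (simp add: powr_powr)
        finally have "real n powr (1/2 - 6 * e) / 2 \<le> (real n powr (1 - 8 * e)) powr (1/2 - 2 * e) / 2" by simp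
        also have "\<dots> \<le> (real n powr (1 - 8 * e)) powr (1/2 - 2 * e) / 2 powr (1/2 - 2 * e)"
          using e powr_mono[of "1/2 - 2 * e" 1 "2::real"] by (intro divide_left_mono) auto
        also have "\<dots> = (real n powr (1 - 8 * e) / 2) powr (1/2 - 2 * e)" by (simp add: powr_divide)
        also have "\<dots> \<le> real n2 powr (1/2 - 2 * e)" using r e by (intro powr_mono2) auto
        finally show ?thesis .
      qed
      finally have "\<bar>real n1' - real n2\<bar> \<le> real n2 powr (1/2 - 2 * e)" using dd by simp
      then have "s n1' \<le> A1 * s n2" using A1(2) n2(1) n1'1 by blast
      also have "\<dots> \<le> A1 * (E ^ k * s n)" using n2 A1 by (intro mult_left_mono) auto
      finally have "E ^ k * s n1' \<le> E ^ k * (A1 * (E ^ k * s n))" using E_ge_1 by (intro mult_left_mono) auto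
      then have "s n' \<le> A1 * (E ^ k * E ^ k) * s n" using s1 by (simp add: algebra_simps)
      also have "\<dots> \<le> A1 * (2 powr (2 * b) * real n powr (16 * b * e)) * s n"
      proof (intro mult_right_mono mult_left_mono)
        have "E ^ k = (2 ^ k) powr b"
        proof -
          have "E ^ k = E powr real k" using E_ge_1 by (simp add: powr_realpow)
          also have "\<dots> = 2 powr (b * real k)" by (simp add: powr_powr flip: b(2))
          also have "\<dots> = (2 powr real k) powr b" by (simp add: powr_powr mult.commute)
          finally show ?thesis by (simp add: powr_realpow)
        qed
        also have "\<dots> \<le> (2 * z) powr b" using k2 b by (intro powr_mono2) auto
        also have "\<dots> = 2 powr b * real n powr (8 * b * e)" using z by (simp add: powr_mult z_def powr_powr mult_ac)
        finally have "E ^ k * E ^ k \<le> (2 powr b * real n powr (8 * b * e)) * (2 powr b * real n powr (8 * b * e))"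
          using E_ge_1 by (intro mult_mono) auto
        also have "\<dots> = (2 powr b * 2 powr b) * (real n powr (8 * b * e) * real n powr (8 * b * e))" by (simp only: mult_ac)
        also have "\<dots> = 2 powr (2 * b) * real n powr (16 * b * e)" by (simp add: mult.assoc flip: powr_add)
        finally show "E ^ k * E ^ k \<le> 2 powr (2 * b) * real n powr (16 * b * e)" .
      qed (use A1 pos[OF n1(2)] in auto)
      finally show ?thesis by (simp add: algebra_simps)
    qed
    obtain A2 where A2: "A2 > 0" "\<And>n n'. n \<ge> 1 \<Longrightarrow> n' \<ge> 1 \<Longrightarrow> n' \<le> 2 * n0 \<Longrightarrow> s n' \<le> A2 * s n"
      using small_case[of "2 * n0"] by blast
    define A where "A = max (A1 * 2 powr (2 * b)) A2"
    show "\<exists>A>0. \<forall>n\<ge>1. \<forall>n'\<ge>1. \<bar>real n' - real n\<bar> \<le> real n powr (1/2 + e) \<longrightarrow> s n' \<le> A * real n powr (16 * b * e) * s n"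
    proof (intro exI[of _ A] conjI allI impI)
      show "A > 0" using A2 by (simp add: A_def)
      fix n n' :: nat assume n: "1 \<le> n" "1 \<le> n'" "\<bar>real n' - real n\<bar> \<le> real n powr (1/2 + e)"
      show "s n' \<le> A * real n powr (16 * b * e) * s n"
      proof (cases "n \<ge> n0")
        case True
        have "(A1 * 2 powr (2 * b)) * real n powr (16 * b * e) * s n \<le> A * real n powr (16 * b * e) * s n"
          using pos[OF n(1)] by (intro mult_right_mono) (auto simp: A_def)
        then show ?thesis using large[OF True n(3)] by simp
      next
        case False
        have "real n powr (1/2 + e) \<le> real n powr 1" using n e by (intro powr_mono) auto
        then have "real n' \<le> 2 * real n" using n by simp
        then have "n' \<le> 2 * n0" using False by linarith
        then have "s n' \<le> A2 * s n" using A2 n by blast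
        also have "\<dots> \<le> A * real n powr (16 * b * e) * s n"
        proof (intro mult_right_mono)
          have "real n powr (16 * b * e) \<ge> 1" using n e b by (intro ge_one_powr_ge_zero) auto
          then show "A2 \<le> A * real n powr (16 * b * e)" using A2 mult_mono[of A2 A 1 "real n powr (16 * b * e)"] by (simp add: A_def)
        qed (use pos[OF n(1)] in auto)
        finally show ?thesis .
      qed
    qed
  qed
qed

text \<open>A window of width n^(1/4), that is \<open>smooth_small\<close> at e = 1/8, eventually
  contains every shift up to J. This is the direction that submultiplicativity alone cannot
  give.\<close>

lemma shift_down_bounded: "\<exists>A>0. \<forall>j\<le>J. \<forall>n\<ge>1. s n \<le> A * s (n + j)"
proof -
  obtain A1 where A1: "A1 > 0" "\<And>n n'. n \<ge> 1 \<Longrightarrow> n' \<ge> 1 \<Longrightarrow>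
        \<bar>real n' - real n\<bar> \<le> real n powr (1/2 - 2 * (1/8)) \<Longrightarrow> s n' \<le> A1 * s n"
    using smooth_small[of "1/8"] by auto
  obtain na where na: "na \<ge> 1" "\<And>n. n \<ge> na \<Longrightarrow> real J \<le> real n powr (1/4)" using powr_eventually_ge[of "1/4"] by auto
  obtain A2 where A2: "A2 > 0" "\<And>n n'. n \<ge> 1 \<Longrightarrow> n' \<ge> 1 \<Longrightarrow> n' \<le> na \<Longrightarrow> s n' \<le> A2 * s n"
    using small_case[of na] by blast
  have "s n \<le> max A1 A2 * s (n + j)" if "j \<le> J" "n \<ge> 1" for j n
  proof (cases "n \<ge> na")
    case True
    have "real J \<le> real (n + j) powr (1/4)" using na(2)[of "n + j"] True by simp
    then have "\<bar>real n - real (n + j)\<bar> \<le> real (n + j) powr (1/2 - 2 * (1/8))" using that by simp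
    then have "s n \<le> A1 * s (n + j)" using A1(2)[of "n + j" n] that by simp
    moreover have "A1 * s (n + j) \<le> max A1 A2 * s (n + j)" using pos[of "n + j"] that by (intro mult_right_mono) auto
    ultimately show ?thesis by simp
  next
    case False
    then have "s n \<le> A2 * s (n + j)" using A2(2)[of "n + j" n] that by simp
    moreover have "A2 * s (n + j) \<le> max A1 A2 * s (n + j)" using pos[of "n + j"] that by (intro mult_right_mono) auto
    ultimately show ?thesis by simp
  qed
  then show ?thesis using A1(1) by (intro exI[of _ "max A1 A2"]) auto
qed

text \<open>If y is off n by half of n^(1/2 + 2 e), then mean * y is off mean * n by at least as
  much, since \<open>mean\<close> is at least 1. This exceeds both the permitted deviation of m, of
  exponent 1/2 + e, and y^(1/2 + e), so \<open>cpow_tail\<close> applies. The slack K + h allows for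
  m - j and m + j.\<close>

lemma far_small:
  assumes e: "0 < e" "e \<le> 1/64"
  shows "\<exists>n0\<ge>1. \<forall>n\<ge>n0. \<forall>m y. \<bar>real m - mean * real n\<bar> \<le> real n powr (1/2 + e) + real K + real h \<longrightarrow>
     (real n / 4 \<le> real m \<and> real m \<le> (2 * real h + 1) * real n) \<and> (1 \<le> y \<longrightarrow> \<bar>real y - real n\<bar> > real n powr (1/2 + 2 * e) / 2 \<longrightarrow>
     cpow h p y m \<le> exp (1 - (real n / (4 * real h)) powr e / real h))"
proof -
  have hp: "real h > 0" "real h \<ge> 1" using h_ge_1 by auto
  obtain na where na: "na \<ge> 1" "\<And>n. n \<ge> na \<Longrightarrow> 2 * (2 * real h + 3 + real K + real h) \<le> real n powr e" using powr_eventually_ge[OF e(1)] by blast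
  obtain nb where nb: "nb \<ge> 1" "\<And>n. n \<ge> nb \<Longrightarrow> 4 \<le> real n powr (1/4)" using powr_eventually_ge[of "1/4"] by auto
  show ?thesis
  proof (intro exI[of _ "max (max na nb) (4 * K + 4 * h)"] conjI[of "_ \<ge> _"] allI impI)
    show "max (max na nb) (4 * K + 4 * h) \<ge> 1" using na by simp
    fix n m y :: nat
    assume "max (max na nb) (4 * K + 4 * h) \<le> n" and m: "\<bar>real m - mean * real n\<bar> \<le> real n powr (1/2 + e) + real K + real h"
    then have n: "n \<ge> na" "n \<ge> nb" "real K + real h \<le> real n / 4" "real n \<ge> 1" using na(1) by auto
    have q34: "real n powr (1/2 + e) \<le> real n / 4"
    proof -
      have "real n powr (1/2 + e) \<le> real n powr (3/4)" using n e by (intro powr_mono) auto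
      also have "real n powr (3/4) * 4 \<le> real n powr (3/4) * real n powr (1/4)" using nb(2)[OF n(2)] by (intro mult_left_mono) auto
      also have "\<dots> = real n" using n by (simp flip: powr_add)
      finally show ?thesis by simp
    qed
    have mn: "real n \<le> mean * real n" "mean * real n \<le> real h * real n"
      using mean_bounds n by (auto intro: mult_right_mono)
    have mb: "real n / 4 \<le> real m" "real m \<le> (2 * real h + 1) * real n"
    proof -
      show "real n / 4 \<le> real m" using m mn q34 n by linarith
      have "real m \<le> real h * real n + real n" using m mn q34 n by linarith
      also have "\<dots> \<le> (2 * real h + 1) * real n" by (simp add: algebra_simps)
      finally show "real m \<le> (2 * real h + 1) * real n" .
    qed
    have "cpow h p y m \<le> exp (1 - (real n / (4 * real h)) powr e / real h)"
      if y: "1 \<le> y" "\<bar>real y - real n\<bar> > real n powr (1/2 + 2 * e) / 2"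
    proof (cases "m < y \<or> h * y < m")
      case True
      then show ?thesis by (simp add: cpow_eq_0)
    next
      case False
      then have ym: "real y \<le> real m" "real m \<le> real h * real y" by (auto simp flip: of_nat_mult)
      have yl: "real n / (4 * real h) \<le> real y" using ym mb hp by (simp add: field_simps)
      have yu: "real y powr (1/2 + e) \<le> (2 * real h + 1) * real n powr (1/2 + e)"
      proof -
        have "real y powr (1/2 + e) \<le> ((2 * real h + 1) * real n) powr (1/2 + e)" using ym mb e by (intro powr_mono2) auto
        also have "\<dots> = (2 * real h + 1) powr (1/2 + e) * real n powr (1/2 + e)" by (simp add: powr_mult)
        also have "\<dots> \<le> (2 * real h + 1) powr 1 * real n powr (1/2 + e)" using e hp by (intro mult_right_mono powr_mono) auto
        finally show ?thesis by simp
      qed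
      have big: "(2 * real h + 3 + real K + real h) * real n powr (1/2 + e) \<le> real n powr (1/2 + 2 * e) / 2"
      proof -
        have "2 * (2 * real h + 3 + real K + real h) * real n powr (1/2 + e) \<le> real n powr e * real n powr (1/2 + e)"
          using na(2)[OF n(1)] by (intro mult_right_mono) auto
        also have "\<dots> = real n powr (e + (1/2 + e))" by (rule powr_add[symmetric])
        also have "e + (1/2 + e) = 1/2 + 2 * e" by simp
        finally show ?thesis by (simp add: algebra_simps)
      qed
      have n12: "real n powr (1/2 + e) \<ge> 1" using n e by (intro ge_one_powr_ge_zero) auto
      have Kh: "real K + real h \<le> (real K + real h) * real n powr (1/2 + e)" using n12 mult_left_mono[OF n12, of "real K + real h"] by simp
      have "1 * \<bar>real y - real n\<bar> \<le> mean * \<bar>real y - real n\<bar>" using mean_bounds by (intro mult_right_mono) auto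
      also have "\<dots> = \<bar>mean * real y - mean * real n\<bar>" using mean_bounds by (simp add: abs_mult flip: right_diff_distrib)
      finally have "real n powr (1/2 + 2 * e) / 2 \<le> \<bar>mean * real y - mean * real n\<bar>" using y by simp
      then have "\<bar>real m - mean * real y\<bar> \<ge> real n powr (1/2 + 2 * e) / 2 - real n powr (1/2 + e) - (real K + real h)"
        using m by linarith
      moreover have "real n powr (1/2 + 2 * e) / 2 - real n powr (1/2 + e) - (real K + real h) \<ge> (2 * real h + 1) * real n powr (1/2 + e)"
        using big Kh n12 by (simp add: algebra_simps)
      ultimately have "\<bar>real m - mean * real y\<bar> \<ge> real y powr (1/2 + e)" using yu by linarith
      then have "cpow h p y m \<le> exp (1 - real y powr e / real h)" by (rule cpow_tail[OF y(1)])
      also have "\<dots> \<le> exp (1 - (real n / (4 * real h)) powr e / real h)"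
        using yl hp e by (simp add: divide_right_mono powr_mono2)
      finally show ?thesis .
    qed
    then show "(real n / 4 \<le> real m \<and> real m \<le> (2 * real h + 1) * real n) \<and> (1 \<le> y \<longrightarrow> \<bar>real y - real n\<bar> > real n powr (1/2 + 2 * e) / 2 \<longrightarrow>
     cpow h p y m \<le> exp (1 - (real n / (4 * real h)) powr e / real h))" using mb by blast
  qed
qed


lemma sum_cpow_le_1: "(\<Sum>y\<in>{1..N}. cpow h p y m) \<le> 1"
proof -
  have "(\<Sum>y\<in>{1..N}. cpow h p y m) \<le> (\<Sum>y\<le>max N m. cpow h p y m)"
    by (rule sum_mono2) (auto simp: cp_nonneg)
  also have "\<dots> = U (int m)" by (subst U_upto[of _ "max N m"]) auto
  finally show ?thesis using U_le_1[of "int m"] by simp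
qed

text \<open>Upper bound: in \<open>renewal_upper\<close> at m only y near n matter, there
  \<open>s y\<close> is at most n^O(e) * s n by \<open>smooth\<close>, and the kernel weights sum to
  at most 1. Lower bound: at a single m the weights may vanish, for instance by periodicity, so
  \<open>renewal_lower\<close> is summed over the window m, ..., m + h - 1, which has mass at least
  1 by \<open>U_window\<close>; \<open>shift_up_bounded\<close> then returns from m + j to
  m.\<close>

lemma compare_near_mean:
  "\<exists>\<beta>\<ge>0. \<forall>e. 0 < e \<longrightarrow> e \<le> 1/64 \<longrightarrow> (\<exists>A>0. \<forall>n\<ge>1. \<forall>m\<ge>1.
     \<bar>real m - mean * real n\<bar> \<le> real n powr (1/2 + e) \<longrightarrow>
       s m \<le> A * real n powr (\<beta> * e) * s n \<and> s n \<le> A * real n powr (\<beta> * e) * s m)"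
proof -
  obtain b where b: "b \<ge> 0" and bsm: "\<And>e. 0 < e \<Longrightarrow> e \<le> 1/32 \<Longrightarrow> (\<exists>A>0. \<forall>n\<ge>1. \<forall>n'\<ge>1.
     \<bar>real n' - real n\<bar> \<le> real n powr (1/2 + e) \<longrightarrow> s n' \<le> A * real n powr (b * e) * s n)"
    using smooth by blast
  show ?thesis
  proof (rule exI[of _ "2 * b"], intro conjI allI impI)
    show "2 * b \<ge> 0" using b by simp
    fix e :: real assume e: "0 < e" "e \<le> 1/64"
    obtain A1 where A1: "A1 > 0" "\<And>n n'. n \<ge> 1 \<Longrightarrow> n' \<ge> 1 \<Longrightarrow>
       \<bar>real n' - real n\<bar> \<le> real n powr (1/2 + 2 * e) \<Longrightarrow> s n' \<le> A1 * real n powr (b * (2 * e)) * s n"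
      using bsm[of "2 * e"] e by auto
    obtain B M where B: "B \<ge> 0" "M \<ge> 1" "\<And>n. n \<ge> 1 \<Longrightarrow> s n \<le> M * real n powr B" using poly_on by blast
    have hp: "real h > 0" "real h \<ge> 1" using h_ge_1 by auto
    define w where "w = (1 / (4 * real h)) powr e / real h"
    have wpos: "w > 0" using hp by (simp add: w_def)
    obtain S where S: "S > 0" "\<And>x. x \<ge> 1 \<Longrightarrow> exp (- w * x powr e) * x powr (B + 2) \<le> S"
      using exp_powr_superpoly[OF wpos e(1), of "B + 2"] by blast
    obtain nf where nf: "nf \<ge> 1" and far: "\<And>n m y. n \<ge> nf \<Longrightarrow> \<bar>real m - mean * real n\<bar> \<le> real n powr (1/2 + e) + real K + real h \<Longrightarrow>
       (real n / 4 \<le> real m \<and> real m \<le> (2 * real h + 1) * real n) \<and> (1 \<le> y \<longrightarrow> \<bar>real y - real n\<bar> > real n powr (1/2 + 2 * e) / 2 \<longrightarrow>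
         cpow h p y m \<le> exp (1 - (real n / (4 * real h)) powr e / real h))"
      using far_small[OF e] by blast
    obtain C1 where C1: "C1 \<ge> 1" "\<And>j n. j \<le> h \<Longrightarrow> n \<ge> 1 \<Longrightarrow> s (n + j) \<le> C1 * s n"
      using shift_up_bounded[of h] by blast
    obtain nb where nb: "nb \<ge> 1" "\<And>n. n \<ge> nb \<Longrightarrow> 2 * (real h * (3 * real h + 1) * exp 1 * S) \<le> real n powr 1"
      using powr_eventually_ge[of 1] by auto
    obtain nc where nc: "nc \<ge> 1" "\<And>n. n \<ge> nc \<Longrightarrow> 2 \<le> real n powr (1/4)" using powr_eventually_ge[of "1/4"] by auto
    define n0 where "n0 = max (max nf nb) (max nc (4 * K + 4 * h + 4))"
    define Q where "Q = (\<lambda>n::nat. exp (1 - (real n / (4 * real h)) powr e / real h))"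
    have Qeq: "Q n = exp 1 * exp (- w * real n powr e)" for n
    proof -
      have "(real n / (4 * real h)) powr e = real n powr e * (1 / (4 * real h)) powr e"
        using hp by (subst powr_mult[symmetric]) auto
      then have "1 - (real n / (4 * real h)) powr e / real h = 1 + (- w * real n powr e)" by (simp add: w_def)
      then show ?thesis unfolding Q_def by (simp only: exp_add)
    qed
    define H where "H = 2 * real h + 1"
    have H1: "H \<ge> 1" using hp by (simp add: H_def)
    define Au where "Au = C * (real K + 1) * (A1 + H * M * H powr B * exp 1 * S)"
    define Al where "Al = real h * C1 * (2 * A1 * 2 powr (2 * b * e)) / c"
    have large: "s m \<le> Au * real n powr (2 * b * e) * s n \<and> s n \<le> Al * real n powr (2 * b * e) * s m"
      if n: "n \<ge> n0" and m: "\<bar>real m - mean * real n\<bar> \<le> real n powr (1/2 + e)" for n m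
    proof -
      have n1: "n \<ge> 1" "real n \<ge> 1" "n \<ge> nf" "n \<ge> nb" "n \<ge> nc" "real K + real h + 1 \<le> real n / 4"
        using n nf by (auto simp: n0_def)
      have nbe: "real n powr (2 * b * e) \<ge> 1" using n1 b e by (intro ge_one_powr_ge_zero) auto
      have "\<bar>real m - mean * real n\<bar> \<le> real n powr (1/2 + e) + real K + real h" using m by simp
      then have mb: "real n / 4 \<le> real m" "real m \<le> H * real n" using far[OF n1(3)] by (auto simp: H_def)
      have Km: "K < m" using mb n1 hp by linarith
      have m1: "m \<ge> 1" using Km by simp
      have Qn: "real n powr (B + 2) * Q n \<le> exp 1 * S" using S(2)[OF n1(2)] by (simp add: Qeq algebra_simps)
      have Q0: "Q n \<ge> 0" by (simp add: Q_def)
      have up: "(\<Sum>y\<in>{1..m}. s y * cpow h p y (m - j)) \<le> (A1 + H * M * H powr B * exp 1 * S) * real n powr (2 * b * e) * s n" if j: "j \<le> K" for j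
      proof -
        have "real (m - j) = real m - real j" using j Km by (simp add: of_nat_diff)
        then have mj: "\<bar>real (m - j) - mean * real n\<bar> \<le> real n powr (1/2 + e) + real K + real h" using m j by linarith
        have "(\<Sum>y\<in>{1..m}. s y * cpow h p y (m - j)) \<le> (\<Sum>y\<in>{1..m}. A1 * real n powr (2 * b * e) * s n * cpow h p y (m - j) + M * (H * real n) powr B * Q n)"
        proof (rule sum_mono)
          fix y assume y: "y \<in> {1..m}"
          show "s y * cpow h p y (m - j) \<le> A1 * real n powr (2 * b * e) * s n * cpow h p y (m - j) + M * (H * real n) powr B * Q n"
          proof (cases "\<bar>real y - real n\<bar> > real n powr (1/2 + 2 * e) / 2")
            case True
            then have "cpow h p y (m - j) \<le> Q n" using far[OF n1(3) mj, of y] y by (simp add: Q_def)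
            moreover have "s y \<le> M * (H * real n) powr B"
            proof -
              have "s y \<le> M * real y powr B" using B y by auto
              also have "\<dots> \<le> M * (H * real n) powr B" using B y mb by (intro mult_left_mono powr_mono2) auto
              finally show ?thesis .
            qed
            ultimately have "s y * cpow h p y (m - j) \<le> M * (H * real n) powr B * Q n"
              using B cp_nonneg by (intro mult_mono) auto
            moreover have "A1 * real n powr (2 * b * e) * s n * cpow h p y (m - j) \<ge> 0"
              using A1 pos[OF n1(1)] cp_nonneg by simp
            ultimately show ?thesis by linarith
          next
            case False
            have "real n powr (1/2 + 2 * e) \<ge> 0" by simp
            then have "\<bar>real y - real n\<bar> \<le> real n powr (1/2 + 2 * e)" using False by linarith
            then have "s y \<le> A1 * real n powr (b * (2 * e)) * s n" using A1(2)[of n y] n1 y by simp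
            then have "s y * cpow h p y (m - j) \<le> A1 * real n powr (2 * b * e) * s n * cpow h p y (m - j)"
              using cp_nonneg by (intro mult_right_mono) (auto simp: mult_ac)
            moreover have "M * (H * real n) powr B * Q n \<ge> 0" using B Q0 by simp
            ultimately show ?thesis by linarith
          qed
        qed
        also have "\<dots> = A1 * real n powr (2 * b * e) * s n * (\<Sum>y\<in>{1..m}. cpow h p y (m - j)) + real m * (M * (H * real n) powr B * Q n)"
          by (simp add: sum.distrib sum_distrib_left)
        also have "\<dots> \<le> A1 * real n powr (2 * b * e) * s n * 1 + (H * real n) * (M * (H * real n) powr B * Q n)"
          using sum_cpow_le_1 A1 pos[OF n1(1)] mb B Q0 by (intro add_mono mult_left_mono mult_right_mono) auto
        also have "(H * real n) * (M * (H * real n) powr B * Q n) \<le> H * M * H powr B * exp 1 * S"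
        proof -
          have "(H * real n) * (M * (H * real n) powr B * Q n) = H * M * H powr B * (real n powr (B + 1) * Q n)"
            using n1 H1 by (simp add: powr_mult powr_add algebra_simps)
          also have "real n powr (B + 1) * Q n \<le> real n powr (B + 2) * Q n" using n1 Q0 by (intro mult_right_mono powr_mono) auto
          finally have "(H * real n) * (M * (H * real n) powr B * Q n) \<le> H * M * H powr B * (real n powr (B + 2) * Q n)"
            using H1 B by (simp add: mult_left_mono)
          also have "\<dots> \<le> H * M * H powr B * (exp 1 * S)" using Qn H1 B by (intro mult_left_mono) auto
          finally show ?thesis by simp
        qed
        finally have 1: "(\<Sum>y\<in>{1..m}. s y * cpow h p y (m - j)) \<le> A1 * real n powr (2 * b * e) * s n + H * M * H powr B * exp 1 * S" by simp
        have "H * M * H powr B * exp 1 * S * 1 \<le> H * M * H powr B * exp 1 * S * (real n powr (2 * b * e) * s n)"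
          using nbe ge_1[OF n1(1)] H1 B S mult_mono[of 1 "real n powr (2 * b * e)" 1 "s n"] by (intro mult_left_mono) auto
        then show ?thesis using 1 by (simp add: algebra_simps)
      qed
      have "s m \<le> C * (\<Sum>j\<le>K. \<Sum>y\<in>{1..m}. s y * cpow h p y (m - j))" by (rule renewal_upper[OF Km])
      also have "\<dots> \<le> C * (\<Sum>j\<le>K. (A1 + H * M * H powr B * exp 1 * S) * real n powr (2 * b * e) * s n)"
        using up C_pos by (intro mult_left_mono sum_mono) auto
      also have "\<dots> = Au * real n powr (2 * b * e) * s n" by (simp add: Au_def algebra_simps)
      finally have upper: "s m \<le> Au * real n powr (2 * b * e) * s n" .

      \<comment> \<open>These y carry at least half of the window mass, since every other y
        contributes at most \<open>Q n\<close>.\<close>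
      define near where "near = {y \<in> {1..m + h}. \<bar>real y - real n\<bar> \<le> real n powr (1/2 + 2 * e) / 2}"
      have fin: "finite near" by (simp add: near_def)
      have q34: "real n powr (1/2 + 2 * e) \<le> real n / 2"
      proof -
        have "real n powr (1/2 + 2 * e) \<le> real n powr (3/4)" using n1 e by (intro powr_mono) auto
        also have "real n powr (3/4) * 2 \<le> real n powr (3/4) * real n powr (1/4)" using nc(2)[OF n1(5)] by (intro mult_left_mono) auto
        also have "\<dots> = real n" using n1 by (simp flip: powr_add)
        finally show ?thesis by simp
      qed
      have nears: "s n \<le> 2 * A1 * 2 powr (2 * b * e) * real n powr (2 * b * e) * s y / 2" if y: "y \<in> near" for y
      proof -
        have "\<bar>real y - real n\<bar> \<le> real n powr (1/2 + 2 * e) / 2" using y by (simp add: near_def)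
        then have y2: "real y \<ge> real n / 2" "real y \<le> 2 * real n" using q34 n1 by linarith+
        have y2: "real y \<ge> real n / 2" "real y \<le> 2 * real n" "y \<ge> 1" using y2 y by (auto simp: near_def)
        have "real n powr (1/2 + 2 * e) / 2 \<le> real y powr (1/2 + 2 * e)"
        proof -
          have "real n powr (1/2 + 2 * e) / 2 \<le> real n powr (1/2 + 2 * e) / 2 powr (1/2 + 2 * e)"
            using e powr_mono[of "1/2 + 2 * e" 1 "2::real"] by (intro divide_left_mono) auto
          also have "\<dots> = (real n / 2) powr (1/2 + 2 * e)" by (simp add: powr_divide)
          also have "\<dots> \<le> real y powr (1/2 + 2 * e)" using y2 e by (intro powr_mono2) auto
          finally show ?thesis .
        qed
        moreover have "\<bar>real y - real n\<bar> \<le> real n powr (1/2 + 2 * e) / 2" using y by (simp add: near_def)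
        ultimately have "\<bar>real n - real y\<bar> \<le> real y powr (1/2 + 2 * e)" by linarith
        then have "s n \<le> A1 * real y powr (b * (2 * e)) * s y" using A1(2)[of y n] y2 n1 by simp
        also have "real y powr (b * (2 * e)) \<le> (2 * real n) powr (b * (2 * e))" using y2 b e by (intro powr_mono2) auto
        also have "(2 * real n) powr (b * (2 * e)) = 2 powr (2 * b * e) * real n powr (2 * b * e)" by (simp add: powr_mult mult_ac)
        finally show ?thesis using A1 pos[OF y2(3)] by (simp add: mult_ac)
      qed
      have half: "(\<Sum>j<h. \<Sum>y\<in>near. cpow h p y (m + j)) \<ge> 1/2"
      proof -
        have jj: "U (int m + int j) \<le> (\<Sum>y\<in>near. cpow h p y (m + j)) + (H * real n + real h) * Q n" if j: "j < h" for j
        proof -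
          have mj: "\<bar>real (m + j) - mean * real n\<bar> \<le> real n powr (1/2 + e) + real K + real h" using m j by auto
          have "U (int m + int j) = (\<Sum>y\<le>m + h. cpow h p y (m + j))" using j by (subst U_upto[of _ "m + h"]) (auto simp: nat_add_distrib)
          also have "\<dots> = (\<Sum>y\<in>{1..m + h}. cpow h p y (m + j))"
            using m1 by (intro sum.mono_neutral_right) (auto simp: not_le)
          also have "\<dots> = (\<Sum>y\<in>near. cpow h p y (m + j)) + (\<Sum>y\<in>{1..m + h} - near. cpow h p y (m + j))"
            by (subst sum.subset_diff[of near]) (auto simp: near_def)
          also have "(\<Sum>y\<in>{1..m + h} - near. cpow h p y (m + j)) \<le> (\<Sum>y\<in>{1..m + h} - near. Q n)"
            using far[OF n1(3) mj] by (intro sum_mono) (auto simp: near_def Q_def)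
          also have "\<dots> \<le> (\<Sum>y\<in>{1..m + h}. Q n)" using Q0 by (intro sum_mono2) auto
          also have "\<dots> = (real m + real h) * Q n" by simp
          also have "\<dots> \<le> (H * real n + real h) * Q n" using mb Q0 by (intro mult_right_mono) auto
          finally show ?thesis by simp
        qed
        have "1 \<le> (\<Sum>j<h. U (int m + int j))" by (rule U_window) simp
        also have "\<dots> \<le> (\<Sum>j<h. (\<Sum>y\<in>near. cpow h p y (m + j)) + (H * real n + real h) * Q n)"
          using jj by (intro sum_mono) auto
        also have "\<dots> = (\<Sum>j<h. \<Sum>y\<in>near. cpow h p y (m + j)) + real h * ((H * real n + real h) * Q n)"
          by (simp add: sum.distrib)
        also have "real h * ((H * real n + real h) * Q n) \<le> 1/2"
        proof -
          have "H * real n + real h \<le> (3 * real h + 1) * real n"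
            using mult_left_mono[OF n1(2), of "real h"] by (simp add: H_def algebra_simps)
          then have 1: "real h * ((H * real n + real h) * Q n) \<le> real h * ((3 * real h + 1) * real n * Q n)"
            using Q0 by (intro mult_left_mono mult_right_mono) auto
          have "real n powr 2 * Q n \<le> real n powr (B + 2) * Q n" using n1 Q0 B by (intro mult_right_mono powr_mono) auto
          then have "real n powr 2 * Q n \<le> exp 1 * S" using Qn by simp
          then have "real n * (real n * Q n) \<le> exp 1 * S" using n1 by (simp add: power2_eq_square mult_ac)
          then have "real h * (3 * real h + 1) * (real n * (real n * Q n)) \<le> real h * (3 * real h + 1) * (exp 1 * S)"
            using hp by (intro mult_left_mono) auto
          then have "real n * (real h * ((3 * real h + 1) * real n * Q n)) \<le> real n * (1/2)"
            using nb(2)[OF n1(4)] n1 by (simp add: algebra_simps)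
          then have "real h * ((3 * real h + 1) * real n * Q n) \<le> 1/2" using n1 by (subst (asm) mult_le_cancel_left_pos) auto
          then show ?thesis using 1 by linarith
        qed
        finally show ?thesis by simp
      qed
      define F where "F = A1 * 2 powr (2 * b * e) * real n powr (2 * b * e)"
      have Fp: "F > 0" using A1 n1 by (simp add: F_def)
      have "c * (\<Sum>y\<in>near. s n / F * cpow h p y (m + j)) \<le> C1 * s m" if j: "j < h" for j
      proof -
        have "(\<Sum>y\<in>near. s n / F * cpow h p y (m + j)) \<le> (\<Sum>y\<in>near. s y * cpow h p y (m + j))"
        proof (intro sum_mono mult_right_mono cp_nonneg)
          fix y assume "y \<in> near"
          then have "s n \<le> F * s y" using nears by (simp add: F_def mult_ac)
          then show "s n / F \<le> s y" using Fp by (simp add: divide_le_eq mult.commute)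
        qed
        also have "\<dots> \<le> (\<Sum>y\<in>{1..m + h}. s y * cpow h p y (m + j))"
          using pos by (intro sum_mono2) (auto simp: near_def cp_nonneg less_imp_le)
        finally have "c * (\<Sum>y\<in>near. s n / F * cpow h p y (m + j)) \<le> c * (\<Sum>y\<in>{1..m + h}. s y * cpow h p y (m + j))"
          using c_pos by simp
        also have "\<dots> \<le> s (m + j)" using renewal_lower_upto m1 by simp
        also have "\<dots> \<le> C1 * s m" using C1 j m1 by simp
        finally show ?thesis .
      qed
      then have "(\<Sum>j<h. c * (\<Sum>y\<in>near. s n / F * cpow h p y (m + j))) \<le> (\<Sum>j<h. C1 * s m)" by (intro sum_mono) auto
      moreover have "(\<Sum>j<h. c * (\<Sum>y\<in>near. s n / F * cpow h p y (m + j))) = c * (s n / F) * (\<Sum>j<h. \<Sum>y\<in>near. cpow h p y (m + j))"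
        by (simp add: sum_distrib_left algebra_simps)
      moreover have "c * (s n / F) * (1/2) \<le> c * (s n / F) * (\<Sum>j<h. \<Sum>y\<in>near. cpow h p y (m + j))"
        using half c_pos Fp pos[OF n1(1)] by (intro mult_left_mono) auto
      ultimately have "c * (s n / F) * (1/2) \<le> real h * C1 * s m" by simp
      then have "s n \<le> real h * C1 * (2 * F) / c * s m" using c_pos Fp by (simp add: field_simps)
      then have "s n \<le> Al * real n powr (2 * b * e) * s m" by (simp add: Al_def F_def mult_ac)
      then show ?thesis using upper by blast
    qed
    \<comment> \<open>For n < n0 the hypothesis on m gives m \<le> (h + 1) * n0, so that
      \<open>small_case\<close> settles what remains.\<close>
    define N where "N = (h + 1) * n0"
    obtain A2 where A2: "A2 > 0" "\<And>n n'. n \<ge> 1 \<Longrightarrow> n' \<ge> 1 \<Longrightarrow> n' \<le> N \<Longrightarrow> s n' \<le> A2 * s n"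
      using small_case[of N] by blast
    define A where "A = max (max Au Al) A2"
    show "\<exists>A>0. \<forall>n\<ge>1. \<forall>m\<ge>1. \<bar>real m - mean * real n\<bar> \<le> real n powr (1/2 + e) \<longrightarrow>
       s m \<le> A * real n powr (2 * b * e) * s n \<and> s n \<le> A * real n powr (2 * b * e) * s m"
    proof (intro exI[of _ A] conjI[of "_ > _"] allI impI)
      show "A > 0" using A2 by (simp add: A_def)
      fix n m :: nat assume n: "1 \<le> n" "1 \<le> m" "\<bar>real m - mean * real n\<bar> \<le> real n powr (1/2 + e)"
      have nbe: "real n powr (2 * b * e) \<ge> 1" using n b e by (intro ge_one_powr_ge_zero) auto
      have mono: "X * real n powr (2 * b * e) * s k \<le> A * real n powr (2 * b * e) * s k" if "X \<le> A" "k \<ge> 1" for X k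
        using that pos[of k] by (intro mult_right_mono) auto
      show "s m \<le> A * real n powr (2 * b * e) * s n \<and> s n \<le> A * real n powr (2 * b * e) * s m"
      proof (cases "n \<ge> n0")
        case True
        then show ?thesis using large[OF True n(3)] mono[of Au n] mono[of Al m] n by (auto simp: A_def intro: order_trans)
      next
        case False
        have "real n powr (1/2 + e) \<le> real n powr 1" using n e by (intro powr_mono) auto
        moreover have "mean * real n \<le> real h * real n" using mean_bounds by (intro mult_right_mono) auto
        ultimately have "real m \<le> real h * real n + real n" using n(3) by (simp only: powr_one)
        also have "\<dots> = (real h + 1) * real n" by (simp add: algebra_simps)
        also have "\<dots> \<le> (real h + 1) * real n0" using False by (intro mult_left_mono) auto
        finally have "real m \<le> real N" by (simp add: N_def algebra_simps)
        then have mN: "m \<le> N" by simp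
        have nN: "n \<le> N" using False by (simp add: N_def)
        have A2': "A2 * s k \<le> A * real n powr (2 * b * e) * s k" if "k \<ge> 1" for k
        proof (intro mult_right_mono)
          show "A2 \<le> A * real n powr (2 * b * e)" using A2 nbe mult_mono[of A2 A 1 "real n powr (2 * b * e)"] by (simp add: A_def)
        qed (use pos[OF that] in auto)
        show ?thesis using A2(2)[of n m] A2(2)[of m n] n mN nN A2'[of n] A2'[of m] by auto
      qed
    qed
  qed
qed

text \<open>Within n^(1/2 + e) of the mean \<open>compare_near_mean\<close> applies. Outside, 1 / s
  m \<le> 1 meets a superpolynomially small probability, which is dominated by 1 / s n because s
  grows polynomially. For the lower bound, half of the mass near the mean is enough.\<close>

theorem expect_inverse:
  assumes eps: "\<epsilon> > 0"
  shows "\<exists>A>0. \<forall>n\<ge>1. (\<Sum>m\<in>{1..h * n}. cpow h p n m / s m) \<le> A * real n powr \<epsilon> / s n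
     \<and> real n powr (- \<epsilon>) / (A * s n) \<le> (\<Sum>m\<in>{1..h * n}. cpow h p n m / s m)"
proof -
  obtain b where b: "b \<ge> 0" and cmp: "\<And>e. 0 < e \<Longrightarrow> e \<le> 1/64 \<Longrightarrow> (\<exists>A>0. \<forall>n\<ge>1. \<forall>m\<ge>1.
     \<bar>real m - mean * real n\<bar> \<le> real n powr (1/2 + e) \<longrightarrow>
       s m \<le> A * real n powr (b * e) * s n \<and> s n \<le> A * real n powr (b * e) * s m)"
    using compare_near_mean by blast
  \<comment> \<open>Small enough for the loss n^(b * e) to stay below n^\<epsilon>; b + 1 in the
    denominator avoids division by 0.\<close>
  define e where "e = min (1/64) (\<epsilon> / (b + 1))"
  have e: "0 < e" "e \<le> 1/64" using eps b by (auto simp: e_def min.cobounded1 simp del: divide_le_eq_numeral1 le_divide_eq_numeral1)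
  have be: "b * e \<le> \<epsilon>"
  proof -
    have "b * e \<le> (b + 1) * (\<epsilon> / (b + 1))" using b eps e by (intro mult_mono) (auto simp: e_def)
    then show ?thesis using b by simp
  qed
  obtain A1 where A1: "A1 > 0" "\<And>n m. n \<ge> 1 \<Longrightarrow> m \<ge> 1 \<Longrightarrow>
     \<bar>real m - mean * real n\<bar> \<le> real n powr (1/2 + e) \<Longrightarrow>
       s m \<le> A1 * real n powr (b * e) * s n \<and> s n \<le> A1 * real n powr (b * e) * s m"
    using cmp[OF e] by blast
  have pe: "real n powr (b * e) \<le> real n powr \<epsilon>" if "n \<ge> 1" for n :: nat using that be by (intro powr_mono) auto
  have A1': "s m \<le> A1 * real n powr \<epsilon> * s n" "s n \<le> A1 * real n powr \<epsilon> * s m"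
    if "n \<ge> 1" "m \<ge> 1" "\<bar>real m - mean * real n\<bar> \<le> real n powr (1/2 + e)" for n m
  proof -
    have "A1 * real n powr (b * e) * s k \<le> A1 * real n powr \<epsilon> * s k" if "k \<ge> 1" for k
      using that pe[OF \<open>n \<ge> 1\<close>] A1(1) pos[OF that] by (intro mult_right_mono mult_left_mono) auto
    then show "s m \<le> A1 * real n powr \<epsilon> * s n" "s n \<le> A1 * real n powr \<epsilon> * s m"
      using A1(2)[OF that] that by (blast intro: order_trans)+
  qed
  obtain B M where B: "B \<ge> 0" "M \<ge> 1" "\<And>n. n \<ge> 1 \<Longrightarrow> s n \<le> M * real n powr B" using poly_on by blast
  have hp: "real h > 0" "real h \<ge> 1" using h_ge_1 by auto
  obtain S where S: "S > 0" "\<And>x. x \<ge> 1 \<Longrightarrow> exp (- (1 / real h) * x powr e) * x powr (B + 2) \<le> S"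
    using exp_powr_superpoly[OF _ e(1), of "1 / real h" "B + 2"] hp by auto
  define Q where "Q = (\<lambda>n::nat. exp (1 - real n powr e / real h))"
  have Q0: "Q n \<ge> 0" for n by (simp add: Q_def)
  have Qn: "real n powr (B + 2) * Q n \<le> exp 1 * S" if "n \<ge> 1" for n :: nat
  proof -
    have "Q n = exp 1 * exp (- (1 / real h) * real n powr e)" by (simp add: Q_def flip: exp_add)
    then show ?thesis using S(2)[of "real n"] that by (simp add: algebra_simps)
  qed
  have farQ: "cpow h p n m \<le> Q n" if "n \<ge> 1" "\<not> \<bar>real m - mean * real n\<bar> \<le> real n powr (1/2 + e)" for n m
    using cpow_tail[of n e m] that by (simp add: Q_def)
  have tot: "(\<Sum>m\<in>{1..h * n}. cpow h p n m) = 1" if "n \<ge> 1" for n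
  proof -
    have "(\<Sum>m\<in>{1..h * n}. cpow h p n m) = (\<Sum>m\<le>h * n. cpow h p n m)"
      using that by (intro sum.mono_neutral_left) (auto simp: not_le intro!: cpow_eq_0)
    also have "\<dots> = (\<Sum>a\<in>{1..h}. p a) ^ n" by (rule sum_cpow) simp
    finally show ?thesis by (simp only: p_sum power_one)
  qed
  define Au where "Au = A1 + real h * M * exp 1 * S"
  have upper: "(\<Sum>m\<in>{1..h * n}. cpow h p n m / s m) \<le> Au * real n powr \<epsilon> / s n" if n: "n \<ge> 1" for n
  proof -
    have ne: "real n powr \<epsilon> \<ge> 1" using n eps by (intro ge_one_powr_ge_zero) auto
    have "(\<Sum>m\<in>{1..h * n}. cpow h p n m / s m) \<le> (\<Sum>m\<in>{1..h * n}. cpow h p n m * (A1 * real n powr \<epsilon> / s n) + Q n)"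
    proof (rule sum_mono)
      fix m assume m: "m \<in> {1..h * n}"
      show "cpow h p n m / s m \<le> cpow h p n m * (A1 * real n powr \<epsilon> / s n) + Q n"
      proof (cases "\<bar>real m - mean * real n\<bar> \<le> real n powr (1/2 + e)")
        case True
        have "1 / s m \<le> A1 * real n powr \<epsilon> / s n" using A1'(2)[OF n _ True] m pos[of m] pos[OF n] by (simp add: field_simps)
        then have "cpow h p n m * (1 / s m) \<le> cpow h p n m * (A1 * real n powr \<epsilon> / s n)" using cp_nonneg by (intro mult_left_mono) auto
        then show ?thesis using Q0[of n] by simp
      next
        case False
        have "cpow h p n m / s m \<le> cpow h p n m / 1" using ge_1[of m] m cp_nonneg by (intro divide_left_mono) auto
        moreover have "cpow h p n m * (A1 * real n powr \<epsilon> / s n) \<ge> 0" using cp_nonneg A1 pos[OF n] by simp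
        ultimately show ?thesis using farQ[OF n False] by simp
      qed
    qed
    also have "\<dots> = (\<Sum>m\<in>{1..h * n}. cpow h p n m) * (A1 * real n powr \<epsilon> / s n) + real (h * n) * Q n"
      unfolding sum.distrib sum_distrib_right by simp
    also have "\<dots> = A1 * real n powr \<epsilon> / s n + real h * (real n * Q n)" using tot[OF n] by simp
    also have "real h * (real n * Q n) \<le> real h * M * exp 1 * S * real n powr \<epsilon> / s n"
    proof -
      have "s n * (real n * Q n) \<le> (M * real n powr B) * (real n * Q n)" using B n Q0 by (intro mult_right_mono) auto
      also have "\<dots> = M * (real n powr (B + 1) * Q n)" using n by (simp add: powr_add)
      also have "\<dots> \<le> M * (real n powr (B + 2) * Q n)" using n B Q0 by (intro mult_left_mono mult_right_mono powr_mono) auto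
      also have "\<dots> \<le> M * (exp 1 * S)" using Qn[OF n] B by (intro mult_left_mono) auto
      also have "\<dots> \<le> M * (exp 1 * S) * real n powr \<epsilon>" using ne B S mult_left_mono[OF ne, of "M * (exp 1 * S)"] by simp
      finally have "real h * (s n * (real n * Q n)) \<le> real h * (M * (exp 1 * S) * real n powr \<epsilon>)" using hp by (intro mult_left_mono) auto
      then show ?thesis using pos[OF n] by (simp add: field_simps)
    qed
    finally show ?thesis by (simp add: Au_def algebra_simps add_divide_distrib)
  qed
  obtain nb where nb: "nb \<ge> 1" "\<And>n. n \<ge> nb \<Longrightarrow> 2 * (real h * (exp 1 * S)) \<le> real n powr 1"
    using powr_eventually_ge[of 1] by auto
  obtain A2 where A2: "A2 > 0" "\<And>n n'. n \<ge> 1 \<Longrightarrow> n' \<ge> 1 \<Longrightarrow> n' \<le> h * nb \<Longrightarrow> s n' \<le> A2 * s n"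
    using small_case[of "h * nb"] by blast
  define Al where "Al = max (2 * A1) A2"
  have Alp: "Al > 0" using A2 by (simp add: Al_def)
  have lower: "real n powr (- \<epsilon>) / (Al * s n) \<le> (\<Sum>m\<in>{1..h * n}. cpow h p n m / s m)" if n: "n \<ge> 1" for n
  proof (cases "n \<ge> nb")
    case True
    define near where "near = {m \<in> {1..h * n}. \<bar>real m - mean * real n\<bar> \<le> real n powr (1/2 + e)}"
    have half: "(\<Sum>m\<in>near. cpow h p n m) \<ge> 1/2"
    proof -
      have "1 = (\<Sum>m\<in>near. cpow h p n m) + (\<Sum>m\<in>{1..h * n} - near. cpow h p n m)"
        using tot[OF n] by (subst (asm) sum.subset_diff[of near]) (auto simp: near_def)
      also have "(\<Sum>m\<in>{1..h * n} - near. cpow h p n m) \<le> (\<Sum>m\<in>{1..h * n} - near. Q n)"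
        using farQ[OF n] by (intro sum_mono) (auto simp: near_def)
      also have "\<dots> \<le> (\<Sum>m\<in>{1..h * n}. Q n)" using Q0 by (intro sum_mono2) auto
      also have "\<dots> = real h * (real n * Q n)" by simp
      also have "\<dots> \<le> 1/2"
      proof -
        have "real n powr 2 * Q n \<le> real n powr (B + 2) * Q n" using n Q0 B by (intro mult_right_mono powr_mono) auto
        then have "real n powr 2 * Q n \<le> exp 1 * S" using Qn[OF n] by simp
        then have "real n * (real n * Q n) \<le> exp 1 * S" using n by (simp add: power2_eq_square mult_ac)
        then have "real h * (real n * (real n * Q n)) \<le> real h * (exp 1 * S)" using hp by (intro mult_left_mono) auto
        moreover have "2 * (real h * (exp 1 * S)) \<le> real n" using nb(2)[OF True] by simp
        moreover have "real n * (real h * (real n * Q n)) = real h * (real n * (real n * Q n))" by (simp only: mult_ac)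
        ultimately have "real n * (real h * (real n * Q n)) \<le> real n * (1/2)" by linarith
        then show ?thesis using n by (subst (asm) mult_le_cancel_left_pos) auto
      qed
      finally show ?thesis by simp
    qed
    have ee: "real n powr (- \<epsilon>) = 1 / real n powr \<epsilon>" by (simp add: powr_minus_divide)
    have "real n powr (- \<epsilon>) / (Al * s n) \<le> real n powr (- \<epsilon>) / (2 * A1 * s n)"
      using A1 pos[OF n] by (intro divide_left_mono mult_right_mono) (auto simp: Al_def)
    also have "\<dots> = (1/2) * (1 / (A1 * real n powr \<epsilon> * s n))" by (simp add: ee)
    also have "\<dots> \<le> (\<Sum>m\<in>near. cpow h p n m) * (1 / (A1 * real n powr \<epsilon> * s n))"
      using half A1 pos[OF n] by (intro mult_right_mono) auto
    also have "\<dots> = (\<Sum>m\<in>near. cpow h p n m * (1 / (A1 * real n powr \<epsilon> * s n)))" by (rule sum_distrib_right)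
    also have "\<dots> \<le> (\<Sum>m\<in>near. cpow h p n m * (1 / s m))"
    proof (intro sum_mono mult_left_mono cp_nonneg)
      fix m assume m: "m \<in> near"
      then have "s m \<le> A1 * real n powr \<epsilon> * s n" using A1'(1)[OF n] by (auto simp: near_def)
      then show "1 / (A1 * real n powr \<epsilon> * s n) \<le> 1 / s m" using pos[of m] m by (intro divide_left_mono) (auto simp: near_def)
    qed
    also have "\<dots> \<le> (\<Sum>m\<in>{1..h * n}. cpow h p n m / s m)"
      using cp_nonneg pos by (simp, intro sum_mono2) (auto simp: near_def less_imp_le)
    finally show ?thesis .
  next
    case False
    have "real n powr (- \<epsilon>) / (Al * s n) \<le> 1 / (Al * s n)"
      using n eps Alp pos[OF n] powr_mono[of "- \<epsilon>" 0 "real n"] by (intro divide_right_mono) auto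
    also have "\<dots> \<le> 1 / (A2 * s n)" using A2 pos[OF n] by (intro divide_left_mono mult_right_mono) (auto simp: Al_def)
    also have "\<dots> = (\<Sum>m\<in>{1..h * n}. cpow h p n m) * (1 / (A2 * s n))" using tot[OF n] by simp
    also have "\<dots> = (\<Sum>m\<in>{1..h * n}. cpow h p n m * (1 / (A2 * s n)))" by (rule sum_distrib_right)
    also have "\<dots> \<le> (\<Sum>m\<in>{1..h * n}. cpow h p n m * (1 / s m))"
    proof (intro sum_mono mult_left_mono cp_nonneg)
      fix m assume m: "m \<in> {1..h * n}"
      have "h * n \<le> h * nb" using False by (intro mult_le_mono2) simp
      then have "m \<le> h * nb" using m by (meson atLeastAtMost_iff order_trans)
      then have "s m \<le> A2 * s n" using A2 n m by auto
      then show "1 / (A2 * s n) \<le> 1 / s m" using pos[of m] m by (intro divide_left_mono) auto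
    qed
    finally show ?thesis by simp
  qed
  define A where "A = max Au Al"
  have Ap: "A > 0" using Alp by (simp add: A_def)
  show ?thesis
  proof (intro exI[of _ A] conjI[of "_ > _"] allI impI Ap)
    fix n :: nat assume n: "1 \<le> n"
    have "Au * real n powr \<epsilon> / s n \<le> A * real n powr \<epsilon> / s n" using pos[OF n] by (intro divide_right_mono mult_right_mono) (auto simp: A_def)
    moreover have "real n powr (- \<epsilon>) / (A * s n) \<le> real n powr (- \<epsilon>) / (Al * s n)"
      using Alp Ap pos[OF n] by (intro divide_left_mono mult_right_mono) (auto simp: A_def)
    ultimately show "(\<Sum>m\<in>{1..h * n}. cpow h p n m / s m) \<le> A * real n powr \<epsilon> / s n
      \<and> real n powr (- \<epsilon>) / (A * s n) \<le> (\<Sum>m\<in>{1..h * n}. cpow h p n m / s m)"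
      using upper[OF n] lower[OF n] by linarith
  qed
qed

end

context doubling_submult
begin

text \<open>s lies between 1 and a power of its argument. A total weight q > 1 puts mass q^n on at
  most h * n points, so the lower inequality would make s exponentially large at one of them. If q <
  1, the right side of the upper inequality is exponentially small, since y >= (m - j) / h in every
  nonzero term.\<close>

lemma total_weight_eq_1:
  assumes r: "\<And>a. r a \<ge> 0" and c: "c > 0" and C: "C > 0"
    and renewal_lower: "\<And>m. m \<ge> 1 \<Longrightarrow> c * (\<Sum>y\<in>{1..m}. s y * cpow h r y m) \<le> s m"
    and renewal_upper: "\<And>m. m > K \<Longrightarrow> s m \<le> C * (\<Sum>j\<le>K. \<Sum>y\<in>{1..m}. s y * cpow h r y (m - j))"
  shows "(\<Sum>a\<in>{1..h}. r a) = 1"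
proof -
  define q where "q = (\<Sum>a\<in>{1..h}. r a)"
  have q0: "q \<ge> 0" unfolding q_def by (intro sum_nonneg r)
  obtain B where B: "B \<ge> 0" "\<And>n. n \<ge> 1 \<Longrightarrow> s n \<le> s 1 * real n powr B" using poly_bound by blast
  define M where "M = s 1"
  have M: "M \<ge> 1" using ge_1[of 1] by (simp add: M_def)
  have sM: "s n \<le> M * real n powr B" if "n \<ge> 1" for n using B that by (simp add: M_def)
  have nn: "cpow h r y m \<ge> 0" for y m by (rule cpow_nonneg[OF r])
  have cq: "cpow h r y m \<le> q ^ y" for y m
  proof -
    have "cpow h r y m \<le> (\<Sum>m\<le>max m (h * y). cpow h r y m)" by (rule member_le_sum) (auto simp: nn)
    also have "\<dots> = q ^ y" unfolding q_def by (rule sum_cpow) simp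
    finally show ?thesis .
  qed
  have h1: "h \<ge> 1"
  proof (rule ccontr)
    assume "\<not> h \<ge> 1"
    then have "h = 0" by simp
    then have z: "cpow h r y m = 0" if "y \<ge> 1" for y m using that by (cases y) auto
    have "(\<Sum>j\<le>K. \<Sum>y\<in>{1..K+1}. s y * cpow h r y (K + 1 - j)) = 0" by (intro sum.neutral ballI) (simp add: z)
    then show False using pos[of "K + 1"] renewal_upper[of "K + 1"] by simp
  qed
  have hp: "real h \<ge> 1" using h1 by simp
  have "\<not> q > 1"
  proof
    assume q1: "q > 1"
    have lq: "ln q > 0" using q1 by simp
    obtain S where S: "S > 0" "\<And>x. x \<ge> 1 \<Longrightarrow> exp (- ln q * x powr 1) * x powr (B + 2) \<le> S"
      using exp_powr_superpoly[OF lq, of 1 "B + 2"] by auto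
    have ineq: "real n \<le> S * (real h * M * real h powr B) / c" if n: "n \<ge> 1" for n :: nat
    proof -
      have "c * q ^ n \<le> c * (s n * q ^ n)"
        using ge_1[OF n] c q1 mult_right_mono[of 1 "s n" "q ^ n"] by simp
      also have "\<dots> = (\<Sum>m\<le>h * n. c * (s n * cpow h r n m))"
        unfolding sum_distrib_left[symmetric] q_def by (subst sum_cpow) auto
      also have "\<dots> = (\<Sum>m\<in>{1..h * n}. c * (s n * cpow h r n m))"
        using n by (intro sum.mono_neutral_right) (auto simp: not_le intro!: cpow_eq_0)
      also have "\<dots> \<le> (\<Sum>m\<in>{1..h * n}. M * (real h * real n) powr B)"
      proof (rule sum_mono)
        fix m assume m: "m \<in> {1..h * n}"
        have "c * (s n * cpow h r n m) \<le> s m"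
        proof (cases "n \<le> m")
          case True
          have "s n * cpow h r n m \<le> (\<Sum>y\<in>{1..m}. s y * cpow h r y m)"
            using n True pos nn by (intro member_le_sum) (auto simp: less_imp_le)
          then have "c * (s n * cpow h r n m) \<le> c * (\<Sum>y\<in>{1..m}. s y * cpow h r y m)" using c by simp
          then show ?thesis using renewal_lower[of m] m by simp
        next
          case False
          then show ?thesis using pos[of m] m by (simp add: cpow_eq_0)
        qed
        also have "s m \<le> M * real m powr B" using sM m by simp
        also have "\<dots> \<le> M * (real h * real n) powr B" using m M B by (intro mult_left_mono powr_mono2) (auto simp flip: of_nat_mult)
        finally show "c * (s n * cpow h r n m) \<le> M * (real h * real n) powr B" .
      qed
      also have "\<dots> = (real h * M * real h powr B) * (real n powr (B + 1))"
        using n hp by (simp add: powr_mult powr_add)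
      finally have a: "c * q ^ n \<le> (real h * M * real h powr B) * real n powr (B + 1)" .
      have "exp (- ln q * real n powr 1) = 1 / q ^ n"
        using q1 n by (simp add: exp_minus exp_of_nat_mult field_simps)
      moreover have "exp (- ln q * real n powr 1) * real n powr (B + 2) \<le> S" by (rule S(2)) (use n in simp)
      ultimately have "1 / q ^ n * real n powr (B + 2) \<le> S" by (simp only:)
      then have "real n powr (B + 2) \<le> S * q ^ n" using q1 by (simp add: divide_le_eq)
      then have "c * real n powr (B + 2) \<le> S * (c * q ^ n)" using c by (simp add: mult_left_mono mult_ac)
      also have "\<dots> \<le> S * ((real h * M * real h powr B) * real n powr (B + 1))" using a S by (intro mult_left_mono) auto
      finally have "real n powr (B + 1) * (c * real n) \<le> real n powr (B + 1) * (S * (real h * M * real h powr B))"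
        using n by (simp add: powr_add power2_eq_square mult_ac)
      then have "c * real n \<le> S * (real h * M * real h powr B)" using n by (subst (asm) mult_le_cancel_left_pos) auto
      then show ?thesis using c by (simp add: field_simps)
    qed
    obtain n :: nat where "real n > max 1 (S * (real h * M * real h powr B) / c)" using reals_Archimedean2 by blast
    then show False using ineq[of n] by (simp add: max_def split: if_splits)
  qed
  moreover have "\<not> q < 1"
  proof
    assume q1: "q < 1"
    \<comment> \<open>Raising q to at least 1/2 keeps the logarithm meaningful when q = 0.\<close>
    define t where "t = max q (1/2)"
    have t: "0 < t" "t < 1" "q \<le> t" using q1 by (auto simp: t_def)
    define w where "w = - ln t / (2 * real h)"
    have w: "w > 0" using t hp by (simp add: w_def divide_neg_pos)
    obtain S where S: "S > 0" "\<And>x. x \<ge> 1 \<Longrightarrow> exp (- w * x powr 1) * x powr (B + 2) \<le> S"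
      using exp_powr_superpoly[OF w, of 1 "B + 2"] by auto
    have ineq: "real m \<le> C * (real K + 1) * M * S" if m: "m > 2 * K" "m \<ge> 1" for m :: nat
    proof -
      have b: "cpow h r y (m - j) \<le> exp (- w * real m)" if j: "j \<le> K" for y j
      proof (cases "h * y < m - j")
        case True
        then show ?thesis by (simp add: cpow_eq_0)
      next
        case False
        then have "real (m - j) \<le> real h * real y" by (simp flip: of_nat_mult)
        moreover have "real (m - j) \<ge> real m / 2" using j m by (simp add: of_nat_diff)
        ultimately have ym: "real m / (2 * real h) \<le> real y" using hp by (simp add: field_simps)
        have "cpow h r y (m - j) \<le> q ^ y" by (rule cq)
        also have "\<dots> \<le> t ^ y" using q0 t by (intro power_mono) auto
        also have "\<dots> = exp (ln t * real y)" using t by (simp add: exp_of_nat2_mult)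
        also have "\<dots> \<le> exp (ln t * (real m / (2 * real h)))"
          using mult_left_mono_neg[OF ym, of "ln t"] t by (simp only: exp_le_cancel_iff) simp
        also have "\<dots> = exp (- w * real m)" by (simp add: w_def)
        finally show ?thesis .
      qed
      have "1 \<le> s m" using ge_1 m by simp
      also have "\<dots> \<le> C * (\<Sum>j\<le>K. \<Sum>y\<in>{1..m}. s y * cpow h r y (m - j))" using m by (intro renewal_upper) auto
      also have "\<dots> \<le> C * (\<Sum>j\<le>K. \<Sum>y\<in>{1..m}. (M * real m powr B) * exp (- w * real m))"
      proof (intro mult_left_mono sum_mono mult_mono)
        fix y assume y: "y \<in> {1..m}"
        have "s y \<le> M * real y powr B" using sM y by simp
        also have "\<dots> \<le> M * real m powr B" using y M B by (intro mult_left_mono powr_mono2) auto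
        finally show "s y \<le> M * real m powr B" .
      qed (use b C M nn in auto)
      also have "\<dots> = C * (real K + 1) * M * (exp (- w * real m) * real m powr (B + 1))"
        using m by (simp add: powr_add algebra_simps)
      finally have "1 * real m \<le> (C * (real K + 1) * M * (exp (- w * real m) * real m powr (B + 1))) * real m"
        by (intro mult_right_mono) auto
      also have "\<dots> = C * (real K + 1) * M * (exp (- w * real m powr 1) * real m powr (B + 2))"
        using m by (simp add: powr_add power2_eq_square)
      also have "\<dots> \<le> C * (real K + 1) * M * S" using S(2)[of "real m"] m C M by (intro mult_left_mono) auto
      finally show ?thesis by simp
    qed
    obtain m :: nat where m: "real m > max (2 * real K + 1) (C * (real K + 1) * M * S)" using reals_Archimedean2 by blast
    then have "m > 2 * K" "m \<ge> 1" by linarith+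
    then show False using ineq[of m] m by linarith
  qed
  ultimately show ?thesis by (simp add: q_def)
qed

end

subsection \<open>Mid-edge walks\<close>

lemma mid_saw_Nil: "mid_saw V E [] es \<longleftrightarrow> (\<exists>e\<in>edges V E. es = [e])"
  by (auto simp: mid_saw_def length_Suc_conv)

lemma mid_saw_Cons:
  "mid_saw V E (v # vs) es \<longleftrightarrow> (\<exists>e es'. es = e # es' \<and> e \<in> edges V E \<and> v \<in> V \<and> v \<in> e \<and> v \<in> hd es' \<and>
     v \<notin> set vs \<and> e \<notin> set es' \<and> mid_saw V E vs es')"
proof (cases es)
  case (Cons e es')
  have "(\<forall>i<length (v # vs). (v # vs) ! i \<in> (e # es') ! i \<and> (v # vs) ! i \<in> (e # es') ! Suc i)
     \<longleftrightarrow> v \<in> e \<and> v \<in> es' ! 0 \<and> (\<forall>i<length vs. vs ! i \<in> es' ! i \<and> vs ! i \<in> es' ! Suc i)"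
    by (auto simp: less_Suc_eq_0_disj)
  moreover have "es' ! 0 = hd es'" if "length es' = Suc (length vs)" using that by (cases es') auto
  ultimately show ?thesis using Cons by (auto simp: mid_saw_def)
qed (auto simp: mid_saw_def)

lemma mid_saw_length: "mid_saw V E vs es \<Longrightarrow> length es = Suc (length vs)"
  by (simp add: mid_saw_def)

lemma mid_saw_hd_edge: "mid_saw V E vs es \<Longrightarrow> hd es \<in> edges V E"
  by (cases es) (auto simp: mid_saw_def)

lemma mid_saw_append:
  assumes "length es1 = length vs1"
  shows "mid_saw V E (vs1 @ vs2) (es1 @ e # es2) \<longleftrightarrow> mid_saw V E vs1 (es1 @ [e]) \<and> mid_saw V E vs2 (e # es2)
     \<and> set vs1 \<inter> set vs2 = {} \<and> set es1 \<inter> set (e # es2) = {}"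
  using assms
proof (induction vs1 arbitrary: es1)
  case Nil
  then show ?case using mid_saw_hd_edge[of V E vs2 "e # es2"] by (auto simp: mid_saw_Nil)
next
  case (Cons v vs1)
  then obtain e1 es1' where es1: "es1 = e1 # es1'" "length es1' = length vs1" by (cases es1) auto
  have "hd (es1' @ e # es2) = hd (es1' @ [e])" by (cases es1') auto
  then show ?case unfolding es1 append_Cons mid_saw_Cons using Cons.IH[OF es1(2)] by auto
qed

lemma mid_saw_rev: "mid_saw V E vs es \<Longrightarrow> mid_saw V E (rev vs) (rev es)"
proof -
  assume m: "mid_saw V E vs es"
  have l: "length es = Suc (length vs)" using m by (simp add: mid_saw_def)
  have "rev vs ! i \<in> rev es ! i \<and> rev vs ! i \<in> rev es ! Suc i" if i: "i < length vs" for i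
  proof -
    define j where "j = length vs - Suc i"
    have j: "j < length vs" "length es - Suc i = Suc j" "length es - Suc (Suc i) = j" using i l by (auto simp: j_def)
    then show ?thesis using m i l by (simp add: rev_nth mid_saw_def j_def[symmetric])
  qed
  then show ?thesis using m by (auto simp: mid_saw_def)
qed

text \<open>\<open>lt_edges\<close> also relates (v, x) and (v, y) for v outside V0 whenever EH x y
  holds, so the transformed graph is simple only after restriction to its vertex set. This weaker
  form is what both graphs share.\<close>

definition simple_on :: "'v set \<Rightarrow> ('v \<Rightarrow> 'v \<Rightarrow> bool) \<Rightarrow> bool" where
  "simple_on V E \<longleftrightarrow> (\<forall>a\<in>V. \<forall>b\<in>V. E a b \<longrightarrow> a \<noteq> b \<and> E b a)"

lemma simple_graph_on: "simple_graph V E \<Longrightarrow> simple_on V E"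
  by (auto simp: simple_graph_def simple_on_def)

lemma edgesE:
  assumes "simple_on V E" "e \<in> edges V E"
  obtains a b where "e = {a, b}" "a \<noteq> b" "E a b" "E b a" "a \<in> V" "b \<in> V"
  using assms by (fastforce simp: edges_def simple_on_def)

lemma edgesI: "a \<in> V \<Longrightarrow> b \<in> V \<Longrightarrow> E a b \<Longrightarrow> {a, b} \<in> edges V E"
  unfolding edges_def by blast

lemma edges_subset: "e \<in> edges V E \<Longrightarrow> e \<subseteq> V" by (auto simp: edges_def)

lemma edge_eqI:
  assumes "simple_on V E" "e \<in> edges V E" "a \<in> e" "b \<in> e" "a \<noteq> b"
  shows "e = {a, b}" "E a b"
  using assms by (auto elim!: edgesE)

fun path_edges :: "'v list \<Rightarrow> 'v set list" where
  "path_edges (x # y # zs) = {x, y} # path_edges (y # zs)"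
| "path_edges _ = []"

lemma is_walk_simps:
  "is_walk V E [x] \<longleftrightarrow> x \<in> V"
  "is_walk V E (x # y # zs) \<longleftrightarrow> x \<in> V \<and> E x y \<and> is_walk V E (y # zs)"
  "\<not> is_walk V E []"
  by (auto simp: is_walk_def less_Suc_eq_0_disj All_less_Suc2 nth_Cons split: nat.splits)

lemma length_path_edges: "length (path_edges xs) = length xs - 1"
  by (induction xs rule: path_edges.induct) auto

lemma path_edges_map: "path_edges (map f xs) = map (image f) (path_edges xs)"
  by (induction xs rule: path_edges.induct) auto

lemma path_edges_subset: "e \<in> set (path_edges xs) \<Longrightarrow> e \<subseteq> set xs"
  by (induction xs rule: path_edges.induct) auto

lemma path_edges_in: "is_walk V E xs \<Longrightarrow> e \<in> set (path_edges xs) \<Longrightarrow> e \<in> edges V E"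
proof (induction xs rule: path_edges.induct)
  case (1 x y zs)
  have "y \<in> V" using 1(2) by (cases zs) (auto simp: is_walk_simps)
  then show ?case using 1 by (auto simp: is_walk_simps edges_def)
qed auto

lemma distinct_path_edges: "distinct xs \<Longrightarrow> distinct (path_edges xs)"
proof (induction xs rule: path_edges.induct)
  case (1 x y zs)
  then show ?case using path_edges_subset[of "{x, y}" "y # zs"] by auto
qed auto

text \<open>Since vertices do not repeat, each inner mid-edge must be the edge joining two
  consecutive vertices. Only the first and the last mid-edge are not determined by the vertex
  list.\<close>

lemma mid_saw_canonical:
  assumes g: "simple_on V E" and m: "mid_saw V E vs es" and ne: "vs \<noteq> []"
  shows "is_walk V E vs" "es = hd es # path_edges vs @ [last es]" "distinct vs" "hd vs \<in> hd es" "last vs \<in> last es"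
proof -
  show "distinct vs" using m by (simp add: mid_saw_def)
  have "is_walk V E vs \<and> es = hd es # path_edges vs @ [last es] \<and> hd vs \<in> hd es \<and> last vs \<in> last es"
    using m ne
  proof (induction vs arbitrary: es)
    case (Cons v vs)
    obtain e es' where es: "es = e # es'" "v \<in> V" "v \<in> e" "v \<in> hd es'" "v \<notin> set vs" "mid_saw V E vs es'"
      using Cons.prems(1) by (auto simp: mid_saw_Cons)
    have ne': "es' \<noteq> []" using es by (auto simp: mid_saw_def)
    show ?case
    proof (cases vs)
      case Nil
      then obtain e' where "es' = [e']" using es by (auto simp: mid_saw_Nil)
      then show ?thesis using es Nil by (simp add: is_walk_simps)
    next
      case (Cons w vs')
      then have IH: "is_walk V E vs" "es' = hd es' # path_edges vs @ [last es']" "hd vs \<in> hd es'" "last vs \<in> last es'"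
        using Cons.IH[OF es(6)] by auto
      have "hd es' \<in> edges V E" using es(6) by (rule mid_saw_hd_edge)
      moreover have "w \<in> hd es'" "w \<noteq> v" using IH(3) Cons es(5) by auto
      ultimately have "hd es' = {v, w}" "E v w" using edge_eqI[OF g, of "hd es'" v w] es(4) by auto
      then show ?thesis using es IH Cons ne' by (auto simp: is_walk_simps)
    qed
  qed simp
  then show "is_walk V E vs" "es = hd es # path_edges vs @ [last es]" "hd vs \<in> hd es" "last vs \<in> last es" by blast+
qed

lemma mid_saw_of_path:
  assumes "is_walk V E xs" "distinct xs" "e0 \<in> edges V E" "e1 \<in> edges V E" "hd xs \<in> e0" "last xs \<in> e1"
    "e0 \<noteq> e1" "e0 \<notin> set (path_edges xs)" "e1 \<notin> set (path_edges xs)"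
  shows "mid_saw V E xs (e0 # path_edges xs @ [e1])"
  using assms
proof (induction xs arbitrary: e0 rule: path_edges.induct)
  case (1 x y zs)
  have "{x, y} \<in> edges V E" by (rule path_edges_in[OF 1(2)]) simp
  moreover have "{x, y} \<notin> set (path_edges (y # zs))" using distinct_path_edges[OF 1(3)] by simp
  ultimately have "mid_saw V E (y # zs) ({x, y} # path_edges (y # zs) @ [e1])"
    using 1 by (intro 1(1)) (auto simp: is_walk_simps)
  then show ?case using 1(2-) unfolding mid_saw_Cons[of _ _ x] by (auto simp: is_walk_simps)
next
  case ("2_2" v)
  then show ?case by (auto simp: mid_saw_Cons mid_saw_Nil is_walk_simps)
qed (auto simp: is_walk_simps)

lemma length_one_saw:
  assumes "mid_saw V E vs es" "length vs = 1"
  obtains v e f where "vs = [v]" "es = [e, f]" "v \<in> V" "v \<in> e" "v \<in> f" "e \<in> edges V E" "f \<in> edges V E"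
proof -
  obtain v where v: "vs = [v]" using assms(2) by (auto simp: length_Suc_conv)
  have "length es = 2" using assms by (simp add: mid_saw_def)
  then obtain e f where es: "es = [e, f]" by (auto simp: length_Suc_conv numeral_2_eq_2)
  show ?thesis using that[OF v es] assms(1) v es by (auto simp: mid_saw_def)
qed

subsection \<open>The transformed graph\<close>

locale local_transformation =
  fixes V0 :: "'v set" and E0 :: "'v \<Rightarrow> 'v \<Rightarrow> bool" and Hv :: "'g set" and EH :: "'g \<Rightarrow> 'g \<Rightarrow> bool"
    and w1 w2 w3 :: 'g and P :: "'v \<Rightarrow> 'v \<Rightarrow> 'g"
  assumes simple0: "simple_graph V0 E0" and cubic0: "cubic V0 E0"
    and gadget: "gadget Hv EH w1 w2 w3" and ports: "port_assignment V0 E0 P w1 w2 w3"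
begin

abbreviation "V1 \<equiv> lt_vertices V0 Hv"
abbreviation "E1 \<equiv> lt_edges E0 Hv EH P"
abbreviation "Ed0 \<equiv> edges V0 E0"
abbreviation "Ed1 \<equiv> edges V1 E1"
abbreviation "Ports \<equiv> {w1, w2, w3}"

lemma gadget_facts: "finite Hv" "simple_graph Hv EH" "connected_graph Hv EH" "Ports \<subseteq> Hv" "w1 \<noteq> w2" "w1 \<noteq> w3" "w2 \<noteq> w3"
  using gadget by (auto simp: gadget_def)

lemma P_inj: "v \<in> V0 \<Longrightarrow> a \<in> nbrs V0 E0 v \<Longrightarrow> b \<in> nbrs V0 E0 v \<Longrightarrow> P v a = P v b \<Longrightarrow> a = b"
  using ports by (auto simp: port_assignment_def bij_betw_def inj_on_def)

lemma P_in: "E0 v a \<Longrightarrow> P v a \<in> Ports"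
  using ports simple0 by (fastforce simp: port_assignment_def bij_betw_def nbrs_def simple_graph_def)

lemma E0_sym: "E0 a b \<Longrightarrow> E0 b a" and E0_in: "E0 a b \<Longrightarrow> a \<in> V0 \<and> b \<in> V0" and E0_irrefl: "\<not> E0 a a"
  using simple0 by (auto simp: simple_graph_def)

lemma EH_sym: "EH a b \<Longrightarrow> EH b a" and EH_in: "EH a b \<Longrightarrow> a \<in> Hv \<and> b \<in> Hv" and EH_irrefl: "\<not> EH a a"
  using gadget_facts(2) by (auto simp: simple_graph_def)

text \<open>The edges of the transformed graph fall into those inherited from an old edge e, namely
  \<open>lift e\<close>, and those inside a gadget, \<open>internal u\<close>; see
  \<open>Ed1_cases\<close>. \<open>port v e\<close> is P indexed by edges instead of
  neighbours.\<close>

definition lift :: "'v set \<Rightarrow> ('v \<times> 'g) set" where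
  "lift e = {(a, P a b) | a b. e = {a, b}}"

definition internal :: "'v \<Rightarrow> ('v \<times> 'g) set set" where
  "internal u = image (Pair u) ` edges Hv EH"

definition port :: "'v \<Rightarrow> 'v set \<Rightarrow> 'g" where
  "port v e = P v (THE b. e = {v, b})"

lemma lift_pair: "lift {a, b} = {(a, P a b), (b, P b a)}"
  by (auto simp: lift_def doubleton_eq_iff)

lemma port_pair: "port a {a, b} = P a b" "port b {a, b} = P b a"
proof -
  have "(THE c. {a, b} = {a, c}) = b" "(THE c. {a, b} = {b, c}) = a" by (auto intro!: the_equality simp: doubleton_eq_iff)
  then show "port a {a, b} = P a b" "port b {a, b} = P b a" by (simp_all add: port_def)
qed

lemma Ed0E:
  assumes "e \<in> Ed0" obtains a b where "e = {a, b}" "a \<noteq> b" "E0 a b" "E0 b a" "a \<in> V0" "b \<in> V0"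
  using edgesE[OF simple_graph_on[OF simple0] assms] by blast

lemma mem_lift: "e \<in> Ed0 \<Longrightarrow> (v, x) \<in> lift e \<longleftrightarrow> v \<in> e \<and> x = port v e"
  by (elim Ed0E) (auto simp: lift_pair port_pair)

lemma fst_lift: "e \<in> Ed0 \<Longrightarrow> fst ` lift e = e"
  by (elim Ed0E) (auto simp: lift_pair)

lemma lift_inj: "e \<in> Ed0 \<Longrightarrow> f \<in> Ed0 \<Longrightarrow> lift e = lift f \<Longrightarrow> e = f"
  using fst_lift by metis

lemma port_in: "e \<in> Ed0 \<Longrightarrow> v \<in> e \<Longrightarrow> port v e \<in> Ports"
proof -
  assume e: "e \<in> Ed0" "v \<in> e"
  obtain a b where ab: "e = {a, b}" "E0 a b" "E0 b a" using e(1) by (elim Ed0E)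
  then show ?thesis using e(2) P_in[of a b] P_in[of b a] by (cases "v = a") (auto simp: port_pair)
qed

lemma port_inj: "e \<in> Ed0 \<Longrightarrow> f \<in> Ed0 \<Longrightarrow> v \<in> e \<Longrightarrow> v \<in> f \<Longrightarrow> port v e = port v f \<Longrightarrow> e = f"
proof -
  assume a: "e \<in> Ed0" "f \<in> Ed0" "v \<in> e" "v \<in> f" "port v e = port v f"
  obtain b where b: "e = {v, b}" "E0 v b" "b \<in> V0" "v \<in> V0" using a(1,3) by (elim Ed0E) (auto simp: insert_commute)
  obtain c where c: "f = {v, c}" "E0 v c" "c \<in> V0" using a(2,4) by (elim Ed0E) (auto simp: insert_commute)
  have "b = c" using a(5) b c by (intro P_inj[of v]) (auto simp: port_pair nbrs_def)
  then show ?thesis using b c by simp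
qed

lemma Ed1_cases: "e \<in> Ed1 \<longleftrightarrow> e \<in> lift ` Ed0 \<or> (\<exists>u\<in>V0. e \<in> internal u)"
proof
  assume "e \<in> Ed1"
  then obtain u x v y where e: "e = {(u, x), (v, y)}" "u \<in> V0" "v \<in> V0" "x \<in> Hv" "y \<in> Hv" "E1 (u, x) (v, y)"
    by (auto simp: edges_def lt_vertices_def)
  show "e \<in> lift ` Ed0 \<or> (\<exists>u\<in>V0. e \<in> internal u)"
  proof (cases "E0 u v")
    case True
    then have "x = P u v" "y = P v u" using e(6) E0_irrefl by (auto simp: lt_edges_def)
    then have "e = lift {u, v}" using e by (simp add: lift_pair)
    then show ?thesis using True e by (auto simp: edges_def)
  next
    case False
    then have "v = u" "EH x y" using e(6) by (auto simp: lt_edges_def)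
    then have "e = image (Pair u) {x, y}" "{x, y} \<in> edges Hv EH" using e by (auto simp: edges_def)
    then show ?thesis using e(2) by (auto simp only: internal_def)
  qed
next
  assume "e \<in> lift ` Ed0 \<or> (\<exists>u\<in>V0. e \<in> internal u)"
  then show "e \<in> Ed1"
  proof
    assume "e \<in> lift ` Ed0"
    then obtain a b where ab: "e = lift {a, b}" "E0 a b" "E0 b a" "a \<in> V0" "b \<in> V0" by (auto elim!: Ed0E)
    then have "P a b \<in> Hv" "P b a \<in> Hv" using P_in gadget_facts(4) by blast+
    then show ?thesis unfolding ab(1) lift_pair using ab by (intro edgesI) (auto simp: lt_vertices_def lt_edges_def)
  next
    assume "\<exists>u\<in>V0. e \<in> internal u"
    then obtain u x y where "u \<in> V0" "e = {(u, x), (u, y)}" "x \<in> Hv" "y \<in> Hv" "EH x y" by (auto simp: internal_def edges_def)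
    then show ?thesis by (auto simp: lt_vertices_def lt_edges_def intro!: edgesI)
  qed
qed

lemma internal_not_lift: "e \<in> internal u \<Longrightarrow> e \<notin> lift ` Ed0"
proof
  assume e: "e \<in> internal u" "e \<in> lift ` Ed0"
  have "fst ` e \<subseteq> {u}" using e(1) by (auto simp: internal_def)
  moreover obtain f where "f \<in> Ed0" "fst ` e = f" using e(2) fst_lift by auto
  ultimately show False by (auto elim!: Ed0E)
qed

lemma internal_fst: "e \<in> internal u \<Longrightarrow> x \<in> e \<Longrightarrow> fst x = u" by (auto simp: internal_def)

lemma simple1: "simple_on V1 E1"
  using E0_sym E0_irrefl EH_sym EH_irrefl by (auto simp: simple_on_def lt_edges_def)

lemmas canonical1 = mid_saw_canonical[OF simple1]

definition star :: "'v \<Rightarrow> 'v set set" where "star v = {e \<in> Ed0. v \<in> e}"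

lemma star_card: "v \<in> V0 \<Longrightarrow> finite (star v) \<and> card (star v) = 3"
proof -
  assume v: "v \<in> V0"
  have "star v = (\<lambda>u. {v, u}) ` nbrs V0 E0 v"
    using v E0_sym by (auto simp: star_def nbrs_def edges_def insert_commute)
  moreover have "inj_on (\<lambda>u. {v, u}) (nbrs V0 E0 v)" by (auto simp: inj_on_def doubleton_eq_iff)
  moreover have "finite (nbrs V0 E0 v)" "card (nbrs V0 E0 v) = 3" using cubic0 v by (auto simp: cubic_def)
  ultimately show ?thesis by (simp add: card_image)
qed

text \<open>Two crossings of the same gadget by a self-avoiding walk would need four different edges
  at v. This is why the projection of such a walk does not revisit a vertex.\<close>

lemma no_four_edges:
  assumes "v \<in> V0" "{a, b, c, d} \<subseteq> star v" "distinct [a, b, c, d]"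
  shows False
proof -
  have "card {a, b, c, d} \<le> card (star v)" using assms star_card by (intro card_mono) auto
  then show False using assms star_card[OF assms(1)] by simp
qed

section \<open>Decorating walks by gadget paths\<close>

definition GP :: "'g \<Rightarrow> 'g \<Rightarrow> 'g list set" where
  "GP a b = {\<gamma>. is_walk Hv EH \<gamma> \<and> distinct \<gamma> \<and> hd \<gamma> = a \<and> last \<gamma> = b}"

text \<open>A decoration \<open>\<gamma>s\<close> of a walk \<open>(vs, es)\<close> of $G_0$ lists one gadget path per visited vertex; \<open>dvs\<close> and
  \<open>des\<close> are the vertices and mid-edges of the resulting walk of $G_1$.\<close>
fun valid :: "'v list \<Rightarrow> 'v set list \<Rightarrow> 'g list list \<Rightarrow> bool" where
  "valid [] es \<gamma>s \<longleftrightarrow> \<gamma>s = []"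
| "valid (v # vs) (e # es) (\<gamma> # \<gamma>s) \<longleftrightarrow> \<gamma> \<in> GP (port v e) (port v (hd es)) \<and> valid vs es \<gamma>s"
| "valid _ _ _ \<longleftrightarrow> False"

fun dvs :: "'v list \<Rightarrow> 'g list list \<Rightarrow> ('v \<times> 'g) list" where
  "dvs (v # vs) (\<gamma> # \<gamma>s) = map (Pair v) \<gamma> @ dvs vs \<gamma>s"
| "dvs _ _ = []"

fun des :: "'v list \<Rightarrow> 'v set list \<Rightarrow> 'g list list \<Rightarrow> ('v \<times> 'g) set list" where
  "des (v # vs) (e # es) (\<gamma> # \<gamma>s) = lift e # map (image (Pair v)) (path_edges \<gamma>) @ des vs es \<gamma>s"
| "des _ es _ = map lift es"

lemma GP_ne: "\<gamma> \<in> GP a b \<Longrightarrow> \<gamma> \<noteq> []" by (auto simp: GP_def is_walk_def)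

lemma GP_set: "\<gamma> \<in> GP a b \<Longrightarrow> set \<gamma> \<subseteq> Hv" by (auto simp: GP_def is_walk_def)

lemma is_walk_map_Pair: "u \<in> V0 \<Longrightarrow> is_walk Hv EH \<gamma> \<Longrightarrow> is_walk V1 E1 (map (Pair u) \<gamma>)"
  by (auto simp: is_walk_def lt_vertices_def lt_edges_def)

lemma path_edges_internal: "is_walk Hv EH \<gamma> \<Longrightarrow> e \<in> set (path_edges (map (Pair u) \<gamma>)) \<Longrightarrow> e \<in> internal u"
  using path_edges_in[of Hv EH \<gamma>] by (auto simp: internal_def path_edges_map)

lemma length_dvs: "valid vs es \<gamma>s \<Longrightarrow> length (dvs vs \<gamma>s) = sum_list (map length \<gamma>s)"
  by (induction vs es \<gamma>s rule: valid.induct) auto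

lemma hd_des: "es \<noteq> [] \<Longrightarrow> des vs es \<gamma>s \<noteq> [] \<and> hd (des vs es \<gamma>s) = lift (hd es)"
  by (cases "(vs, es, \<gamma>s)" rule: des.cases) (auto simp: hd_map)

lemma last_des: "mid_saw V0 E0 vs es \<Longrightarrow> valid vs es \<gamma>s \<Longrightarrow> last (des vs es \<gamma>s) = lift (last es)"
proof (induction vs es \<gamma>s rule: valid.induct)
  case (2 v vs e es \<gamma> \<gamma>s)
  have m: "mid_saw V0 E0 vs es" "valid vs es \<gamma>s" using 2 by (auto simp: mid_saw_Cons)
  then have "es \<noteq> []" by (auto simp: mid_saw_def)
  then show ?case using 2(1)[OF m] hd_des[of es vs \<gamma>s] by simp
qed (auto simp: mid_saw_Nil)

lemma dvs_fst: "x \<in> set (dvs vs \<gamma>s) \<Longrightarrow> fst x \<in> set vs"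
  by (induction vs \<gamma>s rule: dvs.induct) auto

lemma des_edges:
  "mid_saw V0 E0 vs es \<Longrightarrow> valid vs es \<gamma>s \<Longrightarrow> x \<in> set (des vs es \<gamma>s) \<Longrightarrow> x \<in> lift ` set es \<or> (\<exists>u\<in>set vs. x \<in> internal u)"
proof (induction vs es \<gamma>s rule: valid.induct)
  case (2 v vs e es \<gamma> \<gamma>s)
  have m: "mid_saw V0 E0 vs es" "valid vs es \<gamma>s" using 2 by (auto simp: mid_saw_Cons)
  have g: "is_walk Hv EH \<gamma>" using 2 by (auto simp: GP_def)
  show ?case using 2(1)[OF m] 2(4) path_edges_internal[OF g, of x v] by (auto simp: path_edges_map)
qed auto

lemma lift_in_des: "mid_saw V0 E0 vs es \<Longrightarrow> valid vs es \<gamma>s \<Longrightarrow> e \<in> set es \<Longrightarrow> lift e \<in> set (des vs es \<gamma>s)"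
  by (induction vs es \<gamma>s rule: valid.induct) (auto simp: mid_saw_Cons)

lemma port_ne: "e \<in> Ed0 \<Longrightarrow> f \<in> Ed0 \<Longrightarrow> v \<in> e \<Longrightarrow> v \<in> f \<Longrightarrow> e \<noteq> f \<Longrightarrow> port v e \<noteq> port v f"
  using port_inj by blast

lemma block_mid_saw:
  assumes "v \<in> V0" "e \<in> Ed0" "f \<in> Ed0" "v \<in> e" "v \<in> f" "e \<noteq> f" "\<gamma> \<in> GP (port v e) (port v f)"
  shows "mid_saw V1 E1 (map (Pair v) \<gamma>) (lift e # map (image (Pair v)) (path_edges \<gamma>) @ [lift f])"
proof -
  have g: "is_walk Hv EH \<gamma>" "distinct \<gamma>" "hd \<gamma> = port v e" "last \<gamma> = port v f" "\<gamma> \<noteq> []"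
    using assms GP_ne by (auto simp: GP_def)
  have n: "lift x \<notin> set (path_edges (map (Pair v) \<gamma>))" if "x \<in> Ed0" for x
    using path_edges_internal[OF g(1)] internal_not_lift that by blast
  show ?thesis unfolding path_edges_map[symmetric]
  proof (rule mid_saw_of_path)
    show "is_walk V1 E1 (map (Pair v) \<gamma>)" by (rule is_walk_map_Pair[OF assms(1) g(1)])
    show "distinct (map (Pair v) \<gamma>)" using g by (simp add: distinct_map inj_on_def)
    show "lift e \<in> Ed1" "lift f \<in> Ed1" using assms Ed1_cases by auto
    show "hd (map (Pair v) \<gamma>) \<in> lift e" "last (map (Pair v) \<gamma>) \<in> lift f"
      using g assms by (auto simp: mem_lift hd_map last_map)
    show "lift e \<noteq> lift f" using assms lift_inj by blast
  qed (use n assms in auto)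
qed

lemma decorate_mid_saw:
  assumes "mid_saw V0 E0 vs es" "valid vs es \<gamma>s"
  shows "mid_saw V1 E1 (dvs vs \<gamma>s) (des vs es \<gamma>s)"
  using assms
proof (induction vs es \<gamma>s rule: valid.induct)
  case (1 es \<gamma>s)
  then show ?case using Ed1_cases by (auto simp: mid_saw_Nil)
next
  case (2 v vs e es \<gamma> \<gamma>s)
  have m: "mid_saw V0 E0 vs es" "valid vs es \<gamma>s" "e \<in> Ed0" "v \<in> V0" "v \<in> e" "v \<in> hd es" "v \<notin> set vs" "e \<notin> set es"
    "\<gamma> \<in> GP (port v e) (port v (hd es))"
    using 2 by (auto simp: mid_saw_Cons)
  have ne: "es \<noteq> []" using m(1) by (auto simp: mid_saw_def)
  have f: "hd es \<in> Ed0" "e \<noteq> hd es" using m ne by (auto simp: mid_saw_hd_edge hd_in_set)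
  have sub: "set es \<subseteq> Ed0" using m(1) by (simp add: mid_saw_def)
  have IH: "mid_saw V1 E1 (dvs vs \<gamma>s) (des vs es \<gamma>s)" using 2 m by blast
  have bl: "mid_saw V1 E1 (map (Pair v) \<gamma>) (lift e # map (image (Pair v)) (path_edges \<gamma>) @ [lift (hd es)])"
    using m f by (intro block_mid_saw) auto
  obtain r where r: "des vs es \<gamma>s = lift (hd es) # r" using hd_des[OF ne, of vs \<gamma>s] by (cases "des vs es \<gamma>s") auto
  have g: "is_walk Hv EH \<gamma>" "\<gamma> \<noteq> []" using m(9) GP_ne by (auto simp: GP_def)
  have int: "x \<in> internal v" if "x \<in> set (map (image (Pair v)) (path_edges \<gamma>))" for x
    using path_edges_internal[OF g(1), of x v] that by (simp add: path_edges_map)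
  have "set (map (Pair v) \<gamma>) \<inter> set (dvs vs \<gamma>s) = {}" using dvs_fst[of _ vs \<gamma>s] m(7) by fastforce
  moreover have "set (lift e # map (image (Pair v)) (path_edges \<gamma>)) \<inter> set (des vs es \<gamma>s) = {}"
  proof (rule ccontr)
    assume "\<not> ?thesis"
    then obtain x where x: "x \<in> set (lift e # map (image (Pair v)) (path_edges \<gamma>))" "x \<in> set (des vs es \<gamma>s)" by blast
    have x2: "x \<in> lift ` set es \<or> (\<exists>u\<in>set vs. x \<in> internal u)" using des_edges[OF m(1,2) x(2)] .
    show False
    proof (cases "x = lift e")
      case True
      then show False using x2 m(3,8) sub lift_inj internal_not_lift by blast
    next
      case False
      then have xi: "x \<in> internal v" using x(1) int by auto
      then have "x \<notin> lift ` set es" using internal_not_lift sub by blast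
      then obtain u where u: "u \<in> set vs" "x \<in> internal u" using x2 by blast
      have "x \<noteq> {}" using xi by (auto simp: internal_def edges_def)
      then have "u = v" using u xi internal_fst by blast
      then show False using u m(7) by simp
    qed
  qed
  ultimately show ?case
    using bl IH g(2) mid_saw_append[of "lift e # map (image (Pair v)) (path_edges \<gamma>)" "map (Pair v) \<gamma>" V1 E1 "dvs vs \<gamma>s" "lift (hd es)" r]
    by (simp add: r length_path_edges Suc_leI)
qed auto

text \<open>Every edge that is not inherited lies inside one gadget, and consecutive edges share a
  vertex, so the gadget never changes.\<close>

lemma internal_walk:
  assumes "is_walk V1 E1 xs" "\<forall>e\<in>set (path_edges xs). e \<notin> lift ` Ed0"
  shows "\<exists>v\<in>V0. \<exists>\<gamma>. xs = map (Pair v) \<gamma> \<and> is_walk Hv EH \<gamma>"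
  using assms
proof (induction xs rule: path_edges.induct)
  case (1 x y zs)
  have w: "is_walk V1 E1 (y # zs)" "E1 x y" "x \<in> V1" using 1(2) by (auto simp: is_walk_simps)
  have "\<forall>e\<in>set (path_edges (y # zs)). e \<notin> lift ` Ed0" using 1(3) by simp
  from 1(1)[OF w(1) this] obtain v \<gamma> where v: "v \<in> V0" "y # zs = map (Pair v) \<gamma>" "is_walk Hv EH \<gamma>"
    by (elim bexE exE conjE) (rule that)
  have y: "y \<in> V1" using w(1) by (cases zs) (auto simp: is_walk_simps)
  have "{x, y} \<in> Ed1" using w y by (intro edgesI)
  moreover have "{x, y} \<notin> lift ` Ed0" using 1(3) by simp
  ultimately obtain u where u: "u \<in> V0" "{x, y} \<in> internal u" using Ed1_cases by blast
  then have fx: "fst x = u" "fst y = u" using internal_fst by auto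
  have "E1 x y" "x \<noteq> y" using w y simple1 by (auto simp: simple_on_def)
  then have eh: "EH (snd x) (snd y)" using fx E0_irrefl by (auto simp: lt_edges_def)
  obtain b \<gamma>' where g: "\<gamma> = b # \<gamma>'" "y = (v, b)" using v(2) by (cases \<gamma>) auto
  then have "x = (v, snd x)" using fx by (cases x) auto
  then have "x # y # zs = map (Pair v) (snd x # \<gamma>)" using v(2) by simp
  moreover have "is_walk Hv EH (snd x # \<gamma>)" using v(3) g eh EH_in by (auto simp: is_walk_simps)
  ultimately show ?case using v(1) by (intro bexI[of _ v] exI[of _ "snd x # \<gamma>"] conjI)
next
  case ("2_2" x)
  then show ?case by (cases x) (auto simp: is_walk_simps lt_vertices_def intro!: exI[of _ "[snd x]"])
qed (auto simp: is_walk_simps)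

text \<open>The walk is cut at its second inherited edge: the part in between stays in one gadget
  and is a path between two different ports, and the rest is covered by induction. What has to be
  proved is that this gadget is not crossed again; a later crossing would produce four edges at
  v.\<close>

lemma decompose_old:
  assumes "mid_saw V1 E1 vs es" "hd es = lift f" "f \<in> Ed0" "last es \<in> lift ` Ed0"
  shows "\<exists>vs0 es0 \<gamma>s. mid_saw V0 E0 vs0 es0 \<and> hd es0 = f \<and> valid vs0 es0 \<gamma>s \<and> vs = dvs vs0 \<gamma>s \<and> es = des vs0 es0 \<gamma>s"
  using assms
proof (induction "length vs" arbitrary: vs es f rule: less_induct)
  case less
  obtain es' where es: "es = lift f # es'" using less.prems by (cases es) (auto simp: mid_saw_def)
  show ?case
  proof (cases "vs = []")
    case True
    then have "es = [lift f]" using less.prems es by (auto simp: mid_saw_Nil)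
    then show ?thesis using True less.prems by (intro exI[of _ "[]"] exI[of _ "[f]"]) (auto simp: mid_saw_Nil)
  next
    case False
    have le: "length es = Suc (length vs)" using less.prems(1) by (rule mid_saw_length)
    have es'ne: "es' \<noteq> []" using le es False by auto
    have lo: "last es' \<in> lift ` Ed0" using less.prems(4) es es'ne by simp
    then obtain ie e' rest where sp: "es' = ie @ e' # rest" "e' \<in> lift ` Ed0" "\<forall>e\<in>set ie. e \<notin> lift ` Ed0"
    proof -
      have "\<exists>x\<in>set es'. x \<in> lift ` Ed0" using lo es'ne last_in_set by blast
      from split_list_first_prop[OF this] show ?thesis using that by blast
    qed
    obtain f' where f': "f' \<in> Ed0" "e' = lift f'" using sp by blast
    define A where "A = take (Suc (length ie)) vs"
    define Bv where "Bv = drop (Suc (length ie)) vs"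
    have vs: "vs = A @ Bv" by (simp add: A_def Bv_def)
    have lA: "length (lift f # ie) = length A" using le es sp by (simp add: A_def)
    have "mid_saw V1 E1 (A @ Bv) ((lift f # ie) @ e' # rest)" using less.prems(1) es sp vs by simp
    then have mm: "mid_saw V1 E1 A ((lift f # ie) @ [e'])" "mid_saw V1 E1 Bv (e' # rest)" "set A \<inter> set Bv = {}"
      "set (lift f # ie) \<inter> set (e' # rest) = {}"
      using mid_saw_append[OF lA] by blast+
    have Ane: "A \<noteq> []" using lA by auto
    note can = canonical1[OF mm(1) Ane]
    have ie: "ie = path_edges A" using can(2) by simp
    obtain v \<gamma> where v: "v \<in> V0" "A = map (Pair v) \<gamma>" "is_walk Hv EH \<gamma>" using internal_walk[OF can(1)] sp ie by auto
    have \<gamma>ne: "\<gamma> \<noteq> []" using Ane v by auto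
    have vf: "v \<in> f" "hd \<gamma> = port v f" "v \<in> f'" "last \<gamma> = port v f'"
      using can(4,5) v \<gamma>ne less.prems(3) f' by (auto simp: hd_map last_map mem_lift)
    have GPg: "\<gamma> \<in> GP (port v f) (port v f')" using v vf can(3) by (auto simp: GP_def distinct_map)
    have "length Bv < length vs" using vs Ane by simp
    moreover have "last (e' # rest) \<in> lift ` Ed0" using lo sp by simp
    ultimately obtain vs0 es0 \<gamma>s where IH: "mid_saw V0 E0 vs0 es0" "hd es0 = f'" "valid vs0 es0 \<gamma>s" "Bv = dvs vs0 \<gamma>s" "e' # rest = des vs0 es0 \<gamma>s"
      using less.hyps[of Bv "e' # rest" f'] mm(2) f' by auto
    have es0ne: "es0 \<noteq> []" using IH(1) by (auto simp: mid_saw_def)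
    have fn: "f \<notin> set es0" using lift_in_des[OF IH(1,3), of f] IH(5) mm(4) by auto
    have sub: "set es0 \<subseteq> Ed0" using IH(1) by (simp add: mid_saw_def)
    have "v \<notin> set vs0"
    proof
      assume "v \<in> set vs0"
      then obtain i where i: "i < length vs0" "vs0 ! i = v" by (auto simp: in_set_conv_nth)
      have mi: "v \<in> es0 ! i" "v \<in> es0 ! Suc i" "length es0 = Suc (length vs0)" "distinct es0"
        using IH(1) i by (auto simp: mid_saw_def)
      \<comment> \<open>With i = 0 the walk would turn back into the gadget it has just left through
        f', and would visit the port vertex (v, port v f') twice.\<close>
      have "i \<noteq> 0"
      proof
        assume "i = 0"
        then obtain vs0' e0 es0' g0 \<gamma>s' where c: "vs0 = v # vs0'" "es0 = e0 # es0'" "\<gamma>s = g0 # \<gamma>s'" "g0 \<in> GP (port v e0) (port v (hd es0'))"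
          using i IH(3) es0ne by (cases "(vs0, es0, \<gamma>s)" rule: valid.cases) auto
        have "g0 \<noteq> []" "hd g0 = port v e0" using c(4) GP_ne by (auto simp: GP_def)
        then have "(v, port v e0) \<in> set Bv" using c IH(4) by (cases g0) auto
        moreover have "e0 = f'" using IH(2) c by simp
        moreover have "(v, port v f') \<in> set A" using v(2) vf(4) \<gamma>ne last_in_set by fastforce
        ultimately show False using mm(3) by auto
      qed
      then have ds: "es0 ! 0 \<noteq> es0 ! i" "es0 ! 0 \<noteq> es0 ! Suc i" "es0 ! i \<noteq> es0 ! Suc i"
        using nth_eq_iff_index_eq[OF mi(4)] mi(3) i(1) by simp_all
      have in_es0: "es0 ! 0 \<in> set es0" "es0 ! i \<in> set es0" "es0 ! Suc i \<in> set es0" using mi(3) i(1) by simp_all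
      have "v \<in> es0 ! 0" using IH(2) es0ne vf(3) by (simp add: hd_conv_nth)
      then have S: "{f, es0 ! 0, es0 ! i, es0 ! Suc i} \<subseteq> star v"
        using in_es0 sub mi(1,2) vf(1) less.prems(3) unfolding star_def by blast
      have "f \<noteq> es0 ! 0" "f \<noteq> es0 ! i" "f \<noteq> es0 ! Suc i" using in_es0 fn by blast+
      then have D: "distinct [f, es0 ! 0, es0 ! i, es0 ! Suc i]" unfolding distinct.simps list.set using ds by blast
      show False by (rule no_four_edges[OF v(1) S D])
    qed
    then have "mid_saw V0 E0 (v # vs0) (f # es0)" using IH fn vf v less.prems(3) by (simp add: mid_saw_Cons)
    moreover have "valid (v # vs0) (f # es0) (\<gamma> # \<gamma>s)" using IH GPg by simp
    moreover have "vs = dvs (v # vs0) (\<gamma> # \<gamma>s)" using vs v IH by simp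
    moreover have "es = des (v # vs0) (f # es0) (\<gamma> # \<gamma>s)" using es sp ie v IH(5) by (simp add: path_edges_map)
    ultimately show ?thesis by (metis list.sel(1))
  qed
qed

end

section \<open>Walks, paths and graph distance\<close>

lemma is_walk_append:
  "xs \<noteq> [] \<Longrightarrow> ys \<noteq> [] \<Longrightarrow> is_walk V E (xs @ ys) \<longleftrightarrow> is_walk V E xs \<and> is_walk V E ys \<and> E (last xs) (hd ys)"
proof (induction xs rule: path_edges.induct)
  case ("2_2" x)
  then show ?case by (cases ys) (auto simp: is_walk_simps)
qed (auto simp: is_walk_simps)

lemma is_walk_rev:
  assumes "\<And>a b. E a b \<Longrightarrow> E b a"
  shows "is_walk V E xs \<Longrightarrow> is_walk V E (rev xs)"
proof (induction xs rule: path_edges.induct)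
  case (1 x y zs)
  then have "is_walk V E (rev (y # zs))" "E y x" "x \<in> V" using assms by (auto simp: is_walk_simps)
  moreover have "last (rev (y # zs)) = y" by simp
  ultimately have "is_walk V E (rev (y # zs) @ [x])" by (subst is_walk_append) (auto simp: is_walk_simps)
  then show ?case by simp
qed (auto simp: is_walk_simps)

lemma is_walk_ne: "is_walk V E p \<Longrightarrow> p \<noteq> []" by (simp add: is_walk_def)

lemma walk_to_path:
  "is_walk V E p \<Longrightarrow> \<exists>q. is_walk V E q \<and> distinct q \<and> hd q = hd p \<and> last q = last p"
proof (induction p rule: path_edges.induct)
  case (1 x y zs)
  then obtain q where q: "is_walk V E q" "distinct q" "hd q = y" "last q = last (y # zs)" "E x y" "x \<in> V"
    by (auto simp: is_walk_simps)
  have ne: "q \<noteq> []" using q is_walk_ne by blast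
  show ?case
  proof (cases "x \<in> set q")
    case True
    then obtain u v where uv: "q = u @ x # v" by (auto dest: split_list)
    have "is_walk V E (x # v)" using q(1) uv is_walk_append[of u "x # v" V E] by (cases "u = []") auto
    then show ?thesis using q uv by (intro exI[of _ "x # v"]) auto
  next
    case False
    obtain y' q' where "q = y' # q'" using ne by (cases q) auto
    then show ?thesis using q False by (intro exI[of _ "x # q"]) (auto simp: is_walk_simps)
  qed
next
  case ("2_2" x)
  then show ?case by (intro exI[of _ "[x]"]) auto
qed (auto simp: is_walk_simps)

lemma gdist_le: "is_walk V E p \<Longrightarrow> hd p = a \<Longrightarrow> last p = b \<Longrightarrow> gdist V E a b \<le> length p - 1"
  unfolding gdist_def by (rule Least_le) (auto intro!: exI[of _ p] simp: is_walk_def)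

lemma gdist_walk:
  assumes "connected_graph V E" "a \<in> V" "b \<in> V"
  obtains p where "is_walk V E p" "length p = Suc (gdist V E a b)" "hd p = a" "last p = b"
proof -
  obtain p where p: "is_walk V E p" "hd p = a" "last p = b" using assms by (auto simp: connected_graph_def)
  have "\<exists>p. is_walk V E p \<and> length p = Suc (gdist V E a b) \<and> hd p = a \<and> last p = b"
    unfolding gdist_def by (rule LeastI[of _ "length p - 1"]) (use p in \<open>auto intro!: exI[of _ p] simp: is_walk_def\<close>)
  then show ?thesis using that by blast
qed

lemma gdist_triangle:
  assumes "connected_graph V E" "a \<in> V" "b \<in> V" "c \<in> V"
  shows "gdist V E a c \<le> gdist V E a b + gdist V E b c"
proof -
  obtain p where p: "is_walk V E p" "length p = Suc (gdist V E a b)" "hd p = a" "last p = b" using gdist_walk[OF assms(1-3)] by blast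
  obtain q where q: "is_walk V E q" "length q = Suc (gdist V E b c)" "hd q = b" "last q = c" using gdist_walk[OF assms(1,3,4)] by blast
  show ?thesis
  proof (cases "tl q = []")
    case True
    then have "q = [b]" using q by (cases q) auto
    then have "c = b" using q by simp
    then show ?thesis by simp
  next
    case False
    then obtain y zs where qq: "q = b # y # zs" using q by (cases q; cases "tl q") auto
    have ne: "p \<noteq> []" using p is_walk_ne by blast
    have "is_walk V E (p @ y # zs)" using p q ne by (subst is_walk_append) (auto simp: qq is_walk_simps)
    then have "gdist V E a c \<le> length (p @ y # zs) - 1" by (rule gdist_le) (use p q ne qq in auto)
    then show ?thesis using p q ne qq by simp
  qed
qed

lemma gdist_self: "a \<in> V \<Longrightarrow> gdist V E a a = 0"
  using gdist_le[of V E "[a]" a a] by (simp add: is_walk_simps)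

lemma gdist_edge: "a \<in> V \<Longrightarrow> b \<in> V \<Longrightarrow> E a b \<Longrightarrow> gdist V E a b \<le> 1"
  using gdist_le[of V E "[a, b]" a b] by (simp add: is_walk_simps)

lemma is_walk_automorphism: "automorphism V E f \<Longrightarrow> is_walk V E p \<Longrightarrow> is_walk V E (map f p)"
  by (auto simp: is_walk_def automorphism_def bij_betw_def subset_iff)

context local_transformation
begin

definition hh :: nat where "hh = card Hv"

lemma hh_pos: "hh \<ge> 1"
  using gadget_facts(1,4) by (auto simp: hh_def Suc_le_eq card_gt_0_iff)

lemma distinct_length: "distinct \<gamma> \<Longrightarrow> set \<gamma> \<subseteq> Hv \<Longrightarrow> length \<gamma> \<le> hh"
  using gadget_facts(1) by (metis card_mono distinct_card hh_def)

lemma GP_length: "\<gamma> \<in> GP a b \<Longrightarrow> length \<gamma> \<in> {1..hh}"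
  using GP_ne[of \<gamma> a b] GP_set[of \<gamma> a b] distinct_length[of \<gamma>] by (auto simp: GP_def Suc_le_eq)

lemma GP_nonempty: "a \<in> Hv \<Longrightarrow> b \<in> Hv \<Longrightarrow> \<exists>\<gamma>. \<gamma> \<in> GP a b"
proof -
  assume "a \<in> Hv" "b \<in> Hv"
  then obtain p where p: "is_walk Hv EH p" "hd p = a" "last p = b" using gadget_facts(3) unfolding connected_graph_def by blast
  then show ?thesis using walk_to_path[OF p(1)] unfolding GP_def by blast
qed

lemma GP_rev: "\<gamma> \<in> GP a b \<Longrightarrow> rev \<gamma> \<in> GP b a"
proof -
  assume "\<gamma> \<in> GP a b"
  then have g: "is_walk Hv EH \<gamma>" "distinct \<gamma>" "hd \<gamma> = a" "last \<gamma> = b" by (auto simp: GP_def)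
  have "is_walk Hv EH (rev \<gamma>)" by (rule is_walk_rev[OF EH_sym g(1)])
  then show ?thesis using g by (simp add: GP_def hd_rev last_rev)
qed

lemma GP_automorphism: "automorphism Hv EH f \<Longrightarrow> \<gamma> \<in> GP a b \<Longrightarrow> map f \<gamma> \<in> GP (f a) (f b)"
proof -
  assume f: "automorphism Hv EH f" and g: "\<gamma> \<in> GP a b"
  have "inj_on f (set \<gamma>)" using f GP_set[OF g] by (auto simp: automorphism_def bij_betw_def intro: inj_on_subset)
  then show ?thesis using is_walk_automorphism[OF f, of \<gamma>] g GP_ne[OF g] by (auto simp: GP_def distinct_map hd_map last_map)
qed

text \<open>Transitivity on three ports prescribes the image of c only. The other two ports may come
  out in either order; where this matters, the paths between them are reversed.\<close>

lemma port_automorphism: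
  assumes "{a, b, c} = Ports" "{a', b', c'} = Ports"
  shows "\<exists>f. automorphism Hv EH f \<and> f c = c' \<and> (f a = a' \<and> f b = b' \<or> f a = b' \<and> f b = a')"
proof -
  obtain S where S: "\<forall>f\<in>S. automorphism Hv EH f" "\<forall>f\<in>S. f ` Ports = Ports" "\<forall>a\<in>Ports. \<forall>b\<in>Ports. \<exists>f\<in>S. f a = b"
    using gadget unfolding gadget_def by (elim conjE exE) (rule that, assumption+)
  have "c \<in> Ports" "c' \<in> Ports" using assms by auto
  then obtain f where f: "f \<in> S" "f c = c'" using S(3) by blast
  have aut: "automorphism Hv EH f" using S f by blast
  have inj: "inj_on f Hv" using aut by (simp add: automorphism_def bij_betw_def)
  have card3: "card Ports = 3" using gadget_facts by simp
  have d: "a \<noteq> c" "b \<noteq> c" "a \<noteq> b" "a' \<noteq> c'" "b' \<noteq> c'" "a' \<noteq> b'"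
    using card3 unfolding assms(1)[symmetric] apply (auto simp: card_insert_if split: if_splits)[3]
    using card3 unfolding assms(2)[symmetric] by (auto simp: card_insert_if split: if_splits)
  have H: "a \<in> Hv" "b \<in> Hv" "c \<in> Hv" using assms(1) gadget_facts(4) by blast+
  have im: "f ` {a, b, c} = {a', b', c'}" unfolding assms using S(2) f(1) by blast
  have fa: "f a \<in> {a', b', c'}" "f b \<in> {a', b', c'}" unfolding im[symmetric] by blast+
  have "f a \<noteq> c'" "f b \<noteq> c'" "f a \<noteq> f b"
    unfolding f(2)[symmetric] using inj_on_eq_iff[OF inj] d H by simp_all
  then have "f a = a' \<and> f b = b' \<or> f a = b' \<and> f b = a'" using fa by (elim insertE emptyE) simp_all
  then show ?thesis using aut f(2) by (intro exI[of _ f]) simp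
qed

definition GPn :: "'g \<Rightarrow> 'g \<Rightarrow> nat \<Rightarrow> 'g list set" where "GPn a b k = {\<gamma> \<in> GP a b. length \<gamma> = k}"

definition g :: "nat \<Rightarrow> real" where "g k = real (card (GPn w1 w2 k))"

lemma finite_GP: "finite (GP a b)"
proof (rule finite_subset)
  show "GP a b \<subseteq> {xs. set xs \<subseteq> Hv \<and> length xs \<le> hh}" using GP_set GP_length by fastforce
  show "finite {xs. set xs \<subseteq> Hv \<and> length xs \<le> hh}" by (rule finite_lists_length_le) (rule gadget_facts)
qed

lemma finite_GPn: "finite (GPn a b k)" using finite_GP by (simp add: GPn_def)

text \<open>The automorphism may exchange the two ends of the path; reversal then restores the
  direction. By symmetry of the statement the counts agree for all pairs of different ports.\<close>

lemma card_GPn_le: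
  assumes "{a, b, c} = Ports" "{a', b', c'} = Ports"
  shows "card (GPn a b k) \<le> card (GPn a' b' k)"
proof -
  obtain f where f: "automorphism Hv EH f" "f a = a' \<and> f b = b' \<or> f a = b' \<and> f b = a'"
    using port_automorphism[OF assms] by blast
  have inj: "inj_on (map f) (GPn a b k)"
  proof (rule inj_onI)
    fix x y assume xy: "x \<in> GPn a b k" "y \<in> GPn a b k" "map f x = map f y"
    have "inj_on f Hv" using f(1) by (simp add: automorphism_def bij_betw_def)
    then have "inj_on f (set x \<union> set y)" using xy GP_set by (auto simp: GPn_def intro!: inj_on_subset[of f Hv])
    then show "x = y" using xy(3) map_inj_on by blast
  qed
  show ?thesis
  proof (cases "f a = a' \<and> f b = b'")
    case True
    then have "map f ` GPn a b k \<subseteq> GPn a' b' k" using GP_automorphism[OF f(1)] by (auto simp: GPn_def)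
    then show ?thesis using inj finite_GPn by (meson card_inj_on_le)
  next
    case False
    then have "f a = b'" "f b = a'" using f(2) by auto
    then have "(rev \<circ> map f) ` GPn a b k \<subseteq> GPn a' b' k" using GP_automorphism[OF f(1)] GP_rev by (fastforce simp: GPn_def)
    moreover have "inj_on (rev \<circ> map f) (GPn a b k)" using inj by (intro comp_inj_on) auto
    ultimately show ?thesis using finite_GPn by (meson card_inj_on_le)
  qed
qed

lemma ports_third:
  assumes "a \<in> Ports" "b \<in> Ports" "a \<noteq> b"
  obtains c where "{a, b, c} = Ports" "c \<noteq> a" "c \<noteq> b"
proof -
  have "card (Ports - {a, b}) = 1" using assms gadget_facts(5-7) by (subst card_Diff_subset) auto
  then obtain c where c: "Ports - {a, b} = {c}" by (auto simp: card_1_singleton_iff)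
  have "Ports = {a, b} \<union> (Ports - {a, b})" using assms by blast
  then have "{a, b, c} = Ports" unfolding c by auto
  moreover have "c \<noteq> a" "c \<noteq> b" using c by blast+
  ultimately show ?thesis by (rule that)
qed

lemma card_GPn: "a \<in> Ports \<Longrightarrow> b \<in> Ports \<Longrightarrow> a \<noteq> b \<Longrightarrow> real (card (GPn a b k)) = g k"
proof -
  assume a: "a \<in> Ports" "b \<in> Ports" "a \<noteq> b"
  obtain c where c: "{a, b, c} = Ports" using a by (rule ports_third)
  show ?thesis unfolding g_def using card_GPn_le[OF c, of w1 w2 w3 k] card_GPn_le[of w1 w2 w3 a b c k] c by simp
qed

lemma g_nonneg: "g k \<ge> 0" by (simp add: g_def)

lemma g_exists: "\<exists>k\<in>{1..hh}. g k > 0"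
proof -
  obtain \<gamma> where \<gamma>: "\<gamma> \<in> GP w1 w2" using GP_nonempty gadget_facts(4) by blast
  then have "\<gamma> \<in> GPn w1 w2 (length \<gamma>)" by (simp add: GPn_def)
  then have "g (length \<gamma>) > 0" unfolding g_def using finite_GPn by (auto simp: card_gt_0_iff)
  then show ?thesis using GP_length[OF \<gamma>] by blast
qed

definition DS :: "'v list \<Rightarrow> 'v set list \<Rightarrow> nat \<Rightarrow> 'g list list set" where
  "DS vs es k = {\<gamma>s. valid vs es \<gamma>s \<and> sum_list (map length \<gamma>s) = k}"

text \<open>Consecutive mid-edges differ, so every visited gadget is crossed between two different
  ports, and the number of crossings of a given length is \<open>g\<close> whichever ports these
  are. Independent choices convolve.\<close>

lemma card_DS:
  "mid_saw V0 E0 vs es \<Longrightarrow> finite (DS vs es k) \<and> real (card (DS vs es k)) = cpow hh g (length vs) k"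
proof (induction vs arbitrary: es k)
  case Nil
  have "DS [] es k = (if k = 0 then {[]} else {})" by (auto simp: DS_def)
  then show ?case by simp
next
  case (Cons v vs)
  obtain e es' where es: "es = e # es'" "e \<in> Ed0" "v \<in> V0" "v \<in> e" "v \<in> hd es'" "e \<notin> set es'" "mid_saw V0 E0 vs es'"
    using Cons.prems by (auto simp: mid_saw_Cons)
  have ne: "es' \<noteq> []" using es(7) by (auto simp: mid_saw_def)
  have f: "hd es' \<in> Ed0" "hd es' \<noteq> e" using es mid_saw_hd_edge hd_in_set[OF ne] by auto
  let ?a = "port v e" and ?b = "port v (hd es')"
  have ab: "?a \<in> Ports" "?b \<in> Ports" "?a \<noteq> ?b" using es f port_in port_ne by auto
  define T where "T = (SIGMA a:{a\<in>{1..hh}. a \<le> k}. GPn ?a ?b a \<times> DS vs es' (k - a))"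
  have eq: "DS (v # vs) es k = (\<lambda>(a, \<gamma>, \<gamma>s). \<gamma> # \<gamma>s) ` T"
  proof (intro set_eqI iffI)
    fix x assume "x \<in> DS (v # vs) es k"
    then obtain \<gamma> \<gamma>s where x: "x = \<gamma> # \<gamma>s" "\<gamma> \<in> GP ?a ?b" "valid vs es' \<gamma>s" "length \<gamma> + sum_list (map length \<gamma>s) = k"
      unfolding DS_def es(1) by (cases x) auto
    then have "(length \<gamma>, \<gamma>, \<gamma>s) \<in> T" using GP_length[OF x(2)] by (auto simp: T_def GPn_def DS_def)
    then show "x \<in> (\<lambda>(a, \<gamma>, \<gamma>s). \<gamma> # \<gamma>s) ` T" using x by force
  next
    fix x assume "x \<in> (\<lambda>(a, \<gamma>, \<gamma>s). \<gamma> # \<gamma>s) ` T"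
    then show "x \<in> DS (v # vs) es k" by (auto simp: T_def GPn_def DS_def es(1))
  qed
  have inj: "inj_on (\<lambda>(a, \<gamma>, \<gamma>s). \<gamma> # \<gamma>s) T" by (auto simp: inj_on_def T_def GPn_def)
  have finT: "finite T" unfolding T_def using Cons.IH[OF es(7)] finite_GPn by (intro finite_SigmaI) auto
  have "real (card T) = (\<Sum>a\<in>{a\<in>{1..hh}. a \<le> k}. g a * cpow hh g (length vs) (k - a))"
    unfolding T_def using Cons.IH[OF es(7)] finite_GPn card_GPn[OF ab]
    by (subst card_SigmaI) (auto simp: card_cartesian_product)
  also have "\<dots> = (\<Sum>a\<in>{1..hh}. if a \<le> k then g a * cpow hh g (length vs) (k - a) else 0)"
    by (subst sum.inter_filter) auto
  finally have "real (card T) = cpow hh g (Suc (length vs)) k" by simp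
  then show ?case unfolding eq using finT inj by (simp add: card_image)
qed

subsection \<open>Distances\<close>

lemma project_walk:
  "is_walk V1 E1 p \<Longrightarrow> \<exists>q. is_walk V0 E0 q \<and> hd q = fst (hd p) \<and> last q = fst (last p) \<and> length q \<le> length p"
proof (induction p rule: path_edges.induct)
  case (1 x y zs)
  then obtain q where q: "is_walk V0 E0 q" "hd q = fst y" "last q = fst (last (y # zs))" "length q \<le> length (y # zs)"
    by (auto simp: is_walk_simps)
  have e: "E1 x y" "x \<in> V1" using 1(2) by (auto simp: is_walk_simps)
  obtain y' q' where qq: "q = y' # q'" using q is_walk_ne by (cases q) auto
  show ?case
  proof (cases "fst x = fst y")
    case True
    then show ?thesis using q by (intro exI[of _ q]) auto
  next
    case False
    then have "E0 (fst x) (fst y)" using e by (auto simp: lt_edges_def)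
    then show ?thesis using q qq e by (intro exI[of _ "fst x # q"]) (auto simp: is_walk_simps lt_vertices_def)
  qed
next
  case ("2_2" x)
  then show ?case by (intro exI[of _ "[fst x]"]) (auto simp: is_walk_simps lt_vertices_def)
qed (auto simp: is_walk_simps)

lemma gadget_walk: "u \<in> V0 \<Longrightarrow> x \<in> Hv \<Longrightarrow> y \<in> Hv \<Longrightarrow>
  \<exists>p. is_walk V1 E1 p \<and> hd p = (u, x) \<and> last p = (u, y) \<and> length p \<le> hh"
proof -
  assume a: "u \<in> V0" "x \<in> Hv" "y \<in> Hv"
  obtain \<gamma> where \<gamma>: "\<gamma> \<in> GP x y" using GP_nonempty a by blast
  then show ?thesis using is_walk_map_Pair[OF a(1), of \<gamma>] GP_length[OF \<gamma>] GP_ne[OF \<gamma>]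
    by (intro exI[of _ "map (Pair u) \<gamma>"]) (auto simp: GP_def hd_map last_map)
qed

lemma lift_walk:
  "is_walk V0 E0 q \<Longrightarrow> x \<in> Hv \<Longrightarrow> y \<in> Hv \<Longrightarrow>
    \<exists>p. is_walk V1 E1 p \<and> hd p = (hd q, x) \<and> last p = (last q, y) \<and> length p \<le> hh * length q"
proof (induction q arbitrary: x rule: path_edges.induct)
  case (1 v w zs)
  have e: "v \<in> V0" "E0 v w" "is_walk V0 E0 (w # zs)" using 1(2) by (auto simp: is_walk_simps)
  have pw: "P v w \<in> Hv" "P w v \<in> Hv" using P_in e(2) E0_sym gadget_facts(4) by blast+
  obtain p1 where p1: "is_walk V1 E1 p1" "hd p1 = (v, x)" "last p1 = (v, P v w)" "length p1 \<le> hh"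
    using gadget_walk[OF e(1) 1(3) pw(1)] by blast
  obtain p2 where p2: "is_walk V1 E1 p2" "hd p2 = (w, P w v)" "last p2 = (last (w # zs), y)" "length p2 \<le> hh * length (w # zs)"
    using 1(1)[OF e(3) pw(2) 1(4)] by auto
  have ne: "p1 \<noteq> []" "p2 \<noteq> []" using p1 p2 is_walk_ne by blast+
  have "is_walk V1 E1 (p1 @ p2)" using p1 p2 ne e by (subst is_walk_append) (auto simp: lt_edges_def)
  then show ?case using p1 p2 ne by (intro exI[of _ "p1 @ p2"]) auto
next
  case ("2_2" v)
  then show ?case using gadget_walk[of v x y] by (auto simp: is_walk_simps)
qed (auto simp: is_walk_simps)

end

lemma mid_dist_le:
  assumes "finite e" "finite f" "a \<in> e" "b \<in> f"
  shows "mid_dist V E e f \<le> 1 + real (gdist V E a b)"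
proof -
  have "{gdist V E a b | a b. a \<in> e \<and> b \<in> f} = (\<lambda>(a, b). gdist V E a b) ` (e \<times> f)" by auto
  then have "finite {gdist V E a b | a b. a \<in> e \<and> b \<in> f}" using assms by simp
  then have "Min {gdist V E a b | a b. a \<in> e \<and> b \<in> f} \<le> gdist V E a b" using assms by (intro Min_le) auto
  then show ?thesis by (simp add: mid_dist_def)
qed

lemma mid_dist_attained:
  assumes "finite e" "finite f" "e \<noteq> {}" "f \<noteq> {}" "e \<noteq> f"
  shows "\<exists>a\<in>e. \<exists>b\<in>f. mid_dist V E e f = 1 + real (gdist V E a b)"
proof -
  have eq: "{gdist V E a b | a b. a \<in> e \<and> b \<in> f} = (\<lambda>(a, b). gdist V E a b) ` (e \<times> f)" by auto
  then have "Min {gdist V E a b | a b. a \<in> e \<and> b \<in> f} \<in> {gdist V E a b | a b. a \<in> e \<and> b \<in> f}"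
    using assms by (intro Min_in) auto
  then obtain a b where "a \<in> e" "b \<in> f" "Min {gdist V E a b | a b. a \<in> e \<and> b \<in> f} = gdist V E a b" by auto
  then show ?thesis using assms(5) by (auto simp: mid_dist_def)
qed

lemma mid_dist_nonneg: "mid_dist V E e f \<ge> 0" by (simp add: mid_dist_def)

lemma mid_dist_ge_1: "e \<noteq> f \<Longrightarrow> mid_dist V E e f \<ge> 1" by (simp add: mid_dist_def)

lemma mid_saw_vs_unique:
  assumes "simple_on V E" "mid_saw V E vs es" "mid_saw V E vs' es"
  shows "vs = vs'"
proof (rule nth_equalityI)
  show l: "length vs = length vs'" using mid_saw_length[OF assms(2)] mid_saw_length[OF assms(3)] by simp
  fix i assume i: "i < length vs"
  have m: "vs ! i \<in> es ! i" "vs ! i \<in> es ! Suc i" "vs' ! i \<in> es ! i" "vs' ! i \<in> es ! Suc i"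
    using assms(2,3) i l by (auto simp: mid_saw_def)
  have e: "es ! i \<in> edges V E" "es ! Suc i \<in> edges V E" "es ! i \<noteq> es ! Suc i"
    using assms(2) i by (auto simp: mid_saw_def nth_eq_iff_index_eq subset_iff)
  show "vs ! i = vs' ! i"
  proof (rule ccontr)
    assume "vs ! i \<noteq> vs' ! i"
    then show False using edge_eqI(1)[OF assms(1) e(1) m(1,3)] edge_eqI(1)[OF assms(1) e(2) m(2,4)] e(3) by simp
  qed
qed

text \<open>Stands in for a map from S to R with fibres of size at most N: it suffices that each x
  lies in some \<open>C r\<close>, and no choice of r has to be made.\<close>

lemma sum_cover_le:
  fixes F :: "'a \<Rightarrow> real" and G :: "'b \<Rightarrow> real"
  assumes fin: "finite S" "finite R" and cov: "S \<subseteq> (\<Union>r\<in>R. C r)"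
    and C: "\<And>r. r \<in> R \<Longrightarrow> finite (C r) \<and> card (C r) \<le> N"
    and F: "\<And>x. x \<in> S \<Longrightarrow> F x \<ge> 0" "\<And>x r. r \<in> R \<Longrightarrow> x \<in> S \<Longrightarrow> x \<in> C r \<Longrightarrow> F x \<le> G r"
    and G: "\<And>r. r \<in> R \<Longrightarrow> G r \<ge> 0"
  shows "sum F S \<le> real N * sum G R"
proof -
  have "sum F S \<le> (\<Sum>x\<in>S. \<Sum>r\<in>R. if x \<in> C r then F x else 0)"
  proof (rule sum_mono)
    fix x assume x: "x \<in> S"
    then obtain r where r: "r \<in> R" "x \<in> C r" using cov by blast
    have "(if x \<in> C r then F x else 0) \<le> (\<Sum>r\<in>R. if x \<in> C r then F x else 0)"
      by (rule member_le_sum) (use r fin F(1)[OF x] in auto)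
    then show "F x \<le> (\<Sum>r\<in>R. if x \<in> C r then F x else 0)" using r by simp
  qed
  also have "\<dots> = (\<Sum>r\<in>R. \<Sum>x\<in>S. if x \<in> C r then F x else 0)" by (rule sum.swap)
  also have "\<dots> \<le> (\<Sum>r\<in>R. real N * G r)"
  proof (rule sum_mono)
    fix r assume r: "r \<in> R"
    have "(\<Sum>x\<in>S. if x \<in> C r then F x else 0) = (\<Sum>x\<in>S \<inter> C r. F x)"
      using fin by (simp add: sum.inter_restrict)
    also have "\<dots> \<le> (\<Sum>x\<in>S \<inter> C r. G r)" using F(2)[OF r] by (intro sum_mono) auto
    also have "\<dots> = real (card (S \<inter> C r)) * G r" by simp
    also have "\<dots> \<le> real N * G r"
    proof (intro mult_right_mono G[OF r])
      have "card (S \<inter> C r) \<le> card (C r)" using C[OF r] by (intro card_mono) auto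
      then show "real (card (S \<inter> C r)) \<le> real N" using C[OF r] by simp
    qed
    finally show "(\<Sum>x\<in>S. if x \<in> C r then F x else 0) \<le> real N * G r" .
  qed
  finally show ?thesis by (simp add: sum_distrib_left)
qed

locale lt_domain = local_transformation V0 E0 Hv EH w1 w2 w3 P
  for V0 :: "'v set" and E0 :: "'v \<Rightarrow> 'v \<Rightarrow> bool" and Hv :: "'g set" and EH :: "'g \<Rightarrow> 'g \<Rightarrow> bool"
    and w1 w2 w3 :: 'g and P :: "'v \<Rightarrow> 'v \<Rightarrow> 'g" +
  fixes W0 :: "'v set"
  assumes conn0: "connected_graph V0 E0" and fund: "fundamental_domain V0 E0 W0" and V0_ne: "V0 \<noteq> {}"
begin

abbreviation "X0 \<equiv> incident_edges V0 E0 W0"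
abbreviation "X1 \<equiv> incident_edges V1 E1 (W0 \<times> Hv)"
abbreviation "S0 \<equiv> Sigma_n V0 E0 X0"
abbreviation "S1 \<equiv> Sigma_n V1 E1 X1"

lemma W0_facts: "finite W0" "W0 \<subseteq> V0" "W0 \<noteq> {}"
  using fund V0_ne by (auto simp: fundamental_domain_def)

lemma gdist_lift:
  assumes "x \<in> V1" "y \<in> V1"
  shows "gdist V1 E1 x y \<le> hh * (gdist V0 E0 (fst x) (fst y) + 1)"
proof -
  have xy: "fst x \<in> V0" "fst y \<in> V0" "snd x \<in> Hv" "snd y \<in> Hv" using assms by (auto simp: lt_vertices_def)
  obtain q where q: "is_walk V0 E0 q" "length q = Suc (gdist V0 E0 (fst x) (fst y))" "hd q = fst x" "last q = fst y"
    using gdist_walk[OF conn0 xy(1,2)] by blast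
  obtain p where p: "is_walk V1 E1 p" "hd p = (hd q, snd x)" "last p = (last q, snd y)" "length p \<le> hh * length q"
    using lift_walk[OF q(1) xy(3,4)] by blast
  have "gdist V1 E1 x y \<le> length p - 1" by (rule gdist_le[OF p(1)]) (use p q in auto)
  then show ?thesis using p(4) q(2) by simp
qed

lemma connected1: "connected_graph V1 E1"
  unfolding connected_graph_def
proof (intro ballI)
  fix x y assume xy: "x \<in> V1" "y \<in> V1"
  then have xy': "fst x \<in> V0" "fst y \<in> V0" "snd x \<in> Hv" "snd y \<in> Hv" by (auto simp: lt_vertices_def)
  obtain q where q: "is_walk V0 E0 q" "hd q = fst x" "last q = fst y"
    using gdist_walk[OF conn0 xy'(1,2)] by blast
  show "\<exists>p. is_walk V1 E1 p \<and> hd p = x \<and> last p = y" using lift_walk[OF q(1) xy'(3,4)] q by auto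
qed

lemma gdist_project:
  assumes "x \<in> V1" "y \<in> V1"
  shows "gdist V0 E0 (fst x) (fst y) \<le> gdist V1 E1 x y"
proof -
  obtain p where p: "is_walk V1 E1 p" "length p = Suc (gdist V1 E1 x y)" "hd p = x" "last p = y"
    using gdist_walk[OF connected1 assms] by blast
  obtain q where q: "is_walk V0 E0 q" "hd q = fst x" "last q = fst y" "length q \<le> length p" using project_walk[OF p(1)] p by auto
  have "gdist V0 E0 (fst x) (fst y) \<le> length q - 1" by (rule gdist_le[OF q(1-3)])
  then show ?thesis using q p by simp
qed

lemma Ed0_finite: "e \<in> Ed0 \<Longrightarrow> finite e \<and> e \<noteq> {} \<and> card e = 2" by (auto elim!: Ed0E)

lemma Ed1_finite: "e \<in> Ed1 \<Longrightarrow> finite e \<and> e \<noteq> {}" by (auto elim!: edgesE[OF simple1])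

lemma mid_dist_lift_ge:
  assumes "e \<in> Ed0" "f \<in> Ed0"
  shows "mid_dist V0 E0 e f \<le> mid_dist V1 E1 (lift e) (lift f)"
proof (cases "e = f")
  case False
  have l: "lift e \<in> Ed1" "lift f \<in> Ed1" "lift e \<noteq> lift f" using assms False Ed1_cases lift_inj by auto
  then obtain x y where xy: "x \<in> lift e" "y \<in> lift f" "mid_dist V1 E1 (lift e) (lift f) = 1 + real (gdist V1 E1 x y)"
    using mid_dist_attained[of "lift e" "lift f" V1 E1] Ed1_finite by blast
  have V: "x \<in> V1" "y \<in> V1" using xy l edges_subset by blast+
  have "fst x \<in> e" "fst y \<in> f" using xy fst_lift[OF assms(1)] fst_lift[OF assms(2)] by auto
  then have "mid_dist V0 E0 e f \<le> 1 + real (gdist V0 E0 (fst x) (fst y))" using assms Ed0_finite by (intro mid_dist_le) auto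
  then show ?thesis using gdist_project[OF V] xy(3) by simp
qed (simp add: mid_dist_def)

text \<open>Moving from x and y to the nearest ends of f and f' costs at most 1 each on the old
  graph, and one old step costs at most hh new ones. As f and f' differ, the old distance is at
  least 1 and absorbs all additive terms; this gives the factor 4.\<close>

lemma mid_dist_upper:
  assumes "e \<in> Ed1" "e' \<in> Ed1" "f \<in> Ed0" "f' \<in> Ed0" "f \<noteq> f'"
    and "x \<in> e" "fst x \<in> f" "y \<in> e'" "fst y \<in> f'"
  shows "mid_dist V1 E1 e e' \<le> 4 * real hh * mid_dist V0 E0 f f'"
proof -
  have V: "x \<in> V1" "y \<in> V1" using assms edges_subset by blast+
  obtain a b where ab: "a \<in> f" "b \<in> f'" "mid_dist V0 E0 f f' = 1 + real (gdist V0 E0 a b)"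
    using mid_dist_attained[of f f' V0 E0] Ed0_finite assms(3-5) by blast
  have near: "gdist V0 E0 u v \<le> 1" if "k \<in> Ed0" "u \<in> k" "v \<in> k" for k u v
    using that gdist_self[of u V0 E0] gdist_edge[of u V0 v E0] by (cases "u = v") (auto elim!: Ed0E)
  have in0: "fst x \<in> V0" "fst y \<in> V0" "a \<in> V0" "b \<in> V0" using V ab assms edges_subset by (auto simp: lt_vertices_def)
  have "gdist V0 E0 (fst x) (fst y) \<le> gdist V0 E0 (fst x) a + (gdist V0 E0 a b + gdist V0 E0 b (fst y))"
    using gdist_triangle[OF conn0 in0(1,3,2)] gdist_triangle[OF conn0 in0(3,4,2)] by linarith
  also have "\<dots> \<le> gdist V0 E0 a b + 2" using near[OF assms(3) assms(7) ab(1)] near[OF assms(4) ab(2) assms(9)] by linarith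
  finally have d: "gdist V0 E0 (fst x) (fst y) \<le> gdist V0 E0 a b + 2" .
  have "mid_dist V1 E1 e e' \<le> 1 + real (gdist V1 E1 x y)" using assms Ed1_finite by (intro mid_dist_le) auto
  also have "\<dots> \<le> 1 + real (hh * (gdist V0 E0 a b + 2 + 1))"
  proof -
    have "gdist V1 E1 x y \<le> hh * (gdist V0 E0 (fst x) (fst y) + 1)" by (rule gdist_lift[OF V])
    also have "\<dots> \<le> hh * (gdist V0 E0 a b + 2 + 1)" using d by (intro mult_le_mono2) simp
    finally show ?thesis by (simp only: add_left_mono of_nat_le_iff)
  qed
  also have "\<dots> = 1 + real hh * real (gdist V0 E0 a b) + 3 * real hh" by (simp add: algebra_simps)
  also have "\<dots> \<le> 4 * real hh * (1 + real (gdist V0 E0 a b))"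
  proof -
    have "real hh * real (gdist V0 E0 a b) \<ge> 0" "real hh \<ge> 1" using hh_pos by simp_all
    moreover have "4 * real hh * (1 + real (gdist V0 E0 a b)) = 4 * real hh + 4 * (real hh * real (gdist V0 E0 a b))"
      by (simp add: algebra_simps)
    ultimately show ?thesis by linarith
  qed
  finally show ?thesis using ab by simp
qed

text \<open>Order k = 0 is the number of walks and k = 2 the sum of squared displacements, so one
  pair of inequalities serves both.\<close>

definition M0 :: "nat \<Rightarrow> nat \<Rightarrow> real" where "M0 k n = (\<Sum>\<pi>\<in>S0 n. saw_norm V0 E0 \<pi> ^ k)"
definition M1 :: "nat \<Rightarrow> nat \<Rightarrow> real" where "M1 k n = (\<Sum>\<pi>\<in>S1 n. saw_norm V1 E1 \<pi> ^ k)"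

lemma S0_iff: "(vs, es) \<in> S0 n \<longleftrightarrow> mid_saw V0 E0 vs es \<and> length vs = n \<and> hd es \<in> X0"
  by (cases es) (auto simp: Sigma_n_def mid_saw_def)

lemma S1_iff: "(vs, es) \<in> S1 n \<longleftrightarrow> mid_saw V1 E1 vs es \<and> length vs = n \<and> hd es \<in> X1"
  by (cases es) (auto simp: Sigma_n_def mid_saw_def)

lemma finite_X0: "finite X0"
proof -
  have "X0 \<subseteq> (\<Union>w\<in>W0. star w)" by (auto simp: incident_edges_def star_def)
  moreover have "finite (\<Union>w\<in>W0. star w)" using W0_facts star_card by auto
  ultimately show ?thesis by (rule finite_subset)
qed

lemma lift_X1: "e \<in> X0 \<Longrightarrow> lift e \<in> X1"
proof -
  assume "e \<in> X0"
  then obtain w where w: "e \<in> Ed0" "w \<in> e" "w \<in> W0" by (auto simp: incident_edges_def)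
  have "(w, port w e) \<in> lift e" "port w e \<in> Hv" using w mem_lift port_in gadget_facts(4) by blast+
  then show ?thesis using w Ed1_cases[of "lift e"] by (auto simp: incident_edges_def)
qed

lemma dvs_inj:
  "valid vs es \<gamma>s \<Longrightarrow> valid vs es \<gamma>s' \<Longrightarrow> distinct vs \<Longrightarrow> dvs vs \<gamma>s = dvs vs \<gamma>s' \<Longrightarrow> \<gamma>s = \<gamma>s'"
proof (induction vs es \<gamma>s arbitrary: \<gamma>s' rule: valid.induct)
  case (2 v vs e es \<gamma> \<gamma>s)
  obtain \<gamma>' \<gamma>s'' where g: "\<gamma>s' = \<gamma>' # \<gamma>s''" "valid vs es \<gamma>s''" using 2(3) by (cases \<gamma>s') auto
  have tw: "takeWhile (\<lambda>x. fst x = v) (map (Pair v) \<delta> @ dvs vs \<delta>s) = map (Pair v) \<delta>" for \<delta> \<delta>s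
  proof -
    have "takeWhile (\<lambda>x. fst x = v) (map (Pair v) \<delta> @ dvs vs \<delta>s) = map (Pair v) \<delta> @ takeWhile (\<lambda>x. fst x = v) (dvs vs \<delta>s)"
      by (rule takeWhile_append2) auto
    moreover have "takeWhile (\<lambda>x. fst x = v) (dvs vs \<delta>s) = []"
    proof (cases "dvs vs \<delta>s")
      case (Cons z zs)
      then have "fst z \<in> set vs" using dvs_fst[of z vs \<delta>s] by simp
      then show ?thesis using Cons 2(4) by auto
    qed simp
    ultimately show ?thesis by simp
  qed
  have eq: "map (Pair v) \<gamma> @ dvs vs \<gamma>s = map (Pair v) \<gamma>' @ dvs vs \<gamma>s''" using 2(5) g by simp
  then have "map (Pair v) \<gamma> = map (Pair v) \<gamma>'" using tw[of \<gamma> \<gamma>s] tw[of \<gamma>' \<gamma>s''] by metis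
  moreover from this have "dvs vs \<gamma>s = dvs vs \<gamma>s''" using eq by simp
  ultimately show ?case using 2(1)[of \<gamma>s''] 2(2,4) g by (auto simp: inj_map_eq_map inj_on_def)
qed auto

lemma filter_des:
  "mid_saw V0 E0 vs es \<Longrightarrow> valid vs es \<gamma>s \<Longrightarrow> filter (\<lambda>e. e \<in> lift ` Ed0) (des vs es \<gamma>s) = map lift es"
proof (induction vs es \<gamma>s rule: valid.induct)
  case (2 v vs e es \<gamma> \<gamma>s)
  have m: "mid_saw V0 E0 vs es" "valid vs es \<gamma>s" "e \<in> Ed0" using 2 by (auto simp: mid_saw_Cons)
  have w: "is_walk Hv EH \<gamma>" using 2 by (auto simp: GP_def)
  have "filter (\<lambda>e. e \<in> lift ` Ed0) (map (image (Pair v)) (path_edges \<gamma>)) = []"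
    using path_edges_internal[OF w, of _ v] internal_not_lift[of _ v] by (fastforce simp: filter_empty_conv path_edges_map)
  then show ?case using 2(1)[OF m(1,2)] m(3) by simp
qed (auto simp: mid_saw_Nil)

text \<open>The inherited edges of the image are the lifts of es in order, es determines vs because
  consecutive edges share only one vertex, and the vertices split into blocks according to their
  first component.\<close>

lemma decorate_inj:
  assumes "mid_saw V0 E0 vs es" "valid vs es \<gamma>s" "mid_saw V0 E0 vs' es'" "valid vs' es' \<gamma>s'"
    "dvs vs \<gamma>s = dvs vs' \<gamma>s'" "des vs es \<gamma>s = des vs' es' \<gamma>s'"
  shows "vs = vs' \<and> es = es' \<and> \<gamma>s = \<gamma>s'"
proof -
  have "map lift es = map lift es'" using filter_des[OF assms(1,2)] filter_des[OF assms(3,4)] assms(6) by simp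
  moreover have "inj_on lift (set es \<union> set es')" using assms(1,3) lift_inj by (auto simp: mid_saw_def inj_on_def subset_iff)
  ultimately have es: "es = es'" using map_inj_on by blast
  have vs: "vs = vs'" using mid_saw_vs_unique[OF simple_graph_on[OF simple0] assms(1)] assms(3) es by simp
  have "distinct vs" using assms(1) by (simp add: mid_saw_def)
  then show ?thesis using dvs_inj[of vs es \<gamma>s \<gamma>s'] assms es vs by simp
qed

lemma norm_decorate_ge:
  assumes "mid_saw V0 E0 vs es" "valid vs es \<gamma>s"
  shows "saw_norm V0 E0 (vs, es) \<le> saw_norm V1 E1 (dvs vs \<gamma>s, des vs es \<gamma>s)"
proof -
  have ne: "es \<noteq> []" "set es \<subseteq> Ed0" using assms by (auto simp: mid_saw_def)
  then show ?thesis using hd_des[OF ne(1), of vs \<gamma>s] last_des[OF assms] mid_dist_lift_ge[of "hd es" "last es"]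
    by (auto simp: saw_norm_def subset_iff)
qed

definition RR :: "nat \<Rightarrow> nat \<Rightarrow> (('v list \<times> 'v set list) \<times> 'g list list) set" where
  "RR n k = (SIGMA \<pi>:S0 n. DS (fst \<pi>) (snd \<pi>) k)"

lemma DS_S0: "\<pi> \<in> S0 n \<Longrightarrow> finite (DS (fst \<pi>) (snd \<pi>) k) \<and> real (card (DS (fst \<pi>) (snd \<pi>) k)) = cpow hh g n k"
  using card_DS[of "fst \<pi>" "snd \<pi>" k] S0_iff[of "fst \<pi>" "snd \<pi>" n] by auto

lemma sum_RR: "finite (S0 n) \<Longrightarrow> finite (RR n k) \<and> (\<Sum>r\<in>RR n k. F (fst r)) = (\<Sum>\<pi>\<in>S0 n. F \<pi>) * cpow hh g n k"
proof -
  assume f: "finite (S0 n)"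
  have "(\<Sum>r\<in>RR n k. F (fst r)) = (\<Sum>\<pi>\<in>S0 n. \<Sum>\<gamma>s\<in>DS (fst \<pi>) (snd \<pi>) k. F \<pi>)"
    unfolding RR_def using f DS_S0 by (subst sum.Sigma) (auto simp: case_prod_unfold)
  also have "\<dots> = (\<Sum>\<pi>\<in>S0 n. F \<pi> * cpow hh g n k)"
    by (rule sum.cong) (auto simp: DS_S0 mult.commute)
  finally show ?thesis using f DS_S0 by (auto simp: RR_def sum_distrib_right)
qed

text \<open>Decoration is injective, maps into the walks of length m starting in X1, and does not
  decrease the displacement because distances shrink under projection.\<close>

lemma moment_lower:
  assumes fin1: "finite (S1 m)" and fin0: "\<And>n. n \<in> {1..m} \<Longrightarrow> finite (S0 n)"
  shows "(\<Sum>n\<in>{1..m}. M0 k n * cpow hh g n m) \<le> M1 k m"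
proof -
  define T where "T = (SIGMA n:{1..m}. RR n m)"
  define \<Phi> where "\<Phi> = (\<lambda>(n::nat, ((vs, es), \<gamma>s)). (dvs vs \<gamma>s, des vs es \<gamma>s))"
  have finT: "finite T" unfolding T_def using sum_RR fin0 by (intro finite_SigmaI) auto
  have mem: "mid_saw V0 E0 vs es \<and> valid vs es \<gamma>s \<and> length vs = n \<and> hd es \<in> X0 \<and> sum_list (map length \<gamma>s) = m"
    if "(n, ((vs, es), \<gamma>s)) \<in> T" for n vs es \<gamma>s
    using that S0_iff by (auto simp: T_def RR_def DS_def)
  have inj: "inj_on \<Phi> T"
  proof (rule inj_onI)
    fix a b assume ab: "a \<in> T" "b \<in> T" "\<Phi> a = \<Phi> b"
    obtain n vs es \<gamma>s where a: "a = (n, ((vs, es), \<gamma>s))" by (metis prod.exhaust)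
    obtain n' vs' es' \<gamma>s' where b: "b = (n', ((vs', es'), \<gamma>s'))" by (metis prod.exhaust)
    show "a = b" using mem[of n vs es \<gamma>s] mem[of n' vs' es' \<gamma>s'] ab decorate_inj[of vs es \<gamma>s vs' es' \<gamma>s'] unfolding a b \<Phi>_def by auto
  qed
  have img: "\<Phi> ` T \<subseteq> S1 m"
  proof
    fix y assume "y \<in> \<Phi> ` T"
    then obtain n vs es \<gamma>s where a: "(n, ((vs, es), \<gamma>s)) \<in> T" "y = (dvs vs \<gamma>s, des vs es \<gamma>s)" by (auto simp: \<Phi>_def)
    note m = mem[OF a(1)]
    have "es \<noteq> []" using m by (auto simp: mid_saw_def)
    then show "y \<in> S1 m" unfolding a(2) S1_iff using m decorate_mid_saw length_dvs hd_des lift_X1 by auto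
  qed
  have "(\<Sum>n\<in>{1..m}. M0 k n * cpow hh g n m) = (\<Sum>n\<in>{1..m}. \<Sum>r\<in>RR n m. saw_norm V0 E0 (fst r) ^ k)"
    using sum_RR[OF fin0, of _ m "\<lambda>\<pi>. saw_norm V0 E0 \<pi> ^ k"] by (intro sum.cong) (auto simp: M0_def)
  also have "\<dots> = (\<Sum>t\<in>T. saw_norm V0 E0 (fst (snd t)) ^ k)"
    unfolding T_def using sum_RR fin0 by (subst sum.Sigma) (auto simp: case_prod_unfold)
  also have "\<dots> \<le> (\<Sum>t\<in>T. saw_norm V1 E1 (\<Phi> t) ^ k)"
  proof (intro sum_mono power_mono)
    fix t assume t: "t \<in> T"
    obtain n vs es \<gamma>s where a: "t = (n, ((vs, es), \<gamma>s))" by (metis prod.exhaust)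
    show "saw_norm V0 E0 (fst (snd t)) \<le> saw_norm V1 E1 (\<Phi> t)"
      using mem[of n vs es \<gamma>s] t norm_decorate_ge[of vs es \<gamma>s] unfolding a \<Phi>_def by simp
    show "0 \<le> saw_norm V0 E0 (fst (snd t))" by (simp add: saw_norm_def mid_dist_nonneg)
  qed
  also have "\<dots> = (\<Sum>\<pi>\<in>\<Phi> ` T. saw_norm V1 E1 \<pi> ^ k)" using inj by (simp add: sum.reindex)
  also have "\<dots> \<le> M1 k m" unfolding M1_def using fin1 img by (intro sum_mono2) (auto simp: saw_norm_def mid_dist_nonneg)
  finally show ?thesis .
qed

end

section \<open>Automorphisms and submultiplicativity of the counts\<close>

lemma automorphism_edge:
  assumes "automorphism V E f" "e \<in> edges V E" shows "f ` e \<in> edges V E"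
proof -
  obtain a b where ab: "e = {a, b}" "a \<in> V" "b \<in> V" "E a b" using assms(2) by (auto simp: edges_def)
  have "f a \<in> V" "f b \<in> V" "E (f a) (f b)" using assms(1) ab by (auto simp: automorphism_def bij_betw_def)
  then have "{f a, f b} \<in> edges V E" by (rule edgesI)
  then show ?thesis using ab by simp
qed

lemma automorphism_mid_saw:
  assumes f: "automorphism V E f" and m: "mid_saw V E vs es"
  shows "mid_saw V E (map f vs) (map (image f) es)"
proof -
  have inj: "inj_on f V" and im: "f ` V \<subseteq> V" using f by (auto simp: automorphism_def bij_betw_def)
  have sub: "set vs \<subseteq> V" "set es \<subseteq> edges V E" using m by (auto simp: mid_saw_def)
  have "inj_on (image f) (set es)"
  proof (rule inj_onI)
    fix a b assume "a \<in> set es" "b \<in> set es" "f ` a = f ` b"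
    then show "a = b" using sub edges_subset inj by (metis inj_on_image_eq_iff subset_iff)
  qed
  moreover have "inj_on f (set vs)" using inj sub inj_on_subset by blast
  ultimately show ?thesis using m im sub automorphism_edge[OF f] by (auto simp: mid_saw_def distinct_map)
qed

context lt_domain
begin

definition walks_from :: "'v set \<Rightarrow> nat \<Rightarrow> ('v list \<times> 'v set list) set" where
  "walks_from e n = {(vs, es). mid_saw V0 E0 vs es \<and> length vs = n \<and> hd es = e}"

lemma automorphism_inj:
  assumes f: "automorphism V0 E0 f"
  shows "inj_on (\<lambda>(vs, es). (map f vs, map (image f) es)) {(vs, es). mid_saw V0 E0 vs es}"
proof (rule inj_onI, clarify)
  fix vs es vs' es'
  assume m: "mid_saw V0 E0 vs es" "mid_saw V0 E0 vs' es'" and eq: "map f vs = map f vs'" "map (image f) es = map (image f) es'"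
  have inj: "inj_on f V0" using f by (auto simp: automorphism_def bij_betw_def)
  have "inj_on f (set vs \<union> set vs')" using m by (intro inj_on_subset[OF inj]) (auto simp: mid_saw_def)
  then have 1: "vs = vs'" using eq(1) map_inj_on by blast
  have "inj_on (image f) (set es \<union> set es')"
  proof (rule inj_onI)
    fix a b assume ab: "a \<in> set es \<union> set es'" "b \<in> set es \<union> set es'" "f ` a = f ` b"
    then have "a \<in> Ed0" "b \<in> Ed0" using m by (auto simp: mid_saw_def)
    then have "a \<subseteq> V0" "b \<subseteq> V0" using edges_subset by blast+
    then show "a = b" using inj ab(3) by (metis inj_on_image_eq_iff)
  qed
  then show "vs = vs' \<and> es = es'" using 1 eq(2) map_inj_on by blast
qed

lemma to_domain: "v \<in> V0 \<Longrightarrow> \<exists>f. automorphism V0 E0 f \<and> f v \<in> W0"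
  using fund by (auto simp: fundamental_domain_def)

text \<open>An automorphism carries an end of e into W0 and hence e into X0; quasi-transitivity
  takes the place of translation invariance.\<close>

lemma walks_from_card:
  assumes "e \<in> Ed0" "finite (S0 n)"
  shows "finite (walks_from e n) \<and> card (walks_from e n) \<le> card (S0 n)"
proof -
  obtain a where a: "a \<in> e" "a \<in> V0" using assms(1) by (auto elim!: Ed0E)
  obtain f where f: "automorphism V0 E0 f" "f a \<in> W0" using to_domain[OF a(2)] by blast
  let ?T = "\<lambda>(vs, es). (map f vs, map (image f) es)"
  have inj: "inj_on ?T (walks_from e n)" using automorphism_inj[OF f(1)] by (rule inj_on_subset) (auto simp: walks_from_def)
  have "?T ` walks_from e n \<subseteq> S0 n"
  proof (rule subsetI, elim imageE)
    fix y x assume x: "x \<in> walks_from e n" "y = ?T x"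
    obtain vs es where p: "x = (vs, es)" "mid_saw V0 E0 vs es" "length vs = n" "hd es = e" using x(1) by (auto simp: walks_from_def)
    have ne: "es \<noteq> []" using p by (auto simp: mid_saw_def)
    have m: "mid_saw V0 E0 (map f vs) (map (image f) es)" by (rule automorphism_mid_saw[OF f(1) p(2)])
    have "f ` e \<in> X0" using f a assms(1) automorphism_edge[OF f(1)] by (auto simp: incident_edges_def)
    then show "y \<in> S0 n" using x(2) p m ne by (simp add: S0_iff hd_map)
  qed
  then show ?thesis using inj assms(2) by (meson card_inj_on_le finite_imageD finite_subset)
qed

lemma mid_saw_split:
  assumes "mid_saw V E vs es" "m \<le> length vs"
  shows "mid_saw V E (take m vs) (take (Suc m) es)" "mid_saw V E (drop m vs) (drop m es)" "last (take (Suc m) es) = hd (drop m es)"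
proof -
  have l: "length es = Suc (length vs)" using assms(1) by (rule mid_saw_length)
  have ml: "m < length es" using l assms(2) by simp
  have es: "es = take m es @ es ! m # drop (Suc m) es" using ml by (simp add: id_take_nth_drop)
  have t: "take (Suc m) es = take m es @ [es ! m]" using ml by (simp add: take_Suc_conv_app_nth)
  have d: "drop m es = es ! m # drop (Suc m) es" using ml by (simp add: Cons_nth_drop_Suc)
  have "mid_saw V E (take m vs @ drop m vs) (take m es @ es ! m # drop (Suc m) es)" using assms(1) es by simp
  then show "mid_saw V E (take m vs) (take (Suc m) es)" "mid_saw V E (drop m vs) (drop m es)"
    unfolding t d using mid_saw_append[of "take m es" "take m vs" V E "drop m vs"] l assms(2) by auto
  show "last (take (Suc m) es) = hd (drop m es)" unfolding t d by simp
qed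

text \<open>A walk is cut at its m-th mid-edge, which both parts keep. The second part starts at an
  arbitrary mid-edge, so its number is bounded through \<open>walks_from_card\<close>.\<close>

lemma card_S0_submult:
  assumes "finite (S0 m)" "finite (S0 n)"
  shows "card (S0 (m + n)) \<le> card (S0 m) * card (S0 n)"
proof -
  define T where "T = (SIGMA \<pi>:S0 m. walks_from (last (snd \<pi>)) n)"
  define F where "F = (\<lambda>(vs :: 'v list, es). ((take m vs, take (Suc m) es), (drop m vs, drop m es :: 'v set list)))"
  have w: "finite (walks_from (last (snd \<pi>)) n) \<and> card (walks_from (last (snd \<pi>)) n) \<le> card (S0 n)" if "\<pi> \<in> S0 m" for \<pi>
  proof -
    obtain vs es where p: "\<pi> = (vs, es)" by (cases \<pi>)
    then have "mid_saw V0 E0 vs es" using that S0_iff by simp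
    then have "set es \<subseteq> Ed0" "es \<noteq> []" by (auto simp: mid_saw_def)
    then have "last es \<in> Ed0" using last_in_set by blast
    then show ?thesis using walks_from_card[OF _ assms(2)] p by simp
  qed
  have inj: "inj_on F (S0 (m + n))"
  proof (rule inj_onI)
    fix x y assume xy: "x \<in> S0 (m + n)" "y \<in> S0 (m + n)" "F x = F y"
    obtain vs es where x: "x = (vs, es)" by (cases x)
    obtain vs' es' where y: "y = (vs', es')" by (cases y)
    have e: "take m vs = take m vs'" "drop m vs = drop m vs'" "take (Suc m) es = take (Suc m) es'" "drop m es = drop m es'"
      using xy(3) by (auto simp: F_def x y)
    have "vs = vs'" using e(1,2) by (metis append_take_drop_id)
    moreover have "take m es = take m es'" using arg_cong[OF e(3), of "take m"] by (simp add: min_def)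
    then have "es = es'" using e(4) by (metis append_take_drop_id)
    ultimately show "x = y" by (simp add: x y)
  qed
  have "F ` S0 (m + n) \<subseteq> T"
  proof (rule subsetI, elim imageE)
    fix y x assume x: "x \<in> S0 (m + n)" "y = F x"
    obtain vs es where p: "x = (vs, es)" by (cases x)
    then have ms: "mid_saw V0 E0 vs es" "length vs = m + n" "hd es \<in> X0" using x S0_iff by auto
    have ne: "es \<noteq> []" using ms by (auto simp: mid_saw_def)
    note sp = mid_saw_split[OF ms(1), of m]
    have "hd (take (Suc m) es) = hd es" using ne by (cases es) auto
    then have "(take m vs, take (Suc m) es) \<in> S0 m" using sp ms by (simp add: S0_iff)
    moreover have "(drop m vs, drop m es) \<in> walks_from (last (take (Suc m) es)) n" using sp ms by (simp add: walks_from_def)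
    ultimately show "y \<in> T" using x p by (simp add: T_def F_def)
  qed
  moreover have finT: "finite T" unfolding T_def using assms w by (intro finite_SigmaI) auto
  ultimately have "card (S0 (m + n)) \<le> card T" using inj card_inj_on_le by blast
  also have "\<dots> = (\<Sum>\<pi>\<in>S0 m. card (walks_from (last (snd \<pi>)) n))" unfolding T_def using assms w by (subst card_SigmaI) auto
  also have "\<dots> \<le> (\<Sum>\<pi>\<in>S0 m. card (S0 n))" using w by (intro sum_mono) auto
  finally show ?thesis by simp
qed

subsection \<open>Cutting a walk of the transformed graph\<close>

lemma initial_segment:
  assumes m: "mid_saw V1 E1 pv (pe @ [lift f])" and f: "f \<in> Ed0" and pe: "\<forall>e\<in>set pe. e \<notin> lift ` Ed0"
  shows "\<exists>u A ea. u \<in> f \<and> pv = map (Pair u) A \<and> pe = map (image (Pair u)) ea \<and> set ea \<subseteq> edges Hv EH \<and> set A \<subseteq> Hv \<and> distinct A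
     \<and> length ea = length A \<and> (A \<noteq> [] \<longrightarrow> last A = port u f) \<and> mid_saw V1 E1 (map (Pair u) A) (map (image (Pair u)) ea @ [lift f])"
proof (cases "pv = []")
  case True
  then have "pe = []" using m by (auto simp: mid_saw_Nil)
  moreover obtain u where "u \<in> f" using f by (auto elim!: Ed0E)
  ultimately show ?thesis using True m by (intro exI[of _ u] exI[of _ "[]"]) auto
next
  case False
  note can = canonical1[OF m False]
  have l: "length pe = length pv" using mid_saw_length[OF m] by simp
  obtain p0 pe' where pe': "pe = p0 # pe'" using l False by (cases pe) auto
  have "path_edges pv = pe'" using can(2) pe' by simp
  then have "\<forall>e\<in>set (path_edges pv). e \<notin> lift ` Ed0" using pe pe' by simp
  from internal_walk[OF can(1) this] obtain u A where u: "u \<in> V0" "pv = map (Pair u) A" "is_walk Hv EH A"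
    by (elim bexE exE conjE) (rule that)
  have Ane: "A \<noteq> []" using u False by simp
  have la: "last (map (Pair u) A) \<in> lift f" using can(5) u by simp
  then have uf: "u \<in> f" "last A = port u f" using Ane f by (auto simp: last_map mem_lift)
  \<comment> \<open>The very first mid-edge does not join two vertices of the walk, so it is located
    in the gadget of u through the one vertex it shares with the walk.\<close>
  have int: "e \<in> internal u" if e: "e \<in> set pe" for e
  proof -
    obtain i where i: "i < length pe" "e = pe ! i" using e by (auto simp: in_set_conv_nth)
    have "pv ! i \<in> (pe @ [lift f]) ! i" using m i l by (auto simp: mid_saw_def)
    then have pi: "pv ! i \<in> e" using i by (simp add: nth_append)
    have "e \<in> Ed1" using m e by (auto simp: mid_saw_def)
    then obtain u' where u': "e \<in> internal u'" using Ed1_cases pe e by blast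
    have "fst (pv ! i) = u" using u i l by simp
    then show ?thesis using u' internal_fst[OF u' pi] by simp
  qed
  define ea where "ea = map (image snd) pe"
  have "map (image (Pair u)) ea = pe" unfolding ea_def map_map
  proof (rule map_idI)
    fix e assume "e \<in> set pe"
    then show "((`) (Pair u) \<circ> (`) snd) e = e" using int by (force simp: internal_def image_image)
  qed
  moreover have "set ea \<subseteq> edges Hv EH" using int by (force simp: ea_def internal_def image_image)
  moreover have "length ea = length A" using l u by (simp add: ea_def)
  moreover have "distinct A" using can(3) u by (simp add: distinct_map)
  moreover have "set A \<subseteq> Hv" using u(3) by (simp add: is_walk_def)
  ultimately show ?thesis using uf u m by (intro exI[of _ u] exI[of _ A] exI[of _ ea]) auto
qed

lemma final_segment:
  assumes m: "mid_saw V1 E1 qv (lift f # qe)" and f: "f \<in> Ed0" and qe: "\<forall>e\<in>set qe. e \<notin> lift ` Ed0"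
  shows "\<exists>u B eb. u \<in> f \<and> qv = map (Pair u) B \<and> qe = map (image (Pair u)) eb \<and> set eb \<subseteq> edges Hv EH \<and> set B \<subseteq> Hv \<and> distinct B
     \<and> length eb = length B \<and> (B \<noteq> [] \<longrightarrow> hd B = port u f) \<and> mid_saw V1 E1 (map (Pair u) B) (lift f # map (image (Pair u)) eb)"
proof -
  have "mid_saw V1 E1 (rev qv) (rev qe @ [lift f])" using mid_saw_rev[OF m] by simp
  from initial_segment[OF this f] qe obtain u A ea where a: "u \<in> f" "rev qv = map (Pair u) A" "rev qe = map (image (Pair u)) ea"
    "set ea \<subseteq> edges Hv EH" "set A \<subseteq> Hv" "distinct A" "length ea = length A" "A \<noteq> [] \<longrightarrow> last A = port u f" by auto
  have "qv = map (Pair u) (rev A)" "qe = map (image (Pair u)) (rev ea)" using a(2,3) by (simp_all add: rev_map[symmetric] rev_swap)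
  then show ?thesis using a m by (intro exI[of _ u] exI[of _ "rev A"] exI[of _ "rev ea"]) (auto simp: hd_rev)
qed

text \<open>\<open>A\<close> and \<open>B\<close> are the parts before the first and after the last mid-edge inherited from $G_0$.\<close>
definition cut_form where
  "cut_form vs es u A ea vs0 es0 \<gamma>s x B eb \<longleftrightarrow> vs = map (Pair u) A @ dvs vs0 \<gamma>s @ map (Pair x) B
    \<and> es = map (image (Pair u)) ea @ des vs0 es0 \<gamma>s @ map (image (Pair x)) eb
    \<and> mid_saw V0 E0 vs0 es0 \<and> valid vs0 es0 \<gamma>s \<and> hd es0 \<in> X0
    \<and> u \<in> hd es0 \<and> set ea \<subseteq> edges Hv EH \<and> set A \<subseteq> Hv \<and> distinct A \<and> length ea = length A
    \<and> (A \<noteq> [] \<longrightarrow> u \<in> W0) \<and> (A \<noteq> [] \<longrightarrow> last A = port u (hd es0)) \<and> mid_saw V1 E1 (map (Pair u) A) (map (image (Pair u)) ea @ [lift (hd es0)])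
    \<and> x \<in> last es0 \<and> set eb \<subseteq> edges Hv EH \<and> set B \<subseteq> Hv \<and> distinct B \<and> length eb = length B
    \<and> (B \<noteq> [] \<longrightarrow> hd B = port x (last es0)) \<and> mid_saw V1 E1 (map (Pair x) B) (lift (last es0) # map (image (Pair x)) eb)"

text \<open>A walk with more than hh vertices cannot stay inside one gadget and thus uses an
  inherited edge. It is cut at the first and at the last of these. If A is empty the walk starts at
  an inherited edge of X1, otherwise inside a gadget over W0; in both cases the core starts in
  X0.\<close>

lemma decompose:
  assumes m: "mid_saw V1 E1 vs es" and X: "hd es \<in> X1" and long: "length vs > hh"
  shows "\<exists>u A ea vs0 es0 \<gamma>s x B eb. cut_form vs es u A ea vs0 es0 \<gamma>s x B eb"
proof -
  have ne: "vs \<noteq> []" using long by auto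
  note can = canonical1[OF m ne]
  have "\<exists>e\<in>set es. e \<in> lift ` Ed0"
  proof (rule ccontr)
    assume no: "\<not> (\<exists>e\<in>set es. e \<in> lift ` Ed0)"
    have "set (path_edges vs) \<subseteq> set es" using arg_cong[OF can(2), of set] by auto
    then have "\<forall>e\<in>set (path_edges vs). e \<notin> lift ` Ed0" using no by blast
    from internal_walk[OF can(1) this] obtain u A where u: "u \<in> V0" "vs = map (Pair u) A" "is_walk Hv EH A"
      by (elim bexE exE conjE) (rule that)
    then have "length A \<le> hh" using can(3) by (intro distinct_length) (auto simp: distinct_map is_walk_def)
    then show False using u long by simp
  qed
  from split_list_first_prop[OF this] obtain pe e1 rest where
    s1: "es = pe @ e1 # rest" "e1 \<in> lift ` Ed0" "\<forall>e\<in>set pe. e \<notin> lift ` Ed0" by blast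
  have "\<exists>e\<in>set (e1 # rest). e \<in> lift ` Ed0" using s1 by auto
  from split_list_last_prop[OF this] obtain m1 e2 qe where
    s2: "e1 # rest = m1 @ e2 # qe" "e2 \<in> lift ` Ed0" "\<forall>e\<in>set qe. e \<notin> lift ` Ed0" by blast
  have l: "length es = Suc (length vs)" by (rule mid_saw_length[OF m])
  define pv where "pv = take (length pe) vs"
  define v2 where "v2 = drop (length pe) vs"
  have vs: "vs = pv @ v2" "length pe = length pv" using l s1 by (auto simp: pv_def v2_def)
  have a1: "mid_saw V1 E1 pv (pe @ [e1])" "mid_saw V1 E1 v2 (e1 # rest)"
    using m mid_saw_append[OF vs(2), of V1 E1 v2 e1 rest] vs(1) s1(1) by auto
  define mv where "mv = take (length m1) v2"
  define qv where "qv = drop (length m1) v2"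
  have l2: "length (e1 # rest) = Suc (length v2)" by (rule mid_saw_length[OF a1(2)])
  have v2: "v2 = mv @ qv" "length m1 = length mv" using l2 unfolding s2(1) by (auto simp: mv_def qv_def)
  have a2: "mid_saw V1 E1 mv (m1 @ [e2])" "mid_saw V1 E1 qv (e2 # qe)"
    using a1(2) mid_saw_append[OF v2(2), of V1 E1 qv e2 qe] v2(1) s2(1) by auto
  obtain f where f: "f \<in> Ed0" "e1 = lift f" using s1 by blast
  obtain f' where f': "f' \<in> Ed0" "e2 = lift f'" using s2 by blast
  have hd1: "hd (m1 @ [e2]) = lift f" using s2(1) f by (cases m1) auto
  obtain vs0 es0 \<gamma>s where dec: "mid_saw V0 E0 vs0 es0" "hd es0 = f" "valid vs0 es0 \<gamma>s" "mv = dvs vs0 \<gamma>s" "m1 @ [e2] = des vs0 es0 \<gamma>s"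
    using decompose_old[OF a2(1) hd1 f(1)] s2(2) by auto
  have es0ne: "es0 \<noteq> []" "set es0 \<subseteq> Ed0" using dec(1) by (auto simp: mid_saw_def)
  have "lift (last es0) = lift f'" using last_des[OF dec(1,3)] f' by (simp flip: dec(5))
  moreover have "last es0 \<in> Ed0" using es0ne last_in_set by blast
  ultimately have lf: "last es0 = f'" using lift_inj[of "last es0" f'] f' by simp
  obtain u A ea where A: "u \<in> f" "pv = map (Pair u) A" "pe = map (image (Pair u)) ea" "set ea \<subseteq> edges Hv EH" "set A \<subseteq> Hv" "distinct A"
    "length ea = length A" "A \<noteq> [] \<longrightarrow> last A = port u f" "mid_saw V1 E1 (map (Pair u) A) (map (image (Pair u)) ea @ [lift f])"
    using initial_segment[of pv pe f] a1(1) f s1(3) by auto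
  obtain x B eb where B: "x \<in> f'" "qv = map (Pair x) B" "qe = map (image (Pair x)) eb" "set eb \<subseteq> edges Hv EH" "set B \<subseteq> Hv" "distinct B"
    "length eb = length B" "B \<noteq> [] \<longrightarrow> hd B = port x f'" "mid_saw V1 E1 (map (Pair x) B) (lift f' # map (image (Pair x)) eb)"
    using final_segment[of qv f' qe] a2(2) f' s2(3) by auto
  have uW: "u \<in> W0" if "A \<noteq> []"
  proof -
    have "ea \<noteq> []" using that A(7) by auto
    then have "hd es = Pair u ` hd ea" using s1(1) A(3) by (cases ea) auto
    then show ?thesis using X by (auto simp: incident_edges_def)
  qed
  have fX: "f \<in> X0"
  proof (cases "A = []")
    case True
    then have "hd es = lift f" using s1 A f by simp
    then obtain w y where "(w, y) \<in> lift f" "w \<in> W0" using X by (auto simp: incident_edges_def)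
    then show ?thesis using f(1) mem_lift by (auto simp: incident_edges_def)
  next
    case False
    then show ?thesis using uW A(1) f by (auto simp: incident_edges_def)
  qed
  have ves: "vs = map (Pair u) A @ dvs vs0 \<gamma>s @ map (Pair x) B" using vs v2 A(2) B(2) dec(4) by simp
  have ees: "es = map (image (Pair u)) ea @ des vs0 es0 \<gamma>s @ map (image (Pair x)) eb"
    unfolding s1(1) s2(1) dec(5)[symmetric] using A(3) B(3) by simp
  show ?thesis
    by (rule exI[of _ u], rule exI[of _ A], rule exI[of _ ea], rule exI[of _ vs0], rule exI[of _ es0], rule exI[of _ \<gamma>s],
        rule exI[of _ x], rule exI[of _ B], rule exI[of _ eb])
      (unfold cut_form_def, use ves ees dec(1-3) fX A B uW lf in simp)
qed


text \<open>Crude finite supersets of the possible end pieces; only a bound on their number, uniform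
  over all walks, matters. PRE is fixed because a nonempty initial piece lies over W0. POST moves
  with the last edge f of the core, but its size is the same for all edges.\<close>

definition PRE :: "(('v \<times> 'g) list \<times> ('v \<times> 'g) set list) set" where
  "PRE = {xs. set xs \<subseteq> W0 \<times> Hv \<and> length xs \<le> hh} \<times> {ys. set ys \<subseteq> Pow (W0 \<times> Hv) \<and> length ys \<le> hh}"

definition POST :: "'v set \<Rightarrow> (('v \<times> 'g) list \<times> ('v \<times> 'g) set list) set" where
  "POST f = {xs. set xs \<subseteq> f \<times> Hv \<and> length xs \<le> hh} \<times> {ys. set ys \<subseteq> Pow (f \<times> Hv) \<and> length ys \<le> hh}"

definition CC :: "('v list \<times> 'v set list) \<times> 'g list list \<Rightarrow> (('v \<times> 'g) list \<times> ('v \<times> 'g) set list) set" where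
  "CC r = (\<lambda>(p, q). (fst p @ dvs (fst (fst r)) (snd r) @ fst q, snd p @ des (fst (fst r)) (snd (fst r)) (snd r) @ snd q))
     ` (PRE \<times> POST (last (snd (fst r))))"

definition NC :: nat where
  "NC = card PRE * ((\<Sum>i\<le>hh. (2 * hh) ^ i) * (\<Sum>i\<le>hh. (2 ^ (2 * hh)) ^ i))"

lemma finite_PRE: "finite PRE"
  unfolding PRE_def using W0_facts(1) gadget_facts(1) by (intro finite_cartesian_product finite_lists_length_le) auto

lemma CC_card:
  assumes "last (snd (fst r)) \<in> Ed0"
  shows "finite (CC r) \<and> card (CC r) \<le> NC"
proof -
  let ?f = "last (snd (fst r))"
  have f: "finite (?f \<times> Hv)" "card (?f \<times> Hv) = 2 * hh"
    using Ed0_finite[OF assms] gadget_facts(1) by (auto simp: card_cartesian_product hh_def)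
  have fp: "finite (POST ?f)" unfolding POST_def using Ed0_finite[OF assms] gadget_facts(1) by (intro finite_cartesian_product finite_lists_length_le) auto
  have cp: "card (POST ?f) = (\<Sum>i\<le>hh. (2 * hh) ^ i) * (\<Sum>i\<le>hh. (2 ^ (2 * hh)) ^ i)"
    
  proof -
    have pf: "finite (Pow (?f \<times> Hv))" using f(1) by (rule finite_Pow_iff[THEN iffD2])
    show ?thesis unfolding POST_def card_cartesian_product[of "{xs. _ xs}"]
      by (simp only: card_lists_length_le[OF f(1)] card_lists_length_le[OF pf] card_Pow[OF f(1)] f(2))
  qed
  have "card (CC r) \<le> card (PRE \<times> POST ?f)" unfolding CC_def by (rule card_image_le) (use fp finite_PRE in simp)
  then show ?thesis using fp finite_PRE cp unfolding NC_def CC_def card_cartesian_product by simp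
qed

text \<open>Both ends of the new walk lie over the end edges of the old one, which is what
  \<open>mid_dist_upper\<close> asks for.\<close>

definition good :: "('v list \<times> 'v set list) \<Rightarrow> (('v \<times> 'g) list \<times> ('v \<times> 'g) set list) \<Rightarrow> bool" where
  "good p \<pi> \<longleftrightarrow> (\<exists>x\<in>hd (snd \<pi>). fst x \<in> hd (snd p)) \<and> (\<exists>y\<in>last (snd \<pi>). fst y \<in> last (snd p))"

lemma mid_saw_hd_last:
  assumes "mid_saw V E vs es" "vs \<noteq> []"
  shows "hd es \<noteq> last es" "hd es \<in> edges V E" "last es \<in> edges V E"
proof -
  have l: "length es = Suc (length vs)" "distinct es" "set es \<subseteq> edges V E" using assms by (auto simp: mid_saw_def)
  then have ne: "es \<noteq> []" "length es \<ge> 2" using assms(2) by (auto simp: Suc_le_eq)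
  then show "hd es \<noteq> last es" using l(2) by (cases es) (auto simp: last_ConsR)
  show "hd es \<in> edges V E" "last es \<in> edges V E" using ne l by auto
qed

lemma saw_norm_nonneg: "saw_norm V E \<pi> \<ge> 0" by (simp add: saw_norm_def mid_dist_nonneg)

lemma saw_norm_ge_1: "mid_saw V E vs es \<Longrightarrow> vs \<noteq> [] \<Longrightarrow> saw_norm V E (vs, es) \<ge> 1"
  using mid_saw_hd_last(1) by (auto simp: saw_norm_def intro!: mid_dist_ge_1)

lemma good_norm:
  assumes "mid_saw V0 E0 vs0 es0" "vs0 \<noteq> []" "mid_saw V1 E1 vs es" "good (vs0, es0) (vs, es)"
  shows "saw_norm V1 E1 (vs, es) \<le> 4 * real hh * saw_norm V0 E0 (vs0, es0)"
proof -
  note h0 = mid_saw_hd_last[OF assms(1,2)]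
  have "es \<noteq> []" "set es \<subseteq> Ed1" using assms(3) by (auto simp: mid_saw_def)
  then have h1: "hd es \<in> Ed1" "last es \<in> Ed1" by auto
  show ?thesis using assms(4) mid_dist_upper[OF h1 h0(2,3,1)] by (auto simp: good_def saw_norm_def)
qed

lemma hd_lift_good: "f \<in> Ed0 \<Longrightarrow> \<exists>x\<in>lift f. fst x \<in> f"
  by (auto elim!: Ed0E simp: lift_pair)

lemma segment_good: "e \<in> edges Hv EH \<Longrightarrow> \<exists>x\<in>Pair u ` e. fst x = u"
  by (auto simp: edges_def)

lemma in_CC:
  assumes "length A \<le> hh" "length ea = length A" "set A \<subseteq> Hv" "set ea \<subseteq> edges Hv EH" "A \<noteq> [] \<longrightarrow> u \<in> W0"
    and "length B \<le> hh" "length eb = length B" "set B \<subseteq> Hv" "set eb \<subseteq> edges Hv EH" "x \<in> last es0"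
  shows "(map (Pair u) A @ dvs vs0 \<gamma>s @ map (Pair x) B, map (image (Pair u)) ea @ des vs0 es0 \<gamma>s @ map (image (Pair x)) eb) \<in> CC ((vs0, es0), \<gamma>s)"
proof -
  have sub: "e \<subseteq> Hv" if "e \<in> edges Hv EH" for e using that edges_subset by blast
  have "(map (Pair u) A, map (image (Pair u)) ea) \<in> PRE"
  proof (cases "A = []")
    case False
    then show ?thesis using assms sub by (fastforce simp: PRE_def)
  qed (use assms in \<open>auto simp: PRE_def\<close>)
  moreover have "(map (Pair x) B, map (image (Pair x)) eb) \<in> POST (last es0)"
    using assms sub by (fastforce simp: POST_def)
  ultimately show ?thesis unfolding CC_def by force
qed

text \<open>Cutting off the end pieces, of joint length j \<le> 2 * hh, leaves a decorated walk of
  length m - j, and at most \<open>NC\<close> walks share the same core. Since m > 2 * hh the core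
  visits a vertex, so its displacement is at least 1 and controls that of the whole walk.\<close>

lemma moment_upper:
  assumes fin1: "finite (S1 m)" and fin0: "\<And>n. n \<in> {1..m} \<Longrightarrow> finite (S0 n)" and m: "m > 2 * hh"
  shows "M1 k m \<le> real NC * (4 * real hh) ^ k * (\<Sum>j\<le>2 * hh. \<Sum>n\<in>{1..m}. M0 k n * cpow hh g n (m - j))"
proof -
  define T where "T = (SIGMA j:{..2 * hh}. SIGMA n:{1..m}. RR n (m - j))"
  define G where "G = (\<lambda>t :: nat \<times> nat \<times> (('v list \<times> 'v set list) \<times> 'g list list). (4 * real hh) ^ k * saw_norm V0 E0 (fst (snd (snd t))) ^ k :: real)"
  define C where "C = (\<lambda>t :: nat \<times> nat \<times> (('v list \<times> 'v set list) \<times> 'g list list). {\<pi> \<in> CC (snd (snd t)). good (fst (snd (snd t))) \<pi>})"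
  have finT: "finite T" unfolding T_def using sum_RR fin0 by (intro finite_SigmaI) auto
  have mem: "mid_saw V0 E0 vs es \<and> length vs = n \<and> n \<ge> 1"
    if "(j, n, ((vs, es), \<gamma>s)) \<in> T" for j n vs es \<gamma>s
    using that S0_iff by (auto simp: T_def RR_def DS_def)
  have "sum (\<lambda>\<pi>. saw_norm V1 E1 \<pi> ^ k) (S1 m) \<le> real NC * sum G T"
  proof (rule sum_cover_le[OF fin1 finT, of C])
    show "S1 m \<subseteq> (\<Union>t\<in>T. C t)"
    proof
      fix \<pi> assume "\<pi> \<in> S1 m"
      then obtain vs es where p: "\<pi> = (vs, es)" "mid_saw V1 E1 vs es" "length vs = m" "hd es \<in> X1" by (cases \<pi>) (auto simp: S1_iff)
      obtain u A ea vs0 es0 \<gamma>s x B eb where "cut_form vs es u A ea vs0 es0 \<gamma>s x B eb"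
        using decompose[OF p(2,4)] p(3) m by auto
      then have d: "vs = map (Pair u) A @ dvs vs0 \<gamma>s @ map (Pair x) B"
        "es = map (image (Pair u)) ea @ des vs0 es0 \<gamma>s @ map (image (Pair x)) eb"
        "mid_saw V0 E0 vs0 es0" "valid vs0 es0 \<gamma>s" "hd es0 \<in> X0"
        "u \<in> hd es0" "set ea \<subseteq> edges Hv EH" "set A \<subseteq> Hv" "distinct A" "length ea = length A" "A \<noteq> [] \<longrightarrow> u \<in> W0"
        "x \<in> last es0" "set eb \<subseteq> edges Hv EH" "set B \<subseteq> Hv" "distinct B" "length eb = length B"
        unfolding cut_form_def by blast+
      have lA: "length A \<le> hh" "length B \<le> hh" using d distinct_length by auto
      define j where "j = length A + length B"
      have j: "j \<le> 2 * hh" using lA by (simp add: j_def)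
      have ls: "sum_list (map length \<gamma>s) = m - j" using d(1) p(3) length_dvs[OF d(4)] by (simp add: j_def)
      have ge: "sum_list (map length \<gamma>s) \<ge> length vs0"
      proof -
        have "length (dvs vs0 \<gamma>s) \<ge> length vs0" using d(4) 
          by (induction vs0 es0 \<gamma>s rule: valid.induct) (use GP_length in \<open>fastforce\<close>)+
        then show ?thesis using length_dvs[OF d(4)] by simp
      qed
      have "vs0 \<noteq> []"
      proof
        assume "vs0 = []"
        then have "\<gamma>s = []" using d(4) by simp
        then show False using ls j m by simp
      qed
      then have n: "length vs0 \<in> {1..m}" using ge ls by (auto simp: Suc_le_eq)
      have rr: "((vs0, es0), \<gamma>s) \<in> RR (length vs0) (m - j)" using d ls S0_iff by (auto simp: RR_def DS_def)
      have es0: "es0 \<noteq> []" "set es0 \<subseteq> Ed0" using d(3) by (auto simp: mid_saw_def)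
      note hdd = hd_des[OF es0(1), of vs0 \<gamma>s]
      have "good (vs0, es0) \<pi>" unfolding good_def
      proof
        show "\<exists>x\<in>hd (snd \<pi>). fst x \<in> hd (snd (vs0, es0))"
        proof (cases ea)
          case Nil
          then show ?thesis using p d(2) hdd hd_lift_good[of "hd es0"] es0 by (auto simp: subset_iff)
        next
          case (Cons e ea')
          then show ?thesis using p d(2,6,7) segment_good[of e u] by auto
        qed
        show "\<exists>y\<in>last (snd \<pi>). fst y \<in> last (snd (vs0, es0))"
        proof (cases eb rule: rev_cases)
          case Nil
          then show ?thesis using p d(2) last_des[OF d(3,4)] hdd hd_lift_good[of "last es0"] es0 by (auto simp: subset_iff)
        next
          case (snoc eb' e)
          then show ?thesis using p d(2,12,13) segment_good[of e x] by auto
        qed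
      qed
      moreover have "\<pi> \<in> CC ((vs0, es0), \<gamma>s)" unfolding p(1) d(1,2) by (rule in_CC) (use d lA in auto)
      ultimately have "\<pi> \<in> C (j, length vs0, ((vs0, es0), \<gamma>s))" by (simp add: C_def)
      moreover have "(j, length vs0, ((vs0, es0), \<gamma>s)) \<in> T" using j n rr by (simp add: T_def)
      ultimately show "\<pi> \<in> (\<Union>t\<in>T. C t)" by blast
    qed
    fix t assume t: "t \<in> T"
    obtain j n vs es \<gamma>s where tt: "t = (j, n, ((vs, es), \<gamma>s))" by (metis prod.exhaust)
    note mm = mem[OF t[unfolded tt]]
    have vne: "vs \<noteq> []" using mm by auto
    have "last es \<in> Ed0" using mid_saw_hd_last(3)[of V0 E0 vs es] mm vne by simp
    then have c: "finite (CC (snd (snd t))) \<and> card (CC (snd (snd t))) \<le> NC" using tt by (intro CC_card) simp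
    moreover have "C t \<subseteq> CC (snd (snd t))" by (auto simp: C_def)
    ultimately show "finite (C t) \<and> card (C t) \<le> NC" by (meson card_mono finite_subset order_trans)
    show "G t \<ge> 0" by (simp add: G_def saw_norm_nonneg)
    fix \<pi> assume "\<pi> \<in> S1 m" "\<pi> \<in> C t"
    then have "good (vs, es) \<pi>" "mid_saw V1 E1 (fst \<pi>) (snd \<pi>)" using tt S1_iff[of "fst \<pi>" "snd \<pi>"] by (auto simp: C_def)
    then have "saw_norm V1 E1 \<pi> \<le> 4 * real hh * saw_norm V0 E0 (vs, es)"
      using good_norm[of vs es "fst \<pi>" "snd \<pi>"] mm vne by simp
    then have "saw_norm V1 E1 \<pi> ^ k \<le> (4 * real hh * saw_norm V0 E0 (vs, es)) ^ k" by (intro power_mono saw_norm_nonneg)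
    then show "saw_norm V1 E1 \<pi> ^ k \<le> G t" by (simp add: G_def tt power_mult_distrib)
  qed (simp add: saw_norm_nonneg)
  also have "sum G T = (4 * real hh) ^ k * (\<Sum>j\<le>2 * hh. \<Sum>n\<in>{1..m}. M0 k n * cpow hh g n (m - j))"
  proof -
    have "sum G T = (\<Sum>j\<le>2 * hh. \<Sum>n\<in>{1..m}. \<Sum>r\<in>RR n (m - j). (4 * real hh) ^ k * saw_norm V0 E0 (fst r) ^ k)"
      unfolding T_def G_def using sum_RR fin0
      by (subst sum.Sigma, simp, simp, subst sum.Sigma) (auto simp: case_prod_unfold intro!: finite_SigmaI)
    also have "\<dots> = (\<Sum>j\<le>2 * hh. \<Sum>n\<in>{1..m}. (4 * real hh) ^ k * (M0 k n * cpow hh g n (m - j)))"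
      using sum_RR[OF fin0, of _ _ "\<lambda>\<pi>. saw_norm V0 E0 \<pi> ^ k"]
      by (intro sum.cong refl) (simp add: M0_def sum_distrib_left[symmetric])
    finally show ?thesis by (simp add: sum_distrib_left)
  qed
  finally show ?thesis by (simp add: M1_def mult.assoc)
qed


subsection \<open>Gadgets whose port-to-port paths all have the same length\<close>

lemma valid_iff:
  "length es = Suc (length vs) \<Longrightarrow> valid vs es \<gamma>s \<longleftrightarrow> length \<gamma>s = length vs \<and>
     (\<forall>i<length vs. \<gamma>s ! i \<in> GP (port (vs ! i) (es ! i)) (port (vs ! i) (es ! Suc i)))"
proof (induction vs arbitrary: es \<gamma>s)
  case (Cons v vs)
  obtain e es' where es: "es = e # es'" "length es' = Suc (length vs)" using Cons.prems by (cases es) auto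
  have hd: "hd es' = es' ! 0" using es by (cases es') auto
  show ?case
  proof (cases \<gamma>s)
    case (Cons \<gamma> \<gamma>s')
    then show ?thesis using Cons.IH[OF es(2), of \<gamma>s'] hd unfolding es(1) by (auto simp: less_Suc_eq_0_disj All_less_Suc2)
  qed (use es in auto)
qed auto

lemma set_dvs: "length \<gamma>s = length vs \<Longrightarrow> set (dvs vs \<gamma>s) = (\<Union>i<length vs. Pair (vs ! i) ` set (\<gamma>s ! i))"
proof (induction vs arbitrary: \<gamma>s)
  case (Cons v vs)
  then obtain \<gamma> \<gamma>s' where g: "\<gamma>s = \<gamma> # \<gamma>s'" "length \<gamma>s' = length vs" by (cases \<gamma>s) auto
  show ?case unfolding g(1) using Cons.IH[OF g(2)] by (simp add: lessThan_Suc_eq_insert_0 image_image)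
qed auto

lemma valid_snoc:
  assumes "valid vs es \<gamma>s" "length es = Suc (length vs)" "\<gamma> \<in> GP (port x (last es)) (port x e)"
  shows "valid (vs @ [x]) (es @ [e]) (\<gamma>s @ [\<gamma>])"
proof -
  have "length \<gamma>s = length vs" "\<And>i. i < length vs \<Longrightarrow> \<gamma>s ! i \<in> GP (port (vs ! i) (es ! i)) (port (vs ! i) (es ! Suc i))"
    using assms(1) valid_iff[OF assms(2)] by auto
  moreover have "last es = es ! length vs" using assms(2) by (metis diff_Suc_1 last_conv_nth length_0_conv nat.distinct(1))
  ultimately show ?thesis using assms(2,3) by (subst valid_iff) (auto simp: nth_append less_Suc_eq)
qed

lemma mid_saw_embed:
  assumes "x \<in> V0" "set es \<subseteq> edges Hv EH"
  shows "mid_saw V1 E1 (map (Pair x) vs) (map (image (Pair x)) es) \<longleftrightarrow> mid_saw Hv EH vs es"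
proof -
  have 1: "set (map (image (Pair x)) es) \<subseteq> Ed1" 
  proof
    fix e assume "e \<in> set (map (image (Pair x)) es)"
    then have "e \<in> internal x" using assms(2) unfolding internal_def by auto
    then show "e \<in> Ed1" using Ed1_cases assms(1) by blast
  qed
  have 2: "inj_on (image (Pair x)) (set es)" by (auto simp: inj_on_def inj_image_eq_iff)
  have 3: "inj_on (Pair x) (set vs)" by (auto simp: inj_on_def)
  have 4: "(x, a) \<in> Pair x ` e \<longleftrightarrow> a \<in> e" for a :: 'g and e by auto
  show ?thesis unfolding mid_saw_def using 1 2 3 assms
    by (auto simp: distinct_map lt_vertices_def 4)
qed

text \<open>An end piece inside one gadget, entered at the vertex c through an inherited edge. That
  edge is not listed in \<open>eb\<close>, hence \<open>eb\<close> and \<open>B\<close> have the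
  same length. The first vertex is split off because nothing inside the gadget precedes it.\<close>

definition tail :: "'g \<Rightarrow> 'g list \<Rightarrow> 'g set list \<Rightarrow> bool" where
  "tail c B eb \<longleftrightarrow> B \<noteq> [] \<and> hd B = c \<and> c \<in> Hv \<and> hd B \<notin> set (tl B) \<and> hd B \<in> hd eb \<and> mid_saw Hv EH (tl B) eb"

lemma tail_facts:
  assumes "tail c B eb"
  shows "B \<noteq> []" "hd B = c" "distinct B" "set B \<subseteq> Hv" "length eb = length B" "set eb \<subseteq> edges Hv EH" "length B \<le> hh" "length B \<ge> 1"
proof -
  obtain B' where B: "B = c # B'" using assms by (cases B) (auto simp: tail_def)
  show "B \<noteq> []" "hd B = c" "length B \<ge> 1" using B by auto
  show d: "distinct B" and s: "set B \<subseteq> Hv" and "length eb = length B" "set eb \<subseteq> edges Hv EH"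
    using assms unfolding B by (auto simp: tail_def mid_saw_def)
  show "length B \<le> hh" by (rule distinct_length[OF d s])
qed

lemma tail_edge_mem: "tail c B eb \<Longrightarrow> e \<in> set eb \<Longrightarrow> \<exists>b\<in>set B. b \<in> e"
proof -
  assume t: "tail c B eb" and e: "e \<in> set eb"
  obtain B' where B: "B = c # B'" using t by (cases B) (auto simp: tail_def)
  have m: "mid_saw Hv EH B' eb" "c \<in> hd eb" using t B by (auto simp: tail_def)
  obtain i where i: "i < length eb" "e = eb ! i" using e by (auto simp: in_set_conv_nth)
  show ?thesis
  proof (cases i)
    case 0
    have "eb ! 0 = hd eb" using i by (cases eb) auto
    then show ?thesis using 0 i m(2) B by (intro bexI[of _ c]) auto
  next
    case (Suc j)
    then have "j < length B'" using i m(1) by (simp add: mid_saw_def)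
    then show ?thesis using Suc i m(1) B by (intro bexI[of _ "B' ! j"]) (auto simp: mid_saw_def)
  qed
qed

lemma tail_block:
  assumes f: "f \<in> Ed0" "x \<in> f" and eb: "set eb \<subseteq> edges Hv EH" and B: "B \<noteq> []"
  shows "mid_saw V1 E1 (map (Pair x) B) (lift f # map (image (Pair x)) eb) \<longleftrightarrow> tail (port x f) B eb"
proof -
  obtain b B' where Bb: "B = b # B'" using B by (cases B) auto
  have x: "x \<in> V0" using f edges_subset by blast
  have l: "lift f \<in> Ed1" using f Ed1_cases by blast
  have nl: "lift f \<notin> set (map (image (Pair x)) eb)"
    using eb internal_not_lift[of "lift f" x] f by (auto simp: internal_def)
  have p: "port x f \<in> Hv" using port_in[OF f] gadget_facts(4) by blast
  have h: "(x, b) \<in> hd (map (image (Pair x)) eb) \<longleftrightarrow> b \<in> hd eb" if "eb \<noteq> []" using that by (cases eb) auto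
  have e: "eb \<noteq> []" if "mid_saw Hv EH B' eb" using that by (auto simp: mid_saw_def)
  show ?thesis unfolding Bb list.map mid_saw_Cons tail_def using l nl mid_saw_embed[OF x eb, of B'] p f x h e
    by (auto simp: mem_lift lt_vertices_def)
qed

lemma tail_automorphism:
  assumes f: "automorphism Hv EH f" and t: "tail c B eb"
  shows "tail (f c) (map f B) (map (image f) eb)"
proof -
  obtain B' where B: "B = c # B'" using t by (cases B) (auto simp: tail_def)
  have m: "mid_saw Hv EH B' eb" "c \<in> hd eb" "c \<notin> set B'" "c \<in> Hv" using t B by (auto simp: tail_def)
  have inj: "inj_on f Hv" and fH: "f c \<in> Hv" using f m(4) by (auto simp: automorphism_def bij_betw_def)
  have ne: "eb \<noteq> []" "set B' \<subseteq> Hv" using m by (auto simp: mid_saw_def)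
  have "f c \<notin> f ` set B'" using inj m(3,4) ne(2) by (auto simp: inj_on_def)
  then show ?thesis using automorphism_mid_saw[OF f m(1)] m(2) ne(1) fH unfolding B tail_def by (auto simp: hd_map)
qed

lemma Ports_eqI:
  assumes "a \<in> Ports" "b \<in> Ports" "c \<in> Ports" "a \<noteq> b" "a \<noteq> c" "b \<noteq> c"
  shows "{a, b, c} = Ports"
proof -
  have "card Ports = 3" using gadget_facts(5-7) by simp
  moreover have "card {a, b, c} = 3" using assms by simp
  moreover have "{a, b, c} \<subseteq> Ports" using assms by blast
  ultimately show ?thesis by (intro card_subset_eq) auto
qed

lemma Ports_distinct: "{a, b, c} = Ports \<Longrightarrow> a \<noteq> b \<and> a \<noteq> c \<and> b \<noteq> c"
proof -
  assume a: "{a, b, c} = Ports"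
  have "card Ports = 3" using gadget_facts(5-7) by simp
  then have "card {a, b, c} = 3" using a by simp
  then show ?thesis by (auto simp: card_insert_if split: if_splits)
qed

text \<open>The unvisited vertex x has three edges. Inner edges of the walk join visited vertices
  and cannot contain x, so only the first and the last edge must be avoided, and a third one is
  left.\<close>

lemma extend_end:
  assumes m: "mid_saw V0 E0 vs es" "vs \<noteq> []" and x: "x \<in> last es" "x \<notin> set vs"
  shows "\<exists>e\<in>Ed0. x \<in> e \<and> e \<noteq> last es \<and> mid_saw V0 E0 (vs @ [x]) (es @ [e])"
proof -
  have le: "last es \<in> Ed0" using mid_saw_hd_last(3)[OF m] .
  then have xV: "x \<in> V0" using x edges_subset by blast
  have "\<not> star x \<subseteq> {last es, hd es}"
  proof
    assume "star x \<subseteq> {last es, hd es}"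
    then have "card (star x) \<le> card {last es, hd es}" by (intro card_mono) auto
    also have "\<dots> \<le> 2" by (simp add: card_insert_if)
    finally show False using star_card[OF xV] by simp
  qed
  then obtain e where e: "e \<in> Ed0" "x \<in> e" "e \<noteq> last es" "e \<noteq> hd es" by (auto simp: star_def)
  note can = mid_saw_canonical[OF simple_graph_on[OF simple0] m]
  have "e \<notin> set es"
  proof
    assume "e \<in> set es"
    then have "e \<in> set (hd es # path_edges vs @ [last es])" using can(2) by simp
    then have "e \<in> set (path_edges vs)" using e by simp
    then show False using path_edges_subset e(2) x(2) by blast
  qed
  have ne: "es \<noteq> []" and ds: "distinct es" using m by (auto simp: mid_saw_def)
  have es: "es = butlast es @ [last es]" using ne by simp
  have "last es \<notin> set (butlast es)" using ds es by (metis distinct_append Int_iff empty_iff list.set_intros(1))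
  moreover have "e \<notin> set (butlast es)" using \<open>e \<notin> set es\<close> in_set_butlastD by metis
  moreover have "mid_saw V0 E0 [x] [last es, e]" using e le xV x by (auto simp: mid_saw_Cons mid_saw_Nil)
  moreover have "mid_saw V0 E0 vs (butlast es @ [last es])" using m es by simp
  moreover have "length (butlast es) = length vs" using mid_saw_length[OF m(1)] by simp
  ultimately have "mid_saw V0 E0 (vs @ [x]) (butlast es @ last es # [e])"
    using x(2) by (subst mid_saw_append) auto
  then have "mid_saw V0 E0 (vs @ [x]) (es @ [e])" using es by (metis append.assoc append_Cons append_Nil)
  then show ?thesis using e by blast
qed

lemma extend_start:
  assumes m: "mid_saw V0 E0 vs es" "vs \<noteq> []" and x: "x \<in> hd es" "x \<notin> set vs"
  shows "\<exists>e\<in>Ed0. x \<in> e \<and> e \<noteq> hd es \<and> mid_saw V0 E0 (x # vs) (e # es)"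
proof -
  have "es \<noteq> []" using m by (auto simp: mid_saw_def)
  then obtain e where e: "e \<in> Ed0" "x \<in> e" "e \<noteq> hd es" "mid_saw V0 E0 (rev vs @ [x]) (rev es @ [e])"
    using extend_end[OF mid_saw_rev[OF m(1)], of x] m x by (auto simp: last_rev)
  then show ?thesis using mid_saw_rev[OF e(4)] by auto
qed

end

locale monomial_gadget = lt_domain V0 E0 Hv EH w1 w2 w3 P W0
  for V0 :: "'v set" and E0 :: "'v \<Rightarrow> 'v \<Rightarrow> bool" and Hv :: "'g set" and EH :: "'g \<Rightarrow> 'g \<Rightarrow> bool"
    and w1 w2 w3 :: 'g and P :: "'v \<Rightarrow> 'v \<Rightarrow> 'g" and W0 :: "'v set" +
  fixes k0 :: nat
  assumes k0_pos: "g k0 > 0" and k0_only: "\<And>k. k \<in> {1..hh} \<Longrightarrow> k \<noteq> k0 \<Longrightarrow> g k = 0"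
begin

lemma GP_k0: "a \<in> Ports \<Longrightarrow> b \<in> Ports \<Longrightarrow> a \<noteq> b \<Longrightarrow> \<gamma> \<in> GP a b \<Longrightarrow> length \<gamma> = k0"
proof (rule ccontr)
  assume a: "a \<in> Ports" "b \<in> Ports" "a \<noteq> b" "\<gamma> \<in> GP a b" "length \<gamma> \<noteq> k0"
  have "g (length \<gamma>) = 0" using GP_length[OF a(4)] a(5) k0_only by blast
  then have "card (GPn a b (length \<gamma>)) = 0" using card_GPn[OF a(1-3), of "length \<gamma>"] by simp
  then show False using finite_GPn a(4) by (auto simp: GPn_def)
qed

lemma valid_sum:
  assumes "mid_saw V0 E0 vs es" "valid vs es \<gamma>s"
  shows "sum_list (map length \<gamma>s) = k0 * length vs"
  using assms
proof (induction vs es \<gamma>s rule: valid.induct)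
  case (2 v vs e es \<gamma> \<gamma>s)
  have m: "mid_saw V0 E0 vs es" "valid vs es \<gamma>s" "e \<in> Ed0" "v \<in> e" "v \<in> hd es" "e \<notin> set es" "\<gamma> \<in> GP (port v e) (port v (hd es))"
    using 2 by (auto simp: mid_saw_Cons)
  have "es \<noteq> []" using m(1) by (auto simp: mid_saw_def)
  then have "hd es \<in> Ed0" "hd es \<noteq> e" using m mid_saw_hd_edge by auto
  then have "length \<gamma> = k0" using m by (intro GP_k0[OF _ _ _ m(7)] port_in port_ne) auto
  then show ?case using 2(1)[OF m(1,2)] by simp
qed auto

text \<open>\<open>jf\<close> is the longest end piece in a gadget not visited before, \<open>jt\<close> the longest one that enters through
  the third port of a gadget already crossed. Completing a fresh gadget to a full crossing costs \<open>k0\<close>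
  steps, so \<open>J\<close> is the worst net excess.\<close>
definition free_lengths :: "nat set" where "free_lengths = {length B | B eb c. c \<in> Ports \<and> tail c B eb}"
definition touch_lengths :: "nat set" where
  "touch_lengths = {length B | B eb a b c \<gamma>. {a, b, c} = Ports \<and> tail c B eb \<and> \<gamma> \<in> GP a b \<and> set \<gamma> \<inter> set B = {}}"

definition jf :: nat where "jf = Max free_lengths"
definition jt :: nat where "jt = Max touch_lengths"
definition J :: nat where "J = max jt (jf - k0)"

lemma finite_lengths: "finite free_lengths" "finite touch_lengths"
proof -
  have "free_lengths \<subseteq> {..hh}" "touch_lengths \<subseteq> {..hh}" using tail_facts(7) by (auto simp: free_lengths_def touch_lengths_def)
  then show "finite free_lengths" "finite touch_lengths" using finite_subset by blast+
qed

text \<open>A path from a to b through c would contain a strictly shorter path from a to c, but all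
  paths between different ports have length k0.\<close>

lemma third_port_avoided:
  assumes p: "{a, b, c} = Ports" and \<gamma>: "\<gamma> \<in> GP a b"
  shows "c \<notin> set \<gamma>"
proof
  assume "c \<in> set \<gamma>"
  then obtain u v where uv: "\<gamma> = u @ c # v" by (auto dest: split_list)
  note d = Ports_distinct[OF p]
  have ab: "a \<in> Ports" "b \<in> Ports" "c \<in> Ports" using p by blast+
  have une: "u \<noteq> []" using \<gamma> uv d by (auto simp: GP_def)
  have vne: "v \<noteq> []" using \<gamma> uv d by (auto simp: GP_def)
  have "is_walk Hv EH ((u @ [c]) @ v)" using \<gamma> uv by (simp add: GP_def)
  then have "is_walk Hv EH (u @ [c])" using is_walk_append[of "u @ [c]" v Hv EH] vne by simp
  then have "u @ [c] \<in> GP a c" using \<gamma> uv une by (auto simp: GP_def)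
  then have "length (u @ [c]) = k0" using GP_k0[OF ab(1,3)] d by blast
  moreover have "length \<gamma> = k0" using GP_k0[OF ab(1,2) _ \<gamma>] d by blast
  ultimately show False using uv vne by (cases v) simp_all
qed

lemma touch_nonempty: "touch_lengths \<noteq> {}"
proof -
  have H: "w1 \<in> Hv" "w2 \<in> Hv" "w3 \<in> Hv" using gadget_facts(4) by blast+
  obtain \<gamma> where \<gamma>: "\<gamma> \<in> GP w1 w2" using GP_nonempty H by blast
  have c: "w3 \<notin> set \<gamma>" by (rule third_port_avoided[OF refl \<gamma>])
  obtain \<delta> where \<delta>: "\<delta> \<in> GP w3 w1" using GP_nonempty H by blast
  have "\<delta> \<noteq> [w3]"
  proof
    assume "\<delta> = [w3]"
    then show False using \<delta> gadget_facts(6) by (simp add: GP_def)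
  qed
  moreover have "\<delta> \<noteq> []" "hd \<delta> = w3" using \<delta> GP_ne by (auto simp: GP_def)
  ultimately obtain y \<delta>' where "\<delta> = w3 # y # \<delta>'" by (cases \<delta>; cases "tl \<delta>") auto
  then have y: "EH w3 y" using \<delta> by (auto simp: GP_def is_walk_simps)
  then have "{w3, y} \<in> edges Hv EH" using EH_in by (intro edgesI) auto
  then have "tail w3 [w3] [{w3, y}]" using H by (auto simp: tail_def mid_saw_Nil)
  then have "length [w3] \<in> touch_lengths" unfolding touch_lengths_def using \<gamma> c
    by (intro CollectI exI[of _ "[w3]"] exI[of _ "[{w3, y}]"] exI[of _ w1] exI[of _ w2] exI[of _ w3] exI[of _ \<gamma>]) auto
  then show ?thesis by blast
qed

lemma free_nonempty: "free_lengths \<noteq> {}"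
  using touch_nonempty unfolding touch_lengths_def free_lengths_def by blast

lemma jf_ge: "c \<in> Ports \<Longrightarrow> tail c B eb \<Longrightarrow> length B \<le> jf"
  unfolding jf_def by (rule Max_ge[OF finite_lengths(1)]) (auto simp: free_lengths_def)

lemma jt_ge: "{a, b, c} = Ports \<Longrightarrow> tail c B eb \<Longrightarrow> \<gamma> \<in> GP a b \<Longrightarrow> set \<gamma> \<inter> set B = {} \<Longrightarrow> length B \<le> jt"
  unfolding jt_def by (rule Max_ge[OF finite_lengths(2)]) (unfold touch_lengths_def, blast)

text \<open>Port symmetry carries an optimal end piece to any prescribed port, so the maximal length
  is available at every vertex of the old graph.\<close>

lemma jf_attained: "c' \<in> Ports \<Longrightarrow> \<exists>B eb. tail c' B eb \<and> length B = jf"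
proof -
  assume c': "c' \<in> Ports"
  have "jf \<in> free_lengths" unfolding jf_def by (rule Max_in[OF finite_lengths(1) free_nonempty])
  then obtain B eb c where B: "c \<in> Ports" "tail c B eb" "length B = jf" unfolding free_lengths_def by (elim CollectE exE conjE) (rule that, simp_all)
  have ex: "\<exists>a b. {a, b, c} = Ports" if "c \<in> Ports" for c
  proof -
    have "card (Ports - {c}) = 2" using that gadget_facts(5-7) by (subst card_Diff_subset) auto
    then obtain a b where "Ports - {c} = {a, b}" by (auto simp: card_2_iff)
    then have "Ports = {a, b, c}" using that by blast
    then show ?thesis by (intro exI[of _ a] exI[of _ b]) simp
  qed
  obtain a b where ab: "{a, b, c} = Ports" using ex[OF B(1)] by (elim exE)
  obtain a' b' where ab': "{a', b', c'} = Ports" using ex[OF c'] by (elim exE)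
  obtain f where f: "automorphism Hv EH f" "f c = c'" using port_automorphism[OF ab ab'] by (elim exE conjE)
  show ?thesis using tail_automorphism[OF f(1) B(2)] f(2) B(3) by (intro exI[of _ "map f B"] exI[of _ "map (image f) eb"]) simp
qed

lemma jt_attained:
  assumes p': "{a', b', c'} = Ports"
  shows "\<exists>B eb \<gamma>. tail c' B eb \<and> length B = jt \<and> \<gamma> \<in> GP a' b' \<and> set \<gamma> \<inter> set B = {}"
proof -
  have "jt \<in> touch_lengths" unfolding jt_def by (rule Max_in[OF finite_lengths(2) touch_nonempty])
  then obtain B eb a b c \<gamma> where B: "{a, b, c} = Ports" "tail c B eb" "length B = jt" "\<gamma> \<in> GP a b" "set \<gamma> \<inter> set B = {}"
    unfolding touch_lengths_def by (elim CollectE exE conjE) (rule that, simp_all)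
  obtain f where f: "automorphism Hv EH f" "f c = c'" "f a = a' \<and> f b = b' \<or> f a = b' \<and> f b = a'"
    using port_automorphism[OF B(1) p'] by (elim exE conjE)
  have inj: "inj_on f Hv" using f(1) by (simp add: automorphism_def bij_betw_def)
  have "set \<gamma> \<subseteq> Hv" "set B \<subseteq> Hv" using GP_set[OF B(4)] tail_facts(4)[OF B(2)] by auto
  then have dis: "f ` set \<gamma> \<inter> f ` set B = {}" using inj_on_image_Int[OF inj, of "set \<gamma>" "set B"] B(5) by simp
  have t: "tail c' (map f B) (map (image f) eb)" using tail_automorphism[OF f(1) B(2)] f(2) by simp
  show ?thesis
  proof (cases "f a = a' \<and> f b = b'")
    case True
    then have "map f \<gamma> \<in> GP a' b'" using GP_automorphism[OF f(1) B(4)] by simp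
    then show ?thesis using t dis B(3) by (intro exI[of _ "map f B"] exI[of _ "map (image f) eb"] exI[of _ "map f \<gamma>"]) simp
  next
    case False
    then have "map f \<gamma> \<in> GP b' a'" using GP_automorphism[OF f(1) B(4)] f(3) by auto
    then have "rev (map f \<gamma>) \<in> GP a' b'" by (rule GP_rev)
    then show ?thesis using t dis B(3) by (intro exI[of _ "map f B"] exI[of _ "map (image f) eb"] exI[of _ "rev (map f \<gamma>)"]) simp
  qed
qed

lemma three_ports:
  assumes "e1 \<in> Ed0" "e2 \<in> Ed0" "e3 \<in> Ed0" "x \<in> e1" "x \<in> e2" "x \<in> e3" "e1 \<noteq> e2" "e1 \<noteq> e3" "e2 \<noteq> e3"
  shows "{port x e1, port x e2, port x e3} = Ports"
  using assms by (intro Ports_eqI port_in port_ne)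

text \<open>The earlier crossing of the gadget occupies the two ports at its ends. An end piece
  disjoint from it can only enter through the third port, so it is a candidate in
  \<open>touch_lengths\<close>.\<close>

lemma touched_bound:
  assumes m: "mid_saw V0 E0 vs es" "valid vs es \<gamma>s" and x: "x \<in> set vs" "f \<in> Ed0" "x \<in> f"
    and t: "tail (port x f) B eb" and dis: "Pair x ` set B \<inter> set (dvs vs \<gamma>s) = {}"
  shows "length B \<le> jt"
proof -
  have l: "length es = Suc (length vs)" by (rule mid_saw_length[OF m(1)])
  have v: "length \<gamma>s = length vs" "\<And>i. i < length vs \<Longrightarrow> \<gamma>s ! i \<in> GP (port (vs ! i) (es ! i)) (port (vs ! i) (es ! Suc i))"
    using m(2) valid_iff[OF l] by auto
  obtain i where i: "i < length vs" "vs ! i = x" using x(1) by (auto simp: in_set_conv_nth)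
  have \<gamma>: "\<gamma>s ! i \<in> GP (port x (es ! i)) (port x (es ! Suc i))" using v(2)[OF i(1)] i(2) by simp
  have "Pair x ` set (\<gamma>s ! i) \<subseteq> set (dvs vs \<gamma>s)" unfolding set_dvs[OF v(1)] using i by blast
  then have d: "set (\<gamma>s ! i) \<inter> set B = {}" using dis by blast
  have hB: "port x f \<in> set B" using tail_facts(1,2)[OF t] by (metis hd_in_set)
  have gne: "\<gamma>s ! i \<noteq> []" by (rule GP_ne[OF \<gamma>])
  have ends: "port x (es ! i) \<in> set (\<gamma>s ! i)" "port x (es ! Suc i) \<in> set (\<gamma>s ! i)"
    using hd_in_set[OF gne] last_in_set[OF gne] \<gamma> by (simp_all add: GP_def)
  have e: "es ! i \<in> Ed0" "es ! Suc i \<in> Ed0" "x \<in> es ! i" "x \<in> es ! Suc i" "es ! i \<noteq> es ! Suc i"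
    using m(1) i by (auto simp: mid_saw_def nth_eq_iff_index_eq subset_iff)
  have "f \<noteq> es ! i" "f \<noteq> es ! Suc i" using ends hB d by blast+
  then have "{port x (es ! i), port x (es ! Suc i), port x f} = Ports" using e x by (intro three_ports) auto
  then show ?thesis using jt_ge[OF _ t \<gamma> d] by simp
qed


definition dropF :: "('v list \<times> 'v set list) \<times> 'g list list \<Rightarrow> ('v list \<times> 'v set list) \<times> 'g list list" where
  "dropF r = ((tl (fst (fst r)), tl (snd (fst r))), tl (snd r))"

definition dropL :: "('v list \<times> 'v set list) \<times> 'g list list \<Rightarrow> ('v list \<times> 'v set list) \<times> 'g list list" where
  "dropL r = ((butlast (fst (fst r)), butlast (snd (fst r))), butlast (snd r))"

text \<open>After completion the original core is r with neither, one or both of its end gadgets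
  removed; the four sets cover these cases. The guard excludes an empty edge list, for which
  \<open>last\<close> is unspecified and the bound on \<open>CC\<close> would fail to apply.\<close>

definition CCx where
  "CCx r = CC r \<union> CC (dropF r) \<union> CC (dropL r) \<union> (if butlast (tl (snd (fst r))) = [] then {} else CC (dropL (dropF r)))"

text \<open>An end piece in a fresh gadget is replaced by a full crossing: at most jf vertices are
  traded for k0, an excess of at most J. An end piece in a gadget already crossed is discarded, an
  excess of at most jt. Hypothesis \<open>nl\<close> keeps the two completions in different gadgets,
  and u in W0 puts the new first edge into X0.\<close>

lemma complete_walk:
  assumes cut: "cut_form vs es u A ea vs0 es0 \<gamma>s x B eb" and dist: "distinct vs" and ne: "vs0 \<noteq> []"
    and nl: "\<not> (A \<noteq> [] \<and> B \<noteq> [] \<and> u = x)"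
  shows "\<exists>n r. r \<in> RR n (k0 * n) \<and> n \<ge> 1 \<and> k0 * n \<le> length vs + 2 * k0 \<and> length vs \<le> k0 * n + 2 * J
     \<and> good (fst r) (vs, es) \<and> (vs, es) \<in> CCx r"
proof -
  have d: "vs = map (Pair u) A @ dvs vs0 \<gamma>s @ map (Pair x) B"
    "es = map (image (Pair u)) ea @ des vs0 es0 \<gamma>s @ map (image (Pair x)) eb"
    "mid_saw V0 E0 vs0 es0" "valid vs0 es0 \<gamma>s" "hd es0 \<in> X0"
    "u \<in> hd es0" "set ea \<subseteq> edges Hv EH" "set A \<subseteq> Hv" "distinct A" "length ea = length A" "A \<noteq> [] \<longrightarrow> u \<in> W0"
    "x \<in> last es0" "set eb \<subseteq> edges Hv EH" "set B \<subseteq> Hv" "distinct B" "length eb = length B"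
    and mA: "mid_saw V1 E1 (map (Pair u) A) (map (image (Pair u)) ea @ [lift (hd es0)])"
    and mB: "mid_saw V1 E1 (map (Pair x) B) (lift (last es0) # map (image (Pair x)) eb)"
    using cut unfolding cut_form_def by blast+
  have lA: "length A \<le> hh" "length B \<le> hh" using d distinct_length by auto
  note ends = mid_saw_hd_last[OF d(3) ne]
  define n where "n = length vs0"
  have n1: "n \<ge> 1" using ne by (simp add: n_def Suc_le_eq)
  have len: "length vs = length A + k0 * n + length B" using d(1) length_dvs[OF d(4)] valid_sum[OF d(3,4)] by (simp add: n_def)
  have l0: "length es0 = Suc (length vs0)" by (rule mid_saw_length[OF d(3)])
  have es0: "es0 \<noteq> []" "set es0 \<subseteq> Ed0" using d(3) by (auto simp: mid_saw_def)
  note hdd = hd_des[OF es0(1), of vs0 \<gamma>s]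
  have uV: "u \<in> V0" "x \<in> V0" using d(6,12) ends edges_subset by blast+
  have tA: "tail (port u (hd es0)) (rev A) (rev ea)" if "A \<noteq> []"
  proof -
    have "mid_saw V1 E1 (map (Pair u) (rev A)) (lift (hd es0) # map (image (Pair u)) (rev ea))"
      using mid_saw_rev[OF mA] by (simp add: rev_map)
    then show ?thesis using tail_block[OF ends(2) d(6), of "rev ea" "rev A"] that d(7) by simp
  qed
  have tB: "tail (port x (last es0)) B eb" if "B \<noteq> []"
    using tail_block[OF ends(3) d(12) d(13) that] mB by blast
  have disA: "Pair u ` set (rev A) \<inter> set (dvs vs0 \<gamma>s) = {}" using dist unfolding d(1) by auto
  have disB: "Pair x ` set B \<inter> set (dvs vs0 \<gamma>s) = {}" using dist unfolding d(1) by auto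
  define fA where "fA \<longleftrightarrow> A \<noteq> [] \<and> u \<notin> set vs0"
  define fB where "fB \<longleftrightarrow> B \<noteq> [] \<and> x \<notin> set vs0"
  \<comment> \<open>In the fresh case jf \<le> k0 + (jf - k0) also holds when the truncated
    difference is 0.\<close>
  have bA: "length A \<le> (if fA then k0 + J else J)"
  proof (cases "A = []")
    case False
    show ?thesis
    proof (cases fA)
      case True
      have "length (rev A) \<le> jf" by (rule jf_ge[OF port_in[OF ends(2) d(6)] tA[OF False]])
      then show ?thesis using True by (simp add: J_def)
    next
      case nf: False
      then have "u \<in> set vs0" using False by (simp add: fA_def)
      then have "length (rev A) \<le> jt" using touched_bound[OF d(3,4) _ ends(2) d(6) tA[OF False] disA] by blast
      then show ?thesis using nf by (simp add: J_def)
    qed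
  qed simp
  have bB: "length B \<le> (if fB then k0 + J else J)"
  proof (cases "B = []")
    case False
    show ?thesis
    proof (cases fB)
      case True
      have "length B \<le> jf" by (rule jf_ge[OF port_in[OF ends(3) d(12)] tB[OF False]])
      then show ?thesis using True by (simp add: J_def)
    next
      case nf: False
      then have "x \<in> set vs0" using False by (simp add: fB_def)
      then have "length B \<le> jt" using touched_bound[OF d(3,4) _ ends(3) d(12) tB[OF False] disB] by blast
      then show ?thesis using nf by (simp add: J_def)
    qed
  qed simp
  have cc: "(vs, es) \<in> CC ((vs0, es0), \<gamma>s)" unfolding d(1,2) by (rule in_CC) (use d lA in auto)
  have gA: "\<exists>y\<in>hd es. fst y \<in> hd es0"
  proof (cases ea)
    case Nil
    then show ?thesis using d(2) hdd hd_lift_good[of "hd es0"] ends by auto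
  next
    case (Cons e ea')
    then show ?thesis using d(2,6,7) segment_good[of e u] by auto
  qed
  have gA': "\<exists>y\<in>hd es. fst y = u" if Ane: "A \<noteq> []"
  proof -
    obtain e ea' where "ea = e # ea'" using Ane d(10) by (cases ea) auto
    then show ?thesis using d(2,7) segment_good[of e u] by auto
  qed
  have gB: "\<exists>y\<in>last es. fst y \<in> last es0"
  proof (cases eb rule: rev_cases)
    case Nil
    then show ?thesis using d(2) last_des[OF d(3,4)] hdd hd_lift_good[of "last es0"] ends by auto
  next
    case (snoc eb' e)
    then show ?thesis using d(2,12,13) segment_good[of e x] by auto
  qed
  have gB': "\<exists>y\<in>last es. fst y = x" if "B \<noteq> []"
  proof -
    have "eb \<noteq> []" using that d(16) by auto
    then obtain e eb' where "eb = eb' @ [e]" by (cases eb rule: rev_cases) auto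
    then show ?thesis using d(2,13) segment_good[of e x] by auto
  qed
  \<comment> \<open>Complete the first gadget if it is entered for the first time, then the last one.\<close>
  obtain vs1 es1 \<gamma>s1 where w1: "mid_saw V0 E0 vs1 es1" "valid vs1 es1 \<gamma>s1" "hd es1 \<in> X0" "length vs1 = n + (if fA then 1 else 0)"
    "last es1 = last es0" "set vs1 \<subseteq> insert u (set vs0)" "\<not> fA \<longrightarrow> set vs1 = set vs0" "\<exists>y\<in>hd es. fst y \<in> hd es1"
    "((vs0, es0), \<gamma>s) = (if fA then dropF ((vs1, es1), \<gamma>s1) else ((vs1, es1), \<gamma>s1))"
  proof (cases fA)
    case True
    then have uf: "u \<notin> set vs0" "A \<noteq> []" by (auto simp: fA_def)
    obtain e where e: "e \<in> Ed0" "u \<in> e" "e \<noteq> hd es0" "mid_saw V0 E0 (u # vs0) (e # es0)" using extend_start[OF d(3) ne d(6) uf(1)] by blast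
    have pH: "port u e \<in> Hv" "port u (hd es0) \<in> Hv" using port_in[OF e(1,2)] port_in[OF ends(2) d(6)] gadget_facts(4) by blast+
    obtain \<gamma> where \<gamma>: "\<gamma> \<in> GP (port u e) (port u (hd es0))" using GP_nonempty[OF pH] by blast
    have "e \<in> X0" using e d(11) uf by (auto simp: incident_edges_def)
    then show ?thesis using that[of "u # vs0" "e # es0" "\<gamma> # \<gamma>s"] e \<gamma> d(4) True gA' uf es0 by (auto simp: n_def dropF_def)
  next
    case False
    then show ?thesis using that[of vs0 es0 \<gamma>s] d gA by (auto simp: n_def)
  qed
  have ne1: "vs1 \<noteq> []" using w1(4) n1 by auto
  have l1: "length es1 = Suc (length vs1)" by (rule mid_saw_length[OF w1(1)])
  obtain vs2 es2 \<gamma>s2 where w2: "mid_saw V0 E0 vs2 es2" "valid vs2 es2 \<gamma>s2" "hd es2 = hd es1" "length vs2 = length vs1 + (if fB then 1 else 0)"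
    "\<exists>y\<in>last es. fst y \<in> last es2"
    "((vs1, es1), \<gamma>s1) = (if fB then dropL ((vs2, es2), \<gamma>s2) else ((vs2, es2), \<gamma>s2))"
  proof (cases fB)
    case True
    then have xf: "x \<notin> set vs0" "B \<noteq> []" by (auto simp: fB_def)
    have "x \<notin> set vs1"
    proof (cases fA)
      case True
      then have "u \<noteq> x" using nl xf by (auto simp: fA_def)
      then show ?thesis using w1(6) xf(1) by auto
    next
      case False
      then show ?thesis using w1(7) xf(1) by simp
    qed
    moreover have "x \<in> last es1" using w1(5) d(12) by simp
    ultimately obtain e where e: "e \<in> Ed0" "x \<in> e" "e \<noteq> last es1" "mid_saw V0 E0 (vs1 @ [x]) (es1 @ [e])"
      using extend_end[OF w1(1) ne1] by blast
    have pH: "port x e \<in> Hv" "port x (last es1) \<in> Hv"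
      using port_in[OF e(1,2)] port_in[OF ends(3) d(12)] gadget_facts(4) unfolding w1(5) by blast+
    obtain \<gamma> where \<gamma>: "\<gamma> \<in> GP (port x (last es1)) (port x e)" using GP_nonempty[OF pH(2,1)] by blast
    have "valid (vs1 @ [x]) (es1 @ [e]) (\<gamma>s1 @ [\<gamma>])" by (rule valid_snoc[OF w1(2) l1 \<gamma>])
    moreover have "hd (es1 @ [e]) = hd es1" using l1 by (cases es1) auto
    ultimately show ?thesis using that[of "vs1 @ [x]" "es1 @ [e]" "\<gamma>s1 @ [\<gamma>]"] e True gB' xf by (auto simp: dropL_def)
  next
    case False
    then show ?thesis using that[of vs1 es1 \<gamma>s1] w1 gB by auto
  qed
  define n' where "n' = length vs2"
  have n': "n' = n + (if fA then 1 else 0) + (if fB then 1 else 0)" using w2(4) w1(4) by (simp add: n'_def)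
  have rr: "((vs2, es2), \<gamma>s2) \<in> RR n' (k0 * n')"
    using w2 w1(3) S0_iff valid_sum[OF w2(1,2)] by (auto simp: RR_def DS_def n'_def)
  have "(vs, es) \<in> CCx ((vs2, es2), \<gamma>s2)"
  proof -
    have c1: "((vs0, es0), \<gamma>s) = (if fA then dropF ((vs1, es1), \<gamma>s1) else ((vs1, es1), \<gamma>s1))" by (rule w1(9))
    have sw: "dropF (dropL r) = dropL (dropF r)" for r by (simp add: dropF_def dropL_def butlast_tl)
    have both: "butlast (tl es2) \<noteq> []" if "fA" "fB"
    proof -
      have "((vs0, es0), \<gamma>s) = dropL (dropF ((vs2, es2), \<gamma>s2))" using c1 w2(6) that by (simp add: sw)
      then show ?thesis using es0(1) by (simp add: dropF_def dropL_def)
    qed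
    show ?thesis
    proof (cases fA; cases fB)
      assume "fA" "fB"
      then have "(vs, es) \<in> CC (dropL (dropF ((vs2, es2), \<gamma>s2)))" using cc c1 w2(6) by (simp add: sw)
      then show ?thesis using both \<open>fA\<close> \<open>fB\<close> by (simp add: CCx_def)
    qed (use cc c1 w2(6) in \<open>simp_all add: CCx_def\<close>)
  qed
  moreover have "good (vs2, es2) (vs, es)" using w2(3,5) w1(8) by (simp add: good_def)
  moreover have "k0 * n' \<le> length vs + 2 * k0" "length vs \<le> k0 * n' + 2 * J"
    using len bA bB unfolding n' by (auto simp: algebra_simps split: if_splits)
  moreover have "n' \<ge> 1" using n' n1 by simp
  ultimately show ?thesis using rr by (intro exI[of _ n'] exI[of _ "((vs2, es2), \<gamma>s2)"]) simp
qed

text \<open>Each walk with large displacement is charged to a completed walk, at most 4 * NC of them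
  to the same one, since four cores are possible. The remaining walks contribute a bounded square
  each and are kept as a separate multiple of the count.\<close>

lemma moment_upper_monomial:
  assumes fin1: "finite (S1 m)" and fin0: "\<And>n. n \<ge> 1 \<Longrightarrow> finite (S0 n)" and m: "m > 2 * hh"
  shows "M1 2 m \<le> (1 + real hh)\<^sup>2 * real (card (S1 m))
     + real (4 * NC) * (4 * real hh)\<^sup>2 * (\<Sum>n\<in>{n. 1 \<le> n \<and> k0 * n \<le> m + 2 * k0 \<and> m \<le> k0 * n + 2 * J}. M0 2 n * cpow hh g n (k0 * n))"
proof -
  define I where "I = {n. 1 \<le> n \<and> k0 * n \<le> m + 2 * k0 \<and> m \<le> k0 * n + 2 * J}"
  have k01: "k0 \<ge> 1"
  proof (rule ccontr)
    assume "\<not> k0 \<ge> 1"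
    then have "GPn w1 w2 k0 = {}" using GP_length by (fastforce simp: GPn_def)
    then show False using k0_pos by (simp add: g_def)
  qed
  have finI: "finite I"
  proof (rule finite_subset)
    show "I \<subseteq> {..m + 2 * k0}"
    proof
      fix n assume "n \<in> I"
      then have "k0 * n \<le> m + 2 * k0" by (simp add: I_def)
      moreover have "n \<le> k0 * n" using k01 by simp
      ultimately show "n \<in> {..m + 2 * k0}" by (simp only: atMost_iff)
    qed
  qed simp
  \<comment> \<open>If both end pieces lie in the gadget of one vertex u, the two ends of the walk
    are within distance 1 + hh. Removing \<open>Sb\<close> therefore secures the hypothesis
    \<open>nl\<close> of \<open>complete_walk\<close>.\<close>
  define Sb where "Sb = {\<pi> \<in> S1 m. saw_norm V1 E1 \<pi> \<le> 1 + real hh}"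
  define Sc where "Sc = S1 m - Sb"
  define T where "T = (SIGMA n:I. RR n (k0 * n))"
  define G where "G = (\<lambda>t :: nat \<times> (('v list \<times> 'v set list) \<times> 'g list list). (4 * real hh)\<^sup>2 * (saw_norm V0 E0 (fst (snd t)))\<^sup>2 :: real)"
  define C where "C = (\<lambda>t :: nat \<times> (('v list \<times> 'v set list) \<times> 'g list list). {\<pi> \<in> CCx (snd t). good (fst (snd t)) \<pi> \<and> \<pi> \<in> Sc})"
  have I1: "n \<ge> 1" if "n \<in> I" for n using that by (simp add: I_def)
  have finT: "finite T" unfolding T_def using sum_RR fin0 I1 finI by (intro finite_SigmaI) auto
  have "M1 2 m = sum (\<lambda>\<pi>. (saw_norm V1 E1 \<pi>)\<^sup>2) Sb + sum (\<lambda>\<pi>. (saw_norm V1 E1 \<pi>)\<^sup>2) Sc"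
    unfolding M1_def Sc_def using fin1 by (subst sum.subset_diff[of Sb]) (auto simp: Sb_def)
  moreover have "sum (\<lambda>\<pi>. (saw_norm V1 E1 \<pi>)\<^sup>2) Sb \<le> (1 + real hh)\<^sup>2 * real (card (S1 m))"
  proof -
    have "sum (\<lambda>\<pi>. (saw_norm V1 E1 \<pi>)\<^sup>2) Sb \<le> sum (\<lambda>\<pi>. (1 + real hh)\<^sup>2) Sb"
      by (intro sum_mono power_mono saw_norm_nonneg) (simp add: Sb_def)
    also have "\<dots> \<le> sum (\<lambda>\<pi>. (1 + real hh)\<^sup>2) (S1 m)" using fin1 by (intro sum_mono2) (auto simp: Sb_def)
    finally show ?thesis by (simp add: mult.commute)
  qed
  moreover have "sum (\<lambda>\<pi>. (saw_norm V1 E1 \<pi>)\<^sup>2) Sc \<le> real (4 * NC) * sum G T"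
  proof (rule sum_cover_le[OF _ finT, of _ C])
    show "finite Sc" using fin1 by (simp add: Sc_def)
    show "Sc \<subseteq> (\<Union>t\<in>T. C t)"
    proof
      fix \<pi> assume Sc: "\<pi> \<in> Sc"
      then obtain vs es where p: "\<pi> = (vs, es)" "mid_saw V1 E1 vs es" "length vs = m" "hd es \<in> X1" "\<not> saw_norm V1 E1 \<pi> \<le> 1 + real hh"
        by (cases \<pi>) (auto simp: S1_iff Sc_def Sb_def)
      obtain u A ea vs0 es0 \<gamma>s x B eb where cut: "cut_form vs es u A ea vs0 es0 \<gamma>s x B eb"
        using decompose[OF p(2,4)] p(3) m by auto
      then have d: "vs = map (Pair u) A @ dvs vs0 \<gamma>s @ map (Pair x) B"
        "es = map (image (Pair u)) ea @ des vs0 es0 \<gamma>s @ map (image (Pair x)) eb"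
        "valid vs0 es0 \<gamma>s" "set A \<subseteq> Hv" "distinct A" "set B \<subseteq> Hv" "distinct B" "length ea = length A" "length eb = length B"
        "set ea \<subseteq> edges Hv EH" "set eb \<subseteq> edges Hv EH" "A \<noteq> [] \<longrightarrow> u \<in> W0"
        unfolding cut_form_def by blast+
      have lA: "length A \<le> hh" "length B \<le> hh" using d distinct_length by auto
      have ne: "vs0 \<noteq> []" using d(1,3) lA p(3) m by auto
      have dv: "distinct vs" using p(2) by (simp add: mid_saw_def)
      have nl: "\<not> (A \<noteq> [] \<and> B \<noteq> [] \<and> u = x)"
      proof
        assume a: "A \<noteq> [] \<and> B \<noteq> [] \<and> u = x"
        obtain e ea' where e: "ea = e # ea'" using a d(8) by (cases ea) auto
        have "eb \<noteq> []" using a d(9) by auto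
        then obtain f eb' where f: "eb = eb' @ [f]" by (cases eb rule: rev_cases) auto
        have "hd es = Pair u ` e" "e \<in> edges Hv EH" using d(2,10) e by auto
        then obtain y where y: "y \<in> hd es" "fst y = u" using segment_good[of e u] by metis
        have "last es = Pair u ` f" "f \<in> edges Hv EH" using d(2,11) f a by auto
        then obtain z where z: "z \<in> last es" "fst z = u" using segment_good[of f u] by metis
        have es: "es \<noteq> []" "set es \<subseteq> Ed1" using p(2) by (auto simp: mid_saw_def)
        have E: "hd es \<in> Ed1" "last es \<in> Ed1" using es by auto
        have V: "y \<in> V1" "z \<in> V1" using E y z edges_subset by blast+
        have "gdist V1 E1 y z \<le> hh * (gdist V0 E0 (fst y) (fst z) + 1)" by (rule gdist_lift[OF V])
        also have "\<dots> = hh" using y z V gdist_self[of u V0 E0] by (auto simp: lt_vertices_def)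
        finally have "mid_dist V1 E1 (hd es) (last es) \<le> 1 + real hh"
          using mid_dist_le[of "hd es" "last es" y z V1 E1] Ed1_finite E y z by simp
        then show False using p(1,5) by (simp add: saw_norm_def)
      qed
      obtain n r where r: "r \<in> RR n (k0 * n)" "n \<ge> 1" "k0 * n \<le> length vs + 2 * k0" "length vs \<le> k0 * n + 2 * J"
        "good (fst r) (vs, es)" "(vs, es) \<in> CCx r" using complete_walk[OF cut dv ne nl] by blast
      have "(n, r) \<in> T" using r p(3) by (simp add: T_def I_def)
      moreover have "\<pi> \<in> C (n, r)" using r p Sc by (simp add: C_def)
      ultimately show "\<pi> \<in> (\<Union>t\<in>T. C t)" by blast
    qed
    fix t assume t: "t \<in> T"
    obtain n vs es \<gamma>s where tt: "t = (n, ((vs, es), \<gamma>s))" by (metis prod.exhaust)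
    have mm: "mid_saw V0 E0 vs es" "length vs = n" "n \<ge> 1" using t S0_iff I1 by (auto simp: T_def RR_def tt)
    have vne: "vs \<noteq> []" using mm by auto
    show "G t \<ge> 0" by (simp add: G_def)
    show "finite (C t) \<and> card (C t) \<le> 4 * NC"
    proof -
      have l: "length es = Suc (length vs)" "set es \<subseteq> Ed0" using mm(1) by (auto simp: mid_saw_def)
      have CCe: "finite (CC r) \<and> card (CC r) \<le> NC" if "snd (fst r) \<noteq> []" "set (snd (fst r)) \<subseteq> Ed0" for r
        using that by (intro CC_card) auto
      have le: "es \<noteq> []" "tl es \<noteq> []" "butlast es \<noteq> []" using l vne by (cases es; cases "tl es"; auto)+
      have c: "finite (CC (snd t)) \<and> card (CC (snd t)) \<le> NC" using le l by (intro CCe) (auto simp: tt)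
      have c1: "finite (CC (dropF (snd t))) \<and> card (CC (dropF (snd t))) \<le> NC"
        using le l by (intro CCe) (auto simp: tt dropF_def dest: list.set_sel(2))
      have c2: "finite (CC (dropL (snd t))) \<and> card (CC (dropL (snd t))) \<le> NC"
        using le l by (intro CCe) (auto simp: tt dropL_def dest: in_set_butlastD)
      show ?thesis
      proof (cases "butlast (tl es) = []")
        case False
        have c3: "finite (CC (dropL (dropF (snd t)))) \<and> card (CC (dropL (dropF (snd t)))) \<le> NC"
          using False l le by (intro CCe) (auto simp: tt dropL_def dropF_def dest!: in_set_butlastD dest: list.set_sel(2))
        have "card (CCx (snd t)) \<le> card (CC (snd t)) + card (CC (dropF (snd t))) + card (CC (dropL (snd t))) + card (CC (dropL (dropF (snd t))))"
          using False unfolding CCx_def tt by simp (meson add_right_mono card_Un_le order_trans)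
        then have "finite (CCx (snd t)) \<and> card (CCx (snd t)) \<le> 4 * NC" using c c1 c2 c3 by (simp add: CCx_def)
        moreover have "C t \<subseteq> CCx (snd t)" by (auto simp: C_def)
        ultimately show ?thesis by (meson card_mono finite_subset order_trans)
      next
        case True
        have "card (CCx (snd t)) \<le> card (CC (snd t)) + card (CC (dropF (snd t))) + card (CC (dropL (snd t)))"
          using True unfolding CCx_def tt by simp (meson add_right_mono card_Un_le order_trans)
        then have "finite (CCx (snd t)) \<and> card (CCx (snd t)) \<le> 4 * NC" using c c1 c2 True by (simp add: CCx_def tt)
        moreover have "C t \<subseteq> CCx (snd t)" by (auto simp: C_def)
        ultimately show ?thesis by (meson card_mono finite_subset order_trans)
      qed
    qed
    fix \<pi> assume "\<pi> \<in> Sc" "\<pi> \<in> C t"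
    then have "good (vs, es) \<pi>" "mid_saw V1 E1 (fst \<pi>) (snd \<pi>)" using tt S1_iff[of "fst \<pi>" "snd \<pi>"] by (auto simp: C_def Sc_def)
    then have "saw_norm V1 E1 \<pi> \<le> 4 * real hh * saw_norm V0 E0 (vs, es)"
      using good_norm[of vs es "fst \<pi>" "snd \<pi>"] mm vne by simp
    then have "(saw_norm V1 E1 \<pi>)\<^sup>2 \<le> (4 * real hh * saw_norm V0 E0 (vs, es))\<^sup>2" by (intro power_mono saw_norm_nonneg)
    then show "(saw_norm V1 E1 \<pi>)\<^sup>2 \<le> G t" by (simp add: G_def tt power_mult_distrib)
  qed simp
  moreover have "sum G T = (4 * real hh)\<^sup>2 * (\<Sum>n\<in>I. M0 2 n * cpow hh g n (k0 * n))"
  proof -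
    have "sum G T = (\<Sum>n\<in>I. \<Sum>r\<in>RR n (k0 * n). (4 * real hh)\<^sup>2 * (saw_norm V0 E0 (fst r))\<^sup>2)"
      unfolding T_def G_def using sum_RR fin0 I1 finI by (subst sum.Sigma) (auto simp: case_prod_unfold)
    also have "\<dots> = (\<Sum>n\<in>I. (4 * real hh)\<^sup>2 * (M0 2 n * cpow hh g n (k0 * n)))"
      using sum_RR[OF fin0[OF I1], of _ _ "\<lambda>\<pi>. (saw_norm V0 E0 \<pi>)\<^sup>2"]
      by (intro sum.cong refl) (simp add: M0_def sum_distrib_left[symmetric])
    finally show ?thesis by (simp add: sum_distrib_left)
  qed
  ultimately show ?thesis by (simp add: I_def mult.assoc)
qed


text \<open>The vertices beyond the first and last mid-edge of a walk.\<close>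
definition src :: "'v list \<Rightarrow> 'v set list \<Rightarrow> 'v" where "src vs es = the_elem (hd es - {hd vs})"
definition dst :: "'v list \<Rightarrow> 'v set list \<Rightarrow> 'v" where "dst vs es = the_elem (last es - {last vs})"

lemma other_end:
  assumes "e \<in> Ed0" "a \<in> e"
  shows "e = {the_elem (e - {a}), a}" "the_elem (e - {a}) \<noteq> a" "the_elem (e - {a}) \<in> V0"
proof -
  obtain b where b: "e = {a, b}" "a \<noteq> b" "b \<in> V0" using assms by (elim Ed0E) (auto simp: insert_commute)
  then have "e - {a} = {b}" by auto
  then have "the_elem (e - {a}) = b" by simp
  then show "e = {the_elem (e - {a}), a}" "the_elem (e - {a}) \<noteq> a" "the_elem (e - {a}) \<in> V0" using b by auto
qed

lemma src_dst:
  assumes "mid_saw V0 E0 vs es" "vs \<noteq> []"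
  shows "hd es = {src vs es, hd vs}" "src vs es \<noteq> hd vs" "src vs es \<in> V0"
    "last es = {dst vs es, last vs}" "dst vs es \<noteq> last vs" "dst vs es \<in> V0"
  using other_end[of "hd es" "hd vs"] other_end[of "last es" "last vs"] mid_saw_hd_last[OF assms]
    mid_saw_canonical(4,5)[OF simple_graph_on[OF simple0] assms] unfolding src_def dst_def by auto

lemma src_eqI: "mid_saw V0 E0 vs es \<Longrightarrow> vs \<noteq> [] \<Longrightarrow> u \<in> hd es \<Longrightarrow> u \<noteq> hd vs \<Longrightarrow> src vs es = u"
  using src_dst(1)[of vs es] by auto

lemma dst_eqI: "mid_saw V0 E0 vs es \<Longrightarrow> vs \<noteq> [] \<Longrightarrow> u \<in> last es \<Longrightarrow> u \<noteq> last vs \<Longrightarrow> dst vs es = u"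
  using src_dst(4)[of vs es] by auto

section \<open>Attaching end pieces to decorated walks\<close>

lemma des_internal:
  "mid_saw V0 E0 vs es \<Longrightarrow> valid vs es \<gamma>s \<Longrightarrow> e \<in> set (des vs es \<gamma>s) \<Longrightarrow> e \<in> lift ` Ed0 \<or> e \<subseteq> set (dvs vs \<gamma>s)"
proof (induction vs es \<gamma>s rule: valid.induct)
  case (2 v vs e' es \<gamma> \<gamma>s)
  have m: "mid_saw V0 E0 vs es" "valid vs es \<gamma>s" "e' \<in> Ed0" using 2 by (auto simp: mid_saw_Cons)
  have "e \<subseteq> Pair v ` set \<gamma>" if "e \<in> set (map (image (Pair v)) (path_edges \<gamma>))"
    using that path_edges_subset by fastforce
  then show ?case using 2(1)[OF m(1,2)] 2(4) m(3) by auto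
qed (auto simp: mid_saw_Nil)

lemma tail_edges_fresh:
  assumes "mid_saw V0 E0 vs es" "valid vs es \<gamma>s" "tail c B eb" "Pair x ` set B \<inter> set (dvs vs \<gamma>s) = {}" "e \<in> set eb"
  shows "Pair x ` e \<notin> set (des vs es \<gamma>s)"
proof
  assume a: "Pair x ` e \<in> set (des vs es \<gamma>s)"
  have "Pair x ` e \<in> internal x" using tail_facts(6)[OF assms(3)] assms(5) by (auto simp: internal_def)
  then have "Pair x ` e \<subseteq> set (dvs vs \<gamma>s)" using des_internal[OF assms(1,2) a] internal_not_lift by blast
  moreover obtain b where "b \<in> set B" "b \<in> e" using tail_edge_mem[OF assms(3,5)] by blast
  ultimately show False using assms(4) by blast
qed

definition comp where
  "comp vs es \<gamma>s A ea B eb = (map (Pair (src vs es)) (rev A) @ dvs vs \<gamma>s @ map (Pair (dst vs es)) B,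
     map (image (Pair (src vs es))) (rev ea) @ des vs es \<gamma>s @ map (image (Pair (dst vs es))) eb)"

text \<open>The end pieces are attached in the gadgets just beyond the two ends. \<open>src\<close>
  in W0 puts the new first mid-edge into X1; \<open>src\<close> and \<open>dst\<close> being
  different keeps the two pieces in different gadgets, so only clashes with the decoration itself
  have to be excluded.\<close>

lemma comp_in_S1:
  assumes m: "mid_saw V0 E0 vs es" "vs \<noteq> []" and v: "valid vs es \<gamma>s"
    and W: "src vs es \<in> W0" and ne: "src vs es \<noteq> dst vs es"
    and tA: "tail (port (src vs es) (hd es)) A ea" and tB: "tail (port (dst vs es) (last es)) B eb"
    and dA: "Pair (src vs es) ` set A \<inter> set (dvs vs \<gamma>s) = {}" and dB: "Pair (dst vs es) ` set B \<inter> set (dvs vs \<gamma>s) = {}"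
  shows "comp vs es \<gamma>s A ea B eb \<in> S1 (length A + k0 * length vs + length B)"
proof -
  let ?u = "src vs es" and ?x = "dst vs es" and ?d = "des vs es \<gamma>s"
  note sd = src_dst[OF m]
  note ends = mid_saw_hd_last[OF m]
  have uh: "?u \<in> hd es" "?x \<in> last es" using sd by auto
  have D: "mid_saw V1 E1 (dvs vs \<gamma>s) ?d" by (rule decorate_mid_saw[OF m(1) v])
  have ne0: "es \<noteq> []" using m by (auto simp: mid_saw_def)
  have hd: "?d \<noteq> []" "hd ?d = lift (hd es)" "last ?d = lift (last es)" using hd_des[OF ne0, of vs \<gamma>s] last_des[OF m(1) v] by auto
  have dd: "distinct ?d" "length ?d = Suc (length (dvs vs \<gamma>s))" using D by (auto simp: mid_saw_def)
  have PB: "mid_saw V1 E1 (map (Pair ?x) B) (lift (last es) # map (image (Pair ?x)) eb)"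
    using tail_block[OF ends(3) uh(2) tail_facts(6,1)[OF tB]] tB by blast
  have "mid_saw V1 E1 (map (Pair ?u) A) (lift (hd es) # map (image (Pair ?u)) ea)"
    using tail_block[OF ends(2) uh(1) tail_facts(6,1)[OF tA]] tA by blast
  from mid_saw_rev[OF this] have PA: "mid_saw V1 E1 (map (Pair ?u) (rev A)) (map (image (Pair ?u)) (rev ea) @ [lift (hd es)])"
    by (simp add: rev_map)
  have fB: "E \<notin> set ?d" if "E \<in> set (map (image (Pair ?x)) eb)" for E
    using tail_edges_fresh[OF m(1) v tB dB] that by auto
  have fA: "E \<notin> set ?d" if "E \<in> set (map (image (Pair ?u)) (rev ea))" for E
    using tail_edges_fresh[OF m(1) v tA dA] that by auto
  have bl: "?d = butlast ?d @ [lift (last es)]" using hd by (metis append_butlast_last_id)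
  have lb: "length (butlast ?d) = length (dvs vs \<gamma>s)" using dd by simp
  have "lift (last es) \<notin> set (butlast ?d)" using dd(1) bl by (metis distinct_append Int_iff empty_iff list.set_intros(1))
  moreover have "E \<notin> set (butlast ?d)" if "E \<in> set (map (image (Pair ?x)) eb)" for E using fB[OF that] in_set_butlastD by metis
  moreover have "mid_saw V1 E1 (dvs vs \<gamma>s) (butlast ?d @ [lift (last es)])" using D bl by simp
  moreover have "set (dvs vs \<gamma>s) \<inter> set (map (Pair ?x) B) = {}" using dB by auto
  ultimately have "mid_saw V1 E1 (dvs vs \<gamma>s @ map (Pair ?x) B) (butlast ?d @ lift (last es) # map (image (Pair ?x)) eb)"
    using PB by (subst mid_saw_append[OF lb]) auto
  then have R: "mid_saw V1 E1 (dvs vs \<gamma>s @ map (Pair ?x) B) (?d @ map (image (Pair ?x)) eb)"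
    by (metis append.assoc append_Cons append_Nil bl)
  have ht: "?d = lift (hd es) # tl ?d" using hd by (metis list.collapse)
  have la: "length (map (image (Pair ?u)) (rev ea)) = length (map (Pair ?u) (rev A))" using tail_facts(5)[OF tA] by simp
  have "set (map (Pair ?u) (rev A)) \<inter> set (dvs vs \<gamma>s @ map (Pair ?x) B) = {}" using dA ne by auto
  moreover have "set (map (image (Pair ?u)) (rev ea)) \<inter> set (?d @ map (image (Pair ?x)) eb) = {}"
  proof (rule ccontr)
    assume "\<not> ?thesis"
    then obtain E where E: "E \<in> set (map (image (Pair ?u)) (rev ea))" "E \<in> set (?d @ map (image (Pair ?x)) eb)" by blast
    have i: "E \<in> internal ?u" using E(1) tail_facts(6)[OF tA] by (auto simp: internal_def)
    have "E \<in> set (map (image (Pair ?x)) eb)" using E fA by auto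
    then have "E \<in> internal ?x" using tail_facts(6)[OF tB] by (auto simp: internal_def)
    moreover obtain y where "y \<in> E" using i by (auto simp: internal_def edges_def)
    ultimately show False using i internal_fst[of E ?u y] internal_fst[of E ?x y] ne by simp
  qed
  moreover have "mid_saw V1 E1 (dvs vs \<gamma>s @ map (Pair ?x) B) (lift (hd es) # (tl ?d @ map (image (Pair ?x)) eb))"
    using R ht by (metis append_Cons)
  moreover have hteb: "?d @ map (image (Pair ?x)) eb = lift (hd es) # (tl ?d @ map (image (Pair ?x)) eb)" using ht by (metis append_Cons)
  ultimately have "mid_saw V1 E1 (map (Pair ?u) (rev A) @ (dvs vs \<gamma>s @ map (Pair ?x) B)) (map (image (Pair ?u)) (rev ea) @ lift (hd es) # (tl ?d @ map (image (Pair ?x)) eb))"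
    using PA by (subst mid_saw_append[OF la]) (unfold hteb[symmetric], intro conjI, assumption+)
  then have M: "mid_saw V1 E1 (fst (comp vs es \<gamma>s A ea B eb)) (snd (comp vs es \<gamma>s A ea B eb))"
    unfolding comp_def fst_conv snd_conv hteb by simp
  have ea: "rev ea \<noteq> []" using tail_facts(1,5)[OF tA] by auto
  then have h: "hd (snd (comp vs es \<gamma>s A ea B eb)) = Pair ?u ` hd (rev ea)" by (simp add: comp_def hd_append hd_map)
  have "hd (rev ea) \<in> edges Hv EH" using ea tail_facts(6)[OF tA] hd_in_set[OF ea] by auto
  then obtain b where "b \<in> hd (rev ea)" "b \<in> Hv" by (auto simp: edges_def)
  moreover have "hd (snd (comp vs es \<gamma>s A ea B eb)) \<in> Ed1" by (rule mid_saw_hd_edge[OF M])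
  ultimately have "hd (snd (comp vs es \<gamma>s A ea B eb)) \<in> X1" using W unfolding h incident_edges_def by auto
  moreover have "length (fst (comp vs es \<gamma>s A ea B eb)) = length A + k0 * length vs + length B"
    using length_dvs[OF v] valid_sum[OF m(1) v] by (simp add: comp_def)
  ultimately show ?thesis using M S1_iff[of "fst (comp vs es \<gamma>s A ea B eb)" "snd (comp vs es \<gamma>s A ea B eb)"] by simp
qed

lemma comp_es:
  assumes "mid_saw V0 E0 vs es" "valid vs es \<gamma>s" "set ea \<subseteq> edges Hv EH" "set eb \<subseteq> edges Hv EH"
  shows "filter (\<lambda>e. e \<in> lift ` Ed0) (snd (comp vs es \<gamma>s A ea B eb)) = map lift es"
proof -
  have n: "Pair u ` e \<notin> lift ` Ed0" if "e \<in> edges Hv EH" for u e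
    using internal_not_lift[of "Pair u ` e" u] that by (auto simp: internal_def)
  have "filter (\<lambda>e. e \<in> lift ` Ed0) (map (image (Pair u)) l) = []" if "set l \<subseteq> edges Hv EH" for l u
    using n that by (auto simp: filter_empty_conv)
  then show ?thesis using filter_des[OF assms(1,2)] assms(3,4) by (simp add: comp_def)
qed

lemma cpow_k0: "cpow hh g n (k0 * n) = g k0 ^ n"
proof (induction n)
  case (Suc n)
  have k: "k0 \<in> {1..hh}"
  proof -
    obtain k where k: "k \<in> {1..hh}" "g k > 0" using g_exists by blast
    then have "k = k0" using k0_only[of k] by (cases "k = k0") auto
    then show ?thesis using k by simp
  qed
  have "cpow hh g (Suc n) (k0 * Suc n) = (\<Sum>a\<in>{1..hh}. if a = k0 then g k0 * cpow hh g n (k0 * n) else 0)"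
    unfolding cpow.simps
  proof (rule sum.cong[OF refl])
    fix a assume a: "a \<in> {1..hh}"
    show "(if a \<le> k0 * Suc n then g a * cpow hh g n (k0 * Suc n - a) else 0) = (if a = k0 then g k0 * cpow hh g n (k0 * n) else 0)"
      using k0_only[OF a] by (cases "a = k0") auto
  qed
  also have "\<dots> = g k0 ^ Suc n" using k Suc by simp
  finally show ?case .
qed simp

definition Lists :: "'g list set" where "Lists = {xs. set xs \<subseteq> Hv \<and> length xs \<le> hh}"

lemma finite_Lists: "finite Lists"
  unfolding Lists_def by (rule finite_lists_length_le) (rule gadget_facts)

definition avoiding where
  "avoiding vs es A B = {\<gamma>s. valid vs es \<gamma>s \<and> Pair (src vs es) ` set A \<inter> set (dvs vs \<gamma>s) = {} \<and> Pair (dst vs es) ` set B \<inter> set (dvs vs \<gamma>s) = {}}"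

lemma DS_k0: "mid_saw V0 E0 vs es \<Longrightarrow> DS vs es (k0 * length vs) = {\<gamma>s. valid vs es \<gamma>s}"
  using valid_sum by (auto simp: DS_def)

lemma finite_valid: "mid_saw V0 E0 vs es \<Longrightarrow> finite {\<gamma>s. valid vs es \<gamma>s} \<and> real (card {\<gamma>s. valid vs es \<gamma>s}) = g k0 ^ length vs"
  using card_DS[of vs es "k0 * length vs"] DS_k0[of vs es] cpow_k0[of "length vs"] by simp

lemma finite_avoiding: "mid_saw V0 E0 vs es \<Longrightarrow> finite (avoiding vs es A B)"
  using finite_valid[of vs es] by (auto simp: avoiding_def intro: finite_subset[of _ "{\<gamma>s. valid vs es \<gamma>s}"])

text \<open>The old walk can be read off from the inherited edges of the composite walk, and then
  the decoration from its vertices, so composition is injective. Per old walk at least the fraction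
  1 / N of the g k0 ^ n decorations leaves room for the end pieces.\<close>

lemma lower_general:
  assumes n: "n \<ge> 1" and N: "N \<ge> 0" and fin1: "finite (S1 (k0 * n + 2 * j))"
    and Z: "\<And>vs es. (vs, es) \<in> Z \<Longrightarrow> mid_saw V0 E0 vs es \<and> length vs = n \<and> src vs es \<in> W0 \<and> src vs es \<noteq> dst vs es"
    and T: "\<And>vs es. (vs, es) \<in> Z \<Longrightarrow> \<exists>A ea B eb. tail (port (src vs es) (hd es)) A ea \<and> tail (port (dst vs es) (last es)) B eb
        \<and> length A = j \<and> length B = j \<and> g k0 ^ n \<le> N * real (card (avoiding vs es A B))"
  shows "real (card Z) * g k0 ^ n \<le> N * real (card (S1 (k0 * n + 2 * j)))"
proof -
  define PR where "PR = (\<lambda>z t. tail (port (src (fst z) (snd z)) (hd (snd z))) (fst t) (fst (snd t))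
        \<and> tail (port (dst (fst z) (snd z)) (last (snd z))) (fst (snd (snd t))) (snd (snd (snd t)))
        \<and> length (fst t) = j \<and> length (fst (snd (snd t))) = j \<and> g k0 ^ n \<le> N * real (card (avoiding (fst z) (snd z) (fst t) (fst (snd (snd t))))))"
  have "\<forall>z\<in>Z. \<exists>t. PR z t"
  proof
    fix z assume "z \<in> Z"
    then obtain A ea B eb where "tail (port (src (fst z) (snd z)) (hd (snd z))) A ea" "tail (port (dst (fst z) (snd z)) (last (snd z))) B eb"
      "length A = j" "length B = j" "g k0 ^ n \<le> N * real (card (avoiding (fst z) (snd z) A B))" using T[of "fst z" "snd z"] by auto
    then show "\<exists>t. PR z t" unfolding PR_def by (intro exI[of _ "(A, ea, B, eb)"]) simp
  qed
  \<comment> \<open>The end pieces depend on the old walk only and not on the decoration; once the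
    walk is recovered they are known and cancel in the injectivity proof.\<close>
  from bchoice[OF this] obtain t where t: "\<And>z. z \<in> Z \<Longrightarrow> PR z (t z)" by blast
  define A where "A = (\<lambda>z. fst (t z))"
  define ea where "ea = (\<lambda>z. fst (snd (t z)))"
  define B where "B = (\<lambda>z. fst (snd (snd (t z))))"
  define eb where "eb = (\<lambda>z. snd (snd (snd (t z))))"
  have tz: "tail (port (src vs es) (hd es)) (A (vs, es)) (ea (vs, es))" "tail (port (dst vs es) (last es)) (B (vs, es)) (eb (vs, es))"
    "length (A (vs, es)) = j" "length (B (vs, es)) = j" "g k0 ^ n \<le> N * real (card (avoiding vs es (A (vs, es)) (B (vs, es))))"
    if "(vs, es) \<in> Z" for vs es
    using t[OF that] by (auto simp: PR_def A_def ea_def B_def eb_def)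
  define Q where "Q = (\<lambda>z. avoiding (fst z) (snd z) (A z) (B z))"
  define \<Phi> where "\<Phi> = (\<lambda>(z, \<gamma>s). comp (fst z) (snd z) \<gamma>s (A z) (ea z) (B z) (eb z))"
  have vne: "vs \<noteq> []" if "(vs, es) \<in> Z" for vs es using Z[OF that] n by auto
  have img: "\<Phi> ` Sigma Z Q \<subseteq> S1 (k0 * n + 2 * j)"
  proof (rule subsetI, elim imageE SigmaE)
    fix y s z \<gamma>s assume a: "y = \<Phi> s" "s = (z, \<gamma>s)" "z \<in> Z" "\<gamma>s \<in> Q z"
    obtain vs es where z: "z = (vs, es)" by (cases z)
    note zz = Z[OF a(3)[unfolded z]] and tt = tz[OF a(3)[unfolded z]]
    have "comp vs es \<gamma>s (A z) (ea z) (B z) (eb z) \<in> S1 (length (A z) + k0 * length vs + length (B z))"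
      using a(4) zz tt vne[OF a(3)[unfolded z]] by (intro comp_in_S1) (auto simp: Q_def avoiding_def z)
    moreover have "length (A z) + k0 * length vs + length (B z) = k0 * n + 2 * j" using z zz tt by simp
    ultimately show "y \<in> S1 (k0 * n + 2 * j)" using a z by (simp add: \<Phi>_def)
  qed
  have inj: "inj_on \<Phi> (Sigma Z Q)"
  proof (rule inj_onI, elim SigmaE)
    fix s s' z z' \<gamma>s \<gamma>s' assume eq: "\<Phi> s = \<Phi> s'" and s: "s = (z, \<gamma>s)" "z \<in> Z" "\<gamma>s \<in> Q z" "s' = (z', \<gamma>s')" "z' \<in> Z" "\<gamma>s' \<in> Q z'"
    obtain vs es where z: "z = (vs, es)" by (cases z)
    obtain vs' es' where z': "z' = (vs', es')" by (cases z')
    note zz = Z[OF s(2)[unfolded z]] and tt = tz[OF s(2)[unfolded z]] and zz' = Z[OF s(5)[unfolded z']] and tt' = tz[OF s(5)[unfolded z']]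
    have v: "valid vs es \<gamma>s" "valid vs' es' \<gamma>s'" using s z z' by (auto simp: Q_def avoiding_def)
    have c: "comp vs es \<gamma>s (A z) (ea z) (B z) (eb z) = comp vs' es' \<gamma>s' (A z') (ea z') (B z') (eb z')" using eq s z z' by (simp add: \<Phi>_def)
    have "map lift es = map lift es'"
      using comp_es[of vs es \<gamma>s "ea z" "eb z" "A z" "B z"] comp_es[of vs' es' \<gamma>s' "ea z'" "eb z'" "A z'" "B z'"]
        tail_facts(6)[OF tt(1)] tail_facts(6)[OF tt(2)] tail_facts(6)[OF tt'(1)] tail_facts(6)[OF tt'(2)] zz zz' v c z z' by simp
    moreover have "inj_on lift (set es \<union> set es')" using zz zz' lift_inj by (auto simp: mid_saw_def inj_on_def subset_iff)
    ultimately have es: "es = es'" using map_inj_on by blast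
    have vs: "vs = vs'" using mid_saw_vs_unique[OF simple_graph_on[OF simple0]] zz zz' es by blast
    have "dvs vs \<gamma>s = dvs vs \<gamma>s'" using c es vs z z' by (simp add: comp_def)
    moreover have "distinct vs" using zz by (simp add: mid_saw_def)
    ultimately have "\<gamma>s = \<gamma>s'" using dvs_inj[of vs es \<gamma>s \<gamma>s'] v es vs by simp
    then show "s = s'" using s z z' es vs by simp
  qed
  have finS: "finite (Sigma Z Q)" using finite_imageD[OF finite_subset[OF img fin1] inj] .
  have gp: "g k0 ^ n > 0" using k0_pos by simp
  have Qne: "Q z \<noteq> {}" if "z \<in> Z" for z
  proof
    obtain vs es where z: "z = (vs, es)" by (cases z)
    assume "Q z = {}"
    then show False using tz(5)[OF that[unfolded z]] gp z by (simp add: Q_def)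
  qed
  have "Z \<subseteq> fst ` Sigma Z Q" using Qne by force
  then have finZ: "finite Z" using finS finite_surj by blast
  have finQ: "finite (Q z)" if "z \<in> Z" for z using finite_avoiding Z[of "fst z" "snd z"] that by (simp add: Q_def)
  have "real (card Z) * g k0 ^ n = (\<Sum>z\<in>Z. g k0 ^ n)" by simp
  also have "\<dots> \<le> (\<Sum>z\<in>Z. N * real (card (Q z)))" using tz(5) by (intro sum_mono) (auto simp: Q_def)
  also have "\<dots> = N * real (card (Sigma Z Q))" using finZ finQ by (simp add: card_SigmaI sum_distrib_left)
  also have "\<dots> \<le> N * real (card (S1 (k0 * n + 2 * j)))"
    using card_inj_on_le[OF inj img fin1] N by (intro mult_left_mono) auto
  finally show ?thesis .
qed

lemma free_avoiding:
  assumes "src vs es \<notin> set vs" "dst vs es \<notin> set vs"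
  shows "avoiding vs es A B = {\<gamma>s. valid vs es \<gamma>s}"
  using assms dvs_fst by (fastforce simp: avoiding_def)

text \<open>If the gadget of x is crossed by the walk, f is attached to its third port, so an end
  piece of length jt and a crossing avoiding it exist by \<open>jt_attained\<close>.\<close>

lemma touch_choice:
  assumes m: "mid_saw V0 E0 vs es" and f: "f \<in> Ed0" "x \<in> f"
    and nf: "\<And>i. i < length vs \<Longrightarrow> vs ! i = x \<Longrightarrow> f \<noteq> es ! i \<and> f \<noteq> es ! Suc i"
  shows "\<exists>B eb \<gamma>. tail (port x f) B eb \<and> length B = jt \<and> (\<forall>i<length vs. vs ! i = x \<longrightarrow>
      \<gamma> \<in> GP (port x (es ! i)) (port x (es ! Suc i)) \<and> set \<gamma> \<inter> set B = {})"
proof (cases "x \<in> set vs")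
  case True
  then obtain i where i: "i < length vs" "vs ! i = x" by (auto simp: in_set_conv_nth)
  have e: "es ! i \<in> Ed0" "es ! Suc i \<in> Ed0" "x \<in> es ! i" "x \<in> es ! Suc i" "es ! i \<noteq> es ! Suc i"
    using m i by (auto simp: mid_saw_def nth_eq_iff_index_eq subset_iff)
  have "{port x (es ! i), port x (es ! Suc i), port x f} = Ports" using e f nf[OF i] by (intro three_ports) auto
  from jt_attained[OF this] obtain B eb \<gamma> where B: "tail (port x f) B eb" "length B = jt" "\<gamma> \<in> GP (port x (es ! i)) (port x (es ! Suc i))" "set \<gamma> \<inter> set B = {}"
    by (elim exE conjE)
  have "j = i" if "j < length vs" "vs ! j = x" for j using m i that by (auto simp: mid_saw_def nth_eq_iff_index_eq)
  then show ?thesis using B by (intro exI[of _ B] exI[of _ eb] exI[of _ \<gamma>]) auto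
next
  case False
  \<comment> \<open>An unvisited gadget has room for any end piece entering through f; the crossing
    \<open>\<gamma>\<close> is then a dummy value.\<close>
  have c: "port x f \<in> Ports" by (rule port_in[OF f])
  have "card (Ports - {port x f}) = 2" using c gadget_facts(5-7) by (subst card_Diff_subset) auto
  then obtain a b where ab: "Ports - {port x f} = {a, b}" by (auto simp: card_2_iff)
  have "insert (port x f) (Ports - {port x f}) = Ports" using c by (rule insert_Diff)
  then have "{a, b, port x f} = Ports" unfolding ab by (simp only: insert_commute)
  from jt_attained[OF this] obtain B eb \<gamma> where B: "tail (port x f) B eb" "length B = jt" by (elim exE conjE)
  show ?thesis using B False by (intro exI[of _ B] exI[of _ eb] exI[of _ "[]"]) auto
qed

text \<open>Only the crossings of at most two gadgets, those of \<open>src\<close> and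
  \<open>dst\<close>, can get in the way. Replacing them by harmless ones makes any decoration
  avoiding, and the replaced paths are two elements of \<open>Lists\<close>; hence the factor (card
  Lists)^2.\<close>

lemma touch_avoiding:
  assumes m: "mid_saw V0 E0 vs es" "vs \<noteq> []" and ne: "src vs es \<noteq> dst vs es"
  shows "\<exists>A ea B eb. tail (port (src vs es) (hd es)) A ea \<and> tail (port (dst vs es) (last es)) B eb
        \<and> length A = jt \<and> length B = jt \<and> g k0 ^ length vs \<le> real (card Lists * card Lists) * real (card (avoiding vs es A B))"
proof -
  let ?u = "src vs es" and ?x = "dst vs es" and ?n = "length vs"
  note sd = src_dst[OF m]
  note ends = mid_saw_hd_last[OF m]
  have l: "length es = Suc ?n" "distinct es" using m(1) by (auto simp: mid_saw_def)
  have esne: "es \<noteq> []" using l(1) by auto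
  have h0: "hd es = es ! 0" "hd vs = vs ! 0" "last es = es ! ?n" "last vs = vs ! (?n - 1)"
    using hd_conv_nth[OF esne] hd_conv_nth[OF m(2)] last_conv_nth[OF esne] last_conv_nth[OF m(2)] l(1) by simp_all
  have nu: "hd es \<noteq> es ! i \<and> hd es \<noteq> es ! Suc i" if "i < ?n" "vs ! i = ?u" for i
  proof -
    have "i \<noteq> 0" using that(2) sd(2) unfolding h0(2) by metis
    then show ?thesis unfolding h0(1) using nth_eq_iff_index_eq[OF l(2)] l(1) that(1) by simp
  qed
  have nx: "last es \<noteq> es ! i \<and> last es \<noteq> es ! Suc i" if "i < ?n" "vs ! i = ?x" for i
  proof -
    have "i \<noteq> ?n - 1" using that(2) sd(5) unfolding h0(4) by metis
    then show ?thesis unfolding h0(3) using nth_eq_iff_index_eq[OF l(2)] l(1) that(1) by simp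
  qed
  have uh: "?u \<in> hd es" "?x \<in> last es" using sd by auto
  obtain A ea \<gamma>u where A: "tail (port ?u (hd es)) A ea" "length A = jt"
    "\<And>i. i < ?n \<Longrightarrow> vs ! i = ?u \<Longrightarrow> \<gamma>u \<in> GP (port ?u (es ! i)) (port ?u (es ! Suc i)) \<and> set \<gamma>u \<inter> set A = {}"
    using touch_choice[OF m(1) ends(2) uh(1) nu] by blast
  obtain B eb \<gamma>x where B: "tail (port ?x (last es)) B eb" "length B = jt"
    "\<And>i. i < ?n \<Longrightarrow> vs ! i = ?x \<Longrightarrow> \<gamma>x \<in> GP (port ?x (es ! i)) (port ?x (es ! Suc i)) \<and> set \<gamma>x \<inter> set B = {}"
    using touch_choice[OF m(1) ends(3) uh(2) nx] by blast
  \<comment> \<open>Used in both directions: with \<gamma>u and \<gamma>x it makes a decoration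
    avoiding, with the old crossings it recovers the original one.\<close>
  define upd where "upd = (\<lambda>(y1 :: 'g list) y2 \<gamma>s. map (\<lambda>i. if vs ! i = ?u then y1 else if vs ! i = ?x then y2 else \<gamma>s ! i) [0..<?n])"
  have S: "finite {\<gamma>s. valid vs es \<gamma>s}" "real (card {\<gamma>s. valid vs es \<gamma>s}) = g k0 ^ ?n" using finite_valid[OF m(1)] by auto
  have ne': "{} \<in> Pow Hv" by simp
  have nilL: "[] \<in> Lists" by (simp add: Lists_def)
  have "sum (\<lambda>_. 1) {\<gamma>s. valid vs es \<gamma>s} \<le> real (card Lists * card Lists) * sum (\<lambda>_. 1) (avoiding vs es A B)"
  proof (rule sum_cover_le[OF S(1) finite_avoiding[OF m(1)], of "\<lambda>\<gamma>s'. (\<lambda>(y1, y2). upd y1 y2 \<gamma>s') ` (Lists \<times> Lists)"])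
    fix r show "finite ((\<lambda>(y1, y2). upd y1 y2 r) ` (Lists \<times> Lists)) \<and> card ((\<lambda>(y1, y2). upd y1 y2 r) ` (Lists \<times> Lists)) \<le> card Lists * card Lists"
      using finite_Lists card_image_le[of "Lists \<times> Lists" "\<lambda>(y1, y2). upd y1 y2 r"] by (simp add: card_cartesian_product)
  next
    show "{\<gamma>s. valid vs es \<gamma>s} \<subseteq> (\<Union>r\<in>avoiding vs es A B. (\<lambda>(y1, y2). upd y1 y2 r) ` (Lists \<times> Lists))"
    proof
      fix \<gamma>s assume "\<gamma>s \<in> {\<gamma>s. valid vs es \<gamma>s}"
      then have v: "valid vs es \<gamma>s" by simp
      then have vi: "length \<gamma>s = ?n" "\<And>i. i < ?n \<Longrightarrow> \<gamma>s ! i \<in> GP (port (vs ! i) (es ! i)) (port (vs ! i) (es ! Suc i))"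
        using valid_iff[OF l(1)] by auto
      define r where "r = upd \<gamma>u \<gamma>x \<gamma>s"
      have lr: "length r = ?n" by (simp add: r_def upd_def)
      have rn: "r ! i = (if vs ! i = ?u then \<gamma>u else if vs ! i = ?x then \<gamma>x else \<gamma>s ! i)" if "i < ?n" for i
        using that by (simp add: r_def upd_def)
      have rv: "valid vs es r" unfolding valid_iff[OF l(1)] using lr rn vi(2) A(3) B(3) by auto
      have "Pair ?u ` set A \<inter> set (dvs vs r) = {}"
      proof (rule ccontr)
        assume "\<not> ?thesis"
        then obtain i a where i: "i < ?n" "vs ! i = ?u" "a \<in> set A" "a \<in> set (r ! i)" unfolding set_dvs[OF lr] by fastforce
        then have "r ! i = \<gamma>u" using rn by simp
        then show False using A(3)[OF i(1,2)] i(3,4) by blast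
      qed
      moreover have "Pair ?x ` set B \<inter> set (dvs vs r) = {}"
      proof (rule ccontr)
        assume "\<not> ?thesis"
        then obtain i a where i: "i < ?n" "vs ! i = ?x" "a \<in> set B" "a \<in> set (r ! i)" unfolding set_dvs[OF lr] by fastforce
        then have "r ! i = \<gamma>x" using rn ne by simp
        then show False using B(3)[OF i(1,2)] i(3,4) by blast
      qed
      ultimately have ra: "r \<in> avoiding vs es A B" using rv by (simp add: avoiding_def)
      have inL: "\<gamma>s ! i \<in> Lists" if "i < ?n" for i using vi(2)[OF that] GP_set GP_length by (fastforce simp: Lists_def)
      have pick: "\<exists>y\<in>Lists. \<forall>i<?n. vs ! i = z \<longrightarrow> \<gamma>s ! i = y" for z
      proof (cases "z \<in> set vs")
        case True
        then obtain i where i: "i < ?n" "vs ! i = z" by (auto simp: in_set_conv_nth)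
        have "j = i" if "j < ?n" "vs ! j = z" for j using m(1) i that by (auto simp: mid_saw_def nth_eq_iff_index_eq)
        then show ?thesis using inL[OF i(1)] by (intro bexI[of _ "\<gamma>s ! i"]) auto
      next
        case False
        then show ?thesis using nilL by (intro bexI[of _ "[]"]) auto
      qed
      obtain y1 where y1: "y1 \<in> Lists" "\<And>i. i < ?n \<Longrightarrow> vs ! i = ?u \<Longrightarrow> \<gamma>s ! i = y1" using pick by blast
      obtain y2 where y2: "y2 \<in> Lists" "\<And>i. i < ?n \<Longrightarrow> vs ! i = ?x \<Longrightarrow> \<gamma>s ! i = y2" using pick by blast
      have "\<gamma>s = upd y1 y2 r"
      proof (rule nth_equalityI)
        show "length \<gamma>s = length (upd y1 y2 r)" using vi(1) by (simp add: upd_def)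
        fix i assume "i < length \<gamma>s"
        then show "\<gamma>s ! i = upd y1 y2 r ! i" using vi(1) rn y1(2) y2(2) by (simp add: upd_def)
      qed
      then show "\<gamma>s \<in> (\<Union>r\<in>avoiding vs es A B. (\<lambda>(y1, y2). upd y1 y2 r) ` (Lists \<times> Lists))"
        using ra y1(1) y2(1) by (intro UN_I[of r]) auto
    qed
  qed auto
  then have "g k0 ^ ?n \<le> real (card Lists * card Lists) * real (card (avoiding vs es A B))" using S(2) by simp
  then show ?thesis using A(1,2) B(1,2) by (intro exI[of _ A] exI[of _ ea] exI[of _ B] exI[of _ eb]) simp
qed

end

subsection \<open>Lower bound for the number of walks on the transformed graph\<close>

lemma path_edges_last_vertex:
  "distinct xs \<Longrightarrow> e \<in> set (path_edges xs) \<Longrightarrow> last xs \<in> e \<Longrightarrow> e = last (path_edges xs)"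
proof (induction xs rule: path_edges.induct)
  case (1 x y zs)
  show ?case
  proof (cases zs)
    case Nil
    then show ?thesis using 1 by simp
  next
    case (Cons z zs')
    have "last (y # zs) \<noteq> x" "last (y # zs) \<noteq> y" using 1(2) Cons by auto
    then have "e \<noteq> {x, y}" using 1(4) by auto
    then have "e \<in> set (path_edges (y # zs))" using 1(3) by simp
    then show ?thesis using 1(1,2,4) Cons by simp
  qed
qed auto

lemma card_subset_image: "A \<subseteq> f ` B \<Longrightarrow> finite B \<Longrightarrow> card B = k \<Longrightarrow> finite A \<and> card A \<le> k"
  using surj_card_le[of B A f] finite_surj[of B A f] by simp

context monomial_gadget
begin

definition Zt :: "nat \<Rightarrow> ('v list \<times> 'v set list) set" where
  "Zt n = {(vs, es). mid_saw V0 E0 vs es \<and> length vs = n \<and> src vs es \<in> W0 \<and> src vs es \<noteq> dst vs es}"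

definition Zf :: "nat \<Rightarrow> ('v list \<times> 'v set list) set" where
  "Zf n = {(vs, es) \<in> Zt n. src vs es \<notin> set vs \<and> dst vs es \<notin> set vs}"

lemma lower_touch:
  assumes "n \<ge> 1" "finite (S1 (k0 * n + 2 * jt))"
  shows "real (card (Zt n)) * g k0 ^ n \<le> real (card Lists * card Lists) * real (card (S1 (k0 * n + 2 * jt)))"
proof (rule lower_general[OF assms(1) _ assms(2)])
  fix vs es assume z: "(vs, es) \<in> Zt n"
  then show "mid_saw V0 E0 vs es \<and> length vs = n \<and> src vs es \<in> W0 \<and> src vs es \<noteq> dst vs es" by (simp add: Zt_def)
  have m: "mid_saw V0 E0 vs es" "vs \<noteq> []" "src vs es \<noteq> dst vs es" "length vs = n" using z assms(1) by (auto simp: Zt_def)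
  show "\<exists>A ea B eb. tail (port (src vs es) (hd es)) A ea \<and> tail (port (dst vs es) (last es)) B eb
      \<and> length A = jt \<and> length B = jt \<and> g k0 ^ n \<le> real (card Lists * card Lists) * real (card (avoiding vs es A B))"
    using touch_avoiding[OF m(1-3)] m(4) by simp
qed simp

lemma lower_free:
  assumes "n \<ge> 1" "finite (S1 (k0 * n + 2 * jf))"
  shows "real (card (Zf n)) * g k0 ^ n \<le> 1 * real (card (S1 (k0 * n + 2 * jf)))"
proof (rule lower_general[OF assms(1) _ assms(2)])
  fix vs es assume z: "(vs, es) \<in> Zf n"
  then show "mid_saw V0 E0 vs es \<and> length vs = n \<and> src vs es \<in> W0 \<and> src vs es \<noteq> dst vs es" by (simp add: Zf_def Zt_def)
  have m: "mid_saw V0 E0 vs es" "vs \<noteq> []" "length vs = n" "src vs es \<notin> set vs" "dst vs es \<notin> set vs" using z assms(1) by (auto simp: Zf_def Zt_def)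
  note ends = mid_saw_hd_last[OF m(1,2)] and sd = src_dst[OF m(1,2)]
  have uh: "src vs es \<in> hd es" "dst vs es \<in> last es" using sd by auto
  obtain A ea where A: "tail (port (src vs es) (hd es)) A ea" "length A = jf" using jf_attained[OF port_in[OF ends(2) uh(1)]] by blast
  obtain B eb where B: "tail (port (dst vs es) (last es)) B eb" "length B = jf" using jf_attained[OF port_in[OF ends(3) uh(2)]] by blast
  show "\<exists>A ea B eb. tail (port (src vs es) (hd es)) A ea \<and> tail (port (dst vs es) (last es)) B eb
      \<and> length A = jf \<and> length B = jf \<and> g k0 ^ n \<le> 1 * real (card (avoiding vs es A B))"
    using A B free_avoiding[OF m(4,5), of A B] finite_valid[OF m(1)] m(3)
    by (intro exI[of _ A] exI[of _ ea] exI[of _ B] exI[of _ eb]) simp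
qed simp

definition UX :: "'v set" where "UX = \<Union>X0"

lemma finite_UX: "finite UX"
  unfolding UX_def using finite_X0 Ed0_finite by (intro finite_Union) (auto simp: incident_edges_def)

lemma UX_sub: "UX \<subseteq> V0" using edges_subset by (fastforce simp: UX_def incident_edges_def)

definition \<alpha> :: "'v \<Rightarrow> 'v \<Rightarrow> 'v" where "\<alpha> v = (SOME f. automorphism V0 E0 f \<and> f v \<in> W0)"

lemma \<alpha>: "v \<in> V0 \<Longrightarrow> automorphism V0 E0 (\<alpha> v) \<and> \<alpha> v v \<in> W0"
proof -
  assume "v \<in> V0"
  from someI_ex[OF to_domain[OF this]] show ?thesis unfolding \<alpha>_def .
qed

text \<open>The last vertex p has a third edge besides the last mid-edge and the one through which p
  is entered. It is new: an inner edge at p is the entering one, and the first edge joins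
  \<open>src\<close> = \<open>dst\<close> to \<open>hd vs\<close> and so misses p.\<close>

lemma swap_end:
  assumes m: "mid_saw V0 E0 vs es" "length vs \<ge> 2" and eq: "src vs es = dst vs es"
  shows "\<exists>e. mid_saw V0 E0 vs (butlast es @ [e]) \<and> src vs (butlast es @ [e]) = src vs es \<and> dst vs (butlast es @ [e]) \<noteq> src vs es"
proof -
  have ne: "vs \<noteq> []" using m(2) by auto
  note sd = src_dst[OF m(1) ne] and can = mid_saw_canonical[OF simple_graph_on[OF simple0] m(1) ne] and ends = mid_saw_hd_last[OF m(1) ne]
  define p where "p = last vs"
  have pV: "p \<in> V0" using m(1) ne by (auto simp: p_def mid_saw_def)
  have "\<not> star p \<subseteq> {last es, last (path_edges vs)}"
  proof
    assume "star p \<subseteq> {last es, last (path_edges vs)}"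
    then have "card (star p) \<le> card {last es, last (path_edges vs)}" by (intro card_mono) auto
    also have "\<dots> \<le> 2" by (simp add: card_insert_if)
    finally show False using star_card[OF pV] by simp
  qed
  then obtain e where e: "e \<in> Ed0" "p \<in> e" "e \<noteq> last es" "e \<noteq> last (path_edges vs)" by (auto simp: star_def)
  have bl: "butlast es = hd es # path_edges vs"
    by (subst can(2)) (simp add: butlast_append)
  have "hd vs \<noteq> last vs" using can(3) m(2) by (cases vs) (auto simp: last_ConsR Suc_le_eq)
  then have "p \<notin> hd es" using sd(1,5) eq by (auto simp: p_def)
  then have "e \<noteq> hd es" using e(2) by blast
  moreover have "e \<notin> set (path_edges vs)" using path_edges_last_vertex[OF can(3)] e(2,4) by (auto simp: p_def)
  ultimately have en: "e \<notin> set (butlast es)" using bl by simp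
  have l: "length es = Suc (length vs)" by (rule mid_saw_length[OF m(1)])
  have "mid_saw V0 E0 vs (butlast es @ [e])"
    unfolding mid_saw_def
  proof (intro conjI allI impI)
    show "length (butlast es @ [e]) = Suc (length vs)" using l by simp
    show "set (butlast es @ [e]) \<subseteq> Ed0" using e m(1) by (auto simp: mid_saw_def dest: in_set_butlastD)
    show "set vs \<subseteq> V0" "distinct vs" using m(1) by (auto simp: mid_saw_def)
    show "distinct (butlast es @ [e])" using m(1) en by (auto simp: mid_saw_def distinct_butlast)
    fix i assume i: "i < length vs"
    then show "vs ! i \<in> (butlast es @ [e]) ! i" using m(1) l by (auto simp: mid_saw_def nth_append nth_butlast)
    show "vs ! i \<in> (butlast es @ [e]) ! Suc i"
    proof (cases "Suc i < length vs")
      case True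
      then show ?thesis using m(1) l i by (auto simp: mid_saw_def nth_append nth_butlast)
    next
      case False
      then have "i = length vs - 1" using i by simp
      then have "vs ! i = p" using ne by (simp add: p_def last_conv_nth)
      moreover have "(butlast es @ [e]) ! Suc i = e" using False i l by (simp add: nth_append)
      ultimately show ?thesis using e by simp
    qed
  qed
  note m' = this
  have h: "hd (butlast es @ [e]) = hd es" using bl by simp
  have s: "src vs (butlast es @ [e]) = src vs es" by (simp only: src_def h)
  moreover have "dst vs (butlast es @ [e]) \<noteq> src vs es"
  proof
    assume "dst vs (butlast es @ [e]) = src vs es"
    then have "e = {dst vs es, last vs}" using src_dst(4)[OF m' ne] eq by simp
    then show False using sd(4) e(3) by simp
  qed
  ultimately show ?thesis using m' by blast
qed

lemma map_automorphism_eq: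
  assumes "v \<in> V0" "map (\<alpha> v) xs = map (\<alpha> v) ys" "set xs \<subseteq> V0" "set ys \<subseteq> V0"
  shows "xs = ys"
proof -
  have "inj_on (\<alpha> v) (set xs \<union> set ys)" using \<alpha>[OF assms(1)] assms(3,4) by (auto simp: automorphism_def bij_betw_def intro: inj_on_subset)
  then show ?thesis using assms(2) map_inj_on by blast
qed

lemma map_image_automorphism_eq:
  assumes "v \<in> V0" "map (image (\<alpha> v)) xs = map (image (\<alpha> v)) ys" "set xs \<subseteq> Ed0" "set ys \<subseteq> Ed0"
  shows "xs = ys"
proof -
  have inj: "inj_on (\<alpha> v) V0" using \<alpha>[OF assms(1)] by (auto simp: automorphism_def bij_betw_def)
  have "inj_on (image (\<alpha> v)) (set xs \<union> set ys)"
  proof (rule inj_onI)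
    fix a b assume ab: "a \<in> set xs \<union> set ys" "b \<in> set xs \<union> set ys" "\<alpha> v ` a = \<alpha> v ` b"
    then have "a \<in> Ed0" "b \<in> Ed0" using assms(3,4) by auto
    then have "a \<subseteq> V0" "b \<subseteq> V0" using edges_subset by blast+
    then show "a = b" using inj ab(3) by (metis inj_on_image_eq_iff)
  qed
  then show ?thesis using assms(2) map_inj_on by blast
qed

lemma finite_Zt: "finite (S0 n) \<Longrightarrow> n \<ge> 1 \<Longrightarrow> finite (Zt n)"
proof (rule finite_subset)
  assume n: "n \<ge> 1"
  show "Zt n \<subseteq> S0 n"
  proof
    fix z assume "z \<in> Zt n"
    then obtain vs es where z: "z = (vs, es)" "mid_saw V0 E0 vs es" "length vs = n" "src vs es \<in> W0" by (auto simp: Zt_def)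
    have ne: "vs \<noteq> []" using z n by auto
    have "hd es \<in> X0" using src_dst(1)[OF z(2) ne] mid_saw_hd_last(2)[OF z(2) ne] z(4) by (auto simp: incident_edges_def)
    then show "z \<in> S0 n" using z S0_iff by simp
  qed
qed

text \<open>An automorphism moves \<open>src\<close> into W0, and the last edge is exchanged if both
  ends coincide. Given the image, the walk is determined by the original \<open>src\<close>, which
  lies in the finite set \<open>UX\<close>, and by the last edge, one of three.\<close>

lemma card_S0_le_Zt:
  assumes n: "n \<ge> 2" and fin: "finite (S0 n)"
  shows "real (card (S0 n)) \<le> real (card UX * 3) * real (card (Zt n))"
proof -
  define Cv where "Cv = (\<lambda>(z :: 'v list \<times> 'v set list) v. {(vs, es). (vs, es) \<in> S0 n \<and> map (\<alpha> v) vs = fst z \<and> map (image (\<alpha> v)) (butlast es) = butlast (snd z)})"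
  have cv: "finite (Cv z v) \<and> card (Cv z v) \<le> 3" if v: "v \<in> UX" for z v
  proof (cases "Cv z v = {}")
    case False
    have vV: "v \<in> V0" using v UX_sub by blast
    obtain v1 e1 where w: "(v1, e1) \<in> Cv z v" using False by auto
    have m1: "mid_saw V0 E0 v1 e1" "length v1 = n" using w S0_iff by (auto simp: Cv_def)
    have ne1: "v1 \<noteq> []" using m1 n by auto
    have lV: "last v1 \<in> V0" using m1 ne1 by (auto simp: mid_saw_def)
    have "Cv z v \<subseteq> (\<lambda>e. (v1, butlast e1 @ [e])) ` star (last v1)"
    proof
      fix y assume y: "y \<in> Cv z v"
      obtain vs es where ye: "y = (vs, es)" by (cases y)
      have m: "mid_saw V0 E0 vs es" using y S0_iff by (auto simp: Cv_def ye)
      have "map (\<alpha> v) vs = map (\<alpha> v) v1" using y w by (simp add: Cv_def ye)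
      then have vs: "vs = v1" using map_automorphism_eq[OF vV] m m1 by (auto simp: mid_saw_def)
      have "map (image (\<alpha> v)) (butlast es) = map (image (\<alpha> v)) (butlast e1)" using y w by (simp add: Cv_def ye)
      moreover have "set (butlast es) \<subseteq> Ed0" "set (butlast e1) \<subseteq> Ed0" using m m1 by (auto simp: mid_saw_def dest: in_set_butlastD)
      ultimately have be: "butlast es = butlast e1" using map_image_automorphism_eq[OF vV] by blast
      have "es \<noteq> []" using m by (auto simp: mid_saw_def)
      then have "es = butlast e1 @ [last es]" using be by (metis append_butlast_last_id)
      moreover have "last es \<in> star (last v1)"
        using mid_saw_hd_last(3)[OF m] mid_saw_canonical(5)[OF simple_graph_on[OF simple0] m] vs ne1 by (simp add: star_def)
      ultimately show "y \<in> (\<lambda>e. (v1, butlast e1 @ [e])) ` star (last v1)" using ye vs by blast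
    qed
    from card_subset_image[OF this] show ?thesis using star_card[OF lV] by simp
  qed simp
  have "sum (\<lambda>_. 1) (S0 n) \<le> real (card UX * 3) * sum (\<lambda>_. 1) (Zt n)"
  proof (rule sum_cover_le[OF fin finite_Zt[OF fin], of "\<lambda>z. \<Union>v\<in>UX. Cv z v"])
    show "1 \<le> n" using n by simp
    show "finite (\<Union>v\<in>UX. Cv z v) \<and> card (\<Union>v\<in>UX. Cv z v) \<le> card UX * 3" for z
    proof
      show "finite (\<Union>v\<in>UX. Cv z v)" using finite_UX cv by blast
      have "card (\<Union>v\<in>UX. Cv z v) \<le> (\<Sum>v\<in>UX. card (Cv z v))" by (rule card_UN_le[OF finite_UX])
      also have "\<dots> \<le> (\<Sum>v\<in>UX. 3)" using cv by (intro sum_mono) auto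
      finally show "card (\<Union>v\<in>UX. Cv z v) \<le> card UX * 3" by simp
    qed
    show "S0 n \<subseteq> (\<Union>z\<in>Zt n. \<Union>v\<in>UX. Cv z v)"
    proof
      fix y assume y: "y \<in> S0 n"
      obtain vs es where ye: "y = (vs, es)" by (cases y)
      have m: "mid_saw V0 E0 vs es" "length vs = n" "hd es \<in> X0" using y S0_iff by (auto simp: ye)
      have ne: "vs \<noteq> []" "es \<noteq> []" using m n by (auto simp: mid_saw_def)
      note sd = src_dst[OF m(1) ne(1)]
      define v where "v = src vs es"
      have vU: "v \<in> UX" using m(3) sd(1) by (auto simp: UX_def v_def)
      have vV: "v \<in> V0" using vU UX_sub by blast
      note a = \<alpha>[OF vV]
      define vs1 where "vs1 = map (\<alpha> v) vs"
      define es1 where "es1 = map (image (\<alpha> v)) es"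
      have m1: "mid_saw V0 E0 vs1 es1" unfolding vs1_def es1_def using a m by (intro automorphism_mid_saw) auto
      have ne1: "vs1 \<noteq> []" "length vs1 = n" using ne m by (auto simp: vs1_def)
      have inj: "inj_on (\<alpha> v) V0" using a by (auto simp: automorphism_def bij_betw_def)
      have hV: "hd vs \<in> V0" using m(1) ne by (auto simp: mid_saw_def)
      have "\<alpha> v v \<noteq> \<alpha> v (hd vs)" using inj_on_eq_iff[OF inj vV hV] sd(2) by (simp add: v_def)
      moreover have "\<alpha> v v \<in> hd es1" using sd(1) ne by (auto simp: es1_def hd_map v_def)
      ultimately have s1: "src vs1 es1 = \<alpha> v v" using ne by (intro src_eqI[OF m1 ne1(1)]) (auto simp: vs1_def hd_map)
      have bl: "map (image (\<alpha> v)) (butlast es) = butlast es1" by (simp add: es1_def map_butlast)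
      show "y \<in> (\<Union>z\<in>Zt n. \<Union>v\<in>UX. Cv z v)"
      proof (cases "src vs1 es1 = dst vs1 es1")
        case False
        then have "(vs1, es1) \<in> Zt n" using m1 ne1 s1 a by (simp add: Zt_def)
        moreover have "y \<in> Cv (vs1, es1) v" using y bl by (simp add: Cv_def ye vs1_def)
        ultimately show ?thesis using vU by blast
      next
        case True
        obtain e where e: "mid_saw V0 E0 vs1 (butlast es1 @ [e])" "src vs1 (butlast es1 @ [e]) = src vs1 es1" "dst vs1 (butlast es1 @ [e]) \<noteq> src vs1 es1"
          using swap_end[OF m1 _ True] ne1(2) n by auto
        then have "(vs1, butlast es1 @ [e]) \<in> Zt n" using ne1 s1 a by (simp add: Zt_def)
        moreover have "y \<in> Cv (vs1, butlast es1 @ [e]) v" using y bl by (simp add: Cv_def ye vs1_def)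
        ultimately show ?thesis using vU by blast
      qed
    qed
  qed auto
  then show ?thesis by simp
qed

text \<open>Removing the first and the last vertex turns them into \<open>src\<close> and
  \<open>dst\<close> of the remaining walk. They are then unvisited and different from each other,
  as membership in \<open>Zf\<close> demands.\<close>

lemma inner_walk:
  assumes m: "mid_saw V0 E0 vs es" and n: "length vs = n + 2" "n \<ge> 1"
  obtains a w b e0 ee e9 where "vs = a # w @ [b]" "es = e0 # ee @ [e9]" "length w = n" "mid_saw V0 E0 w ee"
    "src w ee = a" "dst w ee = b" "a \<notin> set w" "b \<notin> set w" "a \<noteq> b" "e0 \<in> star a" "e9 \<in> star b"
proof -
  obtain a r where r: "vs = a # r" "length r = n + 1" using n by (cases vs) auto
  obtain w b where w: "r = w @ [b]" "length w = n" using r(2) by (cases r rule: rev_cases) auto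
  have l: "length es = n + 3" using mid_saw_length[OF m] n by simp
  obtain e0 s where s: "es = e0 # s" "length s = n + 2" using l by (cases es) auto
  obtain ee e9 where e: "s = ee @ [e9]" "length ee = n + 1" using s(2) by (cases s rule: rev_cases) auto
  have ne: "ee \<noteq> []" "w \<noteq> []" using e w n by auto
  have c: "e0 \<in> Ed0" "a \<in> e0" "a \<in> hd ee" "a \<notin> set (w @ [b])" "mid_saw V0 E0 (w @ [b]) (ee @ [e9])"
    using m ne unfolding r(1) s(1) mid_saw_Cons w(1) e(1) by auto
  have "mid_saw V0 E0 (b # rev w) (e9 # rev ee)" using mid_saw_rev[OF c(5)] by simp
  then have c2: "e9 \<in> Ed0" "b \<in> e9" "b \<in> last ee" "b \<notin> set w" "mid_saw V0 E0 (rev w) (rev ee)"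
    using ne by (auto simp: mid_saw_Cons hd_rev)
  have mw: "mid_saw V0 E0 w ee" using mid_saw_rev[OF c2(5)] by simp
  have "src w ee = a" using c ne by (intro src_eqI[OF mw]) auto
  moreover have "dst w ee = b" using c2 ne by (intro dst_eqI[OF mw]) auto
  ultimately show ?thesis using that[of a w b e0 ee e9] r w s e c c2 mw by (simp add: star_def)
qed

lemma card_S0_le_Zf:
  assumes n: "n \<ge> 1" and fin: "finite (S0 (n + 2))" "finite (S0 n)"
  shows "real (card (S0 (n + 2))) \<le> real (card UX * 9) * real (card (Zf n))"
proof -
  define Cv where "Cv = (\<lambda>(z :: 'v list \<times> 'v set list) v. {(vs, es). (vs, es) \<in> S0 (n + 2) \<and> hd vs = v \<and>
     map (\<alpha> v) (butlast (tl vs)) = fst z \<and> map (image (\<alpha> v)) (butlast (tl es)) = snd z})"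
  have cv: "finite (Cv z v) \<and> card (Cv z v) \<le> 9" if v: "v \<in> UX" for z v
  proof (cases "Cv z v = {}")
    case False
    have vV: "v \<in> V0" using v UX_sub by blast
    obtain v1 e1 where w: "(v1, e1) \<in> Cv z v" using False by auto
    have m1: "mid_saw V0 E0 v1 e1" "length v1 = n + 2" using w S0_iff by (auto simp: Cv_def)
    obtain a w1' b e0 ee e9 where i1: "v1 = a # w1' @ [b]" "e1 = e0 # ee @ [e9]" "mid_saw V0 E0 w1' ee" "dst w1' ee = b"
      using inner_walk[OF m1 n] by metis
    have av: "a = v" using w i1 by (simp add: Cv_def)
    have bV: "b \<in> V0" using m1 i1 by (simp add: mid_saw_def)
    have sub: "Cv z v \<subseteq> (\<lambda>(e, e'). (v1, e # ee @ [e'])) ` (star v \<times> star b)"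
    proof
      fix y assume y: "y \<in> Cv z v"
      obtain vs es where ye: "y = (vs, es)" by (cases y)
      have m: "mid_saw V0 E0 vs es" "length vs = n + 2" using y S0_iff by (auto simp: Cv_def ye)
      obtain a' w' b' e0' ee' e9' where i: "vs = a' # w' @ [b']" "es = e0' # ee' @ [e9']" "mid_saw V0 E0 w' ee'" "dst w' ee' = b'" "e0' \<in> star a'" "e9' \<in> star b'"
        using inner_walk[OF m n] by metis
      have av': "a' = v" using y i by (simp add: Cv_def ye)
      have "map (\<alpha> v) w' = map (\<alpha> v) w1'" using y w i i1 by (simp add: Cv_def ye)
      then have ww: "w' = w1'" using map_automorphism_eq[OF vV] i(3) i1(3) by (auto simp: mid_saw_def)
      have "map (image (\<alpha> v)) ee' = map (image (\<alpha> v)) ee" using y w i i1 by (simp add: Cv_def ye)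
      then have eeq: "ee' = ee" using map_image_automorphism_eq[OF vV] i(3) i1(3) by (auto simp: mid_saw_def)
      have "b' = b" using i(4) i1(4) ww eeq by simp
      then show "y \<in> (\<lambda>(e, e'). (v1, e # ee @ [e'])) ` (star v \<times> star b)"
        using ye i i1 av av' ww eeq by (intro image_eqI[of _ _ "(e0', e9')"]) auto
    qed
    have "finite (star v \<times> star b)" "card (star v \<times> star b) = 9" using star_card[OF vV] star_card[OF bV] by (auto simp: card_cartesian_product)
    then show ?thesis by (rule card_subset_image[OF sub])
  qed simp
  have finZ: "finite (Zf n)" using finite_Zt[OF fin(2) n] by (rule rev_finite_subset) (auto simp: Zf_def)
  have "sum (\<lambda>_. 1) (S0 (n + 2)) \<le> real (card UX * 9) * sum (\<lambda>_. 1) (Zf n)"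
  proof (rule sum_cover_le[OF fin(1) finZ, of "\<lambda>z. \<Union>v\<in>UX. Cv z v"])
    show "finite (\<Union>v\<in>UX. Cv z v) \<and> card (\<Union>v\<in>UX. Cv z v) \<le> card UX * 9" for z
    proof
      show "finite (\<Union>v\<in>UX. Cv z v)" using finite_UX cv by blast
      have "card (\<Union>v\<in>UX. Cv z v) \<le> (\<Sum>v\<in>UX. card (Cv z v))" by (rule card_UN_le[OF finite_UX])
      also have "\<dots> \<le> (\<Sum>v\<in>UX. 9)" using cv by (intro sum_mono) auto
      finally show "card (\<Union>v\<in>UX. Cv z v) \<le> card UX * 9" by simp
    qed
    show "S0 (n + 2) \<subseteq> (\<Union>z\<in>Zf n. \<Union>v\<in>UX. Cv z v)"
    proof
      fix y assume y: "y \<in> S0 (n + 2)"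
      obtain vs es where ye: "y = (vs, es)" by (cases y)
      have m: "mid_saw V0 E0 vs es" "length vs = n + 2" "hd es \<in> X0" using y S0_iff by (auto simp: ye)
      have ne: "vs \<noteq> []" using m n by auto
      define v where "v = hd vs"
      have vU: "v \<in> UX" using m(3) mid_saw_canonical(4)[OF simple_graph_on[OF simple0] m(1) ne] by (auto simp: UX_def v_def)
      have vV: "v \<in> V0" using vU UX_sub by blast
      note a = \<alpha>[OF vV]
      have m1: "mid_saw V0 E0 (map (\<alpha> v) vs) (map (image (\<alpha> v)) es)" using a m by (intro automorphism_mid_saw) auto
      have l1: "length (map (\<alpha> v) vs) = n + 2" using m by simp
      obtain a' w b e0 ee e9 where i: "map (\<alpha> v) vs = a' # w @ [b]" "map (image (\<alpha> v)) es = e0 # ee @ [e9]" "length w = n" "mid_saw V0 E0 w ee"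
        "src w ee = a'" "dst w ee = b" "a' \<notin> set w" "b \<notin> set w" "a' \<noteq> b" using inner_walk[OF m1 l1 n] by metis
      have "a' = \<alpha> v v" using arg_cong[OF i(1), of hd] ne by (simp add: hd_map v_def)
      then have "(w, ee) \<in> Zf n" using i a by (simp add: Zf_def Zt_def)
      moreover have "y \<in> Cv (w, ee) v"
      proof -
        have "map (\<alpha> v) (butlast (tl vs)) = butlast (tl (map (\<alpha> v) vs))" by (simp add: map_butlast map_tl)
        moreover have "map (image (\<alpha> v)) (butlast (tl es)) = butlast (tl (map (image (\<alpha> v)) es))" by (simp add: map_butlast map_tl)
        ultimately show ?thesis using y i by (simp add: Cv_def ye v_def)
      qed
      ultimately show "y \<in> (\<Union>z\<in>Zf n. \<Union>v\<in>UX. Cv z v)" using vU by blast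
    qed
  qed auto
  then show ?thesis by simp
qed

text \<open>One of the two terms in J = max jt (jf - k0) is attained. If it is jt, end pieces of
  this length are attached to walks of length n. If it is jf - k0, the end gadgets have to be
  unvisited, so the two outer vertices of the walk are given up and end pieces of length jf are
  attached to the inner walk.\<close>

theorem count_lower_monomial:
  assumes fin0: "\<And>n. n \<ge> 1 \<Longrightarrow> finite (S0 n)" and fin1: "\<And>n. n \<ge> 1 \<Longrightarrow> finite (S1 n)"
  shows "\<exists>N>0. \<forall>n\<ge>3. real (card (S0 n)) * g k0 ^ n \<le> N * real (card (S1 (k0 * n + 2 * J)))"
proof (cases "jf - k0 \<le> jt")
  case True
  then have J: "J = jt" by (simp add: J_def)
  have k01: "k0 \<ge> 1" using GP_length GP_k0 GP_nonempty
  proof -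
    have H: "w1 \<in> Hv" "w2 \<in> Hv" using gadget_facts(4) by blast+
    obtain \<gamma> where \<gamma>: "\<gamma> \<in> GP w1 w2" using GP_nonempty H by blast
    then have "length \<gamma> = k0" using GP_k0[OF _ _ gadget_facts(5) \<gamma>] by simp
    then show ?thesis using GP_length[OF \<gamma>] by simp
  qed
  define N where "N = real (card UX * 3) * real (card Lists * card Lists)"
  have "real (card (S0 n)) * g k0 ^ n \<le> (N + 1) * real (card (S1 (k0 * n + 2 * J)))" if n: "n \<ge> 3" for n
  proof -
    have "k0 * n \<ge> 1" using k01 n by simp
    then have f1: "finite (S1 (k0 * n + 2 * jt))" by (intro fin1 trans_le_add1)
    have "real (card (S0 n)) * g k0 ^ n \<le> real (card UX * 3) * real (card (Zt n)) * g k0 ^ n"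
      using card_S0_le_Zt[of n] fin0[of n] n k0_pos by (intro mult_right_mono) auto
    also have "\<dots> = real (card UX * 3) * (real (card (Zt n)) * g k0 ^ n)" by simp
    also have "\<dots> \<le> real (card UX * 3) * (real (card Lists * card Lists) * real (card (S1 (k0 * n + 2 * jt))))"
      using lower_touch[OF _ f1] n by (intro mult_left_mono) auto
    also have "\<dots> \<le> (N + 1) * real (card (S1 (k0 * n + 2 * J)))" by (simp add: N_def J algebra_simps)
    finally show ?thesis .
  qed
  moreover have "N + 1 > 0" by (simp add: N_def add_nonneg_pos)
  ultimately show ?thesis by blast
next
  case False
  then have J: "J = jf - k0" "jf \<ge> k0" by (auto simp: J_def)
  define N where "N = real (card UX * 9) * (g k0)\<^sup>2 + 1"
  have jf1: "jf \<ge> 1" using False by simp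
  have "real (card (S0 n)) * g k0 ^ n \<le> N * real (card (S1 (k0 * n + 2 * J)))" if n: "n \<ge> 3" for n
  proof -
    define n' where "n' = n - 2"
    have n': "n = n' + 2" "n' \<ge> 1" using n by (auto simp: n'_def)
    have f1: "finite (S1 (k0 * n' + 2 * jf))" using jf1 by (intro fin1) simp
    \<comment> \<open>Two lost crossings cost 2 * k0, which is exactly the difference between 2 * jf
      and 2 * J, so both cases end at the same length.\<close>
    have eq: "k0 * n' + 2 * jf = k0 * n + 2 * J" using J n' by (simp add: algebra_simps)
    have "real (card (S0 n)) * g k0 ^ n \<le> real (card UX * 9) * real (card (Zf n')) * g k0 ^ n"
      using card_S0_le_Zf[of n'] fin0[of n] fin0[of n'] n' k0_pos by (intro mult_right_mono) auto
    also have "\<dots> = real (card UX * 9) * (g k0)\<^sup>2 * (real (card (Zf n')) * g k0 ^ n')" by (simp add: n'(1) power_add power2_eq_square)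
    also have "\<dots> \<le> real (card UX * 9) * (g k0)\<^sup>2 * (1 * real (card (S1 (k0 * n' + 2 * jf))))"
      using lower_free[OF n'(2) f1] by (intro mult_left_mono) auto
    also have "\<dots> \<le> N * real (card (S1 (k0 * n + 2 * J)))" unfolding eq by (simp add: N_def algebra_simps)
    finally show ?thesis .
  qed
  moreover have "N > 0" by (simp add: N_def add_nonneg_pos)
  ultimately show ?thesis by blast
qed

end

subsection \<open>Transfer of convergence\<close>

lemma summable_from_tail_bound:
  fixes f :: "nat \<Rightarrow> real"
  assumes "\<And>n. f n \<ge> 0" "\<And>M. (\<Sum>n\<in>{K<..M}. f n) \<le> B"
  shows "summable f"
proof -
  define f' where "f' = (\<lambda>n. if n > K then f n else 0)"
  have "summable f'"
  proof (rule summableI_nonneg_bounded)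
    show "0 \<le> f' n" for n using assms(1) by (simp add: f'_def)
    fix n
    have "sum f' {..<n} \<le> sum f' {..n}" using assms(1) by (intro sum_mono2) (auto simp: f'_def)
    also have "\<dots> = (\<Sum>i\<in>{K<..n}. f i)" by (rule sum.mono_neutral_cong_right) (auto simp: f'_def)
    also have "\<dots> \<le> B" by (rule assms(2))
    finally show "sum f' {..<n} \<le> B" .
  qed
  moreover have "eventually (\<lambda>n. f' n = f n) sequentially"
    using eventually_gt_at_top[of K] by eventually_elim (simp add: f'_def)
  ultimately show ?thesis using summable_cong by blast
qed

lemma powr_compare:
  fixes a b c x :: real
  assumes "0 < a" "0 < b" "a \<le> c * b" "b \<le> c * a" "c \<ge> 1"
  shows "a powr x \<le> c powr \<bar>x\<bar> * b powr x"
proof (cases "x \<ge> 0")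
  case True
  have "a powr x \<le> (c * b) powr x" using assms True by (intro powr_mono2) auto
  then show ?thesis using assms True by (simp add: powr_mult)
next
  case False
  have "a powr x \<le> (b / c) powr x" using assms False by (intro powr_mono2') (auto simp: field_simps)
  also have "\<dots> = c powr (- x) * b powr x" using assms by (simp add: powr_divide powr_minus field_simps)
  finally show ?thesis using False by simp
qed

text \<open>\<open>KL\<close> replaces 1 / s n by an average of 1 / s m under the n-th convolution
  power. After exchanging the sums, \<open>displacement_lower\<close> collapses the sum over n.
  Nonzero terms have n \<le> m \<le> h * n, so powers of n and m are comparable, and the loss
  n^\<epsilon> of \<open>KL\<close> goes into the exponent.\<close>

lemma transfer_down:
  fixes s \<delta> e :: "nat \<Rightarrow> real"
  assumes s: "\<And>n. n \<ge> 1 \<Longrightarrow> s n > 0" and p: "\<And>a. p a \<ge> 0" and d: "\<And>n. \<delta> n \<ge> 0" and e: "\<And>n. e n \<ge> 0"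
    and h: "h \<ge> 1" and A: "A > 0" and Ce: "Ce > 0"
    and KL: "\<And>n. n \<ge> 1 \<Longrightarrow> real n powr (- \<epsilon>) / (A * s n) \<le> (\<Sum>m\<in>{1..h * n}. cpow h p n m / s m)"
    and displacement_lower: "\<And>m. m \<ge> 1 \<Longrightarrow> (\<Sum>n\<in>{1..m}. \<delta> n * cpow h p n m) \<le> Ce * (s m * e m)"
    and sm: "summable (\<lambda>m. real m powr x * e m)"
  shows "summable (\<lambda>n. real n powr (x - \<epsilon>) * (\<delta> n / s n))"
proof (rule summable_from_tail_bound[where K = 0])
  have nn: "cpow h p n m \<ge> 0" for n m by (rule cpow_nonneg[OF p])
  have hp: "real h \<ge> 1" using h by simp
  define H where "H = real h powr \<bar>x\<bar>"
  have Hp: "H > 0" using hp by (simp add: H_def)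
  show "0 \<le> real n powr (x - \<epsilon>) * (\<delta> n / s n)" for n
    using d s[of n] by (cases "n = 0") (auto simp: less_imp_le)
  fix N :: nat
  have "(\<Sum>n\<in>{0<..N}. real n powr (x - \<epsilon>) * (\<delta> n / s n)) \<le> (\<Sum>n\<in>{0<..N}. \<Sum>m\<in>{1..h * N}. A * H * (real m powr x / s m * (\<delta> n * cpow h p n m)))"
  proof (rule sum_mono)
    fix n assume n: "n \<in> {0<..N}"
    have n1: "n \<ge> 1" "n \<le> N" using n by auto
    have "real n powr (x - \<epsilon>) * (\<delta> n / s n) = A * real n powr x * \<delta> n * (real n powr (- \<epsilon>) / (A * s n))"
    proof -
      have "real n powr (x - \<epsilon>) = real n powr x * real n powr (- \<epsilon>)" by (simp flip: powr_add)
      then show ?thesis using A by simp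
    qed
    also have "\<dots> \<le> A * real n powr x * \<delta> n * (\<Sum>m\<in>{1..h * n}. cpow h p n m / s m)"
      using KL[OF n1(1)] A d by (intro mult_left_mono) auto
    also have "\<dots> = (\<Sum>m\<in>{1..h * n}. A * \<delta> n * (cpow h p n m / s m) * real n powr x)"
      by (simp add: sum_distrib_left mult_ac)
    also have "\<dots> \<le> (\<Sum>m\<in>{1..h * n}. A * \<delta> n * (cpow h p n m / s m) * (H * real m powr x))"
    proof (rule sum_mono)
      fix m assume m: "m \<in> {1..h * n}"
      show "A * \<delta> n * (cpow h p n m / s m) * real n powr x \<le> A * \<delta> n * (cpow h p n m / s m) * (H * real m powr x)"
      proof (cases "m < n")
        case True
        then show ?thesis by (simp add: cpow_eq_0)
      next
        case False
        have "real m \<le> real h * real n" using m by (simp flip: of_nat_mult)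
        moreover have "real n \<le> real h * real m"
        proof -
          have "real n \<le> 1 * real m" using False by simp
          also have "\<dots> \<le> real h * real m" using hp by (intro mult_right_mono) auto
          finally show ?thesis .
        qed
        ultimately have "real n powr x \<le> H * real m powr x" unfolding H_def using n1 m hp by (intro powr_compare) auto
        then show ?thesis using A d nn s[of m] m by (intro mult_left_mono) (auto simp: less_imp_le)
      qed
    qed
    also have "\<dots> = (\<Sum>m\<in>{1..h * n}. A * H * (real m powr x / s m * (\<delta> n * cpow h p n m)))" by (simp add: mult_ac)
    also have "\<dots> \<le> (\<Sum>m\<in>{1..h * N}. A * H * (real m powr x / s m * (\<delta> n * cpow h p n m)))"
      using n1 A Hp d nn s by (intro sum_mono2) (auto simp: less_imp_le intro: order_trans[OF _ mult_le_mono2])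
    finally show "real n powr (x - \<epsilon>) * (\<delta> n / s n) \<le> (\<Sum>m\<in>{1..h * N}. A * H * (real m powr x / s m * (\<delta> n * cpow h p n m)))" .
  qed
  also have "\<dots> = (\<Sum>m\<in>{1..h * N}. A * H * (real m powr x / s m * (\<Sum>n\<in>{0<..N}. \<delta> n * cpow h p n m)))"
    by (subst sum.swap) (simp add: sum_distrib_left)
  also have "\<dots> \<le> (\<Sum>m\<in>{1..h * N}. A * H * Ce * (real m powr x * e m))"
  proof (rule sum_mono)
    fix m assume m: "m \<in> {1..h * N}"
    have "(\<Sum>n\<in>{0<..N}. \<delta> n * cpow h p n m) \<le> (\<Sum>n\<in>{1..max N m}. \<delta> n * cpow h p n m)"
      using d nn by (intro sum_mono2) auto
    also have "\<dots> = (\<Sum>n\<in>{1..m}. \<delta> n * cpow h p n m)" by (rule sum.mono_neutral_right) (auto simp: cpow_eq_0)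
    also have "\<dots> \<le> Ce * (s m * e m)" using displacement_lower m by simp
    finally have "A * H * (real m powr x / s m * (\<Sum>n\<in>{0<..N}. \<delta> n * cpow h p n m)) \<le> A * H * (real m powr x / s m * (Ce * (s m * e m)))"
      using A Hp s[of m] m by (intro mult_left_mono) (auto simp: less_imp_le)
    also have "\<dots> = A * H * Ce * (real m powr x * e m)" using s[of m] m by simp
    finally show "A * H * (real m powr x / s m * (\<Sum>n\<in>{0<..N}. \<delta> n * cpow h p n m)) \<le> A * H * Ce * (real m powr x * e m)" .
  qed
  also have "\<dots> = A * H * Ce * (\<Sum>m\<in>{1..h * N}. real m powr x * e m)" by (simp add: sum_distrib_left)
  also have "\<dots> \<le> A * H * Ce * (\<Sum>m. real m powr x * e m)"
    using A Hp Ce e sm by (intro mult_left_mono sum_le_suminf) auto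
  finally show "(\<Sum>n\<in>{0<..N}. real n powr (x - \<epsilon>) * (\<delta> n / s n)) \<le> A * H * Ce * (\<Sum>m. real m powr x * e m)" .
qed

text \<open>The same scheme in the other direction. The kernels now sit at m - j, and
  \<open>sd\<close> serves to replace 1 / s m by a multiple of 1 / s (m - j) before
  \<open>KU\<close> applies.\<close>

lemma transfer_up:
  fixes s \<delta> e :: "nat \<Rightarrow> real"
  assumes s: "\<And>n. n \<ge> 1 \<Longrightarrow> s n > 0" and p: "\<And>a. p a \<ge> 0" and d: "\<And>n. \<delta> n \<ge> 0" and e: "\<And>n. e n \<ge> 0"
    and h: "h \<ge> 1" and A: "A > 0" and Cu: "Cu > 0" and A1: "A1 > 0" and eps: "\<epsilon> \<ge> 0"
    and KU: "\<And>n. n \<ge> 1 \<Longrightarrow> (\<Sum>m\<in>{1..h * n}. cpow h p n m / s m) \<le> A * real n powr \<epsilon> / s n"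
    and sd: "\<And>j n. j \<le> K \<Longrightarrow> n \<ge> 1 \<Longrightarrow> s n \<le> A1 * s (n + j)"
    and displacement_upper: "\<And>m. m > K \<Longrightarrow> s m * e m \<le> Cu * (\<Sum>j\<le>K. \<Sum>n\<in>{1..m}. \<delta> n * cpow h p n (m - j))"
    and sm: "summable (\<lambda>n. real n powr x * (\<delta> n / s n))"
  shows "summable (\<lambda>m. real m powr (x - \<epsilon>) * e m)"
proof (rule summable_from_tail_bound[where K = K])
  have nn: "cpow h p n m \<ge> 0" for n m by (rule cpow_nonneg[OF p])
  have hp: "real h \<ge> 1" using h by simp
  define y where "y = x - \<epsilon>"
  define H where "H = real h powr \<bar>y\<bar>"
  define K' where "K' = (real K + 1) powr \<bar>y\<bar>"
  have Hp: "H > 0" "K' > 0" using hp by (simp_all add: H_def K'_def)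
  show "0 \<le> real n powr (x - \<epsilon>) * e n" for n using e by simp
  fix M :: nat
  define F where "F = (\<lambda>k. real k powr y / s k * (\<Sum>n\<in>{1..M}. \<delta> n * cpow h p n k))"
  have F0: "F k \<ge> 0" if "k \<ge> 1" for k unfolding F_def using s[OF that] d nn by (auto intro!: mult_nonneg_nonneg sum_nonneg divide_nonneg_pos)
  have "(\<Sum>m\<in>{K<..M}. real m powr (x - \<epsilon>) * e m) \<le> (\<Sum>m\<in>{K<..M}. \<Sum>j\<le>K. Cu * A1 * K' * F (m - j))"
  proof (rule sum_mono)
    fix m assume m: "m \<in> {K<..M}"
    then have m1: "m > K" "m \<ge> 1" "m \<le> M" by auto
    have "e m \<le> Cu * (\<Sum>j\<le>K. \<Sum>n\<in>{1..m}. \<delta> n * cpow h p n (m - j)) / s m"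
      using displacement_upper[OF m1(1)] s[OF m1(2)] by (simp add: field_simps)
    then have "real m powr (x - \<epsilon>) * e m \<le> real m powr y * (Cu * (\<Sum>j\<le>K. \<Sum>n\<in>{1..m}. \<delta> n * cpow h p n (m - j)) / s m)"
      unfolding y_def by (intro mult_left_mono) auto
    also have "\<dots> = (\<Sum>j\<le>K. Cu * (real m powr y / s m) * (\<Sum>n\<in>{1..m}. \<delta> n * cpow h p n (m - j)))"
      by (simp add: sum_distrib_left mult_ac sum_divide_distrib)
    also have "\<dots> \<le> (\<Sum>j\<le>K. Cu * A1 * K' * F (m - j))"
    proof (rule sum_mono)
      fix j assume "j \<in> {..K}"
      then have j: "j \<le> K" by simp
      define k where "k = m - j"
      have k: "k \<ge> 1" "m = k + j" using m1 j by (auto simp: k_def)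
      have "real m \<le> (real K + 1) * real k"
      proof -
        have "real m \<le> real k + real K * 1" using k j by simp
        also have "\<dots> \<le> real k + real K * real k" using k by (intro add_left_mono mult_left_mono) auto
        finally show ?thesis by (simp add: algebra_simps)
      qed
      moreover have "real k \<le> (real K + 1) * real m" using k by (simp add: algebra_simps)
      ultimately have "real m powr y \<le> K' * real k powr y" unfolding K'_def using k m1 by (intro powr_compare) auto
      moreover have "1 / s m \<le> A1 / s k" using sd[OF j k(1)] s[OF k(1)] s[OF m1(2)] k(2) by (simp add: field_simps)
      ultimately have "real m powr y * (1 / s m) \<le> (K' * real k powr y) * (A1 / s k)"
        using s[OF m1(2)] Hp by (intro mult_mono) auto
      then have "Cu * (real m powr y / s m) * (\<Sum>n\<in>{1..m}. \<delta> n * cpow h p n k) \<le> Cu * ((K' * real k powr y) * (A1 / s k)) * (\<Sum>n\<in>{1..M}. \<delta> n * cpow h p n k)"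
        using Cu d nn m1 Hp A1 s[OF k(1)] by (intro mult_mono mult_left_mono sum_mono2 sum_nonneg mult_nonneg_nonneg) (auto simp: less_imp_le)
      also have "\<dots> = Cu * A1 * K' * F k" by (simp add: F_def)
      finally show "Cu * (real m powr y / s m) * (\<Sum>n\<in>{1..m}. \<delta> n * cpow h p n (m - j)) \<le> Cu * A1 * K' * F (m - j)"
        by (simp add: k_def)
    qed
    finally show "real m powr (x - \<epsilon>) * e m \<le> (\<Sum>j\<le>K. Cu * A1 * K' * F (m - j))" .
  qed
  also have "\<dots> = Cu * A1 * K' * (\<Sum>j\<le>K. \<Sum>m\<in>{K<..M}. F (m - j))"
    by (subst sum.swap) (simp add: sum_distrib_left)
  also have "\<dots> \<le> Cu * A1 * K' * (\<Sum>j\<le>K. \<Sum>k\<in>{1..M}. F k)"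
  proof (intro mult_left_mono sum_mono)
    fix j assume j: "j \<in> {..K}"
    have "(\<Sum>m\<in>{K<..M}. F (m - j)) = (\<Sum>k\<in>(\<lambda>m. m - j) ` {K<..M}. F k)"
      using j by (subst sum.reindex) (auto simp: inj_on_def)
    also have "\<dots> \<le> (\<Sum>k\<in>{1..M}. F k)" using j F0 by (intro sum_mono2) auto
    finally show "(\<Sum>m\<in>{K<..M}. F (m - j)) \<le> (\<Sum>k\<in>{1..M}. F k)" .
  qed (use Cu A1 Hp in auto)
  also have "\<dots> = Cu * A1 * K' * (real K + 1) * (\<Sum>k\<in>{1..M}. F k)" by (simp add: algebra_simps)
  also have "(\<Sum>k\<in>{1..M}. F k) \<le> A * H * (\<Sum>n. real n powr x * (\<delta> n / s n))"
  proof -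
    have "(\<Sum>k\<in>{1..M}. F k) = (\<Sum>k\<in>{1..M}. \<Sum>n\<in>{1..M}. \<delta> n * (real k powr y * (cpow h p n k / s k)))"
      by (simp add: F_def sum_distrib_left mult_ac)
    also have "\<dots> = (\<Sum>n\<in>{1..M}. \<Sum>k\<in>{1..M}. \<delta> n * (real k powr y * (cpow h p n k / s k)))" by (rule sum.swap)
    also have "\<dots> \<le> (\<Sum>n\<in>{1..M}. A * H * (real n powr x * (\<delta> n / s n)))"
    proof (rule sum_mono)
      fix n assume n: "n \<in> {1..M}"
      have "(\<Sum>k\<in>{1..M}. \<delta> n * (real k powr y * (cpow h p n k / s k))) \<le> (\<Sum>k\<in>{1..M}. \<delta> n * ((H * real n powr y) * (cpow h p n k / s k)))"
      proof (rule sum_mono)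
        fix k assume k: "k \<in> {1..M}"
        show "\<delta> n * (real k powr y * (cpow h p n k / s k)) \<le> \<delta> n * ((H * real n powr y) * (cpow h p n k / s k))"
        proof (cases "k < n \<or> h * n < k")
          case True
          then show ?thesis by (simp add: cpow_eq_0)
        next
          case False
          have "real k \<le> real h * real n" using False by (simp flip: of_nat_mult)
          moreover have "real n \<le> real h * real k"
          proof -
            have "real n \<le> 1 * real k" using False by simp
            also have "\<dots> \<le> real h * real k" using hp by (intro mult_right_mono) auto
            finally show ?thesis .
          qed
          ultimately have "real k powr y \<le> H * real n powr y" unfolding H_def using n k hp by (intro powr_compare) auto
          then show ?thesis using d nn s[of k] k by (intro mult_left_mono mult_right_mono) (auto simp: less_imp_le)
        qed
      qed
      also have "\<dots> = \<delta> n * H * real n powr y * (\<Sum>k\<in>{1..M}. cpow h p n k / s k)" by (simp add: sum_distrib_left mult_ac)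
      also have "\<dots> \<le> \<delta> n * H * real n powr y * (A * real n powr \<epsilon> / s n)"
      proof (intro mult_left_mono)
        have "(\<Sum>k\<in>{1..M}. cpow h p n k / s k) \<le> (\<Sum>k\<in>{1..max M (h * n)}. cpow h p n k / s k)"
          using nn s by (intro sum_mono2) (auto simp: less_imp_le)
        also have "\<dots> = (\<Sum>k\<in>{1..h * n}. cpow h p n k / s k)" by (rule sum.mono_neutral_right) (auto simp: cpow_eq_0)
        also have "\<dots> \<le> A * real n powr \<epsilon> / s n" using KU n by simp
        finally show "(\<Sum>k\<in>{1..M}. cpow h p n k / s k) \<le> A * real n powr \<epsilon> / s n" .
      qed (use d Hp in auto)
      also have "\<dots> = A * H * (real n powr x * (\<delta> n / s n))"
      proof -
        have "real n powr y * real n powr \<epsilon> = real n powr x" by (simp add: y_def flip: powr_add)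
        then show ?thesis by (metis (no_types, opaque_lifting) mult.assoc mult.commute times_divide_eq_right)
      qed
      finally show "(\<Sum>k\<in>{1..M}. \<delta> n * (real k powr y * (cpow h p n k / s k))) \<le> A * H * (real n powr x * (\<delta> n / s n))" .
    qed
    also have "\<dots> = A * H * (\<Sum>n\<in>{1..M}. real n powr x * (\<delta> n / s n))" by (simp add: sum_distrib_left)
    also have "\<dots> \<le> A * H * (\<Sum>n. real n powr x * (\<delta> n / s n))"
    proof (intro mult_left_mono sum_le_suminf sm)
      show "0 \<le> real n powr x * (\<delta> n / s n)" for n using d s[of n] by (cases "n = 0") (auto simp: less_imp_le)
    qed (use A Hp in auto)
    finally show ?thesis .
  qed
  finally show "(\<Sum>m\<in>{K<..M}. real m powr (x - \<epsilon>) * e m) \<le> Cu * A1 * K' * (real K + 1) * (A * H * (\<Sum>n. real n powr x * (\<delta> n / s n)))"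
    using Cu A1 Hp by (simp add: mult_left_mono)
qed

text \<open>A critical exponent is insensitive to shifts by arbitrarily small \<epsilon>; infinite
  infima are included.\<close>

lemma Inf_ereal_le_shift:
  assumes "\<And>z \<epsilon>. Q z \<Longrightarrow> \<epsilon> > 0 \<Longrightarrow> R (z + \<epsilon> :: real)"
  shows "Inf {ereal z | z. R z} \<le> Inf {ereal z | z. Q z}"
proof (rule Inf_greatest)
  fix y assume "y \<in> {ereal z | z. Q z}"
  then obtain z where z: "y = ereal z" "Q z" by blast
  show "Inf {ereal z | z. R z} \<le> y"
  proof (rule ereal_le_epsilon2)
    fix e :: real assume "e > 0"
    then have "R (z + e)" using assms z by blast
    then show "Inf {ereal z | z. R z} \<le> y + ereal e" unfolding z(1) plus_ereal.simps by (intro Inf_lower) blast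
  qed
qed

lemma V_fun_finite_iff:
  "V_fun V E W z < top \<longleftrightarrow> summable (\<lambda>n. real n powr (- (2 * z + 1)) * mean_sq_disp V E W n)"
proof -
  let ?f = "\<lambda>n. real n powr (- (2 * z + 1)) * mean_sq_disp V E W n"
  have nn: "?f n \<ge> 0" for n by (auto simp: mean_sq_disp_def intro!: mult_nonneg_nonneg divide_nonneg_nonneg sum_nonneg)
  have "V_fun V E W z = (\<Sum>n. ennreal (?f n))" unfolding V_fun_def by (intro suminf_cong) auto
  also have "\<dots> < top \<longleftrightarrow> summable ?f"
  proof
    assume "(\<Sum>n. ennreal (?f n)) < top"
    then show "summable ?f" by (intro summable_suminf_not_top) (use nn in auto)
  next
    assume "summable ?f"
    then have "(\<Sum>n. ennreal (?f n)) = ennreal (suminf ?f)" by (intro suminf_ennreal_eq nn summable_sums)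
    then show "(\<Sum>n. ennreal (?f n)) < top" by (simp only: ennreal_less_top)
  qed
  finally show ?thesis .
qed

text \<open>Double counting without kernels: m and n are comparable within a window, and each n
  belongs to the windows of boundedly many m.\<close>

lemma transfer_up_window:
  fixes d e :: "nat \<Rightarrow> real"
  assumes d: "\<And>n. d n \<ge> 0" and e: "\<And>n. e n \<ge> 0" and k: "k \<ge> 1" and C: "C > 0"
    and up: "\<And>m. m > K \<Longrightarrow> e m \<le> C * (\<Sum>n\<in>{n. 1 \<le> n \<and> k * n \<le> m + 2 * k \<and> m \<le> k * n + 2 * J}. d n)"
    and sm: "summable (\<lambda>n. real n powr x * d n)"
  shows "summable (\<lambda>m. real m powr x * e m)"
proof (rule summable_from_tail_bound[where K = K])
  define I where "I = (\<lambda>m. {n. 1 \<le> n \<and> k * n \<le> m + 2 * k \<and> m \<le> k * n + 2 * J})"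
  \<comment> \<open>One constant for two purposes: the ratio of m and n in either order, and the
    number of m whose window contains a given n.\<close>
  define c where "c = real (3 * k + 2 * J + 1)"
  define B where "B = c powr \<bar>x\<bar>"
  have B: "B > 0" by (simp add: B_def c_def)
  show "0 \<le> real m powr x * e m" for m using e by simp
  fix M :: nat
  have le_k: "n \<le> k * n" for n using k by simp
  have Isub: "I m \<subseteq> {1..M + 2 * k}" if "m \<le> M" for m
  proof
    fix n assume n: "n \<in> I m"
    have "n \<le> m + 2 * k" using n order_trans[OF le_k[of n]] by (auto simp: I_def)
    then show "n \<in> {1..M + 2 * k}" using n that by (simp add: I_def)
  qed
  have "(\<Sum>m\<in>{K<..M}. real m powr x * e m) \<le> (\<Sum>m\<in>{K<..M}. \<Sum>n\<in>{1..M + 2 * k}. of_bool (n \<in> I m) * (C * B * (real n powr x * d n)))"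
  proof (rule sum_mono)
    fix m assume m: "m \<in> {K<..M}"
    have "real m powr x * e m \<le> real m powr x * (C * (\<Sum>n\<in>I m. d n))"
      using up[of m] m by (intro mult_left_mono) (auto simp: I_def)
    also have "\<dots> = (\<Sum>n\<in>I m. real m powr x * (C * d n))" by (simp add: sum_distrib_left)
    also have "\<dots> \<le> (\<Sum>n\<in>I m. C * B * (real n powr x * d n))"
    proof (rule sum_mono)
      fix n assume "n \<in> I m"
      then have n: "1 \<le> n" "k * n \<le> m + 2 * k" "m \<le> k * n + 2 * J" by (auto simp: I_def)
      have "m \<le> (3 * k + 2 * J + 1) * n"
      proof -
        have "m \<le> k * n + 2 * J * 1" using n(3) by simp
        also have "\<dots> \<le> k * n + 2 * J * n" by (intro add_left_mono mult_le_mono2 n(1))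
        also have "\<dots> \<le> (3 * k + 2 * J + 1) * n" by (simp add: algebra_simps)
        finally show ?thesis .
      qed
      moreover have "n \<le> (3 * k + 2 * J + 1) * m"
      proof -
        have "n \<le> m + 2 * k * 1" using order_trans[OF le_k[of n] n(2)] by simp
        also have "\<dots> \<le> m + 2 * k * m" using m by (intro add_left_mono mult_le_mono2) auto
        also have "\<dots> \<le> (3 * k + 2 * J + 1) * m" by (simp add: algebra_simps)
        finally show ?thesis .
      qed
      ultimately have "real m \<le> c * real n" "real n \<le> c * real m"
        unfolding c_def of_nat_mult[symmetric] of_nat_le_iff by blast+
      then have "real m powr x \<le> B * real n powr x" unfolding B_def using n(1) m
        by (intro powr_compare) (auto simp: c_def)
      then have "real m powr x * (C * d n) \<le> (B * real n powr x) * (C * d n)" using C d by (intro mult_right_mono) auto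
      then show "real m powr x * (C * d n) \<le> C * B * (real n powr x * d n)" by (simp add: mult_ac)
    qed
    also have "\<dots> = (\<Sum>n\<in>{1..M + 2 * k}. of_bool (n \<in> I m) * (C * B * (real n powr x * d n)))"
      using Isub[of m] m by (intro sum.mono_neutral_cong_left) auto
    finally show "real m powr x * e m \<le> (\<Sum>n\<in>{1..M + 2 * k}. of_bool (n \<in> I m) * (C * B * (real n powr x * d n)))" .
  qed
  also have "\<dots> = (\<Sum>n\<in>{1..M + 2 * k}. (C * B * (real n powr x * d n)) * (\<Sum>m\<in>{K<..M}. of_bool (n \<in> I m)))"
    by (subst sum.swap) (simp add: sum_distrib_left mult.commute)
  also have "\<dots> \<le> (\<Sum>n\<in>{1..M + 2 * k}. (C * B * (real n powr x * d n)) * c)"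
  proof (intro sum_mono mult_left_mono)
    fix n
    have "(\<Sum>m\<in>{K<..M}. of_bool (n \<in> I m)) = real (card ({K<..M} \<inter> {m. n \<in> I m}))"
      by (simp add: of_bool_def sum.If_cases)
    also have "\<dots> \<le> real (card {k * n - 2 * k..k * n + 2 * J})"
      by (intro of_nat_mono card_mono) (auto simp: I_def)
    also have "\<dots> \<le> c" unfolding c_def card_atLeastAtMost of_nat_le_iff by linarith
    finally show "(\<Sum>m\<in>{K<..M}. of_bool (n \<in> I m)) \<le> c" .
  qed (use C B d in auto)
  also have "\<dots> = C * B * c * (\<Sum>n\<in>{1..M + 2 * k}. real n powr x * d n)" by (simp add: sum_distrib_left mult_ac)
  also have "\<dots> \<le> C * B * c * (\<Sum>n. real n powr x * d n)"
    using C B d sm by (intro mult_left_mono sum_le_suminf) (auto simp: c_def)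
  finally show "(\<Sum>m\<in>{K<..M}. real m powr x * e m) \<le> C * B * c * (\<Sum>n. real n powr x * d n)" .
qed

text \<open>Along the integers the quotient converges to k^y, which is not 0, so the quotient and
  its inverse are bounded sequences. This makes the comparison uniform from n = 1 on.\<close>

lemma slowly_varying_dilation:
  assumes L: "slowly_varying L" and k: "k \<ge> (1::nat)"
  shows "\<exists>D>0. \<forall>n\<ge>1. L (real (k * n)) * real (k * n) powr y \<le> D * (L (real n) * real n powr y) \<and>
     L (real n) * real n powr y \<le> D * (L (real (k * n)) * real (k * n) powr y)"
proof -
  define l where "l = (\<lambda>n::nat. L (real n) * real n powr y)"
  have lp: "l n > 0" if "n \<ge> 1" for n using L that by (simp add: l_def slowly_varying_def)
  define \<rho> where "\<rho> = (\<lambda>n. l (k * n) / l n)"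
  have "((\<lambda>x. L (real k * x) / L x) \<longlongrightarrow> 1) at_top" using L k by (simp add: slowly_varying_def)
  then have "(\<lambda>n. L (real k * real n) / L (real n)) \<longlonglongrightarrow> 1"
    using filterlim_compose filterlim_real_sequentially by blast
  then have lim: "(\<lambda>n. L (real k * real n) / L (real n) * real k powr y) \<longlonglongrightarrow> 1 * real k powr y" by (intro tendsto_intros)
  have "eventually (\<lambda>n. L (real k * real n) / L (real n) * real k powr y = \<rho> n) sequentially"
    using eventually_ge_at_top[of 1] by eventually_elim (auto simp: \<rho>_def l_def powr_mult)
  with lim have r: "\<rho> \<longlonglongrightarrow> real k powr y" using Lim_transform_eventually by fastforce
  have "(\<lambda>n. inverse (\<rho> n)) \<longlonglongrightarrow> inverse (real k powr y)" using r k by (intro tendsto_inverse) auto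
  then have "Bseq (\<lambda>n. inverse (\<rho> n))" "Bseq \<rho>" using r by (auto intro: convergentI convergent_imp_Bseq)
  then obtain A B where A: "A > 0" "\<And>n. norm (inverse (\<rho> n)) \<le> A" and B: "B > 0" "\<And>n. norm (\<rho> n) \<le> B"
    unfolding Bseq_def by blast
  have "l (k * n) \<le> max A B * l n \<and> l n \<le> max A B * l (k * n)" if n: "n \<ge> 1" for n
  proof
    have p: "l n > 0" "l (k * n) > 0" using lp n k by auto
    have "\<rho> n \<le> B" "inverse (\<rho> n) \<le> A" using abs_le_D1[of "\<rho> n"] abs_le_D1[of "inverse (\<rho> n)"] A(2)[of n] B(2)[of n] by (simp_all only: real_norm_def)
    then have "l (k * n) \<le> B * l n" "l n \<le> A * l (k * n)" using p by (simp_all add: \<rho>_def field_simps)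
    moreover have "B * l n \<le> max A B * l n" "A * l (k * n) \<le> max A B * l (k * n)" using p by (intro mult_right_mono; simp)+
    ultimately show "l (k * n) \<le> max A B * l n" "l n \<le> max A B * l (k * n)" by linarith+
  qed
  moreover have "max A B > 0" using A by simp
  ultimately show ?thesis unfolding l_def by blast
qed

context lt_domain
begin

section \<open>Walks of length one and moments of order zero\<close>

definition star1 :: "'v \<Rightarrow> ('v \<times> 'g) set set" where "star1 u = lift ` star u \<union> internal u"

lemma finite_star1: "u \<in> V0 \<Longrightarrow> finite (star1 u)"
proof -
  assume u: "u \<in> V0"
  have "edges Hv EH \<subseteq> Pow Hv" using edges_subset by blast
  then have "finite (edges Hv EH)" using gadget_facts(1) by (simp add: finite_subset)
  then show ?thesis using star_card[OF u] by (simp add: star1_def internal_def)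
qed

lemma mem_star1: "e \<in> Ed1 \<Longrightarrow> (u, x) \<in> e \<Longrightarrow> e \<in> star1 u"
proof -
  assume e: "e \<in> Ed1" "(u, x) \<in> e"
  from e(1) consider f where "f \<in> Ed0" "e = lift f" | v where "e \<in> internal v" using Ed1_cases by blast
  then show ?thesis
  proof cases
    case 1
    then have "u \<in> f" using e(2) mem_lift by blast
    then show ?thesis using 1 by (auto simp: star1_def star_def)
  next
    case 2
    then have "v = u" using internal_fst[OF 2 e(2)] by simp
    then show ?thesis using 2 by (simp add: star1_def)
  qed
qed

lemma finite_X1: "finite X1"
proof -
  have "X1 \<subseteq> (\<Union>w\<in>W0. star1 w)" using mem_star1 by (fastforce simp: incident_edges_def)
  moreover have "finite (\<Union>w\<in>W0. star1 w)" using W0_facts finite_star1 by auto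
  ultimately show ?thesis by (rule finite_subset)
qed

text \<open>Finiteness and nonemptiness at length 1 make the count positive, which fixes the signs
  of \<mu>0 and \<mu>1 in \<open>mu_pos\<close>.\<close>

lemma finite_S0_1: "finite (S0 1)"
proof (rule finite_subset)
  show "S0 1 \<subseteq> (\<Union>e\<in>X0. \<Union>v\<in>e. (\<lambda>f. ([v], [e, f])) ` star v)"
  proof
    fix \<pi> assume "\<pi> \<in> S0 1"
    then obtain vs es where p: "\<pi> = (vs, es)" "mid_saw V0 E0 vs es" "length vs = 1" "hd es \<in> X0" by (cases \<pi>) (auto simp: S0_iff)
    from p(2,3) show "\<pi> \<in> (\<Union>e\<in>X0. \<Union>v\<in>e. (\<lambda>f. ([v], [e, f])) ` star v)"
      by (rule length_one_saw) (use p(1,4) in \<open>auto simp: star_def\<close>)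
  qed
  show "finite (\<Union>e\<in>X0. \<Union>v\<in>e. (\<lambda>f. ([v], [e, f])) ` star v)"
  proof (intro finite_UN_I finite_imageI finite_X0)
    fix e v assume e: "e \<in> X0"
    then have "e \<in> Ed0" by (simp add: incident_edges_def)
    then show "finite e" "v \<in> e \<Longrightarrow> finite (star v)" using Ed0_finite edges_subset star_card by blast+
  qed
qed

lemma finite_S1_1: "finite (S1 1)"
proof (rule finite_subset)
  show "S1 1 \<subseteq> (\<Union>e\<in>X1. \<Union>v\<in>e. (\<lambda>f. ([v], [e, f])) ` star1 (fst v))"
  proof
    fix \<pi> assume "\<pi> \<in> S1 1"
    then obtain vs es where p: "\<pi> = (vs, es)" "mid_saw V1 E1 vs es" "length vs = 1" "hd es \<in> X1" by (cases \<pi>) (auto simp: S1_iff)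
    from p(2,3) show "\<pi> \<in> (\<Union>e\<in>X1. \<Union>v\<in>e. (\<lambda>f. ([v], [e, f])) ` star1 (fst v))"
    proof (rule length_one_saw)
      fix v e f assume a: "vs = [v]" "es = [e, f]" "v \<in> e" "v \<in> f" "f \<in> Ed1"
      have "f \<in> star1 (fst v)" using mem_star1[OF a(5), of "fst v" "snd v"] a(4) by simp
      then show ?thesis using a p(1,4) by auto
    qed
  qed
  show "finite (\<Union>e\<in>X1. \<Union>v\<in>e. (\<lambda>f. ([v], [e, f])) ` star1 (fst v))"
  proof (intro finite_UN_I finite_imageI finite_X1)
    fix e v assume e: "e \<in> X1"
    then have e: "e \<in> Ed1" by (simp add: incident_edges_def)
    show "finite e" using Ed1_finite[OF e] by simp
    assume "v \<in> e"
    then have "fst v \<in> V0" using edges_subset[OF e] by (auto simp: lt_vertices_def)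
    then show "finite (star1 (fst v))" by (rule finite_star1)
  qed
qed

lemma S0_1_nonempty: "S0 1 \<noteq> {}"
proof -
  obtain w where w: "w \<in> W0" "w \<in> V0" using W0_facts by blast
  have "card (star w) = 3" using star_card w by blast
  then obtain e f where ef: "e \<in> star w" "f \<in> star w" "e \<noteq> f" by (auto simp: card_3_iff)
  have "e \<in> X0" using ef(1) w by (auto simp: star_def incident_edges_def)
  moreover have "mid_saw V0 E0 [w] [e, f]" using ef w(2) by (simp add: mid_saw_def star_def)
  ultimately have "([w], [e, f]) \<in> S0 1" unfolding S0_iff by simp
  then show ?thesis by blast
qed

lemma S1_1_nonempty: "S1 1 \<noteq> {}"
proof -
  obtain w where w: "w \<in> W0" "w \<in> V0" using W0_facts by blast
  have "card (star w) = 3" using star_card w by blast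
  then obtain e f where ef: "e \<in> star w" "f \<in> star w" "e \<noteq> f" by (auto simp: card_3_iff)
  have ed: "e \<in> Ed0" "f \<in> Ed0" "w \<in> e" "w \<in> f" using ef by (auto simp: star_def)
  define a where "a = port w e"
  define b where "b = port w f"
  have ne: "a \<noteq> b" unfolding a_def b_def by (rule port_ne[OF ed ef(3)])
  have ab: "a \<in> Hv" "b \<in> Hv" using port_in[OF ed(1,3)] port_in[OF ed(2,4)] gadget_facts(4) unfolding a_def b_def by blast+
  obtain \<gamma> where \<gamma>: "\<gamma> \<in> GP a b" using GP_nonempty[OF ab] by blast
  obtain c zs where c: "\<gamma> = a # c # zs"
  proof (cases \<gamma>)
    case Nil
    then show ?thesis using GP_ne[OF \<gamma>] by simp
  next
    case (Cons x ys)
    have h: "x = a" "last \<gamma> = b" using \<gamma> Cons by (auto simp: GP_def)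
    show ?thesis
    proof (cases ys)
      case Nil
      then show ?thesis using h Cons ne by simp
    next
      case (Cons c zs)
      then show ?thesis using that h \<open>\<gamma> = x # ys\<close> by simp
    qed
  qed
  have E: "EH a c" using \<gamma> unfolding c by (simp add: GP_def is_walk_simps)
  then have "{a, c} \<in> edges Hv EH" using EH_in edgesI by metis
  then have i: "Pair w ` {a, c} \<in> internal w" unfolding internal_def by (rule imageI)
  have l: "lift e \<in> X1" using ed(1,3) w by (intro lift_X1) (auto simp: incident_edges_def)
  have "Pair w ` {a, c} \<in> Ed1" "lift e \<in> Ed1" using i w ed(1) Ed1_cases by blast+
  moreover have "lift e \<noteq> Pair w ` {a, c}" using internal_not_lift[OF i] ed(1) by blast
  moreover have "(w, a) \<in> lift e" using mem_lift ed a_def by blast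
  ultimately have "mid_saw V1 E1 [(w, a)] [lift e, Pair w ` {a, c}]"
    using ab(1) w(2) unfolding mid_saw_def by (simp add: lt_vertices_def)
  then have "([(w, a)], [lift e, Pair w ` {a, c}]) \<in> S1 1" using l unfolding S1_iff by simp
  then show ?thesis by blast
qed

lemma M0_0: "M0 0 n = real (card (S0 n))" and M1_0: "M1 0 n = real (card (S1 n))"
  by (simp_all add: M0_def M1_def)

lemma M_nonneg: "M0 k n \<ge> 0" "M1 k n \<ge> 0"
  by (auto simp: M0_def M1_def saw_norm_nonneg intro!: sum_nonneg)

lemma card_le_M0: "n \<ge> 1 \<Longrightarrow> real (card (S0 n)) \<le> M0 k n"
proof -
  assume n: "n \<ge> 1"
  have "(\<Sum>\<pi>\<in>S0 n. 1) \<le> M0 k n" unfolding M0_def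
  proof (rule sum_mono)
    fix \<pi> assume "\<pi> \<in> S0 n"
    then obtain vs es where p: "\<pi> = (vs, es)" "mid_saw V0 E0 vs es" "length vs = n" by (cases \<pi>) (auto simp: S0_iff)
    then have "saw_norm V0 E0 \<pi> \<ge> 1" using n by (auto intro!: saw_norm_ge_1)
    then show "1 \<le> saw_norm V0 E0 \<pi> ^ k" by simp
  qed
  then show ?thesis by simp
qed

end

subsection \<open>Equality of the exponents\<close>

locale regular_counts = lt_domain V0 E0 Hv EH w1 w2 w3 P W0
  for V0 :: "'v set" and E0 :: "'v \<Rightarrow> 'v \<Rightarrow> bool" and Hv :: "'g set" and EH :: "'g \<Rightarrow> 'g \<Rightarrow> bool"
    and w1 w2 w3 :: 'g and P :: "'v \<Rightarrow> 'v \<Rightarrow> 'g" and W0 :: "'v set" +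
  fixes L :: "real \<Rightarrow> real" and \<mu>0 \<mu>1 y C10 C20 C11 C21 :: real
  assumes L: "slowly_varying L" and C0: "0 < C10" "C10 \<le> C20" and C1: "0 < C11" "C11 \<le> C21"
    and bounds0: "n \<ge> 1 \<Longrightarrow> C10 * L (real n) * real n powr y * \<mu>0 ^ n \<le> real (card (S0 n)) \<and>
        real (card (S0 n)) \<le> C20 * L (real n) * real n powr y * \<mu>0 ^ n"
    and bounds1: "n \<ge> 1 \<Longrightarrow> C11 * L (real n) * real n powr y * \<mu>1 ^ n \<le> real (card (S1 n)) \<and>
        real (card (S1 n)) \<le> C21 * L (real n) * real n powr y * \<mu>1 ^ n"
begin

definition l :: "nat \<Rightarrow> real" where "l n = L (real n) * real n powr y"

lemma l_pos: "n \<ge> 1 \<Longrightarrow> l n > 0" using L by (simp add: l_def slowly_varying_def)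

text \<open>The count at n = 1 is positive and bounded above by a positive multiple of
  \<mu>.\<close>

lemma mu_pos: "\<mu>0 > 0" "\<mu>1 > 0"
proof -
  have "L 1 > 0" using L by (simp add: slowly_varying_def)
  moreover have "card (S0 1) > 0" "card (S1 1) > 0" using finite_S0_1 finite_S1_1 S0_1_nonempty S1_1_nonempty by (simp_all add: card_gt_0_iff)
  then have "0 < C20 * L 1 * \<mu>0" "0 < C21 * L 1 * \<mu>1" using bounds0[of 1] bounds1[of 1] by auto
  moreover have "C20 > 0" "C21 > 0" using C0 C1 by auto
  ultimately show "\<mu>0 > 0" "\<mu>1 > 0" by (metis mult_pos_pos zero_less_mult_pos)+
qed

definition s :: "nat \<Rightarrow> real" where "s n = real (card (S0 n)) / \<mu>0 ^ n"
definition t :: "nat \<Rightarrow> real" where "t n = real (card (S1 n)) / \<mu>1 ^ n"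

lemma s_bounds: "n \<ge> 1 \<Longrightarrow> C10 * l n \<le> s n \<and> s n \<le> C20 * l n"
  using bounds0[of n] mu_pos by (simp add: s_def l_def field_simps)

lemma t_bounds: "n \<ge> 1 \<Longrightarrow> C11 * l n \<le> t n \<and> t n \<le> C21 * l n"
  using bounds1[of n] mu_pos by (simp add: t_def l_def field_simps)

lemma s_pos: "n \<ge> 1 \<Longrightarrow> s n > 0"
  using mult_pos_pos[OF C0(1) l_pos[of n]] s_bounds[of n] by linarith

lemma t_pos: "n \<ge> 1 \<Longrightarrow> t n > 0"
  using mult_pos_pos[OF C1(1) l_pos[of n]] t_bounds[of n] by linarith

text \<open>The lower bounds make the cardinalities positive, and \<open>card\<close> of an infinite
  set is 0.\<close>

lemma fin0: "n \<ge> 1 \<Longrightarrow> finite (S0 n)" and fin1: "n \<ge> 1 \<Longrightarrow> finite (S1 n)"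
  using s_pos[of n] t_pos[of n] card.infinite by (fastforce simp: s_def t_def)+

text \<open>Here the common L and the common exponent of the two graphs enter: both normalised
  counts are comparable to the same \<open>l\<close>.\<close>

lemma t_le_s: "n \<ge> 1 \<Longrightarrow> t n \<le> C21 / C10 * s n"
proof -
  assume n: "n \<ge> 1"
  have "t n \<le> C21 / C10 * (C10 * l n)" using t_bounds[OF n] C0 by simp
  also have "\<dots> \<le> C21 / C10 * s n" using s_bounds[OF n] C0 C1 by (intro mult_left_mono) auto
  finally show ?thesis .
qed

lemma s_le_t: "n \<ge> 1 \<Longrightarrow> s n \<le> C20 / C11 * t n"
proof -
  assume n: "n \<ge> 1"
  have "s n \<le> C20 / C11 * (C11 * l n)" using s_bounds[OF n] C1 by simp
  also have "\<dots> \<le> C20 / C11 * t n" using t_bounds[OF n] C0 C1 by (intro mult_left_mono) auto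
  finally show ?thesis .
qed

lemma s_dilation:
  assumes k: "k \<ge> 1"
  shows "\<exists>D>0. \<forall>n\<ge>1. s (k * n) \<le> D * s n \<and> s n \<le> D * s (k * n)"
proof -
  obtain D where D: "D > 0" "\<And>n. n \<ge> 1 \<Longrightarrow> l (k * n) \<le> D * l n \<and> l n \<le> D * l (k * n)"
    using slowly_varying_dilation[OF L k, of y] unfolding l_def by blast
  have C: "C20 > 0" using C0 by simp
  have *: "s a \<le> C20 * D / C10 * s b" if "a \<ge> 1" "b \<ge> 1" "l a \<le> D * l b" for a b
  proof -
    have "s a \<le> C20 * (D * l b)" using s_bounds[OF that(1)] mult_left_mono[OF that(3), of C20] C by linarith
    also have "\<dots> = C20 * D / C10 * (C10 * l b)" using C0 by simp
    also have "\<dots> \<le> C20 * D / C10 * s b" using s_bounds[OF that(2)] C0 C D(1) by (intro mult_left_mono) auto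
    finally show ?thesis .
  qed
  have "k * n \<ge> 1" if "n \<ge> 1" for n using k that by simp
  then show ?thesis using * D C C0 by (intro exI[of _ "C20 * D / C10"]) auto
qed

text \<open>Fixed by \<open>SOME\<close>, because the sublocale declaration below needs a term for
  the doubling constant.\<close>

definition D2 :: real where "D2 = (SOME D. \<forall>n\<ge>1. s (2 * n) \<le> D * s n \<and> s n \<le> D * s (2 * n))"

lemma D2: "n \<ge> 1 \<Longrightarrow> s (2 * n) \<le> D2 * s n \<and> s n \<le> D2 * s (2 * n)"
proof -
  have "\<exists>D. \<forall>n\<ge>1. s (2 * n) \<le> D * s n \<and> s n \<le> D * s (2 * n)" using s_dilation[of 2] by auto
  from someI_ex[OF this] show "n \<ge> 1 \<Longrightarrow> ?thesis" unfolding D2_def by blast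
qed

sublocale ds: doubling_submult s D2
proof
  show "s (m + n) \<le> s m * s n" if "m \<ge> 1" "n \<ge> 1" for m n
  proof -
    have "real (card (S0 (m + n))) \<le> real (card (S0 m)) * real (card (S0 n))"
      using card_S0_submult[OF fin0[OF that(1)] fin0[OF that(2)]] by (metis of_nat_mono of_nat_mult)
    then show ?thesis using mu_pos by (simp add: s_def power_add divide_right_mono)
  qed
qed (use s_pos D2 in auto)

text \<open>The law p of the overview; the tilt is the one that turns the raw counts on both graphs
  into s and t.\<close>

definition r :: "nat \<Rightarrow> real" where "r = (\<lambda>a. \<mu>0 * (1 / \<mu>1) ^ a * g a)"

lemma r_nonneg: "r a \<ge> 0" using mu_pos g_nonneg by (simp add: r_def)

lemma cpow_r: "cpow hh r n m = \<mu>0 ^ n * (1 / \<mu>1) ^ m * cpow hh g n m"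
  unfolding r_def by (rule cpow_scale)

lemma scaled_moment_lower: "m \<ge> 1 \<Longrightarrow> (\<Sum>n\<in>{1..m}. M0 k n / \<mu>0 ^ n * cpow hh r n m) \<le> M1 k m / \<mu>1 ^ m"
proof -
  assume m: "m \<ge> 1"
  have "(\<Sum>n\<in>{1..m}. M0 k n / \<mu>0 ^ n * cpow hh r n m) = (\<Sum>n\<in>{1..m}. M0 k n * cpow hh g n m / \<mu>1 ^ m)"
    using mu_pos by (simp add: cpow_r power_divide)
  also have "\<dots> = (\<Sum>n\<in>{1..m}. M0 k n * cpow hh g n m) / \<mu>1 ^ m" by (simp add: sum_divide_distrib)
  also have "\<dots> \<le> M1 k m / \<mu>1 ^ m" using m fin0 fin1 mu_pos by (intro divide_right_mono moment_lower) auto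
  finally show ?thesis .
qed

text \<open>Bounds \<mu>1^(-j) for all j \<le> 2 * hh, whether \<mu>1 is above or below 1.\<close>

definition B1 :: real where "B1 = max 1 (1 / \<mu>1) ^ (2 * hh)"

lemma B1_pos: "B1 > 0" unfolding B1_def by (intro zero_less_power) simp

lemma scaled_moment_upper: "m > 2 * hh \<Longrightarrow>
  M1 k m / \<mu>1 ^ m \<le> real (Suc NC) * (4 * real hh) ^ k * B1 * (\<Sum>j\<le>2 * hh. \<Sum>n\<in>{1..m}. M0 k n / \<mu>0 ^ n * cpow hh r n (m - j))"
proof -
  assume m: "m > 2 * hh"
  have nn: "M0 k n / \<mu>0 ^ n * cpow hh r n i \<ge> 0" for n i using M_nonneg mu_pos cpow_nonneg[of r] r_nonneg by auto
  have eq: "M0 k n * cpow hh g n (m - j) / \<mu>1 ^ m = (1 / \<mu>1) ^ j * (M0 k n / \<mu>0 ^ n * cpow hh r n (m - j))" if "j \<le> 2 * hh" for n j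
  proof -
    have "\<mu>1 ^ m = \<mu>1 ^ j * \<mu>1 ^ (m - j)" using that m by (simp flip: power_add)
    then show ?thesis using mu_pos by (simp add: cpow_r power_divide)
  qed
  have le: "(1 / \<mu>1) ^ j \<le> B1" if "j \<le> 2 * hh" for j
  proof -
    have "(1 / \<mu>1) ^ j \<le> max 1 (1 / \<mu>1) ^ j" using mu_pos by (intro power_mono) auto
    also have "\<dots> \<le> B1" unfolding B1_def using that by (intro power_increasing) auto
    finally show ?thesis .
  qed
  have "M1 k m / \<mu>1 ^ m \<le> (real NC * (4 * real hh) ^ k * (\<Sum>j\<le>2 * hh. \<Sum>n\<in>{1..m}. M0 k n * cpow hh g n (m - j))) / \<mu>1 ^ m"
    using m fin0 fin1 mu_pos by (intro divide_right_mono moment_upper) auto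
  also have "\<dots> = real NC * (4 * real hh) ^ k * (\<Sum>j\<le>2 * hh. \<Sum>n\<in>{1..m}. M0 k n * cpow hh g n (m - j) / \<mu>1 ^ m)"
    by (simp only: sum_divide_distrib[symmetric] times_divide_eq_right)
  also have "\<dots> = real NC * (4 * real hh) ^ k * (\<Sum>j\<le>2 * hh. \<Sum>n\<in>{1..m}. (1 / \<mu>1) ^ j * (M0 k n / \<mu>0 ^ n * cpow hh r n (m - j)))"
    using eq by simp
  \<comment> \<open>Enlarging \<open>NC\<close> by 1 makes the constant visibly positive, as the
    renewal locale requires of \<open>CF\<close>.\<close>
  also have "\<dots> \<le> real (Suc NC) * (4 * real hh) ^ k * (\<Sum>j\<le>2 * hh. \<Sum>n\<in>{1..m}. B1 * (M0 k n / \<mu>0 ^ n * cpow hh r n (m - j)))"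
    using nn le mu_pos by (intro mult_mono sum_mono mult_right_mono sum_nonneg mult_nonneg_nonneg[OF _ nn]) auto
  also have "\<dots> = real (Suc NC) * (4 * real hh) ^ k * B1 * (\<Sum>j\<le>2 * hh. \<Sum>n\<in>{1..m}. M0 k n / \<mu>0 ^ n * cpow hh r n (m - j))"
    by (simp add: sum_distrib_left mult_ac)
  finally show ?thesis .
qed

definition cF :: real where "cF = C10 / C21"
definition CF :: real where "CF = C20 / C11 * (real (Suc NC) * B1)"

text \<open>Order 0 of the scaled moment inequalities, with the count t of the transformed graph
  replaced by s at the price of constants.\<close>

lemma kernel_facts:
  shows cF_pos: "cF > 0" and CF_pos: "CF > 0"
    and renewal_lower: "m \<ge> 1 \<Longrightarrow> cF * (\<Sum>y\<in>{1..m}. s y * cpow hh r y m) \<le> s m"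
    and renewal_upper: "m > 2 * hh \<Longrightarrow> s m \<le> CF * (\<Sum>j\<le>2 * hh. \<Sum>y\<in>{1..m}. s y * cpow hh r y (m - j))"
proof -
  have C: "C20 > 0" "C21 > 0" using C0 C1 by auto
  show c: "cF > 0" "CF > 0" using C C0 C1 B1_pos by (simp_all add: cF_def CF_def)
  show "cF * (\<Sum>y\<in>{1..m}. s y * cpow hh r y m) \<le> s m" if m: "m \<ge> 1"
  proof -
    have "cF * (\<Sum>y\<in>{1..m}. s y * cpow hh r y m) \<le> cF * t m"
      using scaled_moment_lower[OF m, of 0] c by (intro mult_left_mono) (auto simp: M0_0 M1_0 s_def t_def)
    also have "\<dots> \<le> cF * (C21 / C10 * s m)" using t_le_s[OF m] c by (intro mult_left_mono) auto
    also have "\<dots> = s m" using C C0 by (simp add: cF_def)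
    finally show ?thesis .
  qed
  show "s m \<le> CF * (\<Sum>j\<le>2 * hh. \<Sum>y\<in>{1..m}. s y * cpow hh r y (m - j))" if m: "m > 2 * hh"
  proof -
    have "s m \<le> C20 / C11 * t m" using m by (intro s_le_t) simp
    also have "\<dots> \<le> C20 / C11 * (real (Suc NC) * B1 * (\<Sum>j\<le>2 * hh. \<Sum>y\<in>{1..m}. s y * cpow hh r y (m - j)))"
      using scaled_moment_upper[OF m, of 0] C C1 by (intro mult_left_mono) (auto simp: M0_0 M1_0 s_def t_def)
    also have "\<dots> = CF * (\<Sum>j\<le>2 * hh. \<Sum>y\<in>{1..m}. s y * cpow hh r y (m - j))" unfolding CF_def by (simp only: mult.assoc)
    finally show ?thesis .
  qed
qed

lemma r_sum: "(\<Sum>a\<in>{1..hh}. r a) = 1"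
  by (rule ds.total_weight_eq_1[OF r_nonneg cF_pos CF_pos renewal_lower renewal_upper])

sublocale rk: renewal_kernel s D2 hh r "2 * hh" cF CF
  by unfold_locales (use r_nonneg r_sum cF_pos CF_pos renewal_lower renewal_upper in auto)

definition \<delta> :: "nat \<Rightarrow> real" where "\<delta> n = M0 2 n / \<mu>0 ^ n"
definition e :: "nat \<Rightarrow> real" where "e m = M1 2 m / \<mu>1 ^ m / t m"

lemma disp0: "mean_sq_disp V0 E0 W0 n = \<delta> n / s n"
  using mu_pos by (simp add: mean_sq_disp_def M0_def \<delta>_def s_def)

lemma disp1: "mean_sq_disp V1 E1 (W0 \<times> Hv) n = e n"
  using mu_pos by (simp add: mean_sq_disp_def M1_def e_def t_def)

lemma \<delta>_nonneg: "\<delta> n \<ge> 0" using M_nonneg mu_pos by (simp add: \<delta>_def)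

lemma e_nonneg: "e n \<ge> 0" using M_nonneg mu_pos by (simp add: e_def t_def)

lemma displacement_lower: "m \<ge> 1 \<Longrightarrow> (\<Sum>n\<in>{1..m}. \<delta> n * cpow hh r n m) \<le> C21 / C10 * (s m * e m)"
proof -
  assume m: "m \<ge> 1"
  have "(\<Sum>n\<in>{1..m}. \<delta> n * cpow hh r n m) \<le> t m * e m"
    using scaled_moment_lower[OF m, of 2] t_pos[OF m] by (simp add: \<delta>_def e_def)
  also have "\<dots> \<le> (C21 / C10 * s m) * e m" using t_le_s[OF m] e_nonneg by (intro mult_right_mono)
  finally show ?thesis by (simp only: mult.assoc)
qed

lemma displacement_upper: "\<exists>Cu>0. \<forall>m>2 * hh. s m * e m \<le> Cu * (\<Sum>j\<le>2 * hh. \<Sum>n\<in>{1..m}. \<delta> n * cpow hh r n (m - j))"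
proof -
  define Cu where "Cu = real (Suc NC) * (4 * real hh)\<^sup>2 * B1"
  have C: "C20 > 0" "hh > 0" "Cu > 0" using C0 hh_pos B1_pos by (auto simp: Cu_def)
  have "s m * e m \<le> C20 / C11 * Cu * (\<Sum>j\<le>2 * hh. \<Sum>n\<in>{1..m}. \<delta> n * cpow hh r n (m - j))" if m: "m > 2 * hh" for m
  proof -
    have m1: "m \<ge> 1" using m by simp
    have "s m * e m \<le> (C20 / C11 * t m) * e m" using s_le_t[OF m1] e_nonneg by (intro mult_right_mono)
    also have "\<dots> = C20 / C11 * (M1 2 m / \<mu>1 ^ m)" using t_pos[OF m1] by (simp add: e_def)
    also have "\<dots> \<le> C20 / C11 * (Cu * (\<Sum>j\<le>2 * hh. \<Sum>n\<in>{1..m}. \<delta> n * cpow hh r n (m - j)))"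
      using scaled_moment_upper[OF m, of 2] C C1 unfolding Cu_def \<delta>_def by (intro mult_left_mono) auto
    finally show ?thesis by (simp only: mult.assoc)
  qed
  moreover have "C20 / C11 * Cu > 0" using C C1 by simp
  ultimately show ?thesis by blast
qed

lemma spread_case:
  assumes ij: "1 \<le> i" "i < j" "j \<le> hh" "g i > 0" "g j > 0" and eps: "\<epsilon> > 0"
  shows "summable (\<lambda>m. real m powr x * e m) \<Longrightarrow> summable (\<lambda>n. real n powr (x - \<epsilon>) * (\<delta> n / s n))"
    and "summable (\<lambda>n. real n powr x * (\<delta> n / s n)) \<Longrightarrow> summable (\<lambda>m. real m powr (x - \<epsilon>) * e m)"
proof -
  interpret sk: spread_kernel s D2 hh r "2 * hh" cF CF i "j - i"
    by unfold_locales (use ij mu_pos in \<open>auto simp: r_def\<close>)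
  obtain A where A: "A > 0" "\<And>n. n \<ge> 1 \<Longrightarrow> (\<Sum>m\<in>{1..hh * n}. cpow hh r n m / s m) \<le> A * real n powr \<epsilon> / s n"
    "\<And>n. n \<ge> 1 \<Longrightarrow> real n powr (- \<epsilon>) / (A * s n) \<le> (\<Sum>m\<in>{1..hh * n}. cpow hh r n m / s m)"
    using sk.expect_inverse[OF eps] by blast
  have C: "C21 / C10 > 0" using C0 C1 by simp
  show "summable (\<lambda>m. real m powr x * e m) \<Longrightarrow> summable (\<lambda>n. real n powr (x - \<epsilon>) * (\<delta> n / s n))"
    by (rule transfer_down[OF s_pos r_nonneg \<delta>_nonneg e_nonneg hh_pos A(1) C A(3) displacement_lower])
  obtain A1 where A1: "A1 > 0" "\<And>j n. j \<le> 2 * hh \<Longrightarrow> n \<ge> 1 \<Longrightarrow> s n \<le> A1 * s (n + j)" using sk.shift_down_bounded[of "2 * hh"] by blast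
  obtain Cu where Cu: "Cu > 0" "\<And>m. m > 2 * hh \<Longrightarrow> s m * e m \<le> Cu * (\<Sum>j\<le>2 * hh. \<Sum>n\<in>{1..m}. \<delta> n * cpow hh r n (m - j))"
    using displacement_upper by blast
  show "summable (\<lambda>n. real n powr x * (\<delta> n / s n)) \<Longrightarrow> summable (\<lambda>m. real m powr (x - \<epsilon>) * e m)"
    by (rule transfer_up[OF s_pos r_nonneg \<delta>_nonneg e_nonneg hh_pos A(1) Cu(1) A1(1) less_imp_le[OF eps] A(2) A1(2) Cu(2)])
qed

text \<open>Here \<open>r\<close> is concentrated at k0, so \<mu>0 * g k0 = \<mu>1^k0 and all
  exponential factors cancel up to \<mu>1 raised to a bounded power. No \<epsilon> is lost.\<close>

lemma monomial_case:
  assumes k0: "k0 \<in> {1..hh}" "g k0 > 0" "\<And>k. k \<in> {1..hh} \<Longrightarrow> k \<noteq> k0 \<Longrightarrow> g k = 0"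
  shows "summable (\<lambda>m. real m powr x * e m) \<Longrightarrow> summable (\<lambda>n. real n powr x * (\<delta> n / s n))"
    and "summable (\<lambda>n. real n powr x * (\<delta> n / s n)) \<Longrightarrow> summable (\<lambda>m. real m powr x * e m)"
proof -
  interpret mg: monomial_gadget V0 E0 Hv EH w1 w2 w3 P W0 k0
    by unfold_locales (use k0 in auto)
  have k1: "k0 \<ge> 1" using k0 by simp
  have "(\<Sum>a\<in>{1..hh}. r a) = (\<Sum>a\<in>{k0}. r a)" using k0 by (intro sum.mono_neutral_right) (auto simp: r_def)
  then have "r k0 = 1" using r_sum by simp
  then have rk: "\<mu>0 * g k0 = \<mu>1 ^ k0" using mu_pos by (simp add: r_def field_simps)
  have gk: "\<mu>0 ^ n * g k0 ^ n = \<mu>1 ^ (k0 * n)" for n using rk by (metis power_mult power_mult_distrib)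
  obtain D where D: "D > 0" "\<And>n. n \<ge> 1 \<Longrightarrow> s (k0 * n) \<le> D * s n" using s_dilation[OF k1] by blast
  \<comment> \<open>The convolution power is a point mass at k0 * n, so this is just the dilation
    bound for s, written in the form expected by \<open>transfer_down\<close> with \<epsilon> =
    0.\<close>
  have KL: "real n powr (- 0) / (D * s n) \<le> (\<Sum>m\<in>{1..hh * n}. cpow hh r n m / s m)" if n: "n \<ge> 1" for n
  proof -
    have kn: "k0 * n \<ge> 1" "k0 * n \<le> hh * n" using k0 n by auto
    have c1: "cpow hh r n (k0 * n) = 1" using gk[of n] mu_pos by (simp add: cpow_r mg.cpow_k0 power_divide)
    have "real n powr (- 0) / (D * s n) = 1 / (D * s n)" using n by simp
    also have "\<dots> \<le> 1 / s (k0 * n)" using D(2)[OF n] s_pos[OF kn(1)] by (intro divide_left_mono) auto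
    also have "\<dots> = cpow hh r n (k0 * n) / s (k0 * n)" using c1 by simp
    also have "\<dots> \<le> (\<Sum>m\<in>{1..hh * n}. cpow hh r n m / s m)"
      using kn s_pos cpow_nonneg[of r] r_nonneg by (intro member_le_sum) (auto simp: less_imp_le)
    finally show ?thesis .
  qed
  have C: "C21 / C10 > 0" "C20 / C11 > 0" using C0 C1 by simp_all
  show "summable (\<lambda>n. real n powr x * (\<delta> n / s n))" if "summable (\<lambda>m. real m powr x * e m)"
    using transfer_down[OF s_pos r_nonneg \<delta>_nonneg e_nonneg hh_pos D(1) C(1) KL displacement_lower that] by simp
  define J where "J = mg.J"
  define R where "R = 2 * k0 + 2 * J"
  define I where "I = (\<lambda>m. {n. 1 \<le> n \<and> k0 * n \<le> m + 2 * k0 \<and> m \<le> k0 * n + 2 * J})"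
  obtain N where N: "N > 0" "\<And>n. n \<ge> 3 \<Longrightarrow> real (card (S0 n)) * g k0 ^ n \<le> N * real (card (S1 (k0 * n + 2 * J)))"
    using mg.count_lower_monomial[OF fin0 fin1] unfolding J_def by blast
  obtain Cs where Cs: "Cs \<ge> 1" "\<And>j n. j \<le> R \<Longrightarrow> n \<ge> 1 \<Longrightarrow> s (n + j) \<le> Cs * s n" using ds.shift_up_bounded[of R] by blast
  define B where "B = max (max 1 \<mu>1) (1 / \<mu>1) ^ R"
  have B: "B > 0" unfolding B_def by (intro zero_less_power) simp
  define C' where "C' = N * \<mu>1 ^ (2 * J) * (C21 / C10) * Cs * (C20 / C11)"
  have C': "C' > 0" unfolding C'_def using N Cs C mu_pos by (intro mult_pos_pos) auto
  have ratio: "\<mu>1 ^ (k0 * n) / \<mu>1 ^ m \<le> B" if "n \<in> I m" for n m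
  proof (cases "m \<le> k0 * n")
    case True
    have "\<mu>1 ^ (k0 * n) / \<mu>1 ^ m = \<mu>1 ^ (k0 * n - m)" using True mu_pos by (simp add: power_diff)
    also have "\<dots> \<le> max (max 1 \<mu>1) (1 / \<mu>1) ^ (k0 * n - m)" using mu_pos by (intro power_mono) auto
    also have "\<dots> \<le> B" unfolding B_def using that by (intro power_increasing) (auto simp: I_def R_def)
    finally show ?thesis .
  next
    case False
    have "\<mu>1 ^ (k0 * n) / \<mu>1 ^ m = (1 / \<mu>1) ^ (m - k0 * n)" using False mu_pos by (simp add: power_diff power_divide)
    also have "\<dots> \<le> max (max 1 \<mu>1) (1 / \<mu>1) ^ (m - k0 * n)" using mu_pos by (intro power_mono) auto
    also have "\<dots> \<le> B" unfolding B_def using that by (intro power_increasing) (auto simp: I_def R_def)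
    finally show ?thesis .
  qed
  define K where "K = 2 * hh + 2 * J + 3 * k0"
  have I3: "n \<ge> 3" if "n \<in> I m" "m > K" for n m
  proof -
    have "m \<le> k0 * n + 2 * J" "2 * J + 3 * k0 < m" using that by (auto simp: I_def K_def)
    then have "k0 * 3 \<le> k0 * n" by linarith
    then show ?thesis using k1 by (simp only: mult_le_cancel1)
  qed
  \<comment> \<open>The detour over the length k0 * n + 2 * J = m + j, which is at least m, is what
    makes \<open>shift_up_bounded\<close> sufficient.\<close>
  have st: "s n \<le> C' * t m" if n: "n \<in> I m" and m: "m > K" for n m
  proof -
    define j where "j = k0 * n + 2 * J - m"
    have j: "k0 * n + 2 * J = m + j" "j \<le> R" using n by (auto simp: I_def j_def R_def)
    have m1: "m \<ge> 1" "m + j \<ge> 1" using m by auto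
    have "s n * \<mu>1 ^ (k0 * n) = real (card (S0 n)) * g k0 ^ n" using gk[of n] mu_pos by (simp add: s_def field_simps flip: gk)
    also have "\<dots> \<le> N * real (card (S1 (k0 * n + 2 * J)))" by (rule N(2)[OF I3[OF n m]])
    also have "\<dots> = N * t (m + j) * \<mu>1 ^ (2 * J) * \<mu>1 ^ (k0 * n)" using mu_pos unfolding t_def j(1)[symmetric] by (simp add: power_add)
    finally have "s n \<le> N * t (m + j) * \<mu>1 ^ (2 * J)" using mu_pos by simp
    also have "\<dots> = N * \<mu>1 ^ (2 * J) * t (m + j)" by simp
    also have "\<dots> \<le> N * \<mu>1 ^ (2 * J) * (C21 / C10 * (Cs * (C20 / C11 * t m)))"
    proof (rule mult_left_mono)
      have "t (m + j) \<le> C21 / C10 * s (m + j)" by (rule t_le_s[OF m1(2)])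
      also have "\<dots> \<le> C21 / C10 * (Cs * s m)" using Cs(2)[OF j(2) m1(1)] C by (intro mult_left_mono) auto
      also have "\<dots> \<le> C21 / C10 * (Cs * (C20 / C11 * t m))" using s_le_t[OF m1(1)] C Cs(1) by (intro mult_left_mono) auto
      finally show "t (m + j) \<le> C21 / C10 * (Cs * (C20 / C11 * t m))" .
    qed (use N mu_pos in auto)
    also have "\<dots> = C' * t m" unfolding C'_def by (simp only: mult.assoc)
    finally show ?thesis .
  qed
  have d1: "\<delta> n / s n \<ge> 1" if "n \<ge> 1" for n
  proof -
    have "s n \<le> \<delta> n" using card_le_M0[OF that, of 2] mu_pos by (simp add: \<delta>_def s_def divide_right_mono)
    then show ?thesis using s_pos[OF that] by simp
  qed
  have d0: "\<delta> n / s n \<ge> 0" for n using \<delta>_nonneg mu_pos by (simp add: s_def)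
  define Q where "Q = real (4 * NC) * (4 * real hh)\<^sup>2"
  have up: "e m \<le> ((1 + real hh)\<^sup>2 + Q * (B * C')) * (\<Sum>n\<in>I m. \<delta> n / s n)" if m: "m > K" for m
  proof -
    have m1: "m \<ge> 1" "m > 2 * hh" using m by (auto simp: K_def)
    have fI: "finite (I m)"
    proof (rule finite_subset)
      show "I m \<subseteq> {..m + 2 * k0}"
      proof
        fix n assume n: "n \<in> I m"
        have "1 * n \<le> k0 * n" using k1 by (intro mult_le_mono1)
        also have "\<dots> \<le> m + 2 * k0" using n by (simp add: I_def)
        finally show "n \<in> {..m + 2 * k0}" by simp
      qed
    qed simp
    \<comment> \<open>The window of m is not empty and each of its terms is at least 1, so the sum
      over it absorbs the constant (1 + hh)^2 coming from walks of small displacement.\<close>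
    have ne: "(m + 2 * k0) div k0 \<in> I m"
    proof -
      have "k0 * ((m + 2 * k0) div k0) + (m + 2 * k0) mod k0 = m + 2 * k0" by (rule mult_div_mod_eq)
      moreover have "(m + 2 * k0) mod k0 < k0" using k1 by simp
      moreover have "(m + 2 * k0) div k0 \<ge> 1" using k1 by (simp add: div_greater_zero_iff Suc_le_eq)
      ultimately show ?thesis unfolding I_def mem_Collect_eq by linarith
    qed
    have "1 \<le> \<delta> ((m + 2 * k0) div k0) / s ((m + 2 * k0) div k0)" using ne by (intro d1) (auto simp: I_def)
    also have "\<dots> \<le> (\<Sum>n\<in>I m. \<delta> n / s n)" using fI ne d0 by (intro member_le_sum) auto
    finally have one: "1 \<le> (\<Sum>n\<in>I m. \<delta> n / s n)" .
    have tm: "t m > 0" by (rule t_pos[OF m1(1)])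
    have "e m \<le> ((1 + real hh)\<^sup>2 * real (card (S1 m)) + Q * (\<Sum>n\<in>I m. M0 2 n * cpow hh g n (k0 * n))) / \<mu>1 ^ m / t m"
      unfolding e_def Q_def I_def J_def using mg.moment_upper_monomial[OF fin1[OF m1(1)] fin0 m1(2)] mu_pos tm
      by (intro divide_right_mono) auto
    also have "\<dots> = (1 + real hh)\<^sup>2 + Q * (\<Sum>n\<in>I m. M0 2 n * cpow hh g n (k0 * n) / \<mu>1 ^ m / t m)"
    proof -
      have "real (card (S1 m)) / \<mu>1 ^ m / t m = 1" using tm unfolding t_def[symmetric] by simp
      then have "(1 + real hh)\<^sup>2 * real (card (S1 m)) / \<mu>1 ^ m / t m = (1 + real hh)\<^sup>2"
        by (metis (no_types, lifting) mult.right_neutral times_divide_eq_right)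
      then show ?thesis by (simp only: add_divide_distrib times_divide_eq_right[symmetric] sum_divide_distrib)
    qed
    also have "\<dots> \<le> (1 + real hh)\<^sup>2 * (\<Sum>n\<in>I m. \<delta> n / s n) + Q * (\<Sum>n\<in>I m. B * C' * (\<delta> n / s n))"
    proof (intro add_mono mult_left_mono sum_mono)
      show "(1 + real hh)\<^sup>2 \<le> (1 + real hh)\<^sup>2 * (\<Sum>n\<in>I m. \<delta> n / s n)" using one mult_left_mono[of 1 _ "(1 + real hh)\<^sup>2"] by simp
      show "Q \<ge> 0" by (simp add: Q_def)
      fix n assume n: "n \<in> I m"
      then have n1: "n \<ge> 1" by (simp add: I_def)
      have "M0 2 n * cpow hh g n (k0 * n) / \<mu>1 ^ m / t m = \<delta> n * (\<mu>1 ^ (k0 * n) / \<mu>1 ^ m) * (1 / t m)"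
        using mu_pos by (simp add: \<delta>_def mg.cpow_k0 flip: gk)
      also have "\<dots> \<le> \<delta> n * B * (C' / s n)"
      proof (intro mult_mono mult_left_mono ratio n)
        show "1 / t m \<le> C' / s n" using st[OF n m] tm s_pos[OF n1] by (simp add: field_simps)
      qed (use \<delta>_nonneg B tm mu_pos in auto)
      also have "\<dots> = B * C' * (\<delta> n / s n)" by simp
      finally show "M0 2 n * cpow hh g n (k0 * n) / \<mu>1 ^ m / t m \<le> B * C' * (\<delta> n / s n)" .
    qed
    also have "\<dots> = ((1 + real hh)\<^sup>2 + Q * (B * C')) * (\<Sum>n\<in>I m. \<delta> n / s n)"
      by (simp only: distrib_right sum_distrib_left[symmetric] mult.assoc)
    finally show ?thesis .
  qed
  have "(1 + real hh)\<^sup>2 + Q * (B * C') > 0" using B C' by (intro add_pos_nonneg) (auto simp: Q_def)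
  then show "summable (\<lambda>m. real m powr x * e m)" if "summable (\<lambda>n. real n powr x * (\<delta> n / s n))"
    by (rule transfer_up_window[where d = "\<lambda>n. \<delta> n / s n", OF d0 e_nonneg k1 _ up[unfolded I_def] that])
qed

lemma summable_transfer:
  assumes eps: "\<epsilon> > 0"
  shows "summable (\<lambda>m. real m powr x * e m) \<Longrightarrow> summable (\<lambda>n. real n powr (x - \<epsilon>) * (\<delta> n / s n))"
    and "summable (\<lambda>n. real n powr x * (\<delta> n / s n)) \<Longrightarrow> summable (\<lambda>m. real m powr (x - \<epsilon>) * e m)"
proof -
  \<comment> \<open>Gives away \<epsilon> in the monomial case too, so that both cases take the same
    form.\<close>
  have mono: "summable (\<lambda>n. real n powr (x - \<epsilon>) * f n)" if "summable (\<lambda>n. real n powr x * f n)" "\<And>n. f n \<ge> 0" for f :: "nat \<Rightarrow> real"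
  proof (rule summable_comparison_test'[OF that(1)])
    fix n :: nat assume "n \<ge> 1"
    then have "real n powr (x - \<epsilon>) \<le> real n powr x" using eps by (intro powr_mono) auto
    then show "norm (real n powr (x - \<epsilon>) * f n) \<le> real n powr x * f n" using that(2) by (simp add: mult_right_mono)
  qed
  have d0: "\<delta> n / s n \<ge> 0" for n using \<delta>_nonneg mu_pos by (simp add: s_def)
  obtain k0 where k0: "k0 \<in> {1..hh}" "g k0 > 0" using g_exists by blast
  show "summable (\<lambda>m. real m powr x * e m) \<Longrightarrow> summable (\<lambda>n. real n powr (x - \<epsilon>) * (\<delta> n / s n))"
    and "summable (\<lambda>n. real n powr x * (\<delta> n / s n)) \<Longrightarrow> summable (\<lambda>m. real m powr (x - \<epsilon>) * e m)"
  proof (atomize(full), cases "\<exists>k\<in>{1..hh}. k \<noteq> k0 \<and> g k > 0")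
    case True
    then obtain k where k: "k \<in> {1..hh}" "k \<noteq> k0" "g k > 0" by blast
    define i where "i = min k k0"
    define j where "j = max k k0"
    have "1 \<le> i" "i < j" "j \<le> hh" "g i > 0" "g j > 0" using k k0 by (auto simp: i_def j_def min_def max_def)
    from spread_case[OF this eps] show "(summable (\<lambda>m. real m powr x * e m) \<longrightarrow> summable (\<lambda>n. real n powr (x - \<epsilon>) * (\<delta> n / s n))) \<and>
       (summable (\<lambda>n. real n powr x * (\<delta> n / s n)) \<longrightarrow> summable (\<lambda>m. real m powr (x - \<epsilon>) * e m))" by blast
  next
    case False
    have "g k = 0" if "k \<in> {1..hh}" "k \<noteq> k0" for k using False that g_nonneg[of k] by fastforce
    from monomial_case[OF k0 this] show "(summable (\<lambda>m. real m powr x * e m) \<longrightarrow> summable (\<lambda>n. real n powr (x - \<epsilon>) * (\<delta> n / s n))) \<and>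
       (summable (\<lambda>n. real n powr x * (\<delta> n / s n)) \<longrightarrow> summable (\<lambda>m. real m powr (x - \<epsilon>) * e m))"
      using mono e_nonneg d0 by blast
  qed
qed

theorem nu_exp_eq: "nu_exp V0 E0 W0 = nu_exp V1 E1 (W0 \<times> Hv)"
proof (rule antisym)
  \<comment> \<open>A shift of z by \<epsilon> lowers the exponent of n by 2 * \<epsilon>, which is
    the loss granted to \<open>summable_transfer\<close>.\<close>
  have sh: "- (2 * (z + \<epsilon>) + 1) = - (2 * z + 1) - 2 * \<epsilon>" for z \<epsilon> :: real by simp
  show "nu_exp V0 E0 W0 \<le> nu_exp V1 E1 (W0 \<times> Hv)" unfolding nu_exp_def
    by (rule Inf_ereal_le_shift) (unfold V_fun_finite_iff disp0 disp1 sh, rule summable_transfer, auto)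
  show "nu_exp V1 E1 (W0 \<times> Hv) \<le> nu_exp V0 E0 W0" unfolding nu_exp_def
    by (rule Inf_ereal_le_shift) (unfold V_fun_finite_iff disp0 disp1 sh, rule summable_transfer, auto)
qed

end

theorem theorem3p4:
  fixes V0 :: "'v set" and E0 :: "'v \<Rightarrow> 'v \<Rightarrow> bool"
    and Hv :: "'g set" and EH :: "'g \<Rightarrow> 'g \<Rightarrow> bool" and w1 w2 w3 :: 'g
    and P :: "'v \<Rightarrow> 'v \<Rightarrow> 'g"
    and W0 :: "'v set"
    and L :: "real \<Rightarrow> real"
    and C10 C20 C11 C21 :: real
  defines "\<mu>0 \<equiv> connective_constant V0 E0"
      and "\<mu>1 \<equiv> connective_constant (lt_vertices V0 Hv) (lt_edges E0 Hv EH P)"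
      and "\<gamma> \<equiv> real_of_ereal (gamma_exp V0 E0 W0)"
  assumes G0: "simple_graph V0 E0" "infinite V0" "connected_graph V0 E0"
      "quasi_transitive V0 E0" "cubic V0 E0"
    and phi: "gadget Hv EH w1 w2 w3" "port_assignment V0 E0 P w1 w2 w3"
    and G1conn: "connected_graph (lt_vertices V0 Hv) (lt_edges E0 Hv EH P)"
    and W0: "minimal_fundamental_domain V0 E0 W0"
    and gfin: "\<bar>gamma_exp V0 E0 W0\<bar> < \<infinity>"
    and L: "slowly_varying L"
    and C0: "0 < C10" "C10 \<le> C20"
    and C1: "0 < C11" "C11 \<le> C21"
    and bounds0: "\<And>n. n \<ge> 1 \<Longrightarrow>
        C10 * L (real n) * real n powr (\<gamma> - 1) * \<mu>0 ^ n \<le> real (sigma_n V0 E0 (incident_edges V0 E0 W0) n) \<and>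
        real (sigma_n V0 E0 (incident_edges V0 E0 W0) n) \<le> C20 * L (real n) * real n powr (\<gamma> - 1) * \<mu>0 ^ n"
    and bounds1: "\<And>n. n \<ge> 1 \<Longrightarrow>
        C11 * L (real n) * real n powr (\<gamma> - 1) * \<mu>1 ^ n \<le> real (sigma_n (lt_vertices V0 Hv) (lt_edges E0 Hv EH P) (incident_edges (lt_vertices V0 Hv) (lt_edges E0 Hv EH P) (W0 \<times> Hv)) n) \<and>
        real (sigma_n (lt_vertices V0 Hv) (lt_edges E0 Hv EH P) (incident_edges (lt_vertices V0 Hv) (lt_edges E0 Hv EH P) (W0 \<times> Hv)) n) \<le> C21 * L (real n) * real n powr (\<gamma> - 1) * \<mu>1 ^ n"
  shows "nu_exp V0 E0 W0 = nu_exp (lt_vertices V0 Hv) (lt_edges E0 Hv EH P) (W0 \<times> Hv)"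
proof -
  interpret regular_counts V0 E0 Hv EH w1 w2 w3 P W0 L \<mu>0 \<mu>1 "\<gamma> - 1" C10 C20 C11 C21
  proof
    show "fundamental_domain V0 E0 W0" using W0 by (simp add: minimal_fundamental_domain_def)
    show "V0 \<noteq> {}" using G0(2) by auto
  qed (use G0 phi L C0 C1 bounds0 bounds1 in \<open>auto simp: sigma_n_def\<close>)
  show ?thesis by (rule nu_exp_eq)
qed

end
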